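(* Consider a system of the form $$\begin{aligned}(i\partial_t+\Delta)u_1&=\lambda_1|u_1|^2u_1+\lambda_2|u_1|^2u_2+\lambda_3u_1^2\overline{u_2}+\lambda_4|u_2|^2u_1+\lambda_5u_2^2\overline{u_1}+\lambda_6|u_2|^2u_2, \\ (i\partial_t+\Delta)u_2&=\lambda_7|u_1|^2u_1+\lambda_8|u_1|^2u_2+\lambda_9u_1^2\overline{u_2}+\lambda_{10}|u_2|^2u_1+\lambda_{11}u_2^2\overline{u_1}+\lambda_{12}|u_2|^2u_2,\end{aligned}$$ where $(t,x)\in\mathbb{R}\times\mathbb{R}^3$ and $\lambda_j\in\mathbb{R}$. Suppose there exist $a,b,c\in\mathbb{R}$ with $b^2-ac<0$ and a real-valued quartic polynomial $g=g(z_1,z_2)$ satisfying $g(e^{i\theta}z_1,e^{i\theta}z_2)=g(z_1,z_2)$ for all $(z_1,z_2,\theta)\in\mathbb{C}\times\mathbb{C}\times\mathbb{R}$ such that $$\int_{\mathbb{R}^3}\big(a|\nabla u_1|^2+2b\operatorname{Re}\overline{\nabla u_1}\cdot\nabla u_2+c|\nabla u_2|^2+g(u_1,u_2)\big)dx$$ is a time-independent quantity for any $H^1(\mathbb{R}^3)\times H^1(\mathbb{R}^3)$-solution $(u_1(t),u_2(t))$ of the system. Then there exists $M\in GL_2(\mathbb{R})$ such that the system solved by $$\begin{pmatrix} \tilde u_1 \\ \tilde u_2 \end{pmatrix}=M\begin{pmatrix} u_1 \\ u_2 \end{pmatrix}$$ is one of the systems (NLS1), (NLS2), (NLS3), (NLS4),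 (NLS5) listed in the context.
   Context: The five standard families (all parameters real; unknowns complex-valued) are: (NLS1) $(i\partial_t+\Delta)u_1=\alpha|u_1|^2u_1$, $(i\partial_t+\Delta)u_2=\beta|u_2|^2u_2$, where $\alpha,\beta\in\{-1,0,1\}$, $\alpha\ge\beta$. (NLS2) $(i\partial_t+\Delta)u_1=\alpha|u_1|^2u_1+\sigma(|u_1|^2+|u_2|^2)u_1$, $(i\partial_t+\Delta)u_2=\beta|u_2|^2u_2+\sigma(|u_1|^2+|u_2|^2)u_2$, where $\alpha\ge\beta$, $\sigma\in\{-1,1\}$. (NLS3) $(i\partial_t+\Delta)u_1=(3\alpha_1+\alpha_2)|u_1|^2u_1+(\alpha_1-\alpha_2)(2|u_2|^2u_1+u_2^2\overline{u_1})+r(|u_1|^2+|u_2|^2)u_1$, $(i\partial_t+\Delta)u_2=(3\alpha_1+\alpha_2)|u_2|^2u_2+(\alpha_1-\alpha_2)(2|u_1|^2u_2+u_1^2\overline{u_2})+r(|u_1|^2+|u_2|^2)u_2$, where $\alpha_2\ge0$, $\alpha_1^2\ne\alpha_2^2$, $\alpha_1^2+\alpha_2^2=1$, $r\in\mathbb{R}$. (NLS4) $(i\partial_t+\Delta)u_1=(3\alpha_1+\alpha_2+2\alpha_3)|u_1|^2u_1+(\alpha_1-\alpha_2)(2|u_2|^2u_1+u_2^2\overline{u_1})+r(|u_1|^2+|u_2|^2)u_1$, $(i\partial_t+\Delta)u_2=(3\alpha_1+\alpha_2-2\alpha_3)|u_2|^2u_2+(\alpha_1-\alpha_2)(2|u_1|^2u_2+u_1^2\overline{u_2})+r(|u_1|^2+|u_2|^2)u_2$,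 where $\alpha_2\ge0$, $\alpha_3>0$, $\alpha_1\ne\alpha_2$, $\alpha_1^2+\alpha_2^2+\alpha_3^2=1$, $r\in\mathbb{R}$. (NLS5) $(i\partial_t+\Delta)u_1=(3\alpha_1+\alpha_2+2\alpha_3\cos\eta)|u_1|^2u_1+(\alpha_1-\alpha_2)(2|u_2|^2u_1+u_2^2\overline{u_1})+\alpha_3\sin\eta(2|u_1|^2u_2+u_1^2\overline{u_2}+|u_2|^2u_2)+r(|u_1|^2+|u_2|^2)u_1$, $(i\partial_t+\Delta)u_2=(3\alpha_1+\alpha_2-2\alpha_3\cos\eta)|u_2|^2u_2+(\alpha_1-\alpha_2)(2|u_1|^2u_2+u_1^2\overline{u_2})+\alpha_3\sin\eta(2|u_2|^2u_1+u_2^2\overline{u_1}+|u_1|^2u_1)+r(|u_1|^2+|u_2|^2)u_2$, where $\alpha_2>0$, $\alpha_3>0$, $\alpha_1^2+\alpha_2^2+\alpha_3^2=1$, $\eta\in(0,\pi)$, $r\in\mathbb{R}$, and $\alpha_1>0$ if $\eta>\pi/2$. *)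

theory Defs
  imports "HOL-Analysis.Analysis"
begin

section \<open>Test functions and the Sobolev space $H^1(R^3)$\<close>

fun times_cont_diff :: "nat \<Rightarrow> ('a::euclidean_space \<Rightarrow> 'b::real_normed_vector) \<Rightarrow> bool" where
  "times_cont_diff 0 f \<longleftrightarrow> continuous_on UNIV f"
| "times_cont_diff (Suc k) f \<longleftrightarrow>
     (\<forall>x. f differentiable (at x)) \<and>
     (\<forall>b\<in>Basis. times_cont_diff k (\<lambda>x. frechet_derivative f (at x) b))"

definition test_function :: "('a::euclidean_space \<Rightarrow> real) \<Rightarrow> bool" where
  "test_function \<phi> \<longleftrightarrow> (\<forall>k. times_cont_diff k \<phi>) \<and> compact (closure {x. \<phi> x \<noteq> 0})"

definition partial :: "'n::finite \<Rightarrow> (real^'n \<Rightarrow> real) \<Rightarrow> real^'n \<Rightarrow> real" where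
  "partial k \<phi> x = frechet_derivative \<phi> (at x) (axis k 1)"

definition square_integrable :: "('a::euclidean_space \<Rightarrow> 'b::euclidean_space) \<Rightarrow> bool" where
  "square_integrable f \<longleftrightarrow>
     f \<in> borel_measurable lebesgue \<and> integrable lebesgue (\<lambda>x. (norm (f x))\<^sup>2)"

text \<open>\<open>H1_with_gradient f G\<close>: the function \<open>f\<close> belongs to $H^1$ and \<open>G\<close> represents its weak
  gradient. The gradient is carried along as a second argument, so that no representative (it is
  determined almost everywhere only) has to be chosen. Real test functions suffice, because the
  identity is complex linear in the test function.\<close>

definition H1_with_gradient :: "(real^3 \<Rightarrow> complex) \<Rightarrow> (real^3 \<Rightarrow> complex^3) \<Rightarrow> bool" where
  "H1_with_gradient f G \<longleftrightarrow>
     square_integrable f \<and> square_integrable G \<and>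
     (\<forall>\<phi> k. test_function \<phi> \<longrightarrow>
        (\<integral>x. partial k \<phi> x *\<^sub>R f x \<partial>lebesgue) = - (\<integral>x. \<phi> x *\<^sub>R G x $ k \<partial>lebesgue))"


section \<open>Nonlinear Schroedinger systems and their $H^1$ solutions\<close>

text \<open>The system $(i\partial_t+\Delta)u_j = N_j(u_1,u_2)$, $j=1,2$, is given by its nonlinearity
  \<open>N\<close>.\<close>

type_synonym nonlinearity = "complex \<Rightarrow> complex \<Rightarrow> complex^2"

text \<open>A solution \<open>u\<close> on the time interval \<open>I\<close>, with spatial gradient \<open>Du\<close>, is an element of
  $C(I;H^1\times H^1)$ that satisfies the equation in the sense of distributions on $R^3$ at every
  time of \<open>I\<close>. Since $N(u)\in C(I;L^2)$ for a cubic \<open>N\<close>, this is the same as $u\in C^1(I;H^{-1})$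
  together with the equation in $H^{-1}$; for the same reason the requirement that
  \<open>\<phi> N(u)\<close> be integrable is automatic for such \<open>N\<close>.\<close>

definition H1_solution ::
  "nonlinearity \<Rightarrow> real set \<Rightarrow> (real \<Rightarrow> real^3 \<Rightarrow> complex^2) \<Rightarrow>
   (real \<Rightarrow> real^3 \<Rightarrow> complex^3^2) \<Rightarrow> bool" where
  "H1_solution N I u Du \<longleftrightarrow>
     open I \<and> is_interval I \<and>
     (\<forall>t\<in>I. \<forall>j. H1_with_gradient (\<lambda>x. u t x $ j) (\<lambda>x. Du t x $ j)) \<and>
     (\<forall>s\<in>I. \<forall>j.
        ((\<lambda>t. \<integral>x. (norm (u t x $ j - u s x $ j))\<^sup>2 + (norm (Du t x $ j - Du s x $ j))\<^sup>2 \<partial>lebesgue)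
          \<longlongrightarrow> 0) (at s within I)) \<and>
     (\<forall>t\<in>I. \<forall>j. \<forall>\<phi>. test_function \<phi> \<longrightarrow>
        integrable lebesgue (\<lambda>x. \<phi> x *\<^sub>R N (u t x $ 1) (u t x $ 2) $ j) \<and>
        (\<exists>D. ((\<lambda>s. \<integral>x. \<phi> x *\<^sub>R u s x $ j \<partial>lebesgue) has_vector_derivative D) (at t within I) \<and>
             \<i> * D - (\<integral>x. (\<Sum>k\<in>UNIV. partial k \<phi> x *\<^sub>R Du t x $ j $ k) \<partial>lebesgue)
               = (\<integral>x. \<phi> x *\<^sub>R N (u t x $ 1) (u t x $ 2) $ j \<partial>lebesgue)))"

text \<open>The general cubic gauge invariant nonlinearity; the coefficients are
  \<open>l 1, \<dots>, l 12\<close>, other values of \<open>l\<close> are irrelevant.\<close>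

definition cubic_nonlinearity :: "(nat \<Rightarrow> real) \<Rightarrow> nonlinearity" where
  "cubic_nonlinearity l z1 z2 = vector
    [l 1 *\<^sub>R ((cmod z1)\<^sup>2 *\<^sub>R z1) + l 2 *\<^sub>R ((cmod z1)\<^sup>2 *\<^sub>R z2) + l 3 *\<^sub>R (z1\<^sup>2 * cnj z2) +
       l 4 *\<^sub>R ((cmod z2)\<^sup>2 *\<^sub>R z1) + l 5 *\<^sub>R (z2\<^sup>2 * cnj z1) + l 6 *\<^sub>R ((cmod z2)\<^sup>2 *\<^sub>R z2),
     l 7 *\<^sub>R ((cmod z1)\<^sup>2 *\<^sub>R z1) + l 8 *\<^sub>R ((cmod z1)\<^sup>2 *\<^sub>R z2) + l 9 *\<^sub>R (z1\<^sup>2 * cnj z2) +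
       l 10 *\<^sub>R ((cmod z2)\<^sup>2 *\<^sub>R z1) + l 11 *\<^sub>R (z2\<^sup>2 * cnj z1) + l 12 *\<^sub>R ((cmod z2)\<^sup>2 *\<^sub>R z2)]"


section \<open>Conserved energies\<close>

text \<open>Polynomials are taken in the variables $z_1,\overline{z_1},z_2,\overline{z_2}$, equivalently
  in the real and imaginary parts of $z_1,z_2$. The degree is at most four: lower-order terms are
  admitted and the quartic part may vanish.\<close>

definition real_quartic_polynomial :: "(complex \<Rightarrow> complex \<Rightarrow> real) \<Rightarrow> bool" where
  "real_quartic_polynomial g \<longleftrightarrow>
     (\<exists>C :: nat \<Rightarrow> nat \<Rightarrow> nat \<Rightarrow> nat \<Rightarrow> complex. \<forall>z1 z2.
        complex_of_real (g z1 z2) =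
          (\<Sum>i\<le>4. \<Sum>j\<le>4 - i. \<Sum>k\<le>4 - i - j. \<Sum>l\<le>4 - i - j - k.
             C i j k l * z1 ^ i * cnj z1 ^ j * z2 ^ k * cnj z2 ^ l))"

definition energy_density ::
  "real \<Rightarrow> real \<Rightarrow> real \<Rightarrow> (complex \<Rightarrow> complex \<Rightarrow> real) \<Rightarrow> complex^2 \<Rightarrow> complex^3^2 \<Rightarrow> real" where
  "energy_density a b c g z p =
     a * (norm (p $ 1))\<^sup>2 + 2 * b * Re (\<Sum>k\<in>UNIV. cnj (p $ 1 $ k) * p $ 2 $ k)
       + c * (norm (p $ 2))\<^sup>2 + g (z $ 1) (z $ 2)"

text \<open>The integral has to exist as a Lebesgue integral; this excludes in particular a nonzero
  constant term in \<open>g\<close>, for which the Bochner integral would be $0$ by convention. Local solutions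
  on arbitrary open intervals are considered.\<close>

definition energy_conserved ::
  "nonlinearity \<Rightarrow> real \<Rightarrow> real \<Rightarrow> real \<Rightarrow> (complex \<Rightarrow> complex \<Rightarrow> real) \<Rightarrow> bool" where
  "energy_conserved N a b c g \<longleftrightarrow>
     (\<forall>I u Du. H1_solution N I u Du \<longrightarrow>
        (\<forall>t\<in>I. integrable lebesgue (\<lambda>x. energy_density a b c g (u t x) (Du t x))) \<and>
        (\<lambda>t. \<integral>x. energy_density a b c g (u t x) (Du t x) \<partial>lebesgue) constant_on I)"


section \<open>Linear changes of the unknowns\<close>

definition act :: "real^2^2 \<Rightarrow> 'a::real_vector^2 \<Rightarrow> 'a^2" where
  "act M z = (\<chi> i. \<Sum>j\<in>UNIV. M $ i $ j *\<^sub>R z $ j)"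

text \<open>The system with nonlinearity \<open>F\<close> is the one solved by $Mu$ when \<open>u\<close> solves the system with
  nonlinearity \<open>N\<close>. As \<open>M\<close> commutes with $i\partial_t+\Delta$, this amounts to $F(Mz) = M N(z)$
  for all $z$, and the two systems have the corresponding solutions.\<close>

definition transforms_to :: "real^2^2 \<Rightarrow> nonlinearity \<Rightarrow> nonlinearity \<Rightarrow> bool" where
  "transforms_to M N F \<longleftrightarrow>
     (\<forall>z. F (act M z $ 1) (act M z $ 2) = act M (N (z $ 1) (z $ 2))) \<and>
     (\<forall>I u Du. H1_solution N I u Du \<longleftrightarrow>
        H1_solution F I (\<lambda>t x. act M (u t x)) (\<lambda>t x. act M (Du t x)))"


section \<open>The standard families\<close>

definition NLS1 :: "real \<Rightarrow> real \<Rightarrow> nonlinearity" where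
  "NLS1 \<alpha> \<beta> z1 z2 = vector [\<alpha> *\<^sub>R ((cmod z1)\<^sup>2 *\<^sub>R z1), \<beta> *\<^sub>R ((cmod z2)\<^sup>2 *\<^sub>R z2)]"

definition NLS2 :: "real \<Rightarrow> real \<Rightarrow> real \<Rightarrow> nonlinearity" where
  "NLS2 \<alpha> \<beta> \<sigma> z1 z2 = vector
    [\<alpha> *\<^sub>R ((cmod z1)\<^sup>2 *\<^sub>R z1) + \<sigma> *\<^sub>R (((cmod z1)\<^sup>2 + (cmod z2)\<^sup>2) *\<^sub>R z1),
     \<beta> *\<^sub>R ((cmod z2)\<^sup>2 *\<^sub>R z2) + \<sigma> *\<^sub>R (((cmod z1)\<^sup>2 + (cmod z2)\<^sup>2) *\<^sub>R z2)]"

definition NLS3 :: "real \<Rightarrow> real \<Rightarrow> real \<Rightarrow> nonlinearity" where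
  "NLS3 \<alpha>1 \<alpha>2 r z1 z2 = vector
    [(3 * \<alpha>1 + \<alpha>2) *\<^sub>R ((cmod z1)\<^sup>2 *\<^sub>R z1)
       + (\<alpha>1 - \<alpha>2) *\<^sub>R (2 *\<^sub>R ((cmod z2)\<^sup>2 *\<^sub>R z1) + z2\<^sup>2 * cnj z1)
       + r *\<^sub>R (((cmod z1)\<^sup>2 + (cmod z2)\<^sup>2) *\<^sub>R z1),
     (3 * \<alpha>1 + \<alpha>2) *\<^sub>R ((cmod z2)\<^sup>2 *\<^sub>R z2)
       + (\<alpha>1 - \<alpha>2) *\<^sub>R (2 *\<^sub>R ((cmod z1)\<^sup>2 *\<^sub>R z2) + z1\<^sup>2 * cnj z2)
       + r *\<^sub>R (((cmod z1)\<^sup>2 + (cmod z2)\<^sup>2) *\<^sub>R z2)]"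

definition NLS4 :: "real \<Rightarrow> real \<Rightarrow> real \<Rightarrow> real \<Rightarrow> nonlinearity" where
  "NLS4 \<alpha>1 \<alpha>2 \<alpha>3 r z1 z2 = vector
    [(3 * \<alpha>1 + \<alpha>2 + 2 * \<alpha>3) *\<^sub>R ((cmod z1)\<^sup>2 *\<^sub>R z1)
       + (\<alpha>1 - \<alpha>2) *\<^sub>R (2 *\<^sub>R ((cmod z2)\<^sup>2 *\<^sub>R z1) + z2\<^sup>2 * cnj z1)
       + r *\<^sub>R (((cmod z1)\<^sup>2 + (cmod z2)\<^sup>2) *\<^sub>R z1),
     (3 * \<alpha>1 + \<alpha>2 - 2 * \<alpha>3) *\<^sub>R ((cmod z2)\<^sup>2 *\<^sub>R z2)
       + (\<alpha>1 - \<alpha>2) *\<^sub>R (2 *\<^sub>R ((cmod z1)\<^sup>2 *\<^sub>R z2) + z1\<^sup>2 * cnj z2)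
       + r *\<^sub>R (((cmod z1)\<^sup>2 + (cmod z2)\<^sup>2) *\<^sub>R z2)]"

definition NLS5 :: "real \<Rightarrow> real \<Rightarrow> real \<Rightarrow> real \<Rightarrow> real \<Rightarrow> nonlinearity" where
  "NLS5 \<alpha>1 \<alpha>2 \<alpha>3 \<eta> r z1 z2 = vector
    [(3 * \<alpha>1 + \<alpha>2 + 2 * \<alpha>3 * cos \<eta>) *\<^sub>R ((cmod z1)\<^sup>2 *\<^sub>R z1)
       + (\<alpha>1 - \<alpha>2) *\<^sub>R (2 *\<^sub>R ((cmod z2)\<^sup>2 *\<^sub>R z1) + z2\<^sup>2 * cnj z1)
       + (\<alpha>3 * sin \<eta>) *\<^sub>R
           (2 *\<^sub>R ((cmod z1)\<^sup>2 *\<^sub>R z2) + z1\<^sup>2 * cnj z2 + (cmod z2)\<^sup>2 *\<^sub>R z2)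
       + r *\<^sub>R (((cmod z1)\<^sup>2 + (cmod z2)\<^sup>2) *\<^sub>R z1),
     (3 * \<alpha>1 + \<alpha>2 - 2 * \<alpha>3 * cos \<eta>) *\<^sub>R ((cmod z2)\<^sup>2 *\<^sub>R z2)
       + (\<alpha>1 - \<alpha>2) *\<^sub>R (2 *\<^sub>R ((cmod z1)\<^sup>2 *\<^sub>R z2) + z1\<^sup>2 * cnj z2)
       + (\<alpha>3 * sin \<eta>) *\<^sub>R
           (2 *\<^sub>R ((cmod z2)\<^sup>2 *\<^sub>R z1) + z2\<^sup>2 * cnj z1 + (cmod z1)\<^sup>2 *\<^sub>R z1)
       + r *\<^sub>R (((cmod z1)\<^sup>2 + (cmod z2)\<^sup>2) *\<^sub>R z2)]"

definition standard_nonlinearities :: "nonlinearity set" where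
  "standard_nonlinearities =
     {NLS1 \<alpha> \<beta> |\<alpha> \<beta>. \<alpha> \<in> {-1, 0, 1} \<and> \<beta> \<in> {-1, 0, 1} \<and> \<alpha> \<ge> \<beta>} \<union>
     {NLS2 \<alpha> \<beta> \<sigma> |\<alpha> \<beta> \<sigma>. \<alpha> \<ge> \<beta> \<and> \<sigma> \<in> {-1, 1}} \<union>
     {NLS3 \<alpha>1 \<alpha>2 r |\<alpha>1 \<alpha>2 r. \<alpha>2 \<ge> 0 \<and> \<alpha>1\<^sup>2 \<noteq> \<alpha>2\<^sup>2 \<and> \<alpha>1\<^sup>2 + \<alpha>2\<^sup>2 = 1} \<union>
     {NLS4 \<alpha>1 \<alpha>2 \<alpha>3 r |\<alpha>1 \<alpha>2 \<alpha>3 r.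
        \<alpha>2 \<ge> 0 \<and> \<alpha>3 > 0 \<and> \<alpha>1 \<noteq> \<alpha>2 \<and> \<alpha>1\<^sup>2 + \<alpha>2\<^sup>2 + \<alpha>3\<^sup>2 = 1} \<union>
     {NLS5 \<alpha>1 \<alpha>2 \<alpha>3 \<eta> r |\<alpha>1 \<alpha>2 \<alpha>3 \<eta> r.
        \<alpha>2 > 0 \<and> \<alpha>3 > 0 \<and> \<alpha>1\<^sup>2 + \<alpha>2\<^sup>2 + \<alpha>3\<^sup>2 = 1 \<and>
        0 < \<eta> \<and> \<eta> < pi \<and> (\<eta> > pi / 2 \<longrightarrow> \<alpha>1 > 0)}"

end

theory Submission
  imports Defs "HOL-Probability.Probability"
begin

text \<open>The crucial point is that the hypothesis speaks about all $H^1$ solutions, so enough solutions have to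
  be produced. On the Fourier side the functions of size $(1+|\xi|^2)^{-n}$ form a convolution algebra on
  which the free Schroedinger group acts isometrically, and a contraction argument yields local solutions
  for all data in this class; a Bessel inequality transfers differentiability in time to $L^2$.

  Differentiating the energy at time $0$ for the data $\mu(s e^{-\alpha|x|^2}w + e^{-\beta|x|^2}z)$ and
  extracting the coefficient of $\mu^4 s$ gives, for varying $\alpha,\beta$, enough linear relations to conclude
  that $KN$ is the gradient of the quartic part of $g$, where $K$ is the matrix of the kinetic form.
  As $K$ is definite, a change of variables makes $N$ itself a gradient. Its potential is a quadratic form
  in $\rho=|z_1|^2+|z_2|^2$, $X=|z_1|^2-|z_2|^2$, $Y=2\mathrm{Re}(z_1\bar z_2)$, and rotations of $(z_1,z_2)$
  rotate $(X,Y)$; diagonalizing its $(X,Y)$-part and scaling leads to the five families.\<close>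

subsection \<open>Gaussian integrals\<close>

text \<open>What stands in the way of reading off the gradient identity is the quadratic part of
  \<open>g\<close>: paired with the cubic nonlinearity it contributes to the energy rate at the same
  order \<mu>^4 as the wanted terms. It carries no Laplacian, however, so doubling both \<alpha> and
  \<beta> changes its weight relative to the terms that do. Two profiles of different width are
  needed because, in the term linear in s, the Laplacian falls either on the direction w or on the
  base point z, and only the former case contains the identity sought. Thus three unknown
  combinations have to be separated, and three pairs (\<alpha>,\<beta>) do it. Gaussians serve as
  data because products of Gaussians and the pairing of the Laplacian of one with another have
  closed forms. They do not stay Gaussian under the flow, but only the derivative at time 0 is
  evaluated. Since conservation is assumed for every solution on every open interval, local
  existence is enough.\<close>

lemma cnj_measurable [measurable]: "cnj \<in> borel_measurable borel"
  by (intro borel_measurable_continuous_onI continuous_intros)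

lemma cis_measurable [measurable]: "cis \<in> borel_measurable borel"
  by (intro borel_measurable_continuous_onI continuous_intros)

text \<open>Fubini in coordinates: \<open>lborel\<close> on a Euclidean space is the image of the
  product measure over \<open>Basis\<close>. Through this the Gaussian integrals and the
  integrability of the weights reduce to one dimension.\<close>

lemma
  fixes f :: "'a::euclidean_space \<Rightarrow> real \<Rightarrow> 'b::{real_normed_field,banach,second_countable_topology}"
  assumes int: "\<And>b. b \<in> Basis \<Longrightarrow> integrable lborel (f b)"
  shows integrable_lborel_prod: "integrable lborel (\<lambda>x. \<Prod>b\<in>Basis. f b (x \<bullet> b))"
    and integral_lborel_prod:
      "(\<integral>x. (\<Prod>b\<in>Basis. f b (x \<bullet> b)) \<partial>lborel) = (\<Prod>b\<in>Basis. integral\<^sup>L lborel (f b))"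
proof -
  have [measurable]: "f b \<in> borel_measurable borel" if "b \<in> Basis" for b
    using borel_measurable_integrable[OF int[OF that]] by simp
  interpret product_sigma_finite "\<lambda>_::'a. lborel :: real measure"
    by standard
  let ?P = "\<Pi>\<^sub>M b\<in>(Basis::'a set). (lborel :: real measure)"
  let ?T = "\<lambda>g. \<Sum>b\<in>Basis. g b *\<^sub>R b :: 'a"
  have [measurable]: "?T \<in> measurable ?P borel" by measurable
  have 1: "(\<Prod>b\<in>Basis. f b (?T g \<bullet> b)) = (\<Prod>b\<in>Basis. f b (g b))" for g
    by (intro prod.cong refl arg_cong[where f="f _"]) (simp add: inner_sum_left inner_Basis if_distrib cong: if_cong)
  have m: "(\<lambda>x. \<Prod>b\<in>Basis. f b (x \<bullet> b)) \<in> borel_measurable (borel :: 'a measure)"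
    by measurable
  show "integrable lborel (\<lambda>x. \<Prod>b\<in>Basis. f b (x \<bullet> b))"
    unfolding lborel_eq[where 'a='a]
    by (subst integrable_distr_eq) (use m in \<open>auto simp del: inner_sum_left_Basis simp: 1 int intro!: product_integrable_prod\<close>)
  show "(\<integral>x. (\<Prod>b\<in>Basis. f b (x \<bullet> b)) \<partial>lborel) = (\<Prod>b\<in>Basis. integral\<^sup>L lborel (f b))"
    unfolding lborel_eq[where 'a='a]
    by (subst integral_distr) (use m in \<open>auto simp del: inner_sum_left_Basis simp: 1 int intro!: product_integral_prod\<close>)
qed

lemma cis_sum: "finite A \<Longrightarrow> cis (\<Sum>a\<in>A. f a) = (\<Prod>a\<in>A. cis (f a))"
  by (induction rule: finite_induct) (auto simp: cis_mult[symmetric])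

text \<open>With y = s t and s^2 = 2q the integral becomes the characteristic function of the
  standard normal distribution.\<close>

lemma gaussian_fourier_1:
  fixes q x :: real
  assumes q: "q > 0"
  shows "integrable lborel (\<lambda>t. cis (x * t) * exp (- q * t\<^sup>2))"
    and "(\<integral>t. cis (x * t) * exp (- q * t\<^sup>2) \<partial>lborel) = sqrt (pi / q) * exp (- x\<^sup>2 / (4 * q))"
proof -
  define s where "s = sqrt (2 * q)"
  have s: "s > 0" "s\<^sup>2 = 2 * q" using q by (auto simp: s_def)
  have sn: "std_normal_density y = exp (- y\<^sup>2 / 2) / sqrt (2 * pi)" for y
    by (simp add: std_normal_density_def)
  have i0: "integrable lborel std_normal_density"
    using integrable_std_normal_moment[of 0] by simp
  have "integrable lborel (\<lambda>y. std_normal_density y *\<^sub>R cis (x / s * y))"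
    by (rule Bochner_Integration.integrable_bound[OF i0])
       (auto simp: normal_density_nonneg)
  hence i1: "integrable lborel (\<lambda>y. cis (x / s * y) * exp (- y\<^sup>2 / 2))"
    using integrable_mult_right[of "sqrt (2 * pi)" lborel "\<lambda>y. std_normal_density y *\<^sub>R cis (x / s * y)"]
    by (simp add: sn scaleR_conv_of_real mult_ac real_sqrt_mult)
  have c: "(\<integral>y. cis (x / s * y) * complex_of_real (exp (- y\<^sup>2 / 2)) \<partial>lborel) = sqrt (2 * pi) * exp (- (x / s)\<^sup>2 / 2)"
  proof -
    have "exp (- (x / s)\<^sup>2 / 2) = char std_normal_distribution (x / s)"
      by (simp add: char_std_normal_distribution)
    also have "\<dots> = (\<integral>y. std_normal_density y *\<^sub>R cis (x / s * y) \<partial>lborel)"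
      unfolding char_def by (subst integral_density) (auto simp: normal_density_nonneg cis_conv_exp)
    also have "\<dots> = (\<integral>y. (1 / sqrt (2 * pi)) * (cis (x / s * y) * complex_of_real (exp (- y\<^sup>2 / 2))) \<partial>lborel)"
      by (intro Bochner_Integration.integral_cong refl, subst sn) (simp add: scaleR_conv_of_real field_simps)
    also have "\<dots> = (1 / sqrt (2 * pi)) * (\<integral>y. cis (x / s * y) * complex_of_real (exp (- y\<^sup>2 / 2)) \<partial>lborel)"
      by simp
    finally show ?thesis by (simp add: field_simps)
  qed
  have e: "cis (x / s * (s * t)) * exp (- (s * t)\<^sup>2 / 2) = cis (x * t) * exp (- q * t\<^sup>2)" for t
    using s by (simp add: power_mult_distrib)
  show "integrable lborel (\<lambda>t. cis (x * t) * exp (- q * t\<^sup>2))"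
    using lborel_integrable_real_affine[OF i1, of s 0] s e by simp
  have "(\<integral>y. cis (x / s * y) * exp (- y\<^sup>2 / 2) \<partial>lborel)
      = \<bar>s\<bar> *\<^sub>R (\<integral>t. cis (x / s * (0 + s * t)) * exp (- (0 + s * t)\<^sup>2 / 2) \<partial>lborel)"
    by (rule lborel_integral_real_affine) (use s in auto)
  hence "(\<integral>t. cis (x * t) * exp (- q * t\<^sup>2) \<partial>lborel) = sqrt (2 * pi) / s * exp (- (x / s)\<^sup>2 / 2)"
    using c s e by (simp add: scaleR_conv_of_real field_simps)
  also have "sqrt (2 * pi) / s = sqrt (pi / q)"
    using q by (simp add: s_def real_sqrt_divide real_sqrt_mult)
  also have "- (x / s)\<^sup>2 / 2 = - x\<^sup>2 / (4 * q)"
    using s by (simp add: power_divide)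
  finally show "(\<integral>t. cis (x * t) * exp (- q * t\<^sup>2) \<partial>lborel) = sqrt (pi / q) * exp (- x\<^sup>2 / (4 * q))"
    by simp
qed

lemma norm_sq_Basis: "(norm (x::'a::euclidean_space))\<^sup>2 = (\<Sum>b\<in>Basis. (x \<bullet> b)\<^sup>2)"
  by (simp add: norm_eq_sqrt_inner euclidean_inner[of x x] power2_eq_square sum_nonneg)

lemma gaussian_fourier:
  fixes q :: real and \<xi> :: "'a::euclidean_space"
  assumes q: "q > 0"
  shows "integrable lborel (\<lambda>x. cis (x \<bullet> \<xi>) * exp (- q * (norm x)\<^sup>2))" (is ?int)
    and "(\<integral>x. cis (x \<bullet> \<xi>) * exp (- q * (norm x)\<^sup>2) \<partial>lborel)
           = sqrt (pi / q) ^ DIM('a) * exp (- (norm \<xi>)\<^sup>2 / (4 * q))" (is ?eq)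
proof -
  have e: "cis (x \<bullet> \<xi>) * exp (- q * (norm x)\<^sup>2)
     = (\<Prod>b\<in>Basis. cis ((\<xi> \<bullet> b) * (x \<bullet> b)) * exp (- q * (x \<bullet> b)\<^sup>2))" for x
    by (simp add: prod.distrib cis_sum[symmetric] euclidean_inner[of x \<xi>] norm_sq_Basis[of x]
        sum_distrib_left exp_sum mult.commute sum_negf[symmetric])
  show ?int unfolding e by (rule integrable_lborel_prod) (use gaussian_fourier_1(1)[OF q] in auto)
  have "(\<integral>x. cis (x \<bullet> \<xi>) * exp (- q * (norm x)\<^sup>2) \<partial>lborel)
     = (\<Prod>b\<in>Basis. complex_of_real (sqrt (pi / q) * exp (- (\<xi> \<bullet> b)\<^sup>2 / (4 * q))))"
    unfolding e by (subst integral_lborel_prod)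
       (use gaussian_fourier_1(1)[OF q] gaussian_fourier_1(2)[OF q] in auto)
  also have "\<dots> = sqrt (pi / q) ^ DIM('a) * exp (- (norm \<xi>)\<^sup>2 / (4 * q))"
    by (simp add: prod.distrib norm_sq_Basis[of \<xi>] exp_sum[symmetric] sum_negf[symmetric] sum_divide_distrib
        flip: of_real_prod)
  finally show ?eq .
qed

lemma gaussian_integral:
  fixes q :: real
  assumes q: "q > 0"
  shows "integrable lborel (\<lambda>x::'a::euclidean_space. exp (- q * (norm x)\<^sup>2))" (is ?int)
    and "(\<integral>x. exp (- q * (norm (x::'a))\<^sup>2) \<partial>lborel) = sqrt (pi / q) ^ DIM('a)" (is ?eq)
proof -
  have i: "integrable lborel (\<lambda>x::'a. complex_of_real (exp (- q * (norm x)\<^sup>2)))"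
    using gaussian_fourier(1)[OF q, of "0::'a"] by simp
  thus ?int by (simp only: complex_of_real_integrable_eq)
  have "(\<integral>x. complex_of_real (exp (- q * (norm (x::'a))\<^sup>2)) \<partial>lborel) = of_real (sqrt (pi / q) ^ DIM('a))"
    using gaussian_fourier(2)[OF q, of "0::'a"] by simp
  thus ?eq by (simp only: integral_complex_of_real of_real_eq_iff)
qed

subsection \<open>Weights\<close>

text \<open>The exponent counts powers of 1+|\<xi>|^2, so that one Laplacian costs exactly one unit
  of \<open>n\<close>.\<close>

definition wt :: "nat \<Rightarrow> 'a::euclidean_space \<Rightarrow> real" where
  "wt n \<xi> = inverse ((1 + (norm \<xi>)\<^sup>2) ^ n)"

lemma one_add_norm_sq_pos [simp]: "1 + (norm x)\<^sup>2 > 0"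
  using zero_le_power2[of "norm x"] by linarith

lemma wt_pos [simp]: "wt n \<xi> > 0"
  by (simp add: wt_def)

lemma wt_nonneg [simp]: "wt n \<xi> \<ge> 0"
  by (rule less_imp_le) simp

lemma wt_le_1: "wt n \<xi> \<le> 1"
  by (auto simp: wt_def intro!: inverse_le_1_iff[THEN iffD2] one_le_power)

lemma wt_bound_nonneg: "norm z \<le> A * wt n \<xi> \<Longrightarrow> A \<ge> 0"
  using mult_neg_pos[of A "wt n \<xi>"] norm_ge_zero[of z] wt_pos[of n \<xi>] by linarith

lemma wt_0 [simp]: "wt 0 \<xi> = 1"
  by (simp add: wt_def)

lemma wt_minus [simp]: "wt n (- \<xi>) = wt n \<xi>"
  by (simp add: wt_def)

lemma wt_add: "wt (m + n) \<xi> = wt m \<xi> * wt n \<xi>"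
  by (simp add: wt_def power_add)

lemma wt_cancel: "(1 + (norm \<xi>)\<^sup>2) ^ m * wt (m + n) \<xi> = wt n \<xi>"
proof -
  have "1 + (norm \<xi>)\<^sup>2 \<noteq> 0" using one_add_norm_sq_pos[of \<xi>] by linarith
  thus ?thesis by (simp add: wt_def power_add)
qed

lemma wt_antimono: "m \<le> n \<Longrightarrow> wt n \<xi> \<le> wt m \<xi>"
  using wt_add[of m "n - m" \<xi>] wt_le_1[of "n - m" \<xi>] by (simp add: mult_left_le)

lemma continuous_wt [continuous_intros]:
  "continuous_on S f \<Longrightarrow> continuous_on S (\<lambda>x. wt n (f x))"
  unfolding wt_def by (intro continuous_intros) (auto simp: add_nonneg_eq_0_iff)

lemma wt_measurable [measurable]: "wt n \<in> borel_measurable borel"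
  by (intro borel_measurable_continuous_onI continuous_intros)

text \<open>(1+|x|^2)^d dominates the product of 1+x_b^2 over the d coordinates, so the weight lies
  below a product of one-dimensional Cauchy densities; hence the threshold
  \<open>DIM('a)\<close>.\<close>

lemma wt_integrable:
  assumes "DIM('a) \<le> n"
  shows "integrable lborel (wt n :: 'a::euclidean_space \<Rightarrow> real)"
proof -
  have i1: "integrable lborel (\<lambda>t::real. inverse (1 + t\<^sup>2))"
    using integrable_inverse_1_plus_square by (simp add: set_integrable_def einterval_def)
  have i: "integrable lborel (\<lambda>x::'a. \<Prod>b\<in>Basis. inverse (1 + (x \<bullet> b)\<^sup>2))"
    by (rule integrable_lborel_prod[where f="\<lambda>b t. inverse (1 + t\<^sup>2)", OF i1])
  have "wt n x \<le> (\<Prod>b\<in>Basis. inverse (1 + (x \<bullet> b)\<^sup>2))" for x :: 'a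
  proof -
    have "(\<Prod>b\<in>Basis. 1 + (x \<bullet> b)\<^sup>2) \<le> (\<Prod>b\<in>(Basis::'a set). 1 + (norm x)\<^sup>2)"
      by (intro prod_mono conjI add_left_mono)
         (auto simp: add_nonneg_nonneg intro!: power2_le_iff_abs_le[THEN iffD2] Basis_le_norm)
    also have "\<dots> = (1 + (norm x)\<^sup>2) ^ DIM('a)" by simp
    finally have "inverse ((1 + (norm x)\<^sup>2) ^ DIM('a)) \<le> inverse (\<Prod>b\<in>Basis. 1 + (x \<bullet> b)\<^sup>2)"
      by (intro le_imp_inverse_le) (auto intro!: prod_pos simp: add_pos_nonneg)
    hence "wt DIM('a) x \<le> (\<Prod>b\<in>Basis. inverse (1 + (x \<bullet> b)\<^sup>2))"
      by (simp add: wt_def prod_inversef[symmetric] o_def)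
    with wt_antimono[OF assms, of x] show ?thesis by linarith
  qed
  thus ?thesis
    by (intro Bochner_Integration.integrable_bound[OF i])
       (auto intro!: AE_I2 order_trans[OF _ abs_ge_self])
qed

text \<open>Since \<xi> is the sum of \<xi>-\<eta> and \<eta>, for one of these two 1+|.|^2 is at
  least a quarter of 1+|\<xi>|^2, and its weight can be traded for 4^n \<open>wt n \<xi>\<close>.
  The sum on the right covers both cases and is integrable in \<eta>.\<close>

lemma wt_conv_bound:
  "wt n (\<xi> - \<eta>) * wt n \<eta> \<le> 4 ^ n * wt n \<xi> * (wt n \<eta> + wt n (\<xi> - \<eta>))"
proof -
  define a b where "a = 1 + (norm (\<xi> - \<eta>))\<^sup>2" and "b = 1 + (norm \<eta>)\<^sup>2"
  have ab: "a > 0" "b > 0" by (auto simp: a_def b_def)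
  have "(norm \<xi>)\<^sup>2 \<le> (norm (\<xi> - \<eta>) + norm \<eta>)\<^sup>2"
    using norm_triangle_ineq[of "\<xi> - \<eta>" \<eta>] by (intro power_mono) auto
  also have "\<dots> \<le> 2 * (norm (\<xi> - \<eta>))\<^sup>2 + 2 * (norm \<eta>)\<^sup>2"
    using sum_squares_bound[of "norm (\<xi> - \<eta>)" "norm \<eta>"] by (simp add: power2_sum)
  finally have "1 + (norm \<xi>)\<^sup>2 \<le> 2 * a + 2 * b" by (simp add: a_def b_def)
  hence "1 + (norm \<xi>)\<^sup>2 \<le> 4 * max a b"
    using max.cobounded1[of a b] max.cobounded2[of b a] by linarith
  hence "(1 + (norm \<xi>)\<^sup>2) ^ n \<le> (4 * max a b) ^ n"
    by (intro power_mono) auto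
  also have "\<dots> \<le> 4 ^ n * (a ^ n + b ^ n)"
    using ab by (auto simp: max_def power_mult_distrib)
  finally have "(1 + (norm \<xi>)\<^sup>2) ^ n * inverse (a ^ n) * inverse (b ^ n)
      \<le> 4 ^ n * (a ^ n + b ^ n) * inverse (a ^ n) * inverse (b ^ n)"
    using ab by (intro mult_right_mono) auto
  also have "\<dots> = 4 ^ n * (inverse (b ^ n) + inverse (a ^ n))"
    using ab by (simp add: field_simps)
  finally have "(1 + (norm \<xi>)\<^sup>2) ^ n * (wt n (\<xi> - \<eta>) * wt n \<eta>) \<le> 4 ^ n * (wt n \<eta> + wt n (\<xi> - \<eta>))"
    by (simp add: wt_def a_def b_def mult_ac)
  from mult_left_mono[OF this wt_nonneg[of n \<xi>]]
  have *: "wt n \<xi> * ((1 + (norm \<xi>)\<^sup>2) ^ n * (wt n (\<xi> - \<eta>) * wt n \<eta>)) \<le> wt n \<xi> * (4 ^ n * (wt n \<eta> + wt n (\<xi> - \<eta>)))" .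
  have "wt n \<xi> * ((1 + (norm \<xi>)\<^sup>2) ^ n * X) = ((1 + (norm \<xi>)\<^sup>2) ^ n * wt (n + 0) \<xi>) * X" for X
    by (simp only: mult_ac add_0_right)
  hence P: "wt n \<xi> * ((1 + (norm \<xi>)\<^sup>2) ^ n * X) = X" for X
    by (simp only: wt_cancel wt_0 mult_1)
  show ?thesis using * unfolding P by (simp only: mult_ac)
qed

subsection \<open>Continuous functions with polynomial decay\<close>

text \<open>The weighted class behind the contraction argument. The constant is existential; where
  uniformity in time matters, it is stated separately.\<close>

definition decays :: "nat \<Rightarrow> ('a::euclidean_space \<Rightarrow> 'b::real_normed_vector) \<Rightarrow> bool" where
  "decays n v \<longleftrightarrow> continuous_on UNIV v \<and> (\<exists>C. \<forall>\<xi>. norm (v \<xi>) \<le> C * wt n \<xi>)"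

lemma decaysI: "continuous_on UNIV v \<Longrightarrow> (\<And>\<xi>. norm (v \<xi>) \<le> C * wt n \<xi>) \<Longrightarrow> decays n v"
  by (auto simp: decays_def)

lemma decaysE:
  assumes "decays n v"
  obtains C where "C > 0" "\<And>\<xi>. norm (v \<xi>) \<le> C * wt n \<xi>"
proof -
  obtain C where C: "\<And>\<xi>. norm (v \<xi>) \<le> C * wt n \<xi>"
    using assms by (auto simp: decays_def)
  have "norm (v \<xi>) \<le> (\<bar>C\<bar> + 1) * wt n \<xi>" for \<xi>
    using C[of \<xi>] mult_right_mono[of C "\<bar>C\<bar> + 1" "wt n \<xi>"] by (auto intro: order_trans)
  thus ?thesis using that[of "\<bar>C\<bar> + 1"] by auto
qed

lemma decays_continuous: "decays n v \<Longrightarrow> continuous_on UNIV v"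
  by (simp add: decays_def)

lemma decays_measurable: "decays n v \<Longrightarrow> v \<in> borel_measurable borel"
  by (intro borel_measurable_continuous_onI decays_continuous)

lemma decays_bounded:
  assumes "decays n v"
  obtains C where "\<And>\<xi>. norm (v \<xi>) \<le> C"
proof -
  obtain C where C: "C > 0" "\<And>\<xi>. norm (v \<xi>) \<le> C * wt n \<xi>"
    by (rule decaysE[OF assms]) auto
  have "norm (v \<xi>) \<le> C" for \<xi>
    using C(2)[of \<xi>] mult_left_mono[OF wt_le_1[of n \<xi>], of C] C(1) by linarith
  thus ?thesis by (rule that)
qed

lemma decays_antimono:
  assumes "decays n v" "m \<le> n"
  shows "decays m v"
proof -
  obtain C where C: "C > 0" "\<And>\<xi>. norm (v \<xi>) \<le> C * wt n \<xi>"
    by (rule decaysE[OF assms(1)]) auto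
  have "norm (v \<xi>) \<le> C * wt m \<xi>" for \<xi>
    using C(2)[of \<xi>] mult_left_mono[OF wt_antimono[OF assms(2), of \<xi>], of C] C(1) by linarith
  thus ?thesis using assms by (auto intro: decaysI decays_continuous)
qed

lemma decays_zero [intro]: "decays n (\<lambda>_. 0)"
  by (rule decaysI[where C=0]) auto

lemma decays_add [intro]:
  assumes "decays n v" "decays n w"
  shows "decays n (\<lambda>\<xi>. v \<xi> + w \<xi>)"
proof -
  obtain C where C: "\<And>\<xi>. norm (v \<xi>) \<le> C * wt n \<xi>"
    by (rule decaysE[OF assms(1)]) auto
  obtain D where D: "\<And>\<xi>. norm (w \<xi>) \<le> D * wt n \<xi>"
    by (rule decaysE[OF assms(2)]) auto
  have "norm (v \<xi> + w \<xi>) \<le> (C + D) * wt n \<xi>" for \<xi>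
    using norm_triangle_ineq[of "v \<xi>" "w \<xi>"] C[of \<xi>] D[of \<xi>] by (simp add: algebra_simps)
  thus ?thesis by (rule decaysI[rotated]) (intro continuous_intros decays_continuous[OF assms(1)] decays_continuous[OF assms(2)])
qed

lemma decays_sum [intro]: "(\<And>i. i \<in> A \<Longrightarrow> decays n (v i)) \<Longrightarrow> decays n (\<lambda>\<xi>. \<Sum>i\<in>A. v i \<xi>)"
  by (induction A rule: infinite_finite_induct) auto

text \<open>Bookkeeping of derivatives: a symbol of growth (1+|\<xi>|^2)^m costs m units of
  decay.\<close>

lemma decays_mult_growth:
  fixes v :: "'a::euclidean_space \<Rightarrow> 'b::real_normed_algebra"
  assumes "decays (m + n) v" "continuous_on UNIV p" "\<And>\<xi>. norm (p \<xi>) \<le> K * (1 + (norm \<xi>)\<^sup>2) ^ m"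
  shows "decays n (\<lambda>\<xi>. p \<xi> * v \<xi>)"
proof -
  obtain C where C: "C > 0" "\<And>\<xi>. norm (v \<xi>) \<le> C * wt (m + n) \<xi>"
    by (rule decaysE[OF assms(1)]) auto
  have "norm (p \<xi> * v \<xi>) \<le> (K * C) * wt n \<xi>" for \<xi>
  proof -
    have "norm (p \<xi> * v \<xi>) \<le> norm (p \<xi>) * norm (v \<xi>)" by (rule norm_mult_ineq)
    also have "\<dots> \<le> (K * (1 + (norm \<xi>)\<^sup>2) ^ m) * (C * wt (m + n) \<xi>)"
      using C assms(3) order_trans[OF norm_ge_zero assms(3)] by (intro mult_mono) auto
    also have "\<dots> = (K * C) * ((1 + (norm \<xi>)\<^sup>2) ^ m * wt (m + n) \<xi>)" by (simp add: mult_ac)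
    finally show ?thesis by (simp only: wt_cancel)
  qed
  thus ?thesis
    by (rule decaysI[rotated]) (intro continuous_intros assms(2) decays_continuous[OF assms(1)])
qed

lemma decays_mult_bounded:
  fixes v :: "'a::euclidean_space \<Rightarrow> 'b::real_normed_algebra"
  assumes "decays n v" "continuous_on UNIV p" "\<And>\<xi>. norm (p \<xi>) \<le> K"
  shows "decays n (\<lambda>\<xi>. p \<xi> * v \<xi>)"
  using decays_mult_growth[of 0 n v p K] assms by simp

lemma decays_cmult [intro]:
  fixes v :: "'a::euclidean_space \<Rightarrow> 'b::real_normed_algebra"
  shows "decays n v \<Longrightarrow> decays n (\<lambda>\<xi>. c * v \<xi>)"
  by (rule decays_mult_bounded) (auto intro!: continuous_intros)

lemma decays_reflect [intro]:
  assumes "decays n v"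
  shows "decays n (\<lambda>\<xi>. cnj (v (- \<xi>)))"
proof -
  obtain C where C: "C > 0" "\<And>\<xi>. norm (v \<xi>) \<le> C * wt n \<xi>"
    by (rule decaysE[OF assms(1)]) auto
  show ?thesis
    by (rule decaysI[where C=C])
       (use C(2)[of "- _"] decays_continuous[OF assms] in
         \<open>auto intro!: continuous_intros intro: continuous_on_compose2\<close>)
qed

lemma decays_integrable:
  fixes v :: "'a::euclidean_space \<Rightarrow> 'b::{banach,second_countable_topology}"
  assumes "decays n v" "DIM('a) \<le> n"
  shows "integrable lborel v"
proof -
  obtain C where C: "C > 0" "\<And>\<xi>. norm (v \<xi>) \<le> C * wt n \<xi>"
    by (rule decaysE[OF assms(1)]) auto
  have "integrable lborel (\<lambda>\<xi>::'a. C * wt n \<xi>)"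
    using wt_integrable[OF assms(2)] by simp
  thus ?thesis
    by (rule Bochner_Integration.integrable_bound)
       (use C decays_measurable[OF assms(1)] in \<open>auto intro!: AE_I2 order_trans[OF _ abs_ge_self]\<close>)
qed

lemma decays_square_integrable:
  fixes v :: "'a::euclidean_space \<Rightarrow> complex"
  assumes "decays n v" "DIM('a) \<le> n"
  shows "integrable lborel (\<lambda>\<xi>. (cmod (v \<xi>))\<^sup>2)"
proof -
  obtain C where C: "\<And>\<xi>. norm (v \<xi>) \<le> C"
    by (rule decays_bounded[OF assms(1)]) auto
  have "decays n (\<lambda>\<xi>. cnj (v \<xi>) * v \<xi>)"
    by (rule decays_mult_bounded[OF assms(1), where K=C])
       (use C decays_continuous[OF assms(1)] in \<open>auto intro!: continuous_intros\<close>)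
  hence "integrable lborel (\<lambda>\<xi>. cnj (v \<xi>) * v \<xi>)"
    using assms(2) by (rule decays_integrable)
  hence "integrable lborel (\<lambda>\<xi>. norm (cnj (v \<xi>) * v \<xi>))"
    by (rule integrable_norm)
  thus ?thesis by (simp add: norm_mult power2_eq_square)
qed

lemma continuous_on_lborel_integral:
  fixes F :: "'p::metric_space \<Rightarrow> 'a::euclidean_space \<Rightarrow> 'b::{banach,second_countable_topology}"
  assumes cont: "\<And>x. continuous_on UNIV (\<lambda>p. F p x)"
    and meas: "\<And>p. F p \<in> borel_measurable borel"
    and bound: "\<And>p x. norm (F p x) \<le> h x" and h: "integrable lborel h"
  shows "continuous_on UNIV (\<lambda>p. \<integral>x. F p x \<partial>lborel)"
proof (subst continuous_on_sequentially, intro ballI allI impI)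
  fix u :: "nat \<Rightarrow> 'p" and a assume "(\<forall>n. u n \<in> UNIV) \<and> u \<longlonglongrightarrow> a"
  hence u: "u \<longlonglongrightarrow> a" by simp
  show "((\<lambda>p. \<integral>x. F p x \<partial>lborel) \<circ> u) \<longlonglongrightarrow> (\<integral>x. F a x \<partial>lborel)"
    unfolding o_def
  proof (rule integral_dominated_convergence[OF _ _ h])
    show "AE x in lborel. (\<lambda>n. F (u n) x) \<longlonglongrightarrow> F a x"
    proof (rule AE_I2)
      fix x
      have "isCont (\<lambda>p. F p x) a" using cont[of x] by (simp add: continuous_on_eq_continuous_at)
      thus "(\<lambda>n. F (u n) x) \<longlonglongrightarrow> F a x" using u by (rule isCont_tendsto_compose)
    qed
  qed (use meas bound in auto)
qed

subsection \<open>Convolution and the Fourier integral\<close>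

definition conv :: "('a::euclidean_space \<Rightarrow> complex) \<Rightarrow> ('a \<Rightarrow> complex) \<Rightarrow> 'a \<Rightarrow> complex" where
  "conv f g \<xi> = (\<integral>\<eta>. f (\<xi> - \<eta>) * g \<eta> \<partial>lborel)"

definition fint :: "('a::euclidean_space \<Rightarrow> complex) \<Rightarrow> 'a \<Rightarrow> complex" where
  "fint v x = (\<integral>\<xi>. cis (x \<bullet> \<xi>) * v \<xi> \<partial>lborel)"

definition conv_const :: "'a::euclidean_space itself \<Rightarrow> nat \<Rightarrow> real" where
  "conv_const _ n = 2 * 4 ^ n * (\<integral>\<eta>. wt n (\<eta>::'a) \<partial>lborel)"


lemma lborel_distr_reflect: "distr lborel borel (\<lambda>\<eta>. \<xi> - \<eta>) = (lborel :: 'a::euclidean_space measure)"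
  by (subst (2) lborel_affine[of "-1" \<xi>]) (auto simp: density_1)

lemma lborel_integral_reflect_translate:
  fixes f :: "'a::euclidean_space \<Rightarrow> 'b::{banach,second_countable_topology}"
  assumes [measurable]: "f \<in> borel_measurable borel"
  shows "(\<integral>\<eta>. f (\<xi> - \<eta>) \<partial>lborel) = (\<integral>\<eta>. f \<eta> \<partial>lborel)"
    and "integrable lborel (\<lambda>\<eta>. f (\<xi> - \<eta>)) \<longleftrightarrow> integrable lborel f"
proof -
  have "(\<integral>\<eta>. f \<eta> \<partial>(distr lborel borel (\<lambda>\<eta>. \<xi> - \<eta>))) = (\<integral>\<eta>. f (\<xi> - \<eta>) \<partial>lborel)"
    by (subst integral_distr) auto
  thus "(\<integral>\<eta>. f (\<xi> - \<eta>) \<partial>lborel) = (\<integral>\<eta>. f \<eta> \<partial>lborel)"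
    by (simp add: lborel_distr_reflect)
  have "integrable (distr lborel borel (\<lambda>\<eta>. \<xi> - \<eta>)) f \<longleftrightarrow> integrable lborel (\<lambda>\<eta>. f (\<xi> - \<eta>))"
    by (subst integrable_distr_eq) auto
  thus "integrable lborel (\<lambda>\<eta>. f (\<xi> - \<eta>)) \<longleftrightarrow> integrable lborel f"
    by (simp add: lborel_distr_reflect)
qed

lemma lborel_integral_translate:
  fixes f :: "'a::euclidean_space \<Rightarrow> 'b::{banach,second_countable_topology}"
  assumes [measurable]: "f \<in> borel_measurable borel"
  shows "(\<integral>\<eta>. f (\<eta> + \<xi>) \<partial>lborel) = (\<integral>\<eta>. f \<eta> \<partial>lborel)"
    and "integrable lborel (\<lambda>\<eta>. f (\<eta> + \<xi>)) \<longleftrightarrow> integrable lborel f"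
proof -
  have "(\<integral>\<eta>. f \<eta> \<partial>(distr lborel borel ((+) \<xi>))) = (\<integral>\<eta>. f (\<xi> + \<eta>) \<partial>lborel)"
    by (subst integral_distr) auto
  thus "(\<integral>\<eta>. f (\<eta> + \<xi>) \<partial>lborel) = (\<integral>\<eta>. f \<eta> \<partial>lborel)"
    by (simp add: lborel_distr_plus add.commute)
  have "integrable (distr lborel borel ((+) \<xi>)) f \<longleftrightarrow> integrable lborel (\<lambda>\<eta>. f (\<xi> + \<eta>))"
    by (subst integrable_distr_eq) auto
  thus "integrable lborel (\<lambda>\<eta>. f (\<eta> + \<xi>)) \<longleftrightarrow> integrable lborel f"
    by (simp add: lborel_distr_plus add.commute)
qed

text \<open>The algebra property of the weighted class. \<open>wt_conv_bound\<close> leaves two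
  integrals over \<eta> that agree after reflection and translation, whence the factor 2 in
  \<open>conv_const\<close>.\<close>

lemma conv_bound:
  fixes f g :: "'a::euclidean_space \<Rightarrow> complex"
  assumes n: "DIM('a) \<le> n" and [measurable]: "f \<in> borel_measurable borel" "g \<in> borel_measurable borel"
    and f: "\<And>\<xi>. cmod (f \<xi>) \<le> A * wt n \<xi>" and g: "\<And>\<xi>. cmod (g \<xi>) \<le> B * wt n \<xi>"
  shows "cmod (conv f g \<xi>) \<le> conv_const TYPE('a) n * A * B * wt n \<xi>"
    and "integrable lborel (\<lambda>\<eta>. f (\<xi> - \<eta>) * g \<eta>)"
proof -
  have AB: "A \<ge> 0" "B \<ge> 0"
    using wt_bound_nonneg[OF f] wt_bound_nonneg[OF g] by auto
  have i: "integrable lborel (\<lambda>\<eta>::'a. wt n \<eta>)" by (rule wt_integrable[OF n])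
  have i': "integrable lborel (\<lambda>\<eta>::'a. wt n (\<xi> - \<eta>))"
    using i by (subst lborel_integral_reflect_translate) auto
  define h where "h \<eta> = A * B * (4 ^ n * wt n \<xi> * (wt n \<eta> + wt n (\<xi> - \<eta>)))" for \<eta>
  have h: "integrable lborel h" unfolding h_def using i i' by auto
  have b: "cmod (f (\<xi> - \<eta>) * g \<eta>) \<le> h \<eta>" for \<eta>
  proof -
    have "cmod (f (\<xi> - \<eta>) * g \<eta>) \<le> (A * wt n (\<xi> - \<eta>)) * (B * wt n \<eta>)"
      unfolding norm_mult using f g AB by (intro mult_mono) auto
    also have "\<dots> = A * B * (wt n (\<xi> - \<eta>) * wt n \<eta>)" by simp
    also have "\<dots> \<le> h \<eta>" unfolding h_def
      by (intro mult_left_mono wt_conv_bound) (use AB in auto)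
    finally show ?thesis .
  qed
  show I: "integrable lborel (\<lambda>\<eta>. f (\<xi> - \<eta>) * g \<eta>)"
    by (rule Bochner_Integration.integrable_bound[OF h])
       (auto intro!: AE_I2 order_trans[OF b abs_ge_self])
  have "cmod (conv f g \<xi>) \<le> (\<integral>\<eta>. h \<eta> \<partial>lborel)"
    unfolding conv_def by (rule Bochner_Integration.integral_norm_bound_integral[OF I h b])
  also have "\<dots> = A * B * (4 ^ n * wt n \<xi> * ((\<integral>\<eta>. wt n (\<eta>::'a) \<partial>lborel) + (\<integral>\<eta>. wt n (\<xi> - \<eta>) \<partial>lborel)))"
    unfolding h_def using i i' by simp
  also have "(\<integral>\<eta>. wt n (\<xi> - \<eta>) \<partial>lborel) = (\<integral>\<eta>. wt n (\<eta>::'a) \<partial>lborel)"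
    by (rule lborel_integral_reflect_translate) auto
  finally show "cmod (conv f g \<xi>) \<le> conv_const TYPE('a) n * A * B * wt n \<xi>"
    by (simp add: conv_const_def mult_ac)
qed

text \<open>Continuity is needed jointly in a parameter, the time, and the frequency, because the
  fixed point is sought among continuous functions of (t,\<xi>).\<close>

lemma continuous_conv:
  fixes f g :: "'p::metric_space \<Rightarrow> 'a::euclidean_space \<Rightarrow> complex"
  assumes n: "DIM('a) \<le> n"
    and fc: "continuous_on UNIV (\<lambda>z. f (fst z) (snd z))" and gc: "continuous_on UNIV (\<lambda>z. g (fst z) (snd z))"
    and f: "\<And>p \<xi>. cmod (f p \<xi>) \<le> A * wt n \<xi>" and g: "\<And>p \<xi>. cmod (g p \<xi>) \<le> B * wt n \<xi>"
  shows "continuous_on UNIV (\<lambda>z. conv (f (fst z)) (g (fst z)) (snd z))"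
  unfolding conv_def
proof (rule continuous_on_lborel_integral)
  have A: "A \<ge> 0" by (rule wt_bound_nonneg[OF f])
  have fc': "continuous_on S (\<lambda>x. f (a x) (b x))" if "continuous_on S a" "continuous_on S b"
    for S :: "'c::topological_space set" and a b
    using continuous_on_compose2[OF fc continuous_on_Pair[OF that]] by simp
  have gc': "continuous_on S (\<lambda>x. g (a x) (b x))" if "continuous_on S a" "continuous_on S b"
    for S :: "'c::topological_space set" and a b
    using continuous_on_compose2[OF gc continuous_on_Pair[OF that]] by simp
  show "continuous_on UNIV (\<lambda>z. f (fst z) (snd z - \<eta>) * g (fst z) \<eta>)" for \<eta>
    by (intro continuous_intros fc' gc')
  show "(\<lambda>\<eta>. f (fst z) (snd z - \<eta>) * g (fst z) \<eta>) \<in> borel_measurable borel" for z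
    by (intro borel_measurable_continuous_onI continuous_intros fc' gc')
  show "cmod (f (fst z) (snd z - \<eta>) * g (fst z) \<eta>) \<le> A * (B * wt n \<eta>)" for z \<eta>
  proof -
    have "cmod (f (fst z) (snd z - \<eta>)) \<le> A"
      using f[of "fst z" "snd z - \<eta>"] mult_left_mono[OF wt_le_1[of n "snd z - \<eta>"] A] by simp
    thus ?thesis unfolding norm_mult using g[of "fst z" \<eta>] A by (intro mult_mono) auto
  qed
  show "integrable lborel (\<lambda>\<eta>::'a. A * (B * wt n \<eta>))"
    using wt_integrable[OF n] by auto
qed

lemma decays_conv:
  fixes f g :: "'a::euclidean_space \<Rightarrow> complex"
  assumes n: "DIM('a) \<le> n" and "decays n f" "decays n g"
  shows "decays n (conv f g)"
proof -
  obtain A where A: "\<And>\<xi>. norm (f \<xi>) \<le> A * wt n \<xi>" by (rule decaysE[OF assms(2)]) auto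
  obtain B where B: "\<And>\<xi>. norm (g \<xi>) \<le> B * wt n \<xi>" by (rule decaysE[OF assms(3)]) auto
  note m = assms(2,3)[THEN decays_measurable] and c = assms(2,3)[THEN decays_continuous]
  \<comment> \<open>A dummy real parameter specializes the joint continuity to a single pair of
    functions.\<close>
  have s: "continuous_on UNIV (snd :: real \<times> 'a \<Rightarrow> 'a)" by (intro continuous_intros)
  have 1: "continuous_on UNIV (\<lambda>z::real \<times> 'a. f (snd z))" "continuous_on UNIV (\<lambda>z::real \<times> 'a. g (snd z))"
    by (rule continuous_on_compose2[OF c(1) s], simp) (rule continuous_on_compose2[OF c(2) s], simp)
  have 2: "continuous_on UNIV (\<lambda>z::real \<times> 'a. conv f g (snd z))"
    using continuous_conv[OF n, where f="\<lambda>_. f" and g="\<lambda>_. g", OF 1 A B] .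
  have p: "continuous_on UNIV (\<lambda>\<xi>::'a. (0::real, \<xi>))" by (intro continuous_intros)
  have "continuous_on UNIV (conv f g)"
    using continuous_on_compose2[OF 2 p] by simp
  thus ?thesis using conv_bound(1)[OF n m A B] by (rule decaysI)
qed

section \<open>Algebra of the Fourier integral\<close>

lemma lborel_integral_swap:
  fixes F :: "'a::euclidean_space \<Rightarrow> 'b::euclidean_space \<Rightarrow> 'c::{banach,second_countable_topology}"
  assumes meas: "(\<lambda>z. F (fst z) (snd z)) \<in> borel_measurable (lborel \<Otimes>\<^sub>M lborel)"
    and 1: "\<And>x. integrable lborel (F x)" and 2: "integrable lborel (\<lambda>x. \<integral>y. norm (F x y) \<partial>lborel)"
  shows "(\<integral>y. (\<integral>x. F x y \<partial>lborel) \<partial>lborel) = (\<integral>x. (\<integral>y. F x y \<partial>lborel) \<partial>lborel)"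
proof (rule lborel_pair.Fubini_integral)
  show "integrable (lborel \<Otimes>\<^sub>M lborel) (case_prod F)"
    unfolding case_prod_beta'
    by (rule lborel_pair.Fubini_integrable[OF meas]) (use 1 2 in auto)
qed

lemma cis_mult_integrable:
  fixes v :: "'a::euclidean_space \<Rightarrow> complex"
  assumes "integrable lborel v"
  shows "integrable lborel (\<lambda>\<xi>. cis (x \<bullet> \<xi>) * v \<xi>)"
    and "integrable lborel (\<lambda>\<xi>. cis (\<xi> \<bullet> x) * v \<xi>)"
  using borel_measurable_integrable[OF assms]
  by (auto intro!: Bochner_Integration.integrable_bound[OF assms] simp: norm_mult)

lemma fint_add: "integrable lborel v \<Longrightarrow> integrable lborel w \<Longrightarrow> fint (\<lambda>\<xi>. v \<xi> + w \<xi>) x = fint v x + fint w x"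
  by (simp add: fint_def distrib_left cis_mult_integrable)

lemma fint_diff: "integrable lborel v \<Longrightarrow> integrable lborel w \<Longrightarrow> fint (\<lambda>\<xi>. v \<xi> - w \<xi>) x = fint v x - fint w x"
  by (simp add: fint_def right_diff_distrib cis_mult_integrable)

lemma fint_cmult: "fint (\<lambda>\<xi>. c * v \<xi>) x = c * fint v x"
  by (simp add: fint_def mult.left_commute)

lemma fint_sum:
  "(\<And>i. i \<in> A \<Longrightarrow> integrable lborel (v i)) \<Longrightarrow> fint (\<lambda>\<xi>. \<Sum>i\<in>A. v i \<xi>) x = (\<Sum>i\<in>A. fint (v i) x)"
  by (simp add: fint_def sum_distrib_left cis_mult_integrable)

lemma fint_modulate: "fint v (x + h) = fint (\<lambda>\<xi>. cis (h \<bullet> \<xi>) * v \<xi>) x"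
  by (simp add: fint_def inner_add_left cis_mult[symmetric] mult_ac)

lemma fint_reflect:
  assumes [measurable]: "v \<in> borel_measurable borel"
  shows "fint (\<lambda>\<xi>. cnj (v (- \<xi>))) x = cnj (fint v x)"
proof -
  have "fint (\<lambda>\<xi>. cnj (v (- \<xi>))) x = (\<integral>\<xi>. (\<lambda>\<xi>. cnj (cis (x \<bullet> \<xi>) * v \<xi>)) (0 - \<xi>) \<partial>lborel)"
    by (simp add: fint_def cis_cnj)
  also have "\<dots> = (\<integral>\<xi>. cnj (cis (x \<bullet> \<xi>) * v \<xi>) \<partial>lborel)"
    by (rule lborel_integral_reflect_translate) measurable
  finally show ?thesis unfolding fint_def Bochner_Integration.integral_cnj .
qed

lemma norm_fint_le: "cmod (fint v x) \<le> (\<integral>\<xi>. cmod (v \<xi>) \<partial>lborel)"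
proof -
  have "cmod (fint v x) \<le> (\<integral>\<xi>. cmod (cis (x \<bullet> \<xi>) * v \<xi>) \<partial>lborel)"
    unfolding fint_def by (rule integral_norm_bound)
  thus ?thesis by (simp add: norm_mult)
qed

lemma continuous_fint:
  assumes "integrable lborel v"
  shows "continuous_on UNIV (fint v)"
  unfolding fint_def
proof (rule continuous_on_lborel_integral)
  show "integrable lborel (\<lambda>\<xi>. cmod (v \<xi>))" using assms by simp
qed (use borel_measurable_integrable[OF assms] in \<open>auto intro!: continuous_intros simp: norm_mult\<close>)

lemma fint_measurable: "integrable lborel v \<Longrightarrow> fint v \<in> borel_measurable borel"
  by (intro borel_measurable_continuous_onI continuous_fint)

lemma fint_conv:
  fixes f g :: "'a::euclidean_space \<Rightarrow> complex"
  assumes f: "integrable lborel f" and g: "integrable lborel g"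
  shows "fint (conv f g) x = fint f x * fint g x"
proof -
  have [measurable]: "f \<in> borel_measurable borel" "g \<in> borel_measurable borel"
    using f g by auto
  have f': "integrable lborel (\<lambda>\<xi>. f (\<xi> - \<eta>))" for \<eta>
    using f lborel_integral_translate(2)[of f "- \<eta>"] by simp
  have "fint (conv f g) x = (\<integral>\<xi>. (\<integral>\<eta>. cis (x \<bullet> \<xi>) * (f (\<xi> - \<eta>) * g \<eta>) \<partial>lborel) \<partial>lborel)"
    by (simp add: fint_def conv_def)
  also have "\<dots> = (\<integral>\<eta>. (\<integral>\<xi>. cis (x \<bullet> \<xi>) * (f (\<xi> - \<eta>) * g \<eta>) \<partial>lborel) \<partial>lborel)"
  proof (rule lborel_integral_swap)
    show "integrable lborel (\<lambda>\<xi>. cis (x \<bullet> \<xi>) * (f (\<xi> - \<eta>) * g \<eta>))" for \<eta>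
      using f' by (intro cis_mult_integrable) auto
    have "(\<integral>\<xi>. cmod (cis (x \<bullet> \<xi>) * (f (\<xi> - \<eta>) * g \<eta>)) \<partial>lborel) = (\<integral>\<xi>. cmod (f \<xi>) \<partial>lborel) * cmod (g \<eta>)" for \<eta>
      using lborel_integral_translate(1)[of "\<lambda>\<xi>. cmod (f \<xi>)" "- \<eta>"] by (simp add: norm_mult)
    thus "integrable lborel (\<lambda>\<eta>. \<integral>\<xi>. cmod (cis (x \<bullet> \<xi>) * (f (\<xi> - \<eta>) * g \<eta>)) \<partial>lborel)"
      using g by simp
  qed measurable
  also have "\<dots> = (\<integral>\<eta>. fint f x * (cis (x \<bullet> \<eta>) * g \<eta>) \<partial>lborel)"
  proof (rule Bochner_Integration.integral_cong[OF refl])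
    fix \<eta>
    have "(\<integral>\<xi>. cis (x \<bullet> \<xi>) * (f (\<xi> - \<eta>) * g \<eta>) \<partial>lborel)
        = (\<integral>\<xi>. (cis (x \<bullet> \<eta>) * g \<eta>) * (\<lambda>\<xi>. cis (x \<bullet> \<xi>) * f \<xi>) (\<xi> + (- \<eta>)) \<partial>lborel)"
    proof (rule Bochner_Integration.integral_cong[OF refl])
      fix \<xi>
      have "cis (x \<bullet> \<xi>) = cis (x \<bullet> \<eta>) * cis (x \<bullet> (\<xi> + (- \<eta>)))"
        unfolding cis_mult by (simp add: inner_diff_right)
      thus "cis (x \<bullet> \<xi>) * (f (\<xi> - \<eta>) * g \<eta>)
        = (cis (x \<bullet> \<eta>) * g \<eta>) * (\<lambda>\<xi>. cis (x \<bullet> \<xi>) * f \<xi>) (\<xi> + (- \<eta>))"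
        by simp
    qed
    also have "\<dots> = (cis (x \<bullet> \<eta>) * g \<eta>) * (\<integral>\<xi>. (\<lambda>\<xi>. cis (x \<bullet> \<xi>) * f \<xi>) (\<xi> + (- \<eta>)) \<partial>lborel)"
      by (rule integral_mult_right_zero)
    also have "(\<integral>\<xi>. (\<lambda>\<xi>. cis (x \<bullet> \<xi>) * f \<xi>) (\<xi> + (- \<eta>)) \<partial>lborel) = fint f x"
      unfolding fint_def by (rule lborel_integral_translate(1)) measurable
    finally show "(\<integral>\<xi>. cis (x \<bullet> \<xi>) * (f (\<xi> - \<eta>) * g \<eta>) \<partial>lborel) = fint f x * (cis (x \<bullet> \<eta>) * g \<eta>)"
      by simp
  qed
  also have "\<dots> = fint f x * fint g x" by (simp add: fint_def)
  finally show ?thesis .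
qed

text \<open>The multiplication formula of the Fourier transform with a Gaussian as second factor:
  Fubini, then the explicit transform of the Gaussian. It serves Bessel's inequality as well as the
  pairing with a Laplacian.\<close>

lemma fint_gaussian_pairing:
  fixes p :: "'a::euclidean_space \<Rightarrow> complex"
  assumes p: "integrable lborel p" and q: "q > 0"
  shows "(\<integral>x. fint p x * exp (- q * (norm x)\<^sup>2) \<partial>lborel)
       = (\<integral>\<xi>. p \<xi> * (sqrt (pi / q) ^ DIM('a) * exp (- (norm \<xi>)\<^sup>2 / (4 * q))) \<partial>lborel)"
proof -
  have [measurable]: "p \<in> borel_measurable borel" using p by auto
  note gi = gaussian_fourier(1)[OF q]
  have "(\<integral>x. fint p x * exp (- q * (norm x)\<^sup>2) \<partial>lborel)
      = (\<integral>x. (\<integral>\<xi>. p \<xi> * (cis (x \<bullet> \<xi>) * exp (- q * (norm x)\<^sup>2)) \<partial>lborel) \<partial>lborel)"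
  proof (rule Bochner_Integration.integral_cong[OF refl])
    fix x
    have "fint p x * exp (- q * (norm x)\<^sup>2) = (\<integral>\<xi>. cis (x \<bullet> \<xi>) * p \<xi> * complex_of_real (exp (- q * (norm x)\<^sup>2)) \<partial>lborel)"
      unfolding fint_def by (rule integral_mult_left_zero[symmetric])
    thus "fint p x * exp (- q * (norm x)\<^sup>2) = (\<integral>\<xi>. p \<xi> * (cis (x \<bullet> \<xi>) * exp (- q * (norm x)\<^sup>2)) \<partial>lborel)"
      by (simp only: mult_ac)
  qed
  also have "\<dots> = (\<integral>\<xi>. (\<integral>x. p \<xi> * (cis (x \<bullet> \<xi>) * exp (- q * (norm x)\<^sup>2)) \<partial>lborel) \<partial>lborel)"
  proof (rule lborel_integral_swap)
    show "integrable lborel (\<lambda>x. p \<xi> * (cis (x \<bullet> \<xi>) * complex_of_real (exp (- q * (norm x)\<^sup>2))))" for \<xi>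
      using gi[of \<xi>] by (rule integrable_mult_right)
    have "(\<integral>x. cmod (p \<xi> * (cis (x \<bullet> \<xi>) * complex_of_real (exp (- q * (norm x)\<^sup>2)))) \<partial>lborel)
       = cmod (p \<xi>) * (\<integral>x. exp (- q * (norm (x::'a))\<^sup>2) \<partial>lborel)" for \<xi>
      by (simp add: norm_mult)
    thus "integrable lborel (\<lambda>\<xi>. \<integral>x. cmod (p \<xi> * (cis (x \<bullet> \<xi>) * complex_of_real (exp (- q * (norm x)\<^sup>2)))) \<partial>lborel)"
      using p by simp
  qed measurable
  also have "\<dots> = (\<integral>\<xi>. p \<xi> * (sqrt (pi / q) ^ DIM('a) * exp (- (norm \<xi>)\<^sup>2 / (4 * q))) \<partial>lborel)"
    by (intro Bochner_Integration.integral_cong refl)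
       (simp only: integral_mult_right_zero gaussian_fourier(2)[OF q])
  finally show ?thesis .
qed


section \<open>Bessel's inequality\<close>

lemma two_mult_le_squares: "2 * (a * b) \<le> a\<^sup>2 + (b::real)\<^sup>2"
  using sum_squares_bound[of a b] by (simp add: mult.assoc)

text \<open>The Gaussian factor makes Fubini applicable; it is removed by Fatou's lemma.\<close>

lemma bessel_fint_gaussian:
  fixes v :: "'a::euclidean_space \<Rightarrow> complex"
  assumes v: "decays n v" and n: "DIM('a) \<le> n" and q: "q > 0"
  shows "integrable lborel (\<lambda>x. (cmod (fint v x))\<^sup>2 * exp (- q * (norm x)\<^sup>2))"
    and "(\<integral>x. (cmod (fint v x))\<^sup>2 * exp (- q * (norm x)\<^sup>2) \<partial>lborel)
          \<le> (2 * pi) ^ DIM('a) * (\<integral>\<xi>. (cmod (v \<xi>))\<^sup>2 \<partial>lborel)"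
proof -
  define w where "w = (\<lambda>\<xi>. cnj (v (- \<xi>)))"
  \<comment> \<open>The autocorrelation of \<open>v\<close>: its Fourier integral is the squared
    modulus of \<open>fint v\<close>, and it is bounded pointwise by the squared L^2 norm of
    \<open>v\<close>.\<close>
  define p where "p = conv v w"
  define B where "B = (\<integral>\<xi>. (cmod (v \<xi>))\<^sup>2 \<partial>lborel)"
  have w: "decays n w" unfolding w_def using v by (rule decays_reflect)
  have p: "decays n p" unfolding p_def by (rule decays_conv[OF n v w])
  note [measurable] = decays_measurable[OF v] decays_measurable[OF w] decays_measurable[OF p]
  note vi = decays_integrable[OF v n] and wi = decays_integrable[OF w n] and pi' = decays_integrable[OF p n]
  note [measurable] = fint_measurable[OF vi]
  note v2 = decays_square_integrable[OF v n] and w2 = decays_square_integrable[OF w n]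
  have fp: "fint p x = complex_of_real ((cmod (fint v x))\<^sup>2)" for x
    using fint_conv[OF vi wi, of x] fint_reflect[OF decays_measurable[OF v], of x]
    unfolding complex_norm_square by (simp add: p_def w_def)
  show i: "integrable lborel (\<lambda>x. (cmod (fint v x))\<^sup>2 * exp (- q * (norm x)\<^sup>2))"
  proof (rule Bochner_Integration.integrable_bound)
    show "integrable lborel (\<lambda>x::'a. (\<integral>\<xi>. cmod (v \<xi>) \<partial>lborel)\<^sup>2 * exp (- q * (norm x)\<^sup>2))"
      using gaussian_integral(1)[OF q] by (rule integrable_mult_right)
    show "AE x in lborel. norm ((cmod (fint v x))\<^sup>2 * exp (- q * (norm x)\<^sup>2))
       \<le> norm ((\<integral>\<xi>. cmod (v \<xi>) \<partial>lborel)\<^sup>2 * exp (- q * (norm x)\<^sup>2))"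
      by (auto simp: norm_mult intro!: AE_I2 mult_right_mono power_mono norm_fint_le)
  qed measurable
  have pB: "cmod (p \<xi>) \<le> B" for \<xi>
  proof -
    have tr: "integrable lborel (\<lambda>\<eta>. (cmod (v (\<xi> - \<eta>)))\<^sup>2)" "integrable lborel (\<lambda>\<eta>. (cmod (v (- \<eta>)))\<^sup>2)"
      using v2 lborel_integral_reflect_translate(2)[of "\<lambda>\<eta>. (cmod (v \<eta>))\<^sup>2" \<xi>]
        lborel_integral_reflect_translate(2)[of "\<lambda>\<eta>. (cmod (v \<eta>))\<^sup>2" 0] by auto
    have tr': "(\<integral>\<eta>. (cmod (v (\<xi> - \<eta>)))\<^sup>2 \<partial>lborel) = B" "(\<integral>\<eta>. (cmod (v (- \<eta>)))\<^sup>2 \<partial>lborel) = B"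
      using lborel_integral_reflect_translate(1)[of "\<lambda>\<eta>. (cmod (v \<eta>))\<^sup>2" \<xi>]
        lborel_integral_reflect_translate(1)[of "\<lambda>\<eta>. (cmod (v \<eta>))\<^sup>2" 0] by (auto simp: B_def)
    have b: "cmod (v (\<xi> - \<eta>) * w \<eta>) \<le> (1 / 2) * ((cmod (v (\<xi> - \<eta>)))\<^sup>2 + (cmod (v (- \<eta>)))\<^sup>2)" for \<eta>
      using two_mult_le_squares[of "cmod (v (\<xi> - \<eta>))" "cmod (v (- \<eta>))"] by (simp add: norm_mult w_def)
    have "cmod (p \<xi>) \<le> (\<integral>\<eta>. (1 / 2) * ((cmod (v (\<xi> - \<eta>)))\<^sup>2 + (cmod (v (- \<eta>)))\<^sup>2) \<partial>lborel)"
      unfolding p_def conv_def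
    proof (rule Bochner_Integration.integral_norm_bound_integral[OF _ _ b])
      obtain A where A: "\<And>\<xi>. norm (v \<xi>) \<le> A * wt n \<xi>" by (rule decaysE[OF v]) auto
      obtain A' where A': "\<And>\<xi>. norm (w \<xi>) \<le> A' * wt n \<xi>" by (rule decaysE[OF w]) auto
      show "integrable lborel (\<lambda>\<eta>. v (\<xi> - \<eta>) * w \<eta>)"
        by (rule conv_bound(2)[OF n _ _ A A']) measurable
    qed (use tr in auto)
    also have "\<dots> = B" using tr tr' by simp
    finally show ?thesis .
  qed
  have gi: "integrable lborel (\<lambda>\<xi>::'a. exp (- (norm \<xi>)\<^sup>2 / (4 * q)))"
    using gaussian_integral(1)[of "1 / (4 * q)"] q by simp
  have "complex_of_real (\<integral>x. (cmod (fint v x))\<^sup>2 * exp (- q * (norm x)\<^sup>2) \<partial>lborel)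
     = (\<integral>x. fint p x * exp (- q * (norm x)\<^sup>2) \<partial>lborel)"
    unfolding fp by (simp only: of_real_mult[symmetric] integral_complex_of_real)
  also have "\<dots> = (\<integral>\<xi>. p \<xi> * (sqrt (pi / q) ^ DIM('a) * exp (- (norm \<xi>)\<^sup>2 / (4 * q))) \<partial>lborel)"
    by (rule fint_gaussian_pairing[OF pi' q])
  finally have e: "complex_of_real (\<integral>x. (cmod (fint v x))\<^sup>2 * exp (- q * (norm x)\<^sup>2) \<partial>lborel)
     = (\<integral>\<xi>. p \<xi> * (sqrt (pi / q) ^ DIM('a) * exp (- (norm \<xi>)\<^sup>2 / (4 * q))) \<partial>lborel)" (is "_ = ?I") .
  have "cmod ?I \<le> (\<integral>\<xi>. B * (sqrt (pi / q) ^ DIM('a) * exp (- (norm (\<xi>::'a))\<^sup>2 / (4 * q))) \<partial>lborel)"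
  proof (rule Bochner_Integration.integral_norm_bound_integral)
    show 1: "integrable lborel (\<lambda>\<xi>::'a. B * (sqrt (pi / q) ^ DIM('a) * exp (- (norm \<xi>)\<^sup>2 / (4 * q))))"
      using gi by auto
    show 2: "cmod (p \<xi> * (sqrt (pi / q) ^ DIM('a) * exp (- (norm \<xi>)\<^sup>2 / (4 * q))))
      \<le> B * (sqrt (pi / q) ^ DIM('a) * exp (- (norm (\<xi>::'a))\<^sup>2 / (4 * q)))" for \<xi>
      using pB[of \<xi>] q by (auto simp: norm_mult norm_power intro!: mult_right_mono)
    show "integrable lborel (\<lambda>\<xi>. p \<xi> * (sqrt (pi / q) ^ DIM('a) * exp (- (norm (\<xi>::'a))\<^sup>2 / (4 * q))))"
    proof (rule Bochner_Integration.integrable_bound[OF 1])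
      show "AE \<xi> in lborel. cmod (p \<xi> * (sqrt (pi / q) ^ DIM('a) * exp (- (norm \<xi>)\<^sup>2 / (4 * q))))
        \<le> norm (B * (sqrt (pi / q) ^ DIM('a) * exp (- (norm (\<xi>::'a))\<^sup>2 / (4 * q))))"
        unfolding real_norm_def by (rule AE_I2, rule order_trans[OF 2 abs_ge_self])
    qed (intro borel_measurable_times borel_measurable_continuous_onI decays_measurable[OF p] continuous_intros, auto)
  qed
  also have "\<dots> = B * (sqrt (pi / q) ^ DIM('a) * (\<integral>\<xi>. exp (- (norm (\<xi>::'a))\<^sup>2 / (4 * q)) \<partial>lborel))"
    by simp
  also have "(\<integral>\<xi>. exp (- (norm (\<xi>::'a))\<^sup>2 / (4 * q)) \<partial>lborel) = sqrt (4 * pi * q) ^ DIM('a)"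
  proof -
    have "pi / (1 / (4 * q)) = 4 * pi * q" by simp
    moreover have "(\<lambda>\<xi>::'a. exp (- (1 / (4 * q)) * (norm \<xi>)\<^sup>2)) = (\<lambda>\<xi>. exp (- (norm \<xi>)\<^sup>2 / (4 * q)))"
      by (rule ext) simp
    moreover have "1 / (4 * q) > 0" using q by simp
    ultimately show ?thesis
      using gaussian_integral(2)[of "1 / (4 * q)", where 'a='a] by (simp only:)
  qed
  \<comment> \<open>The two factors depending on q cancel up to (2 pi)^d, so the bound survives the
    limit q to 0.\<close>
  also have "B * (sqrt (pi / q) ^ DIM('a) * sqrt (4 * pi * q) ^ DIM('a)) = B * (2 * pi) ^ DIM('a)"
  proof -
    have "sqrt (pi / q) * sqrt (4 * pi * q) = sqrt ((pi / q) * (4 * pi * q))"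
      by (rule real_sqrt_mult[symmetric])
    also have "(pi / q) * (4 * pi * q) = (2 * pi)\<^sup>2"
      using q by (simp add: power2_eq_square)
    also have "sqrt \<dots> = 2 * pi" by (rule real_sqrt_unique) auto
    finally show ?thesis by (simp only: power_mult_distrib[symmetric])
  qed
  finally have "cmod ?I \<le> B * (2 * pi) ^ DIM('a)" .
  hence "norm (complex_of_real (\<integral>x. (cmod (fint v x))\<^sup>2 * exp (- q * (norm x)\<^sup>2) \<partial>lborel)) \<le> B * (2 * pi) ^ DIM('a)"
    unfolding e .
  thus "(\<integral>x. (cmod (fint v x))\<^sup>2 * exp (- q * (norm x)\<^sup>2) \<partial>lborel) \<le> (2 * pi) ^ DIM('a) * (\<integral>\<xi>. (cmod (v \<xi>))\<^sup>2 \<partial>lborel)"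
    by (simp add: B_def mult.commute)
qed

lemma bessel_fint:
  fixes v :: "'a::euclidean_space \<Rightarrow> complex"
  assumes v: "decays n v" and n: "DIM('a) \<le> n"
  shows "integrable lborel (\<lambda>x. (cmod (fint v x))\<^sup>2)"
    and "(\<integral>x. (cmod (fint v x))\<^sup>2 \<partial>lborel) \<le> (2 * pi) ^ DIM('a) * (\<integral>\<xi>. (cmod (v \<xi>))\<^sup>2 \<partial>lborel)"
proof -
  define C where "C = (2 * pi) ^ DIM('a) * (\<integral>\<xi>. (cmod (v \<xi>))\<^sup>2 \<partial>lborel)"
  have C0: "C \<ge> 0" by (simp add: C_def)
  note [measurable] = fint_measurable[OF decays_integrable[OF v n]]
  define F where "F k x = (cmod (fint v x))\<^sup>2 * exp (- inverse (real (Suc k)) * (norm x)\<^sup>2)" for k x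
  have [measurable]: "F k \<in> borel_measurable borel" for k unfolding F_def by measurable
  have lim: "(\<lambda>k. F k x) \<longlonglongrightarrow> (cmod (fint v x))\<^sup>2" for x
  proof -
    have "(\<lambda>k. F k x) \<longlonglongrightarrow> (cmod (fint v x))\<^sup>2 * exp (- 0 * (norm x)\<^sup>2)"
      unfolding F_def by (intro tendsto_intros LIMSEQ_inverse_real_of_nat)
    thus ?thesis by simp
  qed
  have F: "(\<integral>\<^sup>+x. ennreal (F k x) \<partial>lborel) \<le> ennreal C" for k
  proof -
    have "(\<integral>\<^sup>+x. ennreal (F k x) \<partial>lborel) = ennreal (\<integral>x. F k x \<partial>lborel)"
      unfolding F_def by (rule nn_integral_eq_integral[OF bessel_fint_gaussian(1)[OF v n]]) auto
    also have "\<dots> \<le> ennreal C"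
      unfolding F_def C_def by (intro ennreal_leI bessel_fint_gaussian(2)[OF v n]) auto
    finally show ?thesis .
  qed
  have "(\<integral>\<^sup>+x. ennreal ((cmod (fint v x))\<^sup>2) \<partial>lborel) = (\<integral>\<^sup>+x. liminf (\<lambda>k. ennreal (F k x)) \<partial>lborel)"
    by (intro nn_integral_cong lim_imp_Liminf[symmetric] tendsto_ennrealI lim) auto
  also have "\<dots> \<le> liminf (\<lambda>k. \<integral>\<^sup>+x. ennreal (F k x) \<partial>lborel)"
    by (rule nn_integral_liminf) measurable
  also have "\<dots> \<le> liminf (\<lambda>k::nat. ennreal C)"
    by (intro Liminf_mono always_eventually allI F)
  finally have *: "(\<integral>\<^sup>+x. ennreal ((cmod (fint v x))\<^sup>2) \<partial>lborel) \<le> ennreal C" by (simp add: Liminf_const)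
  show i: "integrable lborel (\<lambda>x. (cmod (fint v x))\<^sup>2)"
    using * by (intro integrableI_bounded) (auto simp: less_top[symmetric] top_unique)
  have "ennreal (\<integral>x. (cmod (fint v x))\<^sup>2 \<partial>lborel) \<le> ennreal C"
    using * nn_integral_eq_integral[OF i] by simp
  thus "(\<integral>x. (cmod (fint v x))\<^sup>2 \<partial>lborel) \<le> (2 * pi) ^ DIM('a) * (\<integral>\<xi>. (cmod (v \<xi>))\<^sup>2 \<partial>lborel)"
    using C0 by (simp add: C_def)
qed

subsection \<open>Local existence on the Fourier side\<close>

text \<open>The frequency side of f g cnj h: conjugating a Fourier integral conjugates and reflects
  its density.\<close>

definition conv3 :: "('a::euclidean_space \<Rightarrow> complex) \<Rightarrow> ('a \<Rightarrow> complex) \<Rightarrow> ('a \<Rightarrow> complex) \<Rightarrow> 'a \<Rightarrow> complex" where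
  "conv3 f g h = conv (conv f g) (\<lambda>\<xi>. cnj (h (- \<xi>)))"

lemma decays_conv3:
  fixes f g h :: "'a::euclidean_space \<Rightarrow> complex"
  shows "DIM('a) \<le> n \<Longrightarrow> decays n f \<Longrightarrow> decays n g \<Longrightarrow> decays n h \<Longrightarrow> decays n (conv3 f g h)"
  unfolding conv3_def by (intro decays_conv decays_reflect)

lemma fint_conv3:
  fixes f g h :: "'a::euclidean_space \<Rightarrow> complex"
  assumes n: "DIM('a) \<le> n" and f: "decays n f" and g: "decays n g" and h: "decays n h"
  shows "fint (conv3 f g h) x = fint f x * fint g x * cnj (fint h x)"
  using fint_conv[OF decays_integrable[OF decays_conv[OF n f g] n] decays_integrable[OF decays_reflect[OF h] n], of x]
    fint_conv[OF decays_integrable[OF f n] decays_integrable[OF g n], of x] fint_reflect[OF decays_measurable[OF h], of x]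
  by (simp add: conv3_def)

lemma conv3_bound:
  fixes f g h :: "'a::euclidean_space \<Rightarrow> complex"
  assumes n: "DIM('a) \<le> n" and d: "decays n f" "decays n g" "decays n h"
    and f: "\<And>\<xi>. cmod (f \<xi>) \<le> A * wt n \<xi>" and g: "\<And>\<xi>. cmod (g \<xi>) \<le> B * wt n \<xi>"
    and h: "\<And>\<xi>. cmod (h \<xi>) \<le> C * wt n \<xi>"
  shows "cmod (conv3 f g h \<xi>) \<le> (conv_const TYPE('a) n)\<^sup>2 * A * B * C * wt n \<xi>"
proof -
  have "cmod (conv3 f g h \<xi>) \<le> conv_const TYPE('a) n * (conv_const TYPE('a) n * A * B) * C * wt n \<xi>"
    unfolding conv3_def
    by (rule conv_bound(1)[OF n])
       (use d h[of "- _"] in \<open>auto intro!: conv_bound(1)[OF n _ _ f g] decays_measurable decays_conv[OF n] decays_reflect\<close>)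
  thus ?thesis by (simp add: power2_eq_square mult_ac)
qed

lemma decays_diff [intro]:
  assumes "decays n v" "decays n w"
  shows "decays n (\<lambda>\<xi>. v \<xi> - (w \<xi> :: complex))"
  using decays_add[OF assms(1) decays_cmult[OF assms(2), of "-1"]] by simp

lemma conv_diff:
  fixes f g :: "'a::euclidean_space \<Rightarrow> complex"
  assumes n: "DIM('a) \<le> n" and d: "decays n f" "decays n g" "decays n f'" "decays n g'"
  shows "conv f g \<xi> - conv f' g \<xi> = conv (\<lambda>\<xi>. f \<xi> - f' \<xi>) g \<xi>"
    and "conv f g \<xi> - conv f g' \<xi> = conv f (\<lambda>\<xi>. g \<xi> - g' \<xi>) \<xi>"
proof -
  have i: "integrable lborel (\<lambda>\<eta>. a (\<xi> - \<eta>) * b \<eta>)" if a: "decays n a" and b: "decays n b" for a b :: "'a \<Rightarrow> complex"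
  proof -
    obtain A where A: "\<And>\<xi>. norm (a \<xi>) \<le> A * wt n \<xi>" by (rule decaysE[OF a]) auto
    obtain B where B: "\<And>\<xi>. norm (b \<xi>) \<le> B * wt n \<xi>" by (rule decaysE[OF b]) auto
    show ?thesis by (rule conv_bound(2)[OF n _ _ A B]) (use a b decays_measurable in auto)
  qed
  show "conv f g \<xi> - conv f' g \<xi> = conv (\<lambda>\<xi>. f \<xi> - f' \<xi>) g \<xi>"
    and "conv f g \<xi> - conv f g' \<xi> = conv f (\<lambda>\<xi>. g \<xi> - g' \<xi>) \<xi>"
    using i d by (auto simp: conv_def left_diff_distrib right_diff_distrib)
qed

text \<open>Telescoping: one factor is exchanged at a time, which leaves three trilinear terms with
  one difference each.\<close>

lemma conv3_diff_bound:
  fixes f g h f' g' h' :: "'a::euclidean_space \<Rightarrow> complex"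
  assumes n: "DIM('a) \<le> n"
    and d: "decays n f" "decays n g" "decays n h" and d': "decays n f'" "decays n g'" "decays n h'"
    and b: "\<And>\<xi>. cmod (f \<xi>) \<le> R * wt n \<xi>" "\<And>\<xi>. cmod (g \<xi>) \<le> R * wt n \<xi>" "\<And>\<xi>. cmod (h \<xi>) \<le> R * wt n \<xi>"
    and b': "\<And>\<xi>. cmod (f' \<xi>) \<le> R * wt n \<xi>" "\<And>\<xi>. cmod (g' \<xi>) \<le> R * wt n \<xi>" "\<And>\<xi>. cmod (h' \<xi>) \<le> R * wt n \<xi>"
    and D: "\<And>\<xi>. cmod (f \<xi> - f' \<xi>) \<le> D * wt n \<xi>" "\<And>\<xi>. cmod (g \<xi> - g' \<xi>) \<le> D * wt n \<xi>"
      "\<And>\<xi>. cmod (h \<xi> - h' \<xi>) \<le> D * wt n \<xi>"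
  shows "cmod (conv3 f g h \<xi> - conv3 f' g' h' \<xi>) \<le> 3 * (conv_const TYPE('a) n)\<^sup>2 * R\<^sup>2 * D * wt n \<xi>"
proof -
  let ?k = "(conv_const TYPE('a) n)\<^sup>2"
  have 1: "conv3 f g h \<xi> - conv3 f' g h \<xi> = conv3 (\<lambda>\<xi>. f \<xi> - f' \<xi>) g h \<xi>"
  proof -
    have "conv3 f g h \<xi> - conv3 f' g h \<xi> = conv (\<lambda>\<xi>. conv f g \<xi> - conv f' g \<xi>) (\<lambda>\<xi>. cnj (h (- \<xi>))) \<xi>"
      unfolding conv3_def by (rule conv_diff(1)[OF n]) (use d d' in \<open>auto intro!: decays_conv[OF n]\<close>)
    also have "(\<lambda>\<xi>. conv f g \<xi> - conv f' g \<xi>) = conv (\<lambda>\<xi>. f \<xi> - f' \<xi>) g"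
      by (rule ext, rule conv_diff(1)[OF n]) (use d d' in auto)
    finally show ?thesis by (simp add: conv3_def)
  qed
  have 2: "conv3 f' g h \<xi> - conv3 f' g' h \<xi> = conv3 f' (\<lambda>\<xi>. g \<xi> - g' \<xi>) h \<xi>"
  proof -
    have "conv3 f' g h \<xi> - conv3 f' g' h \<xi> = conv (\<lambda>\<xi>. conv f' g \<xi> - conv f' g' \<xi>) (\<lambda>\<xi>. cnj (h (- \<xi>))) \<xi>"
      unfolding conv3_def by (rule conv_diff(1)[OF n]) (use d d' in \<open>auto intro!: decays_conv[OF n]\<close>)
    also have "(\<lambda>\<xi>. conv f' g \<xi> - conv f' g' \<xi>) = conv f' (\<lambda>\<xi>. g \<xi> - g' \<xi>)"
      by (rule ext, rule conv_diff(2)[OF n]) (use d d' in auto)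
    finally show ?thesis by (simp add: conv3_def)
  qed
  have 3: "conv3 f' g' h \<xi> - conv3 f' g' h' \<xi> = conv3 f' g' (\<lambda>\<xi>. h \<xi> - h' \<xi>) \<xi>"
    unfolding conv3_def complex_cnj_diff
    by (rule conv_diff(2)[OF n]) (use d d' in \<open>auto intro!: decays_conv[OF n]\<close>)
  have "conv3 f g h \<xi> - conv3 f' g' h' \<xi> = conv3 (\<lambda>\<xi>. f \<xi> - f' \<xi>) g h \<xi>
      + (conv3 f' (\<lambda>\<xi>. g \<xi> - g' \<xi>) h \<xi> + conv3 f' g' (\<lambda>\<xi>. h \<xi> - h' \<xi>) \<xi>)"
    using 1 2 3 by (simp add: algebra_simps)
  also have "cmod \<dots> \<le> ?k * D * R * R * wt n \<xi> + (?k * R * D * R * wt n \<xi> + ?k * R * R * D * wt n \<xi>)"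
    by (intro norm_triangle_mono conv3_bound[OF n]) (use d d' b b' D in auto)
  finally show ?thesis by (simp add: power2_eq_square algebra_simps)
qed

definition cubic_conv ::
  "('k::finite \<Rightarrow> 'k \<Rightarrow> 'k \<Rightarrow> 'k \<Rightarrow> complex) \<Rightarrow> ('a::euclidean_space \<Rightarrow> complex^'k) \<Rightarrow> 'a \<Rightarrow> complex^'k" where
  "cubic_conv L v \<xi> = (\<chi> j. \<Sum>a\<in>UNIV. \<Sum>b\<in>UNIV. \<Sum>c\<in>UNIV.
     L j a b c * conv3 (\<lambda>\<xi>. v \<xi> $ a) (\<lambda>\<xi>. v \<xi> $ b) (\<lambda>\<xi>. v \<xi> $ c) \<xi>)"

definition coeff_sum :: "('k::finite \<Rightarrow> 'k \<Rightarrow> 'k \<Rightarrow> 'k \<Rightarrow> complex) \<Rightarrow> real" where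
  "coeff_sum L = (\<Sum>j\<in>UNIV. \<Sum>a\<in>UNIV. \<Sum>b\<in>UNIV. \<Sum>c\<in>UNIV. cmod (L j a b c))"

lemma cubic_conv_diff_bound:
  fixes v w :: "'a::euclidean_space \<Rightarrow> complex^'k::finite"
  assumes n: "DIM('a) \<le> n"
    and d: "\<And>j. decays n (\<lambda>\<xi>. v \<xi> $ j)" "\<And>j. decays n (\<lambda>\<xi>. w \<xi> $ j)"
    and b: "\<And>\<xi>. norm (v \<xi>) \<le> R * wt n \<xi>" "\<And>\<xi>. norm (w \<xi>) \<le> R * wt n \<xi>"
    and D: "\<And>\<xi>. norm (v \<xi> - w \<xi>) \<le> D * wt n \<xi>"
  shows "norm (cubic_conv L v \<xi> - cubic_conv L w \<xi>)
    \<le> coeff_sum L * (3 * (conv_const TYPE('a) n)\<^sup>2 * R\<^sup>2 * D * wt n \<xi>)"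
proof -
  let ?E = "3 * (conv_const TYPE('a) n)\<^sup>2 * R\<^sup>2 * D * wt n \<xi>"
  have comp: "cmod (v \<xi> $ j) \<le> R * wt n \<xi>" "cmod (w \<xi> $ j) \<le> R * wt n \<xi>"
    "cmod (v \<xi> $ j - w \<xi> $ j) \<le> D * wt n \<xi>" for j \<xi>
    using order_trans[OF Finite_Cartesian_Product.norm_nth_le b(1)] order_trans[OF Finite_Cartesian_Product.norm_nth_le b(2)]
      order_trans[OF Finite_Cartesian_Product.norm_nth_le D] by auto
  have "norm (cubic_conv L v \<xi> - cubic_conv L w \<xi>) \<le> (\<Sum>j\<in>UNIV. norm ((cubic_conv L v \<xi> - cubic_conv L w \<xi>) $ j))"
    unfolding norm_vec_def[of "cubic_conv L v \<xi> - cubic_conv L w \<xi>"] by (rule L2_set_le_sum) simp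
  also have "\<dots> \<le> (\<Sum>j\<in>UNIV. \<Sum>a\<in>UNIV. \<Sum>b\<in>UNIV. \<Sum>c\<in>UNIV. cmod (L j a b c) * ?E)"
  proof (rule sum_mono)
    fix j
    have "(cubic_conv L v \<xi> - cubic_conv L w \<xi>) $ j = (\<Sum>a\<in>UNIV. \<Sum>b\<in>UNIV. \<Sum>c\<in>UNIV.
        L j a b c * (conv3 (\<lambda>\<xi>. v \<xi> $ a) (\<lambda>\<xi>. v \<xi> $ b) (\<lambda>\<xi>. v \<xi> $ c) \<xi>
          - conv3 (\<lambda>\<xi>. w \<xi> $ a) (\<lambda>\<xi>. w \<xi> $ b) (\<lambda>\<xi>. w \<xi> $ c) \<xi>))"
      by (simp add: cubic_conv_def right_diff_distrib sum_subtractf)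
    also have "norm \<dots> \<le> (\<Sum>a\<in>UNIV. \<Sum>b\<in>UNIV. \<Sum>c\<in>UNIV. cmod (L j a b c) * ?E)"
      unfolding norm_mult[symmetric]
      by (intro sum_norm_le[THEN order_trans, OF _ order_refl] order_trans[OF norm_sum] sum_mono,
          unfold norm_mult, intro mult_left_mono conv3_diff_bound[OF n])
         (use d comp in auto)
    finally show "norm ((cubic_conv L v \<xi> - cubic_conv L w \<xi>) $ j) \<le> (\<Sum>a\<in>UNIV. \<Sum>b\<in>UNIV. \<Sum>c\<in>UNIV. cmod (L j a b c) * ?E)" .
  qed
  also have "\<dots> = coeff_sum L * ?E"
    by (simp add: coeff_sum_def sum_distrib_right)
  finally show ?thesis .
qed

lemma cubic_conv_zero [simp]: "cubic_conv L (\<lambda>_. 0) \<xi> = 0"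
  by (simp add: cubic_conv_def conv3_def conv_def vec_eq_iff)

lemma decays_cubic_conv:
  fixes v :: "'a::euclidean_space \<Rightarrow> complex^'k::finite"
  assumes n: "DIM('a) \<le> n" and d: "\<And>j. decays n (\<lambda>\<xi>. v \<xi> $ j)"
  shows "decays n (\<lambda>\<xi>. cubic_conv L v \<xi> $ j)"
  by (simp add: cubic_conv_def) (intro decays_sum decays_cmult decays_conv3 n d)

lemma continuous_cubic_conv:
  fixes v :: "'p::metric_space \<Rightarrow> 'a::euclidean_space \<Rightarrow> complex^'k::finite"
  assumes n: "DIM('a) \<le> n" and c: "continuous_on UNIV (\<lambda>z. v (fst z) (snd z))"
    and b: "\<And>p \<xi>. norm (v p \<xi>) \<le> R * wt n \<xi>"
  shows "continuous_on UNIV (\<lambda>z. cubic_conv L (v (fst z)) (snd z))"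
proof -
  have cc: "continuous_on UNIV (\<lambda>z. v (fst z) (snd z) $ a)" for a
    using c by (intro continuous_intros)
  have bb: "cmod (v p \<xi> $ a) \<le> R * wt n \<xi>" for p \<xi> a
    using order_trans[OF Finite_Cartesian_Product.norm_nth_le b] by auto
  have cv: "continuous_on UNIV (v p)" for p
  proof -
    have "continuous_on UNIV (\<lambda>\<xi>. (p, \<xi>))" by (intro continuous_intros)
    from continuous_on_compose2[OF c this] show ?thesis by simp
  qed
  have m: "(\<lambda>\<xi>. v p \<xi> $ a) \<in> borel_measurable borel" for p a
    by (intro borel_measurable_continuous_onI continuous_intros cv)
  have r: "continuous_on UNIV (\<lambda>z. cnj (v (fst z) (- snd z) $ a))" for a
  proof -
    have "continuous_on UNIV (\<lambda>z::'p \<times> 'a. (fst z, - snd z))" by (intro continuous_intros)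
    from continuous_on_compose2[OF cc this] have "continuous_on UNIV (\<lambda>z. v (fst z) (- snd z) $ a)" by simp
    thus ?thesis by (rule continuous_on_cnj)
  qed
  have "continuous_on UNIV (\<lambda>z. conv3 (\<lambda>\<xi>. v (fst z) \<xi> $ a) (\<lambda>\<xi>. v (fst z) \<xi> $ b) (\<lambda>\<xi>. v (fst z) \<xi> $ c) (snd z))" for a b c
    unfolding conv3_def
    by (rule continuous_conv[OF n, where A="conv_const TYPE('a) n * R * R" and B=R,
          where f="\<lambda>p. conv (\<lambda>\<xi>. v p \<xi> $ a) (\<lambda>\<xi>. v p \<xi> $ b)" and g="\<lambda>p \<xi>. cnj (v p (- \<xi>) $ c)"])
       (use bb[of _ "- _"] in \<open>auto intro!: r conv_bound(1)[OF n m m bb bb]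
          continuous_conv[where f="\<lambda>p \<xi>. v p \<xi> $ a" and g="\<lambda>p \<xi>. v p \<xi> $ b", OF n cc cc bb bb]\<close>)
  thus ?thesis unfolding cubic_conv_def
    by (intro continuous_on_vec_lambda continuous_intros)
qed

text \<open>t times the mean of \<open>h\<close> over the segment from 0 to t is the oriented
  integral of \<open>h\<close>; written this way, both signs of t are treated alike.\<close>

lemma has_vector_derivative_scaled_integral:
  fixes h :: "real \<Rightarrow> 'b::banach"
  assumes h: "continuous_on UNIV h"
  shows "((\<lambda>t. t *\<^sub>R integral {0..1} (\<lambda>\<theta>. h (t * \<theta>))) has_vector_derivative h t) (at t)"
proof -
  define r where "r = \<bar>t\<bar> + 1"
  obtain g where g: "\<And>x. x \<in> {-r..r} \<Longrightarrow> (g has_vector_derivative h x) (at x within {-r..r})"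
    using antiderivative_continuous[of "-r" r h] continuous_on_subset[OF h] by auto
  have *: "s *\<^sub>R integral {0..1} (\<lambda>\<theta>. h (s * \<theta>)) = g s - g 0" if s: "s \<in> {-r<..<r}" for s
  proof -
    have sub: "s * \<theta> \<in> {-r..r}" if "\<theta> \<in> {0..1}" for \<theta>
    proof -
      have "\<bar>s * \<theta>\<bar> \<le> r * 1" unfolding abs_mult using s that by (intro mult_mono) auto
      thus ?thesis by auto
    qed
    have "((\<lambda>\<theta>. s *\<^sub>R h (s * \<theta>)) has_integral (g \<circ> (\<lambda>\<theta>. s * \<theta>)) 1 - (g \<circ> (\<lambda>\<theta>. s * \<theta>)) 0) {0..1}"
    proof (rule fundamental_theorem_of_calculus)
      fix \<theta> :: real assume \<theta>: "\<theta> \<in> {0..1}"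
      have 1: "((\<lambda>\<theta>. s * \<theta>) has_vector_derivative s) (at \<theta> within {0..1})"
        by (auto intro!: derivative_eq_intros simp: has_real_derivative_iff_has_vector_derivative[symmetric])
      have 2: "(g has_vector_derivative h (s * \<theta>)) (at (s * \<theta>) within (\<lambda>\<theta>. s * \<theta>) ` {0..1})"
        by (rule has_vector_derivative_within_subset[OF g[OF sub[OF \<theta>]]]) (use sub in auto)
      show "((g \<circ> (\<lambda>\<theta>. s * \<theta>)) has_vector_derivative s *\<^sub>R h (s * \<theta>)) (at \<theta> within {0..1})"
        using vector_diff_chain_within[OF 1 2] .
    qed simp
    from integral_unique[OF this] show ?thesis by simp
  qed
  have "(g has_vector_derivative h t) (at t)"
  proof -
    have "t \<in> {-r..r}" "t \<in> interior {-r..r}" by (auto simp: r_def)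
    thus ?thesis using g at_within_interior by fastforce
  qed
  hence "((\<lambda>s. g s - g 0) has_vector_derivative h t) (at t)"
    by (auto intro!: derivative_eq_intros)
  thus ?thesis
    by (rule has_vector_derivative_transform_within_open[where S="{-r<..<r}"]) (auto simp: r_def *)
qed


text \<open>In the interaction picture \<open>y(t,\<xi>) = wt n \<xi>\<^sup>-\<^sup>1 e\<^sup>i\<^sup>t\<^sup>|\<^sup>\<xi>\<^sup>|\<^sup>2 V(t,\<xi>)\<close> the equation is
  \<open>\<partial>\<^sub>t y = G y\<close> with \<open>G\<close> locally Lipschitz on bounded continuous functions of \<open>(t,\<xi>)\<close>.\<close>

definition phase :: "real \<Rightarrow> 'a::euclidean_space \<Rightarrow> complex" where
  "phase t \<xi> = cis (t * (norm \<xi>)\<^sup>2)"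

definition cvscale :: "complex \<Rightarrow> complex^'k::finite \<Rightarrow> complex^'k" where
  "cvscale c z = (\<chi> j. c * z $ j)"

lemma cvscale_nth [simp]: "cvscale c z $ j = c * z $ j"
  by (simp add: cvscale_def)

lemma norm_cvscale: "norm (cvscale c z) = cmod c * norm z"
  by (simp add: norm_vec_def norm_mult L2_set_right_distrib)

lemma cvscale_diff: "cvscale c z - cvscale c w = cvscale c (z - w)"
  by (simp add: vec_eq_iff right_diff_distrib)

lemma continuous_cvscale [continuous_intros]:
  "continuous_on S f \<Longrightarrow> continuous_on S g \<Longrightarrow> continuous_on S (\<lambda>x. cvscale (f x) (g x))"
  unfolding cvscale_def by (intro continuous_intros)

lemma continuous_phase [continuous_intros]:
  "continuous_on S f \<Longrightarrow> continuous_on S g \<Longrightarrow> continuous_on S (\<lambda>x. phase (f x) (g x))"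
  unfolding phase_def by (intro continuous_intros)

lemma norm_phase [simp]: "cmod (phase t \<xi>) = 1"
  by (simp add: phase_def)

definition unweight :: "nat \<Rightarrow> (real \<times> 'a::euclidean_space \<Rightarrow> complex^'k::finite) \<Rightarrow> real \<Rightarrow> 'a \<Rightarrow> complex^'k" where
  "unweight n y t \<xi> = cvscale (phase (- t) \<xi> * wt n \<xi>) (y (t, \<xi>))"

definition interaction_rhs ::
  "('k::finite \<Rightarrow> 'k \<Rightarrow> 'k \<Rightarrow> 'k \<Rightarrow> complex) \<Rightarrow> nat \<Rightarrow> (real \<times> 'a::euclidean_space \<Rightarrow> complex^'k) \<Rightarrow> real \<times> 'a \<Rightarrow> complex^'k" where
  "interaction_rhs L n y z = cvscale (phase (fst z) (snd z) * inverse (wt n (snd z)))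
     (cubic_conv L (unweight n y (fst z)) (snd z))"

lemma norm_unweight: "norm (unweight n y t \<xi>) = norm (y (t, \<xi>)) * wt n \<xi>"
  by (simp add: unweight_def norm_cvscale norm_mult mult.commute)

lemma continuous_unweight:
  assumes "continuous_on UNIV y"
  shows "continuous_on UNIV (\<lambda>z. unweight n y (fst z) (snd z))"
  unfolding unweight_def using assms by (auto intro!: continuous_intros)

lemma decays_unweight:
  fixes y :: "real \<times> 'a::euclidean_space \<Rightarrow> complex^'k::finite"
  assumes y: "continuous_on UNIV y" and b: "\<And>z. norm (y z) \<le> R"
  shows "decays n (\<lambda>\<xi>. unweight n y t \<xi> $ j)"
proof (rule decaysI)
  have p: "continuous_on UNIV (\<lambda>\<xi>::'a. (t, \<xi>))" by (intro continuous_intros)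
  show "continuous_on UNIV (\<lambda>\<xi>. unweight n y t \<xi> $ j)"
    unfolding unweight_def by (intro continuous_intros continuous_on_compose2[OF y p]) auto
  show "cmod (unweight n y t \<xi> $ j) \<le> R * wt n \<xi>" for \<xi>
    using Finite_Cartesian_Product.norm_nth_le[of "unweight n y t \<xi>" j] mult_right_mono[OF b[of "(t, \<xi>)"] wt_nonneg[of n \<xi>]]
    unfolding norm_unweight by (rule order_trans)
qed

lemma continuous_interaction_rhs:
  fixes y :: "real \<times> 'a::euclidean_space \<Rightarrow> complex^'k::finite"
  assumes n: "DIM('a) \<le> n" and y: "continuous_on UNIV y" and b: "\<And>z. norm (y z) \<le> R"
  shows "continuous_on UNIV (interaction_rhs L n y)"
proof -
  have "continuous_on UNIV (\<lambda>z. cubic_conv L (unweight n y (fst z)) (snd z))"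
    by (rule continuous_cubic_conv[OF n continuous_unweight[OF y], where R=R])
       (simp add: norm_unweight b mult_right_mono)
  moreover have "wt n \<xi> \<noteq> 0" for \<xi> :: 'a using wt_pos[of n \<xi>] by linarith
  ultimately show ?thesis
    unfolding interaction_rhs_def by (intro continuous_intros) auto
qed

lemma interaction_rhs_diff_bound:
  fixes y y' :: "real \<times> 'a::euclidean_space \<Rightarrow> complex^'k::finite"
  assumes n: "DIM('a) \<le> n" and y: "continuous_on UNIV y" "continuous_on UNIV y'"
    and b: "\<And>z. norm (y z) \<le> R" "\<And>z. norm (y' z) \<le> R" and D: "\<And>z. norm (y z - y' z) \<le> D"
  shows "norm (interaction_rhs L n y z - interaction_rhs L n y' z)
    \<le> coeff_sum L * (3 * (conv_const TYPE('a) n)\<^sup>2) * R\<^sup>2 * D"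
proof -
  obtain t \<xi> where z: "z = (t, \<xi>)" by (cases z)
  have w: "wt n \<xi> > 0" by simp
  have d: "norm (unweight n y t \<xi> - unweight n y' t \<xi>) \<le> D * wt n \<xi>" for \<xi>
    using mult_right_mono[OF D[of "(t, \<xi>)"] wt_nonneg[of n \<xi>]]
    by (simp add: unweight_def cvscale_diff norm_cvscale norm_mult mult.commute)
  have "norm (cubic_conv L (unweight n y t) \<xi> - cubic_conv L (unweight n y' t) \<xi>)
    \<le> coeff_sum L * (3 * (conv_const TYPE('a) n)\<^sup>2 * R\<^sup>2 * D * wt n \<xi>)"
    by (rule cubic_conv_diff_bound[OF n _ _ _ _ d])
       (use decays_unweight[OF y(1) b(1)] decays_unweight[OF y(2) b(2)] b in \<open>auto simp: norm_unweight intro!: mult_right_mono\<close>)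
  hence "inverse (wt n \<xi>) * norm (cubic_conv L (unweight n y t) \<xi> - cubic_conv L (unweight n y' t) \<xi>)
    \<le> inverse (wt n \<xi>) * (coeff_sum L * (3 * (conv_const TYPE('a) n)\<^sup>2 * R\<^sup>2 * D * wt n \<xi>))"
    using w by (intro mult_left_mono) auto
  also have "\<dots> = coeff_sum L * (3 * (conv_const TYPE('a) n)\<^sup>2) * R\<^sup>2 * D"
    using less_imp_neq[OF w] by (simp add: field_simps)
  finally show ?thesis using w
    by (simp add: z interaction_rhs_def cvscale_diff norm_cvscale norm_mult norm_inverse)
qed

lemma coeff_sum_nonneg: "coeff_sum L \<ge> 0"
  by (auto simp: coeff_sum_def intro!: sum_nonneg)

text \<open>Times are truncated to [-T,T] so that the fixed point can be sought among bounded
  continuous functions on all of time and frequency space, which form a complete space. The equation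
  is asserted only for |t| < T, where the truncation is the identity.\<close>

definition clamp_time :: "real \<Rightarrow> real \<Rightarrow> real" where
  "clamp_time T t = max (- T) (min T t)"

lemma continuous_clamp_time [continuous_intros]:
  "continuous_on S f \<Longrightarrow> continuous_on S (\<lambda>x. clamp_time T (f x))"
  unfolding clamp_time_def by (intro continuous_intros)

lemma continuous_time_average:
  fixes G :: "real \<times> 'a::euclidean_space \<Rightarrow> 'b::banach"
  assumes G: "continuous_on UNIV G"
  shows "continuous_on UNIV (\<lambda>z. integral {0..1} (\<lambda>\<theta>. G (clamp_time T (fst z) * \<theta>, snd z)))"
proof -
  have "continuous_on (UNIV \<times> cbox 0 (1::real)) (\<lambda>(z, \<theta>). G (clamp_time T (fst z) * \<theta>, snd z))"
    unfolding case_prod_beta'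
    by (rule continuous_on_compose2[OF G]) (auto intro!: continuous_intros)
  from integral_continuous_on_param[OF this] show ?thesis by simp
qed

theorem fourier_local_existence:
  fixes V0 :: "'a::euclidean_space \<Rightarrow> complex^'k::finite"
  assumes n: "DIM('a) \<le> n" and V0: "\<And>j. decays n (\<lambda>\<xi>. V0 \<xi> $ j)"
  shows "\<exists>T>0. \<exists>R V. V 0 = V0 \<and> (\<forall>t j. decays n (\<lambda>\<xi>. V t \<xi> $ j)) \<and> (\<forall>t \<xi>. norm (V t \<xi>) \<le> R * wt n \<xi>) \<and>
    (\<forall>t\<in>{-T<..<T}. \<forall>\<xi> j. ((\<lambda>t. V t \<xi> $ j) has_vector_derivative
       (- \<i> * (norm \<xi>)\<^sup>2 * V t \<xi> $ j + cubic_conv L (V t) \<xi> $ j)) (at t))"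
proof -
  obtain C where C: "\<And>j \<xi>. cmod (V0 \<xi> $ j) \<le> C j * wt n \<xi>"
    using V0 unfolding decays_def by metis
  define y0 where "y0 z = cvscale (inverse (wt n (snd z))) (V0 (snd z))" for z :: "real \<times> 'a"
  define R0 where "R0 = (\<Sum>j\<in>UNIV. C j)"
  have wt0: "wt n \<xi> \<noteq> 0" for \<xi> :: 'a using wt_pos[of n \<xi>] by linarith
  have V0c: "continuous_on UNIV V0"
  proof -
    have "continuous_on UNIV (\<lambda>\<xi>. \<chi> j. V0 \<xi> $ j)"
      using V0 by (intro continuous_on_vec_lambda) (auto dest: decays_continuous)
    thus ?thesis by simp
  qed
  have y0c: "continuous_on UNIV y0"
    unfolding y0_def using wt0
    by (auto intro!: continuous_intros continuous_on_compose2[OF V0c])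
  have y0b: "norm (y0 z) \<le> R0" for z
  proof -
    have "norm (V0 \<xi>) \<le> (\<Sum>j\<in>UNIV. cmod (V0 \<xi> $ j))" for \<xi>
      unfolding norm_vec_def by (rule L2_set_le_sum) simp
    also have "(\<Sum>j\<in>UNIV. cmod (V0 \<xi> $ j)) \<le> (\<Sum>j\<in>UNIV. C j * wt n \<xi>)" for \<xi>
      by (intro sum_mono C)
    finally have "norm (V0 (snd z)) \<le> R0 * wt n (snd z)" by (simp add: R0_def sum_distrib_right)
    hence "inverse (wt n (snd z)) * norm (V0 (snd z)) \<le> inverse (wt n (snd z)) * (R0 * wt n (snd z))"
      by (intro mult_left_mono) auto
    also have "\<dots> = R0" using wt0[of "snd z"] by simp
    finally show ?thesis by (simp add: y0_def norm_cvscale norm_inverse)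
  qed
  \<comment> \<open>\<open>R0\<close> bounds the free evolution; the integral term of
    \<open>\<Phi>\<close> may use the remaining unit.\<close>
  define R where "R = R0 + 1"
  have R: "R > 0" using order_trans[OF norm_ge_zero y0b[of undefined]] by (simp add: R_def)
  define K where "K = coeff_sum L * (3 * (conv_const TYPE('a) n)\<^sup>2) * R\<^sup>2"
  have K: "K \<ge> 0" using coeff_sum_nonneg[of L] by (simp add: K_def)
  \<comment> \<open>Chosen for two inequalities: T K R \<le> 1 keeps \<open>\<Phi>\<close> in the
    ball of radius R, and T K \<le> 1/2 makes it a contraction.\<close>
  define T where "T = inverse (2 * (K * R + K + 1))"
  have KR: "K * R \<ge> 0" using K R by simp
  have T: "T > 0" using K KR by (simp add: T_def)
  have T2: "T * (K * R) \<le> 1" "T * K \<le> 1 / 2"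
    using K KR by (auto simp: T_def field_simps)
  let ?c = "clamp_time T"
  have c: "\<bar>?c t\<bar> \<le> T" for t using T by (auto simp: clamp_time_def)
  define G where "G y = interaction_rhs L n (y :: real \<times> 'a \<Rightarrow> complex^'k)" for y
  define \<Phi> where "\<Phi> y z = y0 z + ?c (fst z) *\<^sub>R integral {0..1} (\<lambda>\<theta>. G y (?c (fst z) * \<theta>, snd z))"
    for y :: "real \<times> 'a \<Rightarrow> complex^'k" and z
  have Gc: "continuous_on UNIV (G y)" if "continuous_on UNIV y" "\<And>z. norm (y z) \<le> R" for y
    unfolding G_def by (rule continuous_interaction_rhs[OF n that])
  have Gd: "norm (G y z - G y' z) \<le> K * D"
    if "continuous_on UNIV y" "continuous_on UNIV y'" "\<And>z. norm (y z) \<le> R" "\<And>z. norm (y' z) \<le> R"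
      "\<And>z. norm (y z - y' z) \<le> D" for y y' D z
    unfolding G_def K_def by (rule interaction_rhs_diff_bound[OF n that])
  \<comment> \<open>Compared with the zero function, the Lipschitz estimate \<open>Gd\<close>
    becomes the size estimate \<open>Gb\<close>.\<close>
  have G0: "G (\<lambda>_. 0) z = 0" for z
    by (simp add: G_def interaction_rhs_def unweight_def[abs_def] cvscale_def vec_eq_iff cubic_conv_def conv3_def conv_def)
  have Gb: "norm (G y z) \<le> K * R" if "continuous_on UNIV y" "\<And>z. norm (y z) \<le> R" for y z
    using Gd[of y "\<lambda>_. 0" R z] that R G0 by auto
  have Gi: "(\<lambda>\<theta>. G y (?c t * \<theta>, \<xi>)) integrable_on {0..1}"
    if "continuous_on UNIV y" "\<And>z. norm (y z) \<le> R" for y t \<xi>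
    by (intro integrable_continuous_interval continuous_on_compose2[OF Gc[OF that]] continuous_intros) auto
  have \<Phi>c: "continuous_on UNIV (\<Phi> y)" if "continuous_on UNIV y" "\<And>z. norm (y z) \<le> R" for y
    unfolding \<Phi>_def by (intro continuous_intros y0c continuous_time_average Gc that)
  have \<Phi>b: "norm (\<Phi> y z) \<le> R" if y: "continuous_on UNIV y" "\<And>z. norm (y z) \<le> R" for y z
  proof -
    have "norm (integral {0..1} (\<lambda>\<theta>. G y (?c (fst z) * \<theta>, snd z))) \<le> K * R * (1 - 0)"
      by (rule integral_bound) (auto intro!: Gb[OF y] continuous_on_compose2[OF Gc[OF y]] continuous_intros)
    hence *: "norm (?c (fst z) *\<^sub>R integral {0..1} (\<lambda>\<theta>. G y (?c (fst z) * \<theta>, snd z))) \<le> T * (K * R)"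
      unfolding norm_scaleR using c T by (intro mult_mono) auto
    show ?thesis using norm_triangle_mono[OF y0b[of z] *] T2 by (simp add: \<Phi>_def R_def)
  qed
  have \<Phi>d: "norm (\<Phi> y z - \<Phi> y' z) \<le> 1 / 2 * D"
    if y: "continuous_on UNIV y" "continuous_on UNIV y'" "\<And>z. norm (y z) \<le> R" "\<And>z. norm (y' z) \<le> R"
      "\<And>z. norm (y z - y' z) \<le> D" for y y' D z
  proof -
    have D: "D \<ge> 0" using order_trans[OF norm_ge_zero y(5)] .
    have "\<Phi> y z - \<Phi> y' z = ?c (fst z) *\<^sub>R integral {0..1} (\<lambda>\<theta>. G y (?c (fst z) * \<theta>, snd z) - G y' (?c (fst z) * \<theta>, snd z))"
      unfolding \<Phi>_def
      by (subst Henstock_Kurzweil_Integration.integral_diff) (use Gi y in \<open>auto simp: scaleR_diff_right\<close>)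
    moreover have "norm (integral {0..1} (\<lambda>\<theta>. G y (?c (fst z) * \<theta>, snd z) - G y' (?c (fst z) * \<theta>, snd z))) \<le> K * D * (1 - 0)"
      by (rule integral_bound)
         (auto intro!: Gd[OF y] continuous_on_compose2[OF Gc[OF y(1,3)]] continuous_on_compose2[OF Gc[OF y(2,4)]] continuous_intros)
    ultimately have "norm (\<Phi> y z - \<Phi> y' z) \<le> T * (K * D)"
      using c T by (simp only: norm_scaleR) (intro mult_mono, auto)
    also have "\<dots> \<le> 1 / 2 * D"
      using mult_right_mono[OF T2(2) D] by (simp add: mult_ac)
    finally show ?thesis .
  qed
  let ?S = "cball (0 :: (real \<times> 'a) \<Rightarrow>\<^sub>C (complex^'k)) R"
  define F where "F y = Bcontfun (\<Phi> (apply_bcontfun y))" for y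
  have inS: "continuous_on UNIV (apply_bcontfun y)" "\<And>z. norm (apply_bcontfun y z) \<le> R" if "y \<in> ?S" for y
    using that order_trans[OF norm_bounded[of y]] by (auto intro!: continuous_on_apply_bcontfun)
  have F: "apply_bcontfun (F y) = \<Phi> (apply_bcontfun y)" if "y \<in> ?S" for y
    unfolding F_def
    by (rule Bcontfun_inverse, rule bcontfun_normI) (rule \<Phi>c[OF inS[OF that]], rule \<Phi>b[OF inS[OF that]])
  have "\<exists>!y\<in>?S. F y = y"
  proof (rule Banach_fix[OF complete_eq_closed[THEN iffD2, OF closed_cball], where c="1/2"])
    show "?S \<noteq> {}" using R by auto
    show "F ` ?S \<subseteq> ?S"
    proof (clarify)
      fix y assume y: "y \<in> ?S"
      have "norm (F y) \<le> R"
        by (rule norm_bound) (simp only: F[OF y] \<Phi>b[OF inS[OF y]])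
      thus "F y \<in> ?S" by simp
    qed
    show "dist (F y) (F y') \<le> 1 / 2 * dist y y'" if y: "y \<in> ?S" "y' \<in> ?S" for y y'
    proof -
      show "dist (F y) (F y') \<le> 1 / 2 * dist y y'"
      proof (rule dist_bound)
        fix z
        show "dist (apply_bcontfun (F y) z) (apply_bcontfun (F y') z) \<le> 1 / 2 * dist y y'"
          unfolding F[OF y(1)] F[OF y(2)] dist_norm[of "\<Phi> _ z"]
          by (rule \<Phi>d[OF inS(1)[OF y(1)] inS(1)[OF y(2)] inS(2)[OF y(1)] inS(2)[OF y(2)]])
             (metis dist_bounded dist_norm)
      qed
    qed
  qed auto
  then obtain y' where y': "y' \<in> ?S" "F y' = y'" by blast
  define y where "y = apply_bcontfun y'"
  have yc: "continuous_on UNIV y" and yb: "\<And>z. norm (y z) \<le> R"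
    using inS[OF y'(1)] by (auto simp: y_def)
  have fix_y: "y z = \<Phi> y z" for z using F[OF y'(1)] y'(2) by (simp add: y_def)
  define V where "V = unweight n y"
  show ?thesis
  proof (rule exI[of _ T], rule conjI[OF T], rule exI[of _ R], rule exI[of _ V], intro conjI allI ballI)
    have "?c 0 = 0" using T by (simp add: clamp_time_def)
    thus "V 0 = V0"
      using wt0 by (auto simp: V_def unweight_def fix_y[of "(0, _)"] \<Phi>_def phase_def y0_def vec_eq_iff fun_eq_iff)
    show "decays n (\<lambda>\<xi>. V t \<xi> $ j)" for t j
      unfolding V_def by (rule decays_unweight[OF yc yb])
    show "norm (V t \<xi>) \<le> R * wt n \<xi>" for t \<xi>
      unfolding V_def norm_unweight by (intro mult_right_mono yb) auto
    fix t \<xi> j assume t: "t \<in> {-T<..<T}"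
    have "((\<lambda>t. t *\<^sub>R integral {0..1} (\<lambda>\<theta>. G y (t * \<theta>, \<xi>))) has_vector_derivative G y (t, \<xi>)) (at t)"
      by (rule has_vector_derivative_scaled_integral[of "\<lambda>t. G y (t, \<xi>)"])
         (intro continuous_on_compose2[OF Gc[OF yc yb]] continuous_intros, auto)
    from has_vector_derivative_add[OF has_vector_derivative_const[of "y0 (0, \<xi>)"] this]
    have "((\<lambda>t. y0 (0, \<xi>) + t *\<^sub>R integral {0..1} (\<lambda>\<theta>. G y (t * \<theta>, \<xi>))) has_vector_derivative G y (t, \<xi>)) (at t)"
      by simp
    hence "((\<lambda>t. y (t, \<xi>)) has_vector_derivative G y (t, \<xi>)) (at t)"
      by (rule has_vector_derivative_transform_within_open[where S="{-T<..<T}"])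
         (use t in \<open>auto simp: fix_y[of "(_, _)"] \<Phi>_def clamp_time_def y0_def\<close>)
    hence yd: "((\<lambda>t. y (t, \<xi>) $ j) has_vector_derivative G y (t, \<xi>) $ j) (at t)"
      by (rule bounded_linear.has_vector_derivative[OF bounded_linear_vec_nth])
    have pd: "((\<lambda>t. phase (- t) \<xi>) has_vector_derivative (- \<i> * (norm \<xi>)\<^sup>2 * phase (- t) \<xi>)) (at t)"
      unfolding phase_def cis_conv_exp
      by (auto intro!: derivative_eq_intros has_vector_derivative_real_field simp: mult_ac)
    have "((\<lambda>t. (phase (- t) \<xi> * y (t, \<xi>) $ j) * wt n \<xi>) has_vector_derivative
       (phase (- t) \<xi> * G y (t, \<xi>) $ j + (- \<i> * (norm \<xi>)\<^sup>2 * phase (- t) \<xi>) * y (t, \<xi>) $ j) * wt n \<xi>) (at t)"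
      by (intro has_vector_derivative_mult_left has_vector_derivative_mult pd yd)
    moreover have "(phase (- t) \<xi> * G y (t, \<xi>) $ j) * wt n \<xi> = cubic_conv L (V t) \<xi> $ j"
      using wt0[of \<xi>] by (simp add: G_def interaction_rhs_def V_def phase_def cis_mult field_simps)
    ultimately show "((\<lambda>t. V t \<xi> $ j) has_vector_derivative
       (- \<i> * (norm \<xi>)\<^sup>2 * V t \<xi> $ j + cubic_conv L (V t) \<xi> $ j)) (at t)"
      by (simp add: V_def unweight_def algebra_simps)
  qed
qed

subsection \<open>Differentiability in $L^2$\<close>

text \<open>Borel representatives with respect to \<open>lborel\<close>; the passage to Lebesgue
  measure is made only where the definitions of solutions and of conservation are met.\<close>

definition l2 :: "('a::euclidean_space \<Rightarrow> 'b::euclidean_space) \<Rightarrow> bool" where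
  "l2 f \<longleftrightarrow> f \<in> borel_measurable borel \<and> integrable lborel (\<lambda>x. (norm (f x))\<^sup>2)"

text \<open>Differentiability at s of a curve in L^2; the remainder quotient is squared so that no
  roots occur.\<close>

definition l2_deriv ::
  "(real \<Rightarrow> 'a::euclidean_space \<Rightarrow> 'b::euclidean_space) \<Rightarrow> ('a \<Rightarrow> 'b) \<Rightarrow> real \<Rightarrow> bool" where
  "l2_deriv F F' s \<longleftrightarrow> (\<forall>t. l2 (F t)) \<and> l2 F' \<and>
     ((\<lambda>t. (\<integral>x. (norm (F t x - F s x - (t - s) *\<^sub>R F' x))\<^sup>2 \<partial>lborel) / (t - s)\<^sup>2) \<longlongrightarrow> 0) (at s)"

lemma l2_measurable [measurable_dest]: "l2 f \<Longrightarrow> f \<in> borel_measurable borel"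
  by (simp add: l2_def)

lemma mult_le_squares: "a * b \<le> a\<^sup>2 + (b::real)\<^sup>2"
  using two_mult_le_squares[of a b] sum_power2_ge_zero[of a b] by linarith

lemma l2_zero [simp]: "l2 (\<lambda>_. 0)"
  by (simp add: l2_def)

lemma l2_bound:
  assumes "l2 f" "g \<in> borel_measurable borel" "\<And>x. norm (g x) \<le> c * norm (f x)"
  shows "l2 g"
  unfolding l2_def
proof
  have [measurable]: "f \<in> borel_measurable borel" "g \<in> borel_measurable borel" using assms by (auto simp: l2_def)
  have "integrable lborel (\<lambda>x. c\<^sup>2 * (norm (f x))\<^sup>2)" using assms(1) by (auto simp: l2_def)
  thus "integrable lborel (\<lambda>x. (norm (g x))\<^sup>2)"
    by (rule Bochner_Integration.integrable_bound)
       (use assms(3) in \<open>auto intro!: AE_I2 power_mono simp flip: power_mult_distrib\<close>)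
qed (rule assms)

lemma norm_add_squared_le: "(norm (a + b))\<^sup>2 \<le> 2 * (norm a)\<^sup>2 + 2 * (norm (b::'a::real_normed_vector))\<^sup>2"
proof -
  have "(norm (a + b))\<^sup>2 \<le> (norm a + norm b)\<^sup>2"
    by (intro power_mono norm_triangle_ineq) auto
  also have "\<dots> \<le> 2 * (norm a)\<^sup>2 + 2 * (norm b)\<^sup>2"
    using two_mult_le_squares[of "norm a" "norm b"] by (simp add: power2_sum)
  finally show ?thesis .
qed

lemma l2_add:
  assumes "l2 f" "l2 g"
  shows "l2 (\<lambda>x. f x + g x)"
  unfolding l2_def
proof
  have [measurable]: "f \<in> borel_measurable borel" "g \<in> borel_measurable borel" using assms by (auto simp: l2_def)
  show "(\<lambda>x. f x + g x) \<in> borel_measurable borel" by measurable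
  have "integrable lborel (\<lambda>x. 2 * (norm (f x))\<^sup>2 + 2 * (norm (g x))\<^sup>2)"
    using assms by (auto simp: l2_def)
  thus "integrable lborel (\<lambda>x. (norm (f x + g x))\<^sup>2)"
    by (rule Bochner_Integration.integrable_bound)
       (auto intro!: AE_I2 norm_add_squared_le)
qed

lemma l2_scaleR: "l2 f \<Longrightarrow> l2 (\<lambda>x. c *\<^sub>R f x)"
  by (rule l2_bound[where c="\<bar>c\<bar>"]) (auto dest: l2_measurable)

lemma l2_diff: "l2 f \<Longrightarrow> l2 g \<Longrightarrow> l2 (\<lambda>x. f x - g x)"
  using l2_add[of f "\<lambda>x. (- 1) *\<^sub>R g x"] l2_scaleR[of g "- 1"] by simp

lemma l2_integrable: "l2 f \<Longrightarrow> integrable lborel (\<lambda>x. (norm (f x))\<^sup>2)"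
  by (simp add: l2_def)

lemma l2_mult_integrable:
  assumes "l2 f" "l2 g" "h \<in> borel_measurable borel" "\<And>x. norm (h x) \<le> c * (norm (f x) * norm (g x))"
  shows "integrable lborel (h :: 'a::euclidean_space \<Rightarrow> 'b::{banach,second_countable_topology})"
proof -
  have i: "integrable lborel (\<lambda>x. \<bar>c\<bar> * ((norm (f x))\<^sup>2 + (norm (g x))\<^sup>2))"
    using assms(1,2) by (auto simp: l2_def)
  have b: "norm (h x) \<le> norm (\<bar>c\<bar> * ((norm (f x))\<^sup>2 + (norm (g x))\<^sup>2))" for x
  proof -
    let ?p = "norm (f x) * norm (g x)"
    have "norm (h x) \<le> c * ?p" by (rule assms)
    also have "\<dots> \<le> \<bar>c\<bar> * ?p" by (rule mult_right_mono) auto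
    also have "?p \<le> (norm (f x))\<^sup>2 + (norm (g x))\<^sup>2"
      by (rule mult_le_squares)
    hence "\<bar>c\<bar> * ?p \<le> \<bar>c\<bar> * ((norm (f x))\<^sup>2 + (norm (g x))\<^sup>2)"
      by (rule mult_left_mono) simp
    also have "\<dots> \<le> norm \<dots>" unfolding real_norm_def by (rule abs_ge_self)
    finally show ?thesis .
  qed
  have "h \<in> borel_measurable lborel" using assms(3) by simp
  thus ?thesis by (rule Bochner_Integration.integrable_bound[OF i]) (rule AE_I2, rule b)
qed

lemma cauchy_schwarz_lborel:
  fixes f g :: "'a::euclidean_space \<Rightarrow> real"
  assumes f: "l2 f" and g: "l2 g" and "\<And>x. f x \<ge> 0" "\<And>x. g x \<ge> 0"
  shows "(\<integral>x. f x * g x \<partial>lborel) \<le> sqrt (\<integral>x. (f x)\<^sup>2 \<partial>lborel) * sqrt (\<integral>x. (g x)\<^sup>2 \<partial>lborel)"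
proof -
  have [measurable]: "f \<in> borel_measurable borel" "g \<in> borel_measurable borel" using f g by (auto simp: l2_def)
  have i: "integrable lborel (\<lambda>x. (f x)\<^sup>2)" "integrable lborel (\<lambda>x. (g x)\<^sup>2)"
    using f g by (auto simp: l2_def)
  have fg: "integrable lborel (\<lambda>x. f x * g x)"
    by (rule l2_mult_integrable[OF f g, where c=1]) (auto simp: abs_mult)
  define A where "A = (\<integral>x. (f x)\<^sup>2 \<partial>lborel)"
  define B where "B = (\<integral>x. (g x)\<^sup>2 \<partial>lborel)"
  define C where "C = (\<integral>x. f x * g x \<partial>lborel)"
  have AB: "A \<ge> 0" "B \<ge> 0" by (auto simp: A_def B_def)
  have key: "2 * s * C \<le> s\<^sup>2 * A + B" for s
  proof -
    have "0 \<le> (\<integral>x. (s * f x - g x)\<^sup>2 \<partial>lborel)" by simp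
    also have "(\<lambda>x. (s * f x - g x)\<^sup>2) = (\<lambda>x. (s\<^sup>2 * (f x)\<^sup>2 + (g x)\<^sup>2) - 2 * s * (f x * g x))"
      by (auto simp: fun_eq_iff power2_diff power_mult_distrib)
    also have "(\<integral>x. (s\<^sup>2 * (f x)\<^sup>2 + (g x)\<^sup>2) - 2 * s * (f x * g x) \<partial>lborel) = s\<^sup>2 * A + B - 2 * s * C"
      using i fg by (simp add: A_def B_def C_def)
    finally show ?thesis by simp
  qed
  have "C\<^sup>2 \<le> A * B"
  proof (cases "A = 0")
    case True
    show ?thesis
    proof (cases "C = 0")
      case False
      \<comment> \<open>For A = 0 the right-hand side of \<open>key\<close> no longer depends on s,
        and this s violates it unless C = 0.\<close>
      have "2 * ((B + 1) / C) * C \<le> B" using key[of "(B + 1) / C"] True by simp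
      thus ?thesis using False AB by simp
    qed (use AB in simp)
  next
    case False
    hence "A > 0" using AB by simp
    have "2 * (C / A) * C \<le> (C / A)\<^sup>2 * A + B" by (rule key)
    hence "A * (2 * (C / A) * C) \<le> A * ((C / A)\<^sup>2 * A + B)" using AB by (intro mult_left_mono)
    thus ?thesis using \<open>A > 0\<close> by (simp add: power2_eq_square field_simps)
  qed
  hence "sqrt (C\<^sup>2) \<le> sqrt (A * B)" by (rule real_sqrt_le_mono)
  hence "\<bar>C\<bar> \<le> sqrt A * sqrt B" by (simp add: real_sqrt_mult)
  thus ?thesis by (simp add: A_def B_def C_def)
qed

lemma l2_norm: "l2 f \<Longrightarrow> l2 (\<lambda>x. norm (f x))"
  by (auto simp: l2_def)

lemma l2_deriv_remainder_sqrt: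
  assumes "l2_deriv F F' s"
  shows "((\<lambda>t. sqrt (\<integral>x. (norm (F t x - F s x - (t - s) *\<^sub>R F' x))\<^sup>2 \<partial>lborel) / \<bar>t - s\<bar>) \<longlongrightarrow> 0) (at s)"
proof -
  have "((\<lambda>t. sqrt ((\<integral>x. (norm (F t x - F s x - (t - s) *\<^sub>R F' x))\<^sup>2 \<partial>lborel) / (t - s)\<^sup>2)) \<longlongrightarrow> sqrt 0) (at s)"
    using assms unfolding l2_deriv_def by (intro tendsto_real_sqrt) auto
  thus ?thesis by (simp add: real_sqrt_divide)
qed

text \<open>The squared increment is even of order (t-s)^2; the rate o(|t-s|) is what makes a
  quadratic remainder disappear from a derivative.\<close>

lemma l2_deriv_difference:
  assumes d: "l2_deriv F F' s"
  shows "((\<lambda>t. (\<integral>x. (norm (F t x - F s x))\<^sup>2 \<partial>lborel) / \<bar>t - s\<bar>) \<longlongrightarrow> 0) (at s)"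
proof -
  have l: "l2 (F t)" "l2 F'" for t using d by (auto simp: l2_deriv_def)
  define r where "r t = (\<integral>x. (norm (F t x - F s x - (t - s) *\<^sub>R F' x))\<^sup>2 \<partial>lborel) / (t - s)\<^sup>2" for t
  define B where "B = (\<integral>x. (norm (F' x))\<^sup>2 \<partial>lborel)"
  have lr: "l2 (\<lambda>x. F t x - F s x - (t - s) *\<^sub>R F' x)" for t
    by (intro l2_diff l2_scaleR l)
  have "(\<integral>x. (norm (F t x - F s x))\<^sup>2 \<partial>lborel) / \<bar>t - s\<bar> \<le> \<bar>t - s\<bar> * (2 * r t + 2 * B)" if "t \<noteq> s" for t
  proof -
    have i: "integrable lborel (\<lambda>x. (norm (F t x - F s x))\<^sup>2)" by (intro l2_integrable l2_diff l)
    have i2: "integrable lborel (\<lambda>x. 2 * (norm (F t x - F s x - (t - s) *\<^sub>R F' x))\<^sup>2 + 2 * (norm ((t - s) *\<^sub>R F' x))\<^sup>2)"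
      by (intro Bochner_Integration.integrable_add integrable_mult_right l2_integrable lr l2_scaleR l)
    have i3: "integrable lborel (\<lambda>x. (norm (F t x - F s x - (t - s) *\<^sub>R F' x))\<^sup>2)" "integrable lborel (\<lambda>x. (norm (F' x))\<^sup>2)"
      by (intro l2_integrable lr l)+
    have "(\<integral>x. (norm (F t x - F s x))\<^sup>2 \<partial>lborel)
      \<le> (\<integral>x. 2 * (norm (F t x - F s x - (t - s) *\<^sub>R F' x))\<^sup>2 + 2 * (norm ((t - s) *\<^sub>R F' x))\<^sup>2 \<partial>lborel)"
    proof (rule integral_mono[OF i i2])
      fix x show "(norm (F t x - F s x))\<^sup>2 \<le> 2 * (norm (F t x - F s x - (t - s) *\<^sub>R F' x))\<^sup>2 + 2 * (norm ((t - s) *\<^sub>R F' x))\<^sup>2"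
        using norm_add_squared_le[of "F t x - F s x - (t - s) *\<^sub>R F' x" "(t - s) *\<^sub>R F' x"] by simp
    qed
    also have "\<dots> = 2 * (r t * (t - s)\<^sup>2) + 2 * ((t - s)\<^sup>2 * B)"
      using i3 that by (simp add: r_def B_def power_mult_distrib)
    also have "\<dots> = \<bar>t - s\<bar> * (\<bar>t - s\<bar> * (2 * r t + 2 * B))"
      by (simp add: power2_eq_square algebra_simps flip: abs_mult)
    finally show ?thesis using that by (simp add: divide_le_eq mult_ac)
  qed
  hence "eventually (\<lambda>t. norm ((\<integral>x. (norm (F t x - F s x))\<^sup>2 \<partial>lborel) / \<bar>t - s\<bar>) \<le> \<bar>t - s\<bar> * (2 * r t + 2 * B)) (at s)"
    by (auto simp: eventually_at_filter)
  moreover have "((\<lambda>t. \<bar>t - s\<bar> * (2 * r t + 2 * B)) \<longlongrightarrow> \<bar>s - s\<bar> * (2 * 0 + 2 * B)) (at s)"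
    using d unfolding l2_deriv_def r_def[symmetric] by (intro tendsto_intros) auto
  ultimately show ?thesis by (simp add: Lim_null_comparison)
qed

lemma l2_deriv_continuous:
  assumes d: "l2_deriv F F' s"
  shows "((\<lambda>t. \<integral>x. (norm (F t x - F s x))\<^sup>2 \<partial>lborel) \<longlongrightarrow> 0) (at s)"
proof -
  have "((\<lambda>t. \<bar>t - s\<bar> * ((\<integral>x. (norm (F t x - F s x))\<^sup>2 \<partial>lborel) / \<bar>t - s\<bar>)) \<longlongrightarrow> \<bar>s - s\<bar> * 0) (at s)"
    by (intro tendsto_intros l2_deriv_difference[OF d])
  thus ?thesis
    by (rule Lim_transform_eventually[THEN tendsto_eq_rhs]) (auto simp: eventually_at_filter)
qed

text \<open>Differentiates a nonlinear integral functional along an L^2-differentiable curve. The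
  linearization \<open>D\<close> is paired with the remainder of the curve by Cauchy-Schwarz, and
  the quadratic error of \<open>e\<close> is absorbed by \<open>l2_deriv_difference\<close>.\<close>

lemma has_vector_derivative_integral_l2:
  fixes F :: "real \<Rightarrow> 'a::euclidean_space \<Rightarrow> 'b::euclidean_space" and e :: "'a \<Rightarrow> 'b \<Rightarrow> 'c::{banach,second_countable_topology}"
  assumes d: "l2_deriv F F' s" and k: "l2 (k :: 'a \<Rightarrow> real)"
    and lin: "\<And>x. linear (D x)" and bound: "\<And>x h. norm (D x h) \<le> k x * norm h"
    and meas: "\<And>f. f \<in> borel_measurable borel \<Longrightarrow> (\<lambda>x. D x (f x)) \<in> borel_measurable borel"
    and int: "\<And>t. integrable lborel (\<lambda>x. e x (F t x))"
    and rem: "\<And>t x. norm (e x (F t x) - e x (F s x) - D x (F t x - F s x)) \<le> C * (norm (F t x - F s x))\<^sup>2"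
  shows "((\<lambda>t. \<integral>x. e x (F t x) \<partial>lborel) has_vector_derivative (\<integral>x. D x (F' x) \<partial>lborel)) (at s)"
    and "integrable lborel (\<lambda>x. D x (F' x))"
proof -
  have l: "l2 (F t)" "l2 F'" for t using d by (auto simp: l2_deriv_def)
  have k0: "k x \<ge> 0" for x
  proof -
    obtain b :: 'b where "b \<in> Basis" using nonempty_Basis ex_in_conv by metis
    thus ?thesis using order_trans[OF norm_ge_zero bound[of x b]] by simp
  qed
  have lr: "l2 (\<lambda>x. F t x - F s x - (t - s) *\<^sub>R F' x)" for t
    by (intro l2_diff l2_scaleR l)
  have Di: "integrable lborel (\<lambda>x. D x (f x))" if "l2 f" for f
    by (rule l2_mult_integrable[OF k that, where c=1]) (use bound k0 meas l2_measurable[OF that] in auto)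
  show "integrable lborel (\<lambda>x. D x (F' x))" by (rule Di[OF l(2)])
  define r where "r t = sqrt (\<integral>x. (norm (F t x - F s x - (t - s) *\<^sub>R F' x))\<^sup>2 \<partial>lborel) / \<bar>t - s\<bar>" for t
  define q where "q t = (\<integral>x. (norm (F t x - F s x))\<^sup>2 \<partial>lborel) / \<bar>t - s\<bar>" for t
  define K where "K = sqrt (\<integral>x. (k x)\<^sup>2 \<partial>lborel)"
  have est: "norm ((\<integral>x. e x (F t x) \<partial>lborel) - (\<integral>x. e x (F s x) \<partial>lborel) - (t - s) *\<^sub>R (\<integral>x. D x (F' x) \<partial>lborel)) / \<bar>t - s\<bar>
    \<le> K * r t + C * q t" if "t \<noteq> s" for t
  proof -
    let ?R = "\<lambda>x. F t x - F s x - (t - s) *\<^sub>R F' x"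
    have "(\<integral>x. e x (F t x) \<partial>lborel) - (\<integral>x. e x (F s x) \<partial>lborel) - (t - s) *\<^sub>R (\<integral>x. D x (F' x) \<partial>lborel)
      = (\<integral>x. e x (F t x) - e x (F s x) - (t - s) *\<^sub>R D x (F' x) \<partial>lborel)"
      using int Di[OF l(2)] by simp
    also have "\<dots> = (\<integral>x. (e x (F t x) - e x (F s x) - D x (F t x - F s x)) + D x (?R x) \<partial>lborel)"
      by (intro Bochner_Integration.integral_cong refl) (simp add: linear_diff[OF lin] linear_scale[OF lin])
    also have "norm \<dots> \<le> (\<integral>x. C * (norm (F t x - F s x))\<^sup>2 + k x * norm (?R x) \<partial>lborel)"
    proof (rule Bochner_Integration.integral_norm_bound_integral)
      show "integrable lborel (\<lambda>x. (e x (F t x) - e x (F s x) - D x (F t x - F s x)) + D x (?R x))"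
        by (intro Bochner_Integration.integrable_add Bochner_Integration.integrable_diff int Di l2_diff l lr)
      show "integrable lborel (\<lambda>x. C * (norm (F t x - F s x))\<^sup>2 + k x * norm (?R x))"
        by (intro Bochner_Integration.integrable_add integrable_mult_right l2_integrable l2_diff l
              l2_mult_integrable[OF k lr, where c=1])
           (use l2_measurable[OF k] l2_measurable[OF lr] in \<open>auto simp: abs_mult\<close>)
      show "norm ((e x (F t x) - e x (F s x) - D x (F t x - F s x)) + D x (?R x)) \<le> C * (norm (F t x - F s x))\<^sup>2 + k x * norm (?R x)" for x
        by (intro norm_triangle_mono rem bound)
    qed
    also have "\<dots> = C * (\<integral>x. (norm (F t x - F s x))\<^sup>2 \<partial>lborel) + (\<integral>x. k x * norm (?R x) \<partial>lborel)"
    proof (subst Bochner_Integration.integral_add)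
      show "integrable lborel (\<lambda>x. k x * norm (?R x))"
        by (rule l2_mult_integrable[OF k lr, where c=1])
           (use l2_measurable[OF k] l2_measurable[OF lr] in \<open>auto simp: abs_mult\<close>)
    qed (auto intro!: integrable_mult_right l2_integrable l2_diff l)
    also have "(\<integral>x. k x * norm (?R x) \<partial>lborel) \<le> K * sqrt (\<integral>x. (norm (?R x))\<^sup>2 \<partial>lborel)"
      unfolding K_def by (rule cauchy_schwarz_lborel[OF k l2_norm[OF lr] k0 norm_ge_zero])
    finally have "norm ((\<integral>x. e x (F t x) \<partial>lborel) - (\<integral>x. e x (F s x) \<partial>lborel) - (t - s) *\<^sub>R (\<integral>x. D x (F' x) \<partial>lborel))
      \<le> C * (\<integral>x. (norm (F t x - F s x))\<^sup>2 \<partial>lborel) + K * sqrt (\<integral>x. (norm (?R x))\<^sup>2 \<partial>lborel)" by simp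
    from divide_right_mono[OF this, of "\<bar>t - s\<bar>"] show ?thesis
      by (simp add: r_def q_def add_divide_distrib)
  qed
  have "((\<lambda>t. K * r t + C * q t) \<longlongrightarrow> K * 0 + C * 0) (at s)"
    unfolding r_def q_def
    by (intro tendsto_intros l2_deriv_remainder_sqrt[OF d] l2_deriv_difference[OF d])
  hence lim: "((\<lambda>t. K * r t + C * q t) \<longlongrightarrow> 0) (at s)" by simp
  have "((\<lambda>t. norm ((\<integral>x. e x (F t x) \<partial>lborel) - (\<integral>x. e x (F s x) \<partial>lborel) - (t - s) *\<^sub>R (\<integral>x. D x (F' x) \<partial>lborel)) / norm (t - s)) \<longlongrightarrow> 0) (at s)"
    by (rule Lim_null_comparison[OF _ lim]) (auto simp: eventually_at_filter est)
  thus "((\<lambda>t. \<integral>x. e x (F t x) \<partial>lborel) has_vector_derivative (\<integral>x. D x (F' x) \<partial>lborel)) (at s)"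
    unfolding has_vector_derivative_def has_derivative_iff_norm
    by (auto intro: bounded_linear_scaleR_left simp: field_simps)
qed


section \<open>Pairs, vectors and products of L^2-differentiable curves\<close>

lemma l2_Pair: "l2 f \<Longrightarrow> l2 g \<Longrightarrow> l2 (\<lambda>x. (f x, g x))"
  unfolding l2_def by (auto simp: norm_Pair intro!: borel_measurable_Pair)

lemma l2_deriv_Pair:
  assumes F: "l2_deriv F F' s" and G: "l2_deriv G G' s"
  shows "l2_deriv (\<lambda>t x. (F t x, G t x)) (\<lambda>x. (F' x, G' x)) s"
proof -
  have l: "l2 (F t)" "l2 F'" "l2 (G t)" "l2 G'" for t using F G by (auto simp: l2_deriv_def)
  have i: "integrable lborel (\<lambda>x. (norm (F t x - F s x - (t - s) *\<^sub>R F' x))\<^sup>2)"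
    "integrable lborel (\<lambda>x. (norm (G t x - G s x - (t - s) *\<^sub>R G' x))\<^sup>2)" for t
    by (intro l2_integrable l2_diff l2_scaleR l)+
  have "((\<lambda>t. (\<integral>x. (norm (F t x - F s x - (t - s) *\<^sub>R F' x))\<^sup>2 \<partial>lborel) / (t - s)\<^sup>2
      + (\<integral>x. (norm (G t x - G s x - (t - s) *\<^sub>R G' x))\<^sup>2 \<partial>lborel) / (t - s)\<^sup>2) \<longlongrightarrow> 0 + 0) (at s)"
    using F G unfolding l2_deriv_def by (intro tendsto_intros) auto
  thus ?thesis
    unfolding l2_deriv_def using i by (simp add: l l2_Pair norm_Pair add_divide_distrib)
qed

lemma norm_vec_squared: "(norm (x::'b::real_normed_vector^'k::finite))\<^sup>2 = (\<Sum>j\<in>UNIV. (norm (x $ j))\<^sup>2)"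
  by (simp add: norm_vec_def L2_set_def sum_nonneg)

lemma borel_measurable_vec_lambda:
  fixes f :: "'k::finite \<Rightarrow> 'a \<Rightarrow> 'b::euclidean_space"
  assumes [measurable]: "\<And>j. f j \<in> borel_measurable M"
  shows "(\<lambda>x. \<chi> j. f j x) \<in> borel_measurable M"
proof (rule borel_measurable_euclidean_space[THEN iffD2], rule ballI)
  fix b :: "'b^'k" assume "b \<in> Basis"
  then obtain i u where b: "b = axis i u" by (auto simp: Basis_vec_def)
  show "(\<lambda>x. (\<chi> j. f j x) \<bullet> b) \<in> borel_measurable M"
    unfolding b by (simp add: inner_axis)
qed

lemma l2_vec:
  fixes f :: "'k::finite \<Rightarrow> 'a::euclidean_space \<Rightarrow> 'b::euclidean_space"
  assumes "\<And>j. l2 (f j)"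
  shows "l2 (\<lambda>x. \<chi> j. f j x)"
  using assms unfolding l2_def by (auto simp: norm_vec_squared intro!: borel_measurable_vec_lambda)

lemma l2_deriv_vec:
  fixes F :: "'k::finite \<Rightarrow> real \<Rightarrow> 'a::euclidean_space \<Rightarrow> 'b::euclidean_space"
  assumes F: "\<And>j. l2_deriv (F j) (F' j) s"
  shows "l2_deriv (\<lambda>t x. \<chi> j. F j t x) (\<lambda>x. \<chi> j. F' j x) s"
proof -
  have l: "l2 (F j t)" "l2 (F' j)" for t j using F by (auto simp: l2_deriv_def)
  have i: "integrable lborel (\<lambda>x. (norm (F j t x - F j s x - (t - s) *\<^sub>R F' j x))\<^sup>2)" for t j
    by (intro l2_integrable l2_diff l2_scaleR l)
  have "((\<lambda>t. \<Sum>j\<in>UNIV. (\<integral>x. (norm (F j t x - F j s x - (t - s) *\<^sub>R F' j x))\<^sup>2 \<partial>lborel) / (t - s)\<^sup>2)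
      \<longlongrightarrow> (\<Sum>j\<in>(UNIV::'k set). 0)) (at s)"
    using F unfolding l2_deriv_def by (intro tendsto_intros) auto
  thus ?thesis
    unfolding l2_deriv_def using i by (simp add: l l2_vec norm_vec_squared sum_divide_distrib)
qed

lemma l2_deriv_const: "l2 f \<Longrightarrow> l2_deriv (\<lambda>_. f) (\<lambda>_. 0) s"
  by (simp add: l2_deriv_def)

lemma has_vector_derivative_integral_mult:
  fixes F G :: "real \<Rightarrow> 'a::euclidean_space \<Rightarrow> complex"
  assumes F: "l2_deriv F F' s" and G: "l2_deriv G G' s"
  shows "((\<lambda>t. \<integral>x. F t x * G t x \<partial>lborel) has_vector_derivative
      (\<integral>x. F s x * G' x + F' x * G s x \<partial>lborel)) (at s)"
proof -
  have l: "l2 (F t)" "l2 F'" "l2 (G t)" "l2 G'" for t using F G by (auto simp: l2_deriv_def)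
  have "((\<lambda>t. \<integral>x. (\<lambda>p. fst p * snd p) (F t x, G t x) \<partial>lborel) has_vector_derivative
     (\<integral>x. (\<lambda>p. F s x * snd p + fst p * G s x) (F' x, G' x) \<partial>lborel)) (at s)"
  proof (rule has_vector_derivative_integral_l2(1)[OF l2_deriv_Pair[OF F G], where C=1])
    show "l2 (\<lambda>x. norm (F s x) + norm (G s x))" by (intro l2_add l2_norm l)
    show "linear (\<lambda>p. F s x * snd p + fst p * G s x)" for x
      by (rule linearI) (auto simp: algebra_simps)
    show "norm (F s x * snd h + fst h * G s x) \<le> (norm (F s x) + norm (G s x)) * norm h" for x h
    proof -
      have "norm (F s x * snd h + fst h * G s x) \<le> norm (F s x) * norm (snd h) + norm (fst h) * norm (G s x)"
        by (intro norm_triangle_mono) (auto simp: norm_mult)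
      also have "\<dots> \<le> norm (F s x) * norm h + norm h * norm (G s x)"
        using norm_fst_le[of "fst h" "snd h"] norm_snd_le[of "snd h" "fst h"]
        by (intro add_mono mult_mono order_refl) auto
      finally show ?thesis by (simp add: algebra_simps)
    qed
    show "(\<lambda>x. F s x * snd (f x) + fst (f x) * G s x) \<in> borel_measurable borel"
      if f: "f \<in> borel_measurable borel" for f
    proof -
      have [measurable]: "(\<lambda>x. fst (f x)) \<in> borel_measurable borel" "(\<lambda>x. snd (f x)) \<in> borel_measurable borel"
        by (intro measurable_compose[OF f] borel_measurable_continuous_onI continuous_intros)+
      show ?thesis using l2_measurable[OF l(1), of s] l2_measurable[OF l(3), of s] by measurable
    qed
    show "integrable lborel (\<lambda>x. fst (F t x, G t x) * snd (F t x, G t x))" for t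
      by (rule l2_mult_integrable[OF l(1)[of t] l(3)[of t], where c=1])
         (use l2_measurable[OF l(1), of t] l2_measurable[OF l(3), of t] in \<open>auto simp: norm_mult\<close>)
    show "norm (fst (F t x, G t x) * snd (F t x, G t x) - fst (F s x, G s x) * snd (F s x, G s x)
        - (F s x * snd ((F t x, G t x) - (F s x, G s x)) + fst ((F t x, G t x) - (F s x, G s x)) * G s x))
        \<le> 1 * (norm ((F t x, G t x) - (F s x, G s x)))\<^sup>2" for t x
    proof -
      have "fst (F t x, G t x) * snd (F t x, G t x) - fst (F s x, G s x) * snd (F s x, G s x)
        - (F s x * snd ((F t x, G t x) - (F s x, G s x)) + fst ((F t x, G t x) - (F s x, G s x)) * G s x)
        = (F t x - F s x) * (G t x - G s x)" by (simp add: algebra_simps)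
      thus ?thesis
        using mult_le_squares[of "norm (F t x - F s x)" "norm (G t x - G s x)"]
        by (simp add: norm_mult norm_Pair)
    qed
  qed
  thus ?thesis by simp
qed

lemma integral_dominated_convergence_at:
  fixes q :: "real \<Rightarrow> 'a::euclidean_space \<Rightarrow> real"
  assumes S: "open S" "s \<in> S" and w: "integrable lborel w"
    and meas: "\<And>t. q t \<in> borel_measurable borel"
    and bound: "\<And>t x. t \<in> S \<Longrightarrow> t \<noteq> s \<Longrightarrow> \<bar>q t x\<bar> \<le> w x"
    and lim: "\<And>x. ((\<lambda>t. q t x) \<longlongrightarrow> 0) (at s)"
  shows "((\<lambda>t. \<integral>x. q t x \<partial>lborel) \<longlongrightarrow> 0) (at s)"
proof -
  have "((\<lambda>t. \<integral>x. q t x \<partial>lborel) \<longlongrightarrow> 0) (at s within S)"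
    unfolding tendsto_at_iff_sequentially
  proof (intro allI impI)
    fix X :: "nat \<Rightarrow> real" assume X: "\<forall>i. X i \<in> S - {s}" "X \<longlonglongrightarrow> s"
    have "(\<lambda>i. \<integral>x. q (X i) x \<partial>lborel) \<longlonglongrightarrow> (\<integral>x. 0 \<partial>(lborel :: 'a measure))"
    proof (rule integral_dominated_convergence[OF _ _ w])
      show "AE x in lborel. (\<lambda>i. q (X i) x) \<longlonglongrightarrow> 0"
      proof (rule AE_I2)
        fix x
        have "((\<lambda>t. q t x) \<longlongrightarrow> 0) (at s within S)" using lim at_within_open[OF S(2,1)] by simp
        thus "(\<lambda>i. q (X i) x) \<longlonglongrightarrow> 0"
          using X unfolding tendsto_at_iff_sequentially o_def by blast
      qed
    qed (use X bound meas in auto)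
    thus "((\<lambda>t. \<integral>x. q t x \<partial>lborel) \<circ> X) \<longlonglongrightarrow> 0" by (simp add: o_def)
  qed
  thus ?thesis using at_within_open[OF S(2,1)] by simp
qed

text \<open>The mean value inequality dominates the difference quotients of the densities by a
  multiple of \<open>wt n\<close>, dominated convergence gives L^2 convergence on the frequency
  side, and Bessel's inequality carries it over to the Fourier integrals.\<close>

lemma l2_deriv_fint:
  fixes v :: "real \<Rightarrow> 'a::euclidean_space \<Rightarrow> complex"
  assumes n: "DIM('a) \<le> n" and v: "\<And>t. decays n (v t)" and v': "\<And>t. t \<in> S \<Longrightarrow> decays n (v' t)"
    and S: "open S" "is_interval S" "s \<in> S"
    and b: "\<And>t \<xi>. t \<in> S \<Longrightarrow> cmod (v' t \<xi>) \<le> C * wt n \<xi>"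
    and d: "\<And>t \<xi>. t \<in> S \<Longrightarrow> ((\<lambda>t. v t \<xi>) has_vector_derivative v' t \<xi>) (at t)"
  shows "l2_deriv (\<lambda>t. fint (v t)) (fint (v' s)) s"
proof -
  have l: "l2 (fint w)" if "decays n w" for w :: "'a \<Rightarrow> complex"
    unfolding l2_def using bessel_fint(1)[OF that n] fint_measurable[OF decays_integrable[OF that n]] by simp
  define q where "q t \<xi> = v t \<xi> - v s \<xi> - (t - s) * v' s \<xi>" for t \<xi>
  have q: "decays n (q t)" for t unfolding q_def using v v' S by (intro decays_diff decays_cmult) auto
  have fq: "fint (v t) x - fint (v s) x - (t - s) *\<^sub>R fint (v' s) x = fint (q t) x" for t x
  proof -
    have "fint (q t) x = fint (\<lambda>\<xi>. v t \<xi> - v s \<xi>) x - fint (\<lambda>\<xi>. (t - s) * v' s \<xi>) x"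
      unfolding q_def using v v' S
      by (intro fint_diff decays_integrable[OF _ n] decays_diff decays_cmult) auto
    also have "fint (\<lambda>\<xi>. v t \<xi> - v s \<xi>) x = fint (v t) x - fint (v s) x"
      using v by (intro fint_diff decays_integrable[OF _ n]) auto
    finally show ?thesis by (simp add: fint_cmult scaleR_conv_of_real)
  qed
  have C: "C \<ge> 0" by (rule wt_bound_nonneg[OF b[OF S(3)]])
  have qb: "cmod (q t \<xi>) / \<bar>t - s\<bar> \<le> 2 * C * wt n \<xi>" if t: "t \<in> S" "t \<noteq> s" for t \<xi>
  proof -
    have "norm (v t \<xi> - v s \<xi>) \<le> (C * wt n \<xi>) * norm (t - s)"
    proof (rule differentiable_bound[of S])
      show "convex S" using S(2) by (simp add: is_interval_convex_1)
      show "((\<lambda>t. v t \<xi>) has_derivative (\<lambda>h. h *\<^sub>R v' r \<xi>)) (at r within S)" if "r \<in> S" for r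
        using d[OF that, of \<xi>] by (simp add: has_vector_derivative_def has_derivative_at_withinI)
      show "onorm (\<lambda>h. h *\<^sub>R v' r \<xi>) \<le> C * wt n \<xi>" if "r \<in> S" for r
        using b[OF that, of \<xi>] by (intro onorm_le) (simp add: mult.commute mult_left_mono)
    qed (use t S in auto)
    moreover have "norm (complex_of_real (t - s) * v' s \<xi>) \<le> (C * wt n \<xi>) * norm (t - s)"
      using b[OF S(3), of \<xi>] by (simp add: norm_mult mult.commute mult_left_mono del: of_real_diff)
    ultimately have "norm (q t \<xi>) \<le> (C * wt n \<xi>) * norm (t - s) + (C * wt n \<xi>) * norm (t - s)"
      unfolding q_def using norm_triangle_ineq4[of "v t \<xi> - v s \<xi>" "complex_of_real (t - s) * v' s \<xi>"] by simp
    thus ?thesis using t by (simp add: divide_le_eq)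
  qed
  have "((\<lambda>t. \<integral>\<xi>. (cmod (q t \<xi>) / \<bar>t - s\<bar>)\<^sup>2 \<partial>lborel) \<longlongrightarrow> 0) (at s)"
  proof (rule integral_dominated_convergence_at[OF S(1,3)])
    show "integrable lborel (\<lambda>\<xi>::'a. (2 * C)\<^sup>2 * wt n \<xi>)" using wt_integrable[OF n] by simp
    show "(\<lambda>\<xi>. (cmod (q t \<xi>) / \<bar>t - s\<bar>)\<^sup>2) \<in> borel_measurable borel" for t
      using decays_measurable[OF q[of t]] by measurable
    show "\<bar>(cmod (q t \<xi>) / \<bar>t - s\<bar>)\<^sup>2\<bar> \<le> (2 * C)\<^sup>2 * wt n \<xi>" if "t \<in> S" "t \<noteq> s" for t \<xi>
    proof -
      have "(cmod (q t \<xi>) / \<bar>t - s\<bar>)\<^sup>2 \<le> (2 * C * wt n \<xi>)\<^sup>2"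
        by (intro power_mono qb that) auto
      also have "\<dots> = (2 * C)\<^sup>2 * (wt n \<xi> * wt n \<xi>)" by (simp add: power2_eq_square)
      also have "\<dots> \<le> (2 * C)\<^sup>2 * (1 * wt n \<xi>)"
        by (intro mult_left_mono mult_right_mono wt_le_1) auto
      finally show ?thesis by simp
    qed
    fix \<xi>
    have "((\<lambda>t. norm (v t \<xi> - v s \<xi> - (t - s) *\<^sub>R v' s \<xi>) / norm (t - s)) \<longlongrightarrow> 0) (at s)"
      using d[OF S(3), of \<xi>] unfolding has_vector_derivative_def has_derivative_iff_norm by simp
    hence "((\<lambda>t. cmod (q t \<xi>) / \<bar>t - s\<bar>) \<longlongrightarrow> 0) (at s)"
      by (simp add: q_def scaleR_conv_of_real)
    from tendsto_power[OF this, of 2] show "((\<lambda>t. (cmod (q t \<xi>) / \<bar>t - s\<bar>)\<^sup>2) \<longlongrightarrow> 0) (at s)" by simp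
  qed
  hence "((\<lambda>t. (2 * pi) ^ DIM('a) * (\<integral>\<xi>. (cmod (q t \<xi>) / \<bar>t - s\<bar>)\<^sup>2 \<partial>lborel)) \<longlongrightarrow> 0) (at s)"
    by (auto intro!: tendsto_mult_right_zero)
  hence lim: "((\<lambda>t. (2 * pi) ^ DIM('a) * (\<integral>\<xi>. (cmod (q t \<xi>))\<^sup>2 \<partial>lborel) / (t - s)\<^sup>2) \<longlongrightarrow> 0) (at s)"
    by (simp add: power_divide)
  have "((\<lambda>t. (\<integral>x. (cmod (fint (q t) x))\<^sup>2 \<partial>lborel) / (t - s)\<^sup>2) \<longlongrightarrow> 0) (at s)"
  proof (rule Lim_null_comparison[OF _ lim], rule always_eventually, rule allI)
    fix t
    have "(\<integral>x. (cmod (fint (q t) x))\<^sup>2 \<partial>lborel) / (t - s)\<^sup>2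
      \<le> (2 * pi) ^ DIM('a) * (\<integral>\<xi>. (cmod (q t \<xi>))\<^sup>2 \<partial>lborel) / (t - s)\<^sup>2"
      by (rule divide_right_mono[OF bessel_fint(2)[OF q n]]) simp
    thus "norm ((\<integral>x. (cmod (fint (q t) x))\<^sup>2 \<partial>lborel) / (t - s)\<^sup>2)
      \<le> (2 * pi) ^ DIM('a) * (\<integral>\<xi>. (cmod (q t \<xi>))\<^sup>2 \<partial>lborel) / (t - s)\<^sup>2"
      by (subst real_norm_def, subst abs_of_nonneg) auto
  qed
  thus ?thesis
    unfolding l2_deriv_def fq using l v v' S by auto
qed


lemma l2_fint:
  fixes v :: "'a::euclidean_space \<Rightarrow> complex"
  shows "DIM('a) \<le> n \<Longrightarrow> decays n v \<Longrightarrow> l2 (fint v)"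
  unfolding l2_def using bessel_fint(1)[of n v] fint_measurable[OF decays_integrable[of n v]] by simp

lemma decays_inner_mult:
  fixes v :: "'a::euclidean_space \<Rightarrow> complex"
  assumes "decays (Suc n) v"
  shows "decays n (\<lambda>\<xi>. (\<i> * (\<xi> \<bullet> e)) * v \<xi>)"
proof (rule decays_mult_growth[where m=1 and K="norm e"])
  show "decays (1 + n) v" using assms by simp
  show "norm (\<i> * complex_of_real (\<xi> \<bullet> e)) \<le> norm e * (1 + (norm \<xi>)\<^sup>2) ^ 1" for \<xi>
  proof -
    have "norm \<xi> \<le> 1 + (norm \<xi>)\<^sup>2"
      using mult_le_squares[of 1 "norm \<xi>"] by simp
    hence "norm e * norm \<xi> \<le> norm e * (1 + (norm \<xi>)\<^sup>2)" by (intro mult_left_mono) auto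
    thus ?thesis using Cauchy_Schwarz_ineq2[of \<xi> e] by (simp add: norm_mult mult.commute)
  qed
qed (intro continuous_intros)

lemma decays_norm_sq_mult:
  fixes v :: "'a::euclidean_space \<Rightarrow> complex"
  assumes "decays (Suc n) v"
  shows "decays n (\<lambda>\<xi>. (norm \<xi>)\<^sup>2 * v \<xi>)"
  by (rule decays_mult_growth[where m=1 and K=1]) (use assms in \<open>auto intro!: continuous_intros simp: norm_power\<close>)

text \<open>Translation in x is modulation in \<xi>, so a directional derivative is the case of
  \<open>l2_deriv_fint\<close> in which the shift h plays the role of time.\<close>

lemma l2_deriv_fint_translate:
  fixes v :: "'a::euclidean_space \<Rightarrow> complex"
  assumes n: "DIM('a) \<le> n" and v: "decays (Suc n) v"
  shows "l2_deriv (\<lambda>h x. fint v (x + h *\<^sub>R e)) (fint (\<lambda>\<xi>. (\<i> * (\<xi> \<bullet> e)) * v \<xi>)) 0"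
proof -
  have vn: "decays n v" by (rule decays_antimono[OF v]) simp
  have w: "decays n (\<lambda>\<xi>. (\<i> * (\<xi> \<bullet> e)) * v \<xi>)" by (rule decays_inner_mult[OF v])
  obtain C where C: "\<And>\<xi>. cmod ((\<i> * (\<xi> \<bullet> e)) * v \<xi>) \<le> C * wt n \<xi>"
    by (rule decaysE[OF w]) auto
  have c: "decays n (\<lambda>\<xi>. cis (h * (\<xi> \<bullet> e)) * f \<xi>)" if "decays n f" for h f
    by (rule decays_mult_bounded[OF that, where K=1]) (auto intro!: continuous_intros)
  have "l2_deriv (\<lambda>h. fint (\<lambda>\<xi>. cis (h * (\<xi> \<bullet> e)) * v \<xi>))
      (fint (\<lambda>\<xi>. cis (0 * (\<xi> \<bullet> e)) * ((\<i> * (\<xi> \<bullet> e)) * v \<xi>))) 0"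
  proof (rule l2_deriv_fint[OF n, where S=UNIV and v'="\<lambda>h \<xi>. cis (h * (\<xi> \<bullet> e)) * ((\<i> * (\<xi> \<bullet> e)) * v \<xi>)"])
    show "cmod (cis (h * (\<xi> \<bullet> e)) * ((\<i> * (\<xi> \<bullet> e)) * v \<xi>)) \<le> C * wt n \<xi>" for h \<xi>
      using C[of \<xi>] by (simp add: norm_mult)
    have der: "((\<lambda>h. cis (h * (\<xi> \<bullet> e))) has_vector_derivative (\<i> * (\<xi> \<bullet> e)) * cis (h * (\<xi> \<bullet> e))) (at h)" for h \<xi>
      unfolding cis_conv_exp
      by (auto intro!: derivative_eq_intros has_vector_derivative_real_field simp: mult_ac)
    show "((\<lambda>h. cis (h * (\<xi> \<bullet> e)) * v \<xi>) has_vector_derivative cis (h * (\<xi> \<bullet> e)) * ((\<i> * (\<xi> \<bullet> e)) * v \<xi>)) (at h)" for h \<xi>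
      using has_vector_derivative_mult_left[OF der[of \<xi> h], of "v \<xi>"] by (simp add: mult_ac)
  qed (use c vn w in auto)
  thus ?thesis by (simp add: fint_modulate inner_commute)
qed

text \<open>Integration by parts: \<open>\<integral> f(x + he) g(x + he) dx\<close> does not depend on \<open>h\<close>.\<close>

lemma integral_by_parts_translate:
  fixes f g :: "'a::euclidean_space \<Rightarrow> complex"
  assumes f: "l2_deriv (\<lambda>h x. f (x + h *\<^sub>R e)) f' 0" and g: "l2_deriv (\<lambda>h x. g (x + h *\<^sub>R e)) g' 0"
  shows "(\<integral>x. f' x * g x \<partial>lborel) = - (\<integral>x. f x * g' x \<partial>lborel)"
proof -
  have l: "l2 f" "l2 g" "l2 f'" "l2 g'"
    using f g unfolding l2_deriv_def by (auto dest: spec[of _ 0])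
  note [measurable] = l[THEN l2_measurable]
  have "(\<integral>x. f (x + h *\<^sub>R e) * g (x + h *\<^sub>R e) \<partial>lborel) = (\<integral>x. f x * g x \<partial>lborel)" for h
    by (rule lborel_integral_translate(1)[of "\<lambda>x. f x * g x"]) measurable
  hence "((\<lambda>h::real. \<integral>x. f x * g x \<partial>lborel) has_vector_derivative
      (\<integral>x. f (x + 0 *\<^sub>R e) * g' x + f' x * g (x + 0 *\<^sub>R e) \<partial>lborel)) (at 0)"
    using has_vector_derivative_integral_mult[OF f g] by simp
  hence "(\<integral>x. f (x + 0 *\<^sub>R e) * g' x + f' x * g (x + 0 *\<^sub>R e) \<partial>lborel) = 0"
    by (rule vector_derivative_unique_at) simp
  moreover have "integrable lborel (\<lambda>x. f x * g' x)"
    by (rule l2_mult_integrable[OF l(1,4), where c=1]) (auto simp: norm_mult)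
  moreover have "integrable lborel (\<lambda>x. f' x * g x)"
    by (rule l2_mult_integrable[OF l(3,2), where c=1]) (auto simp: norm_mult)
  ultimately show ?thesis by (simp add: add_eq_0_iff)
qed

lemma fint_integral_by_parts:
  fixes v w :: "'a::euclidean_space \<Rightarrow> complex"
  assumes n: "DIM('a) \<le> n" and v: "decays (Suc n) v" and w: "decays (Suc n) w"
  shows "(\<integral>x. fint (\<lambda>\<xi>. (\<i> * (\<xi> \<bullet> e)) * v \<xi>) x * cnj (fint w x) \<partial>lborel)
     = - (\<integral>x. fint v x * cnj (fint (\<lambda>\<xi>. (\<i> * (\<xi> \<bullet> e)) * w \<xi>) x) \<partial>lborel)"
proof -
  define w' where "w' = (\<lambda>\<xi>. cnj (w (- \<xi>)))"
  have w': "decays (Suc n) w'" unfolding w'_def using w by (rule decays_reflect)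
  note m = decays_measurable[OF w] decays_measurable[OF decays_inner_mult[OF w]]
  have 1: "fint w' x = cnj (fint w x)" for x unfolding w'_def by (rule fint_reflect[OF m(1)])
  have 2: "fint (\<lambda>\<xi>. (\<i> * (\<xi> \<bullet> e)) * w' \<xi>) x = cnj (fint (\<lambda>\<xi>. (\<i> * (\<xi> \<bullet> e)) * w \<xi>) x)" for x
    using fint_reflect[OF m(2), of e x] by (simp add: w'_def)
  show ?thesis
    using integral_by_parts_translate[OF l2_deriv_fint_translate[OF n v, of e] l2_deriv_fint_translate[OF n w', of e]]
    unfolding 1 2 .
qed

subsection \<open>Test functions\<close>

lemma test_function_facts:
  fixes \<phi> :: "real^'k::finite \<Rightarrow> real"
  assumes \<phi>: "test_function \<phi>"
  shows "continuous_on UNIV \<phi>" "continuous_on UNIV (partial k \<phi>)"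
    and "((\<lambda>h. \<phi> (x + h *\<^sub>R axis k 1)) has_real_derivative partial k \<phi> (x + t *\<^sub>R axis k 1)) (at t)"
    and "\<exists>B r. \<forall>x. \<bar>\<phi> x\<bar> \<le> B \<and> \<bar>partial k \<phi> x\<bar> \<le> B \<and> (norm x > r \<longrightarrow> \<phi> x = 0 \<and> partial k \<phi> x = 0)"
proof -
  have d: "\<phi> differentiable (at x)" for x
    using \<phi> times_cont_diff.simps(2)[of 0 \<phi>] unfolding test_function_def by metis
  show c: "continuous_on UNIV \<phi>"
    using \<phi> times_cont_diff.simps(1)[of \<phi>] unfolding test_function_def by metis
  have "axis k 1 \<in> (Basis :: (real^'k) set)" by (simp add: axis_in_Basis_iff)
  moreover have "times_cont_diff (Suc 0) \<phi>" using \<phi> by (simp only: test_function_def)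
  ultimately show c': "continuous_on UNIV (partial k \<phi>)"
    unfolding partial_def[abs_def] times_cont_diff.simps by blast
  show "((\<lambda>h. \<phi> (x + h *\<^sub>R axis k 1)) has_real_derivative partial k \<phi> (x + t *\<^sub>R axis k 1)) (at t)" for x t
  proof -
    let ?y = "x + t *\<^sub>R axis k 1"
    have D: "(\<phi> has_derivative frechet_derivative \<phi> (at ?y)) (at ?y)"
      using d[of ?y] by (simp add: frechet_derivative_works)
    have "((\<lambda>h. x + h *\<^sub>R axis k 1) has_derivative (\<lambda>h. h *\<^sub>R axis k 1)) (at t)"
      by (auto intro!: derivative_eq_intros)
    from has_derivative_compose[OF this D]
    have "((\<lambda>h. \<phi> (x + h *\<^sub>R axis k 1)) has_derivative (\<lambda>h. frechet_derivative \<phi> (at ?y) (h *\<^sub>R axis k 1))) (at t)" .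
    moreover have "frechet_derivative \<phi> (at ?y) (h *\<^sub>R axis k 1) = partial k \<phi> ?y * h" for h
      unfolding partial_def using linear_scale[OF linear_frechet_derivative[OF d[of ?y]], of h] by simp
    ultimately show ?thesis by (simp add: has_field_derivative_def)
  qed
  define S where "S = closure {x. \<phi> x \<noteq> 0}"
  have S: "compact S" using \<phi> by (simp add: test_function_def S_def)
  have z: "\<phi> x = 0" "partial k \<phi> x = 0" if "x \<notin> S" for x
  proof -
    show 0: "\<phi> x = 0" using that closure_subset[of "{x. \<phi> x \<noteq> 0}"] by (auto simp: S_def)
    have "open (- S)" using S by (simp add: compact_imp_closed open_Compl)
    have "((\<lambda>_. 0) has_derivative frechet_derivative \<phi> (at x)) (at x)"
    proof (rule has_derivative_transform_within_open[OF _ \<open>open (- S)\<close>])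
      show "(\<phi> has_derivative frechet_derivative \<phi> (at x)) (at x)"
        using d[of x] by (simp add: frechet_derivative_works)
      show "x \<in> - S" using that by simp
      show "\<phi> y = 0" if "y \<in> - S" for y
        using that closure_subset[of "{x. \<phi> x \<noteq> 0}"] by (auto simp: S_def)
    qed
    from has_derivative_unique[OF this has_derivative_const[of 0]]
    show "partial k \<phi> x = 0" by (simp add: partial_def)
  qed
  obtain r where r: "\<And>x. x \<in> S \<Longrightarrow> norm x \<le> r"
    using compact_imp_bounded[OF S] by (auto simp: bounded_iff)
  have "compact (\<phi> ` S)" "compact (partial k \<phi> ` S)"
    by (intro compact_continuous_image continuous_on_subset[OF c] continuous_on_subset[OF c'] S subset_UNIV)+
  then obtain B1 B2 where B: "\<And>x. x \<in> S \<Longrightarrow> \<bar>\<phi> x\<bar> \<le> B1" "\<And>x. x \<in> S \<Longrightarrow> \<bar>partial k \<phi> x\<bar> \<le> B2"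
    using compact_imp_bounded[of "\<phi> ` S"] compact_imp_bounded[of "partial k \<phi> ` S"] by (auto simp: bounded_iff)
  have "\<bar>\<phi> x\<bar> \<le> \<bar>B1\<bar> + \<bar>B2\<bar> \<and> \<bar>partial k \<phi> x\<bar> \<le> \<bar>B1\<bar> + \<bar>B2\<bar> \<and> (norm x > r \<longrightarrow> \<phi> x = 0 \<and> partial k \<phi> x = 0)" for x
    using B[of x] z[of x] r[of x] by (cases "x \<in> S") auto
  thus "\<exists>B r. \<forall>x. \<bar>\<phi> x\<bar> \<le> B \<and> \<bar>partial k \<phi> x\<bar> \<le> B \<and> (norm x > r \<longrightarrow> \<phi> x = 0 \<and> partial k \<phi> x = 0)"
    by blast
qed

lemma compact_support_integrable:
  fixes f :: "'a::euclidean_space \<Rightarrow> 'b::{banach,second_countable_topology}"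
  assumes "f \<in> borel_measurable borel" "\<And>x. norm (f x) \<le> B" "\<And>x. norm x > r \<Longrightarrow> f x = 0"
  shows "integrable lborel f"
proof -
  have "integrable lborel (\<lambda>x::'a. indicator (cball 0 r) x *\<^sub>R B)"
    using emeasure_bounded_finite[of "cball 0 r :: 'a set"] by (intro integrable_indicator) auto
  thus ?thesis
    by (rule Bochner_Integration.integrable_bound)
       (use assms order_trans[OF assms(2) abs_ge_self] in \<open>auto simp: indicator_def not_le\<close>)
qed

text \<open>Brings test functions under the same translation argument as Fourier integrals, so that
  weak derivatives follow from \<open>integral_by_parts_translate\<close>.\<close>

lemma l2_deriv_test_translate:
  fixes \<phi> :: "real^'k::finite \<Rightarrow> real"
  assumes \<phi>: "test_function \<phi>"
  shows "l2_deriv (\<lambda>h x. complex_of_real (\<phi> (x + h *\<^sub>R axis k 1))) (\<lambda>x. complex_of_real (partial k \<phi> x)) 0"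
proof -
  note c = test_function_facts(1)[OF \<phi>] and c' = test_function_facts(2)[OF \<phi>, of k]
    and d = test_function_facts(3)[OF \<phi>, of _ k]
  let ?e = "axis k 1 :: real^'k"
  obtain B r where B: "\<And>x. \<bar>\<phi> x\<bar> \<le> B" "\<And>x. \<bar>partial k \<phi> x\<bar> \<le> B"
    and r: "\<And>x. norm x > r \<Longrightarrow> \<phi> x = 0 \<and> partial k \<phi> x = 0"
    using test_function_facts(4)[OF \<phi>, of k] by blast
  have [measurable]: "\<phi> \<in> borel_measurable borel" "partial k \<phi> \<in> borel_measurable borel"
    using c c' by (auto intro: borel_measurable_continuous_onI)
  have sq: "y\<^sup>2 \<le> B\<^sup>2" if "\<bar>y\<bar> \<le> B" for y using that abs_le_square_iff[of y B] by simp
  have i1: "integrable lborel (\<lambda>x. (\<phi> x)\<^sup>2)"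
    by (rule compact_support_integrable[where B="B\<^sup>2" and r=r]) (use B r sq in auto)
  have i2: "integrable lborel (\<lambda>x. (partial k \<phi> x)\<^sup>2)"
    by (rule compact_support_integrable[where B="B\<^sup>2" and r=r]) (use B r sq in auto)
  have l: "l2 (\<lambda>x. complex_of_real (\<phi> (x + h *\<^sub>R ?e)))" for h
    unfolding l2_def using i1 lborel_integral_translate(2)[of "\<lambda>x. (\<phi> x)\<^sup>2" "h *\<^sub>R ?e"] by auto
  have l': "l2 (\<lambda>x. complex_of_real (partial k \<phi> x))"
    unfolding l2_def using i2 by auto
  have "((\<lambda>h. \<integral>x. ((\<phi> (x + h *\<^sub>R ?e) - \<phi> x - h * partial k \<phi> x) / h)\<^sup>2 \<partial>lborel) \<longlongrightarrow> 0) (at 0)"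
  \<comment> \<open>Shifts with |h| < 1 move the support by at most 1, whence the radius r +
    1.\<close>
  proof (rule integral_dominated_convergence_at[where S="{-1<..<1}" and w="\<lambda>x. indicator (cball 0 (r + 1)) x *\<^sub>R (2 * B)\<^sup>2"])
    show "integrable lborel (\<lambda>x::real^'k. indicator (cball 0 (r + 1)) x *\<^sub>R (2 * B)\<^sup>2)"
      using emeasure_bounded_finite[of "cball 0 (r + 1) :: (real^'k) set"] by (intro integrable_indicator) auto
    show "(\<lambda>x. ((\<phi> (x + h *\<^sub>R ?e) - \<phi> x - h * partial k \<phi> x) / h)\<^sup>2) \<in> borel_measurable borel" for h
      by measurable
    show "\<bar>((\<phi> (x + h *\<^sub>R ?e) - \<phi> x - h * partial k \<phi> x) / h)\<^sup>2\<bar> \<le> indicator (cball 0 (r + 1)) x *\<^sub>R (2 * B)\<^sup>2"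
      if h: "h \<in> {-1<..<1}" "h \<noteq> 0" for h x
    proof (cases "norm x \<le> r + 1")
      case False
      have "norm x \<le> norm (x + h *\<^sub>R ?e) + norm (h *\<^sub>R ?e)"
        using norm_triangle_ineq4[of "x + h *\<^sub>R ?e" "h *\<^sub>R ?e"] by simp
      moreover have "norm (h *\<^sub>R ?e) \<le> 1" using h by (auto simp: abs_if)
      ultimately have "norm (x + h *\<^sub>R ?e) > r" using False by linarith
      thus ?thesis using r False by simp
    next
      case True
      have "norm (\<phi> (x + h *\<^sub>R ?e) - \<phi> (x + 0 *\<^sub>R ?e)) \<le> B * norm (h - 0)"
      proof (rule differentiable_bound[of UNIV])
        show "((\<lambda>h. \<phi> (x + h *\<^sub>R ?e)) has_derivative (*) (partial k \<phi> (x + t *\<^sub>R ?e))) (at t within UNIV)" for t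
          using d[of x t] by (simp add: has_field_derivative_def)
        show "onorm ((*) (partial k \<phi> (x + t *\<^sub>R ?e))) \<le> B" for t
          by (intro onorm_le) (use B in \<open>auto simp: abs_mult intro!: mult_right_mono\<close>)
      qed auto
      hence "\<bar>\<phi> (x + h *\<^sub>R ?e) - \<phi> x\<bar> \<le> B * \<bar>h\<bar>" by simp
      moreover have "\<bar>h * partial k \<phi> x\<bar> \<le> B * \<bar>h\<bar>"
        using mult_right_mono[OF B(2)[of x] abs_ge_zero[of h]] by (simp add: abs_mult mult.commute)
      ultimately have "\<bar>\<phi> (x + h *\<^sub>R ?e) - \<phi> x - h * partial k \<phi> x\<bar> \<le> (2 * B) * \<bar>h\<bar>" by linarith
      hence "\<bar>(\<phi> (x + h *\<^sub>R ?e) - \<phi> x - h * partial k \<phi> x) / h\<bar> \<le> 2 * B"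
        using h by (simp add: divide_le_eq)
      hence "((\<phi> (x + h *\<^sub>R ?e) - \<phi> x - h * partial k \<phi> x) / h)\<^sup>2 \<le> (2 * B)\<^sup>2"
        by (rule power2_le_iff_abs_le[THEN iffD2, rotated]) (use B(1)[of x] in linarith)
      thus ?thesis using True by simp
    qed
    show "((\<lambda>h. ((\<phi> (x + h *\<^sub>R ?e) - \<phi> x - h * partial k \<phi> x) / h)\<^sup>2) \<longlongrightarrow> 0) (at 0)" for x
    proof -
      have "((\<lambda>h. (\<phi> (x + h *\<^sub>R ?e) - \<phi> x) / h - partial k \<phi> x) \<longlongrightarrow> partial k \<phi> x - partial k \<phi> x) (at 0)"
        using d[of x 0] unfolding has_field_derivative_iff by (intro tendsto_intros) simp
      hence "((\<lambda>h. (\<phi> (x + h *\<^sub>R ?e) - \<phi> x - h * partial k \<phi> x) / h) \<longlongrightarrow> 0) (at 0)"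
        by (rule Lim_transform_eventually[THEN tendsto_eq_rhs]) (auto simp: eventually_at_filter diff_divide_distrib)
      from tendsto_power[OF this, of 2] show ?thesis by simp
    qed
  qed auto
  moreover have "(cmod (complex_of_real (\<phi> (x + h *\<^sub>R ?e)) - complex_of_real (\<phi> x) - h *\<^sub>R complex_of_real (partial k \<phi> x)))\<^sup>2
     = (\<phi> (x + h *\<^sub>R ?e) - \<phi> x - h * partial k \<phi> x)\<^sup>2" for x h
  proof -
    have "complex_of_real (\<phi> (x + h *\<^sub>R ?e)) - complex_of_real (\<phi> x) - h *\<^sub>R complex_of_real (partial k \<phi> x)
      = complex_of_real (\<phi> (x + h *\<^sub>R ?e) - \<phi> x - h * partial k \<phi> x)" by (simp add: scaleR_conv_of_real)
    thus ?thesis by (simp only: norm_of_real power2_abs)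
  qed
  ultimately show ?thesis unfolding l2_deriv_def using l l' by (simp add: power_divide)
qed

lemma fint_weak_derivative:
  fixes v :: "real^'k::finite \<Rightarrow> complex"
  assumes n: "CARD('k) \<le> n" and v: "decays (Suc n) v" and \<phi>: "test_function \<phi>"
  shows "(\<integral>x. partial k \<phi> x *\<^sub>R fint v x \<partial>lborel)
     = - (\<integral>x. \<phi> x *\<^sub>R fint (\<lambda>\<xi>. (\<i> * (\<xi> $ k)) * v \<xi>) x \<partial>lborel)"
  using integral_by_parts_translate[OF l2_deriv_test_translate[OF \<phi>, of k] l2_deriv_fint_translate[OF _ v, of "axis k 1"]] n
  by (simp add: scaleR_conv_of_real inner_axis)


subsection \<open>Solutions of the system\<close>

lemma l2_square_integrable: "l2 f \<Longrightarrow> square_integrable f"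
  unfolding l2_def square_integrable_def
  by (auto intro: measurable_completion simp: integrable_completion)

text \<open>Companion of \<open>decays_mult_growth\<close> that keeps the constant, as uniformity in
  time requires.\<close>

lemma decays_bound_growth:
  assumes "\<And>\<xi>. norm (v \<xi>) \<le> C * wt (Suc n) \<xi>" "\<And>\<xi>. cmod (p \<xi>) \<le> 1 + (norm \<xi>)\<^sup>2"
  shows "cmod (p \<xi> * v \<xi>) \<le> C * wt n \<xi>"
proof -
  have C: "C \<ge> 0" by (rule wt_bound_nonneg[OF assms(1)])
  have "cmod (p \<xi> * v \<xi>) \<le> (1 + (norm \<xi>)\<^sup>2) * (C * wt (Suc n) \<xi>)"
    unfolding norm_mult using assms by (intro mult_mono) (auto intro: add_nonneg_nonneg)
  also have "\<dots> = C * ((1 + (norm \<xi>)\<^sup>2) ^ 1 * wt (1 + n) \<xi>)" by simp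
  also have "\<dots> = C * wt n \<xi>" by (simp only: wt_cancel)
  finally show ?thesis .
qed

lemma decays_component_mult:
  fixes v :: "real^'k::finite \<Rightarrow> complex"
  assumes "decays (Suc n) v"
  shows "decays n (\<lambda>\<xi>. (\<i> * (\<xi> $ k)) * v \<xi>)"
  using decays_inner_mult[OF assms, of "axis k 1"] by (simp add: inner_axis)

lemma fint_norm_sq:
  fixes v :: "real^3 \<Rightarrow> complex"
  assumes v: "decays 6 v"
  shows "fint (\<lambda>\<xi>. (norm \<xi>)\<^sup>2 * v \<xi>) x = - (\<Sum>k\<in>UNIV. fint (\<lambda>\<xi>. (\<i> * (\<xi> $ k)) * ((\<i> * (\<xi> $ k)) * v \<xi>)) x)"
proof -
  have g: "decays 4 (\<lambda>\<xi>. (\<i> * (\<xi> $ k)) * ((\<i> * (\<xi> $ k)) * v \<xi>))" for k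
    using decays_component_mult[of 4, OF decays_component_mult[of "Suc 4" v]] v by simp
  have "(\<Sum>k\<in>UNIV. fint (\<lambda>\<xi>. (\<i> * (\<xi> $ k)) * ((\<i> * (\<xi> $ k)) * v \<xi>)) x)
    = fint (\<lambda>\<xi>. \<Sum>k\<in>UNIV. (\<i> * (\<xi> $ k)) * ((\<i> * (\<xi> $ k)) * v \<xi>)) x"
    by (intro fint_sum[symmetric] decays_integrable[OF g]) simp
  also have "(\<lambda>\<xi>. \<Sum>k\<in>UNIV. (\<i> * complex_of_real (\<xi> $ k)) * ((\<i> * (\<xi> $ k)) * v \<xi>)) = (\<lambda>\<xi>. (-1) * ((norm \<xi>)\<^sup>2 * v \<xi>))"
  proof (rule ext)
    fix \<xi> :: "real^3"
    have "(\<Sum>k\<in>UNIV. (\<i> * complex_of_real (\<xi> $ k)) * ((\<i> * (\<xi> $ k)) * v \<xi>))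
      = (\<Sum>k\<in>UNIV. complex_of_real ((\<xi> $ k)\<^sup>2) * ((-1) * v \<xi>))"
    proof (intro sum.cong refl)
      fix k :: 3
      have "(\<i> * a) * ((\<i> * a) * b) = (\<i> * \<i>) * (a\<^sup>2 * b)" for a b :: complex
        by (simp only: power2_eq_square mult_ac)
      thus "(\<i> * complex_of_real (\<xi> $ k)) * ((\<i> * (\<xi> $ k)) * v \<xi>) = complex_of_real ((\<xi> $ k)\<^sup>2) * ((-1) * v \<xi>)"
        by simp
    qed
    also have "\<dots> = complex_of_real (\<Sum>k\<in>UNIV. (\<xi> $ k)\<^sup>2) * ((-1) * v \<xi>)"
      unfolding of_real_sum by (rule sum_distrib_right[symmetric])
    also have "(\<Sum>k\<in>UNIV. (\<xi> $ k)\<^sup>2) = (norm \<xi>)\<^sup>2" by (simp add: norm_vec_squared)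
    finally show "(\<Sum>k\<in>UNIV. (\<i> * complex_of_real (\<xi> $ k)) * ((\<i> * (\<xi> $ k)) * v \<xi>)) = (-1) * ((norm \<xi>)\<^sup>2 * v \<xi>)"
      by simp
  qed
  also have "fint (\<lambda>\<xi>. (-1) * ((norm \<xi>)\<^sup>2 * v \<xi>)) x = (-1) * fint (\<lambda>\<xi>. (norm \<xi>)\<^sup>2 * v \<xi>) x"
    by (rule fint_cmult)
  finally show ?thesis by simp
qed

text \<open>The decay exponents run through 6, 5, 4 for the density, its time derivative and the
  gradient of the latter, so all of them stay above the threshold 3 for integrability in dimension
  three. The uniform bound B is exported because it lets quartic terms of the energy be controlled
  by squares.\<close>

theorem H1_solution_exists:
  fixes v0 :: "real^3 \<Rightarrow> complex^2" and \<Lambda> :: "2 \<Rightarrow> 2 \<Rightarrow> 2 \<Rightarrow> 2 \<Rightarrow> real"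
  assumes v0: "\<And>j. decays 6 (\<lambda>\<xi>. v0 \<xi> $ j)"
    and N: "\<And>z j. N (z $ 1) (z $ 2) $ j = (\<Sum>a\<in>UNIV. \<Sum>b\<in>UNIV. \<Sum>c\<in>UNIV. \<Lambda> j a b c * (z $ a * z $ b * cnj (z $ c)))"
  obtains T B u Du v1 where "T > 0" "H1_solution N {-T<..<T} u Du" "\<And>t x. norm (u t x) \<le> B"
    "\<And>x j. u 0 x $ j = fint (\<lambda>\<xi>. v0 \<xi> $ j) x"
    "\<And>x j k. Du 0 x $ j $ k = fint (\<lambda>\<xi>. (\<i> * (\<xi> $ k)) * v0 \<xi> $ j) x"
    "\<And>j. decays 5 (v1 j)"
    "\<And>x j. fint (v1 j) x = - \<i> * fint (\<lambda>\<xi>. (norm \<xi>)\<^sup>2 * v0 \<xi> $ j) x - \<i> * N (u 0 x $ 1) (u 0 x $ 2) $ j"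
    "l2_deriv (\<lambda>t x. (u t x, Du t x)) (\<lambda>x. (\<chi> j. fint (v1 j) x, \<chi> j k. fint (\<lambda>\<xi>. (\<i> * (\<xi> $ k)) * v1 j \<xi>) x)) 0"
proof -
  \<comment> \<open>The equation reads u_t = i \<Delta> u - i N(u); the factor -i goes into the
    coefficients.\<close>
  define L where "L j a b c = - \<i> * complex_of_real (\<Lambda> j a b c)" for j a b c
  have "DIM(real^3) \<le> 6" by simp
  from fourier_local_existence[OF this v0, of L] obtain T R V where T: "T > 0" and V0: "V 0 = v0"
    and *: "\<forall>t j. decays 6 (\<lambda>\<xi>. V t \<xi> $ j)" "\<forall>t \<xi>. norm (V t \<xi>) \<le> R * wt 6 \<xi>"
      "\<forall>t\<in>{-T<..<T}. \<forall>\<xi> j. ((\<lambda>t. V t \<xi> $ j) has_vector_derivative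
       (- \<i> * (norm \<xi>)\<^sup>2 * V t \<xi> $ j + cubic_conv L (V t) \<xi> $ j)) (at t)" by blast
  note Vd = *(1)[rule_format] and Vb = *(2)[rule_format] and Vt = *(3)[rule_format]
  let ?I = "{-T<..<T}"
  have I: "open ?I" "is_interval ?I" by (auto simp: is_interval_convex_1)
  define v' where "v' j t \<xi> = - \<i> * ((norm \<xi>)\<^sup>2 * V t \<xi> $ j) + cubic_conv L (V t) \<xi> $ j" for j t \<xi>
  define C where "C = R + coeff_sum L * (3 * (conv_const TYPE(real^3) 6)\<^sup>2 * R\<^sup>2 * R)"
  have dim: "DIM(real^3) \<le> 5" "DIM(real^3) \<le> 4" "DIM(real^3) \<le> 6" by simp_all
  have R: "R \<ge> 0" by (rule wt_bound_nonneg[OF Vb])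
  have Vbj: "cmod (V t \<xi> $ j) \<le> R * wt 6 \<xi>" for t \<xi> j
    using order_trans[OF Finite_Cartesian_Product.norm_nth_le Vb] .
  have V5: "decays 5 (\<lambda>\<xi>. V t \<xi> $ j)" for t j by (rule decays_antimono[OF Vd]) simp
  have cub5: "decays 5 (\<lambda>\<xi>. cubic_conv L (V t) \<xi> $ j)" for t j
    by (rule decays_antimono[OF decays_cubic_conv[OF dim(3) Vd]]) simp
  have sq5: "decays 5 (\<lambda>\<xi>. (norm \<xi>)\<^sup>2 * V t \<xi> $ j)" for t j
    by (rule decays_norm_sq_mult) (use Vd in simp)
  have v'5: "decays 5 (v' j t)" for j t
    unfolding v'_def[abs_def] by (intro decays_add decays_cmult cub5 sq5)
  have cubb: "cmod (cubic_conv L (V t) \<xi> $ j) \<le> coeff_sum L * (3 * (conv_const TYPE(real^3) 6)\<^sup>2 * R\<^sup>2 * R) * wt 5 \<xi>" for t \<xi> j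
  proof -
    have "norm (cubic_conv L (V t) \<xi> - cubic_conv L (\<lambda>_. 0) \<xi>)
      \<le> coeff_sum L * (3 * (conv_const TYPE(real^3) 6)\<^sup>2 * R\<^sup>2 * R * wt 6 \<xi>)"
      by (rule cubic_conv_diff_bound[OF dim(3)]) (use Vd Vb R in auto)
    hence "cmod (cubic_conv L (V t) \<xi> $ j) \<le> coeff_sum L * (3 * (conv_const TYPE(real^3) 6)\<^sup>2 * R\<^sup>2 * R) * wt 6 \<xi>"
      using order_trans[OF Finite_Cartesian_Product.norm_nth_le[of "cubic_conv L (V t) \<xi>" j]] by (simp add: mult_ac)
    also have "\<dots> \<le> coeff_sum L * (3 * (conv_const TYPE(real^3) 6)\<^sup>2 * R\<^sup>2 * R) * wt 5 \<xi>"
      by (intro mult_left_mono wt_antimono mult_nonneg_nonneg coeff_sum_nonneg) (use R in auto)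
    finally show ?thesis .
  qed
  have v'b: "cmod (v' j t \<xi>) \<le> C * wt 5 \<xi>" for j t \<xi>
  proof -
    have "cmod (complex_of_real ((norm \<xi>)\<^sup>2) * V t \<xi> $ j) \<le> R * wt 5 \<xi>"
      by (rule decays_bound_growth[where p="\<lambda>\<xi>. complex_of_real ((norm \<xi>)\<^sup>2)"]) (use Vbj in \<open>auto simp: norm_power\<close>)
    hence "cmod (- \<i> * ((norm \<xi>)\<^sup>2 * V t \<xi> $ j)) \<le> R * wt 5 \<xi>" by (simp add: norm_mult)
    from norm_triangle_mono[OF this cubb] show ?thesis
      by (simp add: v'_def C_def algebra_simps)
  qed
  have Vt': "((\<lambda>t. V t \<xi> $ j) has_vector_derivative v' j t \<xi>) (at t)" if "t \<in> ?I" for t \<xi> j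
    using Vt[OF that, of \<xi> j] by (simp add: v'_def mult.assoc)
  have xk: "cmod (\<i> * complex_of_real (\<xi> $ k)) \<le> 1 + (norm \<xi>)\<^sup>2" for k and \<xi> :: "real^3"
    using component_le_norm_cart[of \<xi> k] mult_le_squares[of 1 "norm \<xi>"] by (simp add: norm_mult)
  have g4: "decays 4 (\<lambda>\<xi>. (\<i> * (\<xi> $ k)) * w \<xi>)" if "decays 5 w" for w :: "real^3 \<Rightarrow> complex" and k
    using decays_inner_mult[of 4 w "axis k 1"] that by (simp add: inner_axis)
  have g5: "decays 5 (\<lambda>\<xi>. (\<i> * (\<xi> $ k)) * w \<xi>)" if "decays 6 w" for w :: "real^3 \<Rightarrow> complex" and k
    using decays_inner_mult[of 5 w "axis k 1"] that by (simp add: inner_axis)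
  define u where "u t x = (\<chi> j. fint (\<lambda>\<xi>. V t \<xi> $ j) x)" for t x
  define Du where "Du t x = (\<chi> j k. fint (\<lambda>\<xi>. (\<i> * (\<xi> $ k)) * V t \<xi> $ j) x)" for t x
  have uj: "u t x $ j = fint (\<lambda>\<xi>. V t \<xi> $ j) x" for t x j by (simp add: u_def)
  have Dujk: "Du t x $ j $ k = fint (\<lambda>\<xi>. (\<i> * (\<xi> $ k)) * V t \<xi> $ j) x" for t x j k by (simp add: Du_def)
  have du: "l2_deriv (\<lambda>t. fint (\<lambda>\<xi>. V t \<xi> $ j)) (fint (v' j s)) s" if "s \<in> ?I" for s j
    by (rule l2_deriv_fint[OF dim(1), where S="?I" and v'="v' j"]) (use that I V5 v'5 v'b Vt' in auto)
  have dDu: "l2_deriv (\<lambda>t. fint (\<lambda>\<xi>. (\<i> * (\<xi> $ k)) * V t \<xi> $ j)) (fint (\<lambda>\<xi>. (\<i> * (\<xi> $ k)) * v' j s \<xi>)) s"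
    if "s \<in> ?I" for s j k
  proof (rule l2_deriv_fint[OF dim(2), where S="?I" and v'="\<lambda>t \<xi>. (\<i> * (\<xi> $ k)) * v' j t \<xi>"])
    show "decays 4 (\<lambda>\<xi>. (\<i> * (\<xi> $ k)) * V t \<xi> $ j)" for t by (rule g4[OF V5])
    show "decays 4 (\<lambda>\<xi>. (\<i> * (\<xi> $ k)) * v' j t \<xi>)" for t by (rule g4[OF v'5])
    show "cmod ((\<i> * (\<xi> $ k)) * v' j t \<xi>) \<le> C * wt 4 \<xi>" for t \<xi>
      by (rule decays_bound_growth[where p="\<lambda>\<xi>. \<i> * complex_of_real (\<xi> $ k)"]) (use v'b xk in auto)
    show "((\<lambda>t. (\<i> * (\<xi> $ k)) * V t \<xi> $ j) has_vector_derivative (\<i> * (\<xi> $ k)) * v' j t \<xi>) (at t)" if "t \<in> ?I" for t \<xi>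
      by (rule has_vector_derivative_mult_right[OF Vt'[OF that]])
  qed (use that I in auto)
  have dall: "l2_deriv (\<lambda>t x. (u t x, Du t x)) (\<lambda>x. (\<chi> j. fint (v' j s) x, \<chi> j k. fint (\<lambda>\<xi>. (\<i> * (\<xi> $ k)) * v' j s \<xi>) x)) s"
    if "s \<in> ?I" for s
    unfolding u_def Du_def by (intro l2_deriv_Pair l2_deriv_vec du dDu that)
  have dj: "l2_deriv (\<lambda>t x. (u t x $ j, Du t x $ j)) (\<lambda>x. (fint (v' j s) x, \<chi> k. fint (\<lambda>\<xi>. (\<i> * (\<xi> $ k)) * v' j s \<xi>) x)) s"
    if "s \<in> ?I" for s j
    unfolding u_def Du_def using that by (simp add: l2_deriv_Pair l2_deriv_vec du dDu)
  have Nf: "N (u t x $ 1) (u t x $ 2) $ j = \<i> * fint (\<lambda>\<xi>. cubic_conv L (V t) \<xi> $ j) x" for t x j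
  proof -
    have i3: "integrable lborel (\<lambda>\<xi>. L j a b c * conv3 (\<lambda>\<xi>. V t \<xi> $ a) (\<lambda>\<xi>. V t \<xi> $ b) (\<lambda>\<xi>. V t \<xi> $ c) \<xi>)" for a b c
      by (intro decays_integrable[OF _ dim(3)] decays_cmult decays_conv3[OF dim(3)] Vd)
    have "fint (\<lambda>\<xi>. cubic_conv L (V t) \<xi> $ j) x = (\<Sum>a\<in>UNIV. \<Sum>b\<in>UNIV. \<Sum>c\<in>UNIV.
        L j a b c * fint (conv3 (\<lambda>\<xi>. V t \<xi> $ a) (\<lambda>\<xi>. V t \<xi> $ b) (\<lambda>\<xi>. V t \<xi> $ c)) x)"
      using i3 by (simp add: cubic_conv_def fint_sum fint_cmult Bochner_Integration.integrable_sum)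
    also have "\<dots> = (\<Sum>a\<in>UNIV. \<Sum>b\<in>UNIV. \<Sum>c\<in>UNIV. L j a b c * (u t x $ a * u t x $ b * cnj (u t x $ c)))"
      by (intro sum.cong refl) (simp add: fint_conv3[OF dim(3) Vd Vd Vd] uj)
    also have "\<i> * \<dots> = N (u t x $ 1) (u t x $ 2) $ j"
      by (simp add: N L_def sum_distrib_left mult_ac)
    finally show ?thesis by simp
  qed
  have v'f: "fint (v' j t) x = - \<i> * fint (\<lambda>\<xi>. (norm \<xi>)\<^sup>2 * V t \<xi> $ j) x - \<i> * N (u t x $ 1) (u t x $ 2) $ j" for j t x
  proof -
    have "fint (v' j t) x = fint (\<lambda>\<xi>. - \<i> * ((norm \<xi>)\<^sup>2 * V t \<xi> $ j)) x + fint (\<lambda>\<xi>. cubic_conv L (V t) \<xi> $ j) x"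
      unfolding v'_def[abs_def] by (intro fint_add decays_integrable[OF _ dim(1)] decays_cmult sq5 cub5)
    also have "fint (\<lambda>\<xi>. - \<i> * ((norm \<xi>)\<^sup>2 * V t \<xi> $ j)) x = - \<i> * fint (\<lambda>\<xi>. (norm \<xi>)\<^sup>2 * V t \<xi> $ j) x"
      by (rule fint_cmult)
    finally show ?thesis unfolding Nf by (simp add: algebra_simps)
  qed
  have lu: "l2 (fint (\<lambda>\<xi>. V t \<xi> $ j))" and lD: "l2 (fint (\<lambda>\<xi>. (\<i> * (\<xi> $ k)) * V t \<xi> $ j))"
    and lv: "l2 (fint (v' j t))" for t j k
    by (intro l2_fint[OF dim(1)] V5 g5 Vd v'5)+
  have sol: "H1_solution N ?I u Du"
    unfolding H1_solution_def
  proof (intro conjI ballI allI impI I)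
    fix t j assume t: "t \<in> ?I"
    show "H1_with_gradient (\<lambda>x. u t x $ j) (\<lambda>x. Du t x $ j)"
      unfolding H1_with_gradient_def
    proof (intro conjI allI impI)
      show "square_integrable (\<lambda>x. u t x $ j)" unfolding uj by (intro l2_square_integrable lu)
      have "l2 (\<lambda>x. \<chi> k. fint (\<lambda>\<xi>. (\<i> * (\<xi> $ k)) * V t \<xi> $ j) x)" by (intro l2_vec lD)
      thus "square_integrable (\<lambda>x. Du t x $ j)" by (intro l2_square_integrable) (simp add: Du_def)
      fix \<phi> :: "real^3 \<Rightarrow> real" and k assume \<phi>: "test_function \<phi>"
      have [measurable]: "\<phi> \<in> borel_measurable borel" "partial k \<phi> \<in> borel_measurable borel"
        using test_function_facts(1,2)[OF \<phi>] by (auto intro: borel_measurable_continuous_onI)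
      note [measurable] = lu[THEN l2_measurable] lD[THEN l2_measurable]
      show "(\<integral>x. partial k \<phi> x *\<^sub>R u t x $ j \<partial>lebesgue) = - (\<integral>x. \<phi> x *\<^sub>R Du t x $ j $ k \<partial>lebesgue)"
        unfolding uj Dujk using fint_weak_derivative[OF _ _ \<phi>, of 5 "\<lambda>\<xi>. V t \<xi> $ j" k] Vd
        by (simp add: integral_completion)
    qed
  next
    fix s j assume s: "s \<in> ?I"
    have m: "(\<lambda>x. (norm (u t x $ j - u s x $ j))\<^sup>2 + (norm (Du t x $ j - Du s x $ j))\<^sup>2) \<in> borel_measurable lborel" for t
    proof -
      have "l2 (\<lambda>x. (u t x $ j, Du t x $ j))" for t using dj[OF s] by (auto simp: l2_deriv_def)
      from l2_measurable[OF l2_diff[OF this this]]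
      have "(\<lambda>x. (norm ((u t x $ j, Du t x $ j) - (u s x $ j, Du s x $ j)))\<^sup>2) \<in> borel_measurable lborel" by simp
      thus ?thesis by (simp add: norm_Pair)
    qed
    have "((\<lambda>t. \<integral>x. (norm (u t x $ j - u s x $ j))\<^sup>2 + (norm (Du t x $ j - Du s x $ j))\<^sup>2 \<partial>lebesgue) \<longlongrightarrow> 0) (at s)"
      using l2_deriv_continuous[OF dj[OF s], of j] by (simp add: norm_Pair integral_completion[OF m])
    thus "((\<lambda>t. \<integral>x. (norm (u t x $ j - u s x $ j))\<^sup>2 + (norm (Du t x $ j - Du s x $ j))\<^sup>2 \<partial>lebesgue) \<longlongrightarrow> 0) (at s within ?I)"
      by (rule tendsto_within_subset) simp
  next
    fix t j and \<phi> :: "real^3 \<Rightarrow> real" assume t: "t \<in> ?I" and \<phi>: "test_function \<phi>"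
    have [measurable]: "\<phi> \<in> borel_measurable borel" "partial k \<phi> \<in> borel_measurable borel" for k
      using test_function_facts(1,2)[OF \<phi>] by (auto intro: borel_measurable_continuous_onI)
    have l\<phi>: "l2 (\<lambda>x. complex_of_real (\<phi> x))" "l2 (\<lambda>x. complex_of_real (partial k \<phi> x))" for k
      using l2_deriv_test_translate[OF \<phi>, of k] by (auto simp: l2_deriv_def dest: spec[of _ 0])
    have lN: "l2 (\<lambda>x. N (u t x $ 1) (u t x $ 2) $ j)"
      unfolding Nf by (rule l2_bound[where c=1, OF l2_fint[OF dim(1) cub5[of t j]]])
        (use fint_measurable[OF decays_integrable[OF cub5[of t j] dim(1)]] in \<open>auto simp: norm_mult\<close>)
    have ii: "integrable lborel (\<lambda>x. f x * g x)" if "l2 f" "l2 g" for f g :: "real^3 \<Rightarrow> complex"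
      by (rule l2_mult_integrable[OF that, where c=1]) (use l2_measurable[OF that(1)] l2_measurable[OF that(2)] in \<open>auto simp: norm_mult\<close>)
    have m: "(\<lambda>x. f x * g x) \<in> borel_measurable lborel" if "l2 f" "l2 g" for f g :: "real^3 \<Rightarrow> complex"
      using l2_measurable[OF that(1)] l2_measurable[OF that(2)] by measurable
    show "integrable lebesgue (\<lambda>x. \<phi> x *\<^sub>R N (u t x $ 1) (u t x $ 2) $ j)"
      unfolding scaleR_conv_of_real using ii[OF l\<phi>(1) lN] m[OF l\<phi>(1) lN] by (simp add: integrable_completion)
    let ?D = "\<integral>x. \<phi> x * fint (v' j t) x \<partial>lborel"
    have "((\<lambda>s. \<integral>x. \<phi> x * u s x $ j \<partial>lborel) has_vector_derivative
        (\<integral>x. \<phi> x * fint (v' j t) x + 0 * fint (\<lambda>\<xi>. V t \<xi> $ j) x \<partial>lborel)) (at t)"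
      unfolding uj by (rule has_vector_derivative_integral_mult[OF l2_deriv_const[OF l\<phi>(1)] du[OF t]])
    hence D1: "((\<lambda>s. \<integral>x. \<phi> x *\<^sub>R u s x $ j \<partial>lebesgue) has_vector_derivative ?D) (at t)"
      unfolding scaleR_conv_of_real using m[OF l\<phi>(1) lu] by (simp add: integral_completion uj)
    note sqV = fint_norm_sq[OF Vd[of t j]]
    have lDD: "l2 (fint (\<lambda>\<xi>. (\<i> * (\<xi> $ k)) * ((\<i> * (\<xi> $ k)) * V t \<xi> $ j)))" for k
      by (intro l2_fint[OF dim(2)] g4 g5 Vd)
    have lsq: "l2 (fint (\<lambda>\<xi>. (norm \<xi>)\<^sup>2 * V t \<xi> $ j))" by (intro l2_fint[OF dim(1)] sq5)
    have "(\<integral>x. (\<Sum>k\<in>UNIV. partial k \<phi> x *\<^sub>R Du t x $ j $ k) \<partial>lebesgue)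
      = (\<integral>x. (\<Sum>k\<in>UNIV. partial k \<phi> x * Du t x $ j $ k) \<partial>lborel)"
      unfolding scaleR_conv_of_real Dujk by (intro integral_completion borel_measurable_sum m l\<phi>(2) lD)
    also have "\<dots> = (\<Sum>k\<in>UNIV. (\<integral>x. partial k \<phi> x * Du t x $ j $ k \<partial>lborel))"
      unfolding Dujk by (intro Bochner_Integration.integral_sum ii l\<phi> lD)
    also have "\<dots> = (\<Sum>k\<in>UNIV. - (\<integral>x. \<phi> x * fint (\<lambda>\<xi>. (\<i> * (\<xi> $ k)) * ((\<i> * (\<xi> $ k)) * V t \<xi> $ j)) x \<partial>lborel))"
      unfolding Dujk
      using fint_weak_derivative[OF _ _ \<phi>, of 4 "\<lambda>\<xi>. (\<i> * (\<xi> $ _)) * V t \<xi> $ j"] g5[OF Vd[of t j]]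
      by (intro sum.cong refl) (simp add: scaleR_conv_of_real)
    also have "\<dots> = (\<integral>x. \<phi> x * fint (\<lambda>\<xi>. (norm \<xi>)\<^sup>2 * V t \<xi> $ j) x \<partial>lborel)"
      unfolding sqV using ii[OF l\<phi>(1) lDD] by (simp add: sum_negf sum_distrib_left)
    finally have D2: "(\<integral>x. (\<Sum>k\<in>UNIV. partial k \<phi> x *\<^sub>R Du t x $ j $ k) \<partial>lebesgue)
      = (\<integral>x. \<phi> x * fint (\<lambda>\<xi>. (norm \<xi>)\<^sup>2 * V t \<xi> $ j) x \<partial>lborel)" .
    have "\<i> * ?D = (\<integral>x. \<i> * (\<phi> x * fint (v' j t) x) \<partial>lborel)" by simp
    also have "\<dots> = (\<integral>x. \<phi> x * fint (\<lambda>\<xi>. (norm \<xi>)\<^sup>2 * V t \<xi> $ j) x + \<phi> x * N (u t x $ 1) (u t x $ 2) $ j \<partial>lborel)"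
      by (intro Bochner_Integration.integral_cong refl) (simp add: v'f algebra_simps)
    also have "\<dots> = (\<integral>x. \<phi> x * fint (\<lambda>\<xi>. (norm \<xi>)\<^sup>2 * V t \<xi> $ j) x \<partial>lborel) + (\<integral>x. \<phi> x * N (u t x $ 1) (u t x $ 2) $ j \<partial>lborel)"
      by (rule Bochner_Integration.integral_add[OF ii[OF l\<phi>(1) lsq] ii[OF l\<phi>(1) lN]])
    also have "(\<integral>x. \<phi> x * N (u t x $ 1) (u t x $ 2) $ j \<partial>lborel) = (\<integral>x. \<phi> x *\<^sub>R N (u t x $ 1) (u t x $ 2) $ j \<partial>lebesgue)"
      unfolding scaleR_conv_of_real by (rule integral_completion[OF m[OF l\<phi>(1) lN], symmetric])
    finally have D3: "\<i> * ?D - (\<integral>x. (\<Sum>k\<in>UNIV. partial k \<phi> x *\<^sub>R Du t x $ j $ k) \<partial>lebesgue)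
        = (\<integral>x. \<phi> x *\<^sub>R N (u t x $ 1) (u t x $ 2) $ j \<partial>lebesgue)"
      unfolding D2 by simp
    show "\<exists>D. ((\<lambda>s. \<integral>x. \<phi> x *\<^sub>R u s x $ j \<partial>lebesgue) has_vector_derivative D) (at t within ?I) \<and>
       \<i> * D - (\<integral>x. (\<Sum>k\<in>UNIV. partial k \<phi> x *\<^sub>R Du t x $ j $ k) \<partial>lebesgue)
         = (\<integral>x. \<phi> x *\<^sub>R N (u t x $ 1) (u t x $ 2) $ j \<partial>lebesgue)"
      using D1 D3 has_vector_derivative_at_within by blast
  qed
  \<comment> \<open>The sup norm of a Fourier integral is at most the L^1 norm of its density, here
    dominated by \<open>R * wt 6\<close> at every time.\<close>
  define B where "B = (\<Sum>j\<in>(UNIV::2 set). R * (\<integral>\<xi>. wt 6 (\<xi>::real^3) \<partial>lborel))"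
  have ub: "norm (u t x) \<le> B" for t x
  proof -
    have "norm (u t x) \<le> (\<Sum>j\<in>UNIV. cmod (u t x $ j))"
      unfolding norm_vec_def by (rule L2_set_le_sum) simp
    also have "\<dots> \<le> B" unfolding B_def
    proof (rule sum_mono)
      fix j
      have "cmod (u t x $ j) \<le> (\<integral>\<xi>. cmod (V t \<xi> $ j) \<partial>lborel)" unfolding uj by (rule norm_fint_le)
      also have "\<dots> \<le> (\<integral>\<xi>. R * wt 6 (\<xi>::real^3) \<partial>lborel)"
        using decays_integrable[OF Vd dim(3)] wt_integrable[OF dim(3)] by (intro integral_mono Vbj) auto
      finally show "cmod (u t x $ j) \<le> R * (\<integral>\<xi>. wt 6 (\<xi>::real^3) \<partial>lborel)" by simp
    qed
    finally show ?thesis .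
  qed
  have z: "0 \<in> ?I" using T by simp
  show thesis
    by (rule that[OF T sol ub, of "\<lambda>j. v' j 0"])
       (use v'5 v'f[of _ 0] dall[OF z] V0 in \<open>auto simp: uj Dujk\<close>)
qed

subsection \<open>Linear changes of variables and normal forms\<close>

lemma act_nth: "act M z $ i = M $ i $ 1 *\<^sub>R z $ 1 + M $ i $ 2 *\<^sub>R z $ 2"
  by (simp add: act_def sum_2)

lemma act_act: "act M (act M' z) = act (M ** M') z"
  by (simp add: vec_eq_iff act_nth matrix_matrix_mult_def sum_2 algebra_simps)

lemma act_mat_1 [simp]: "act (mat 1) z = z"
  by (simp add: vec_eq_iff act_nth mat_def forall_2)

text \<open>The algebraic half of \<open>transforms_to\<close>. The half about solutions follows
  from it once and for all, so normal forms can be composed by pure algebra.\<close>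

definition conjugate_to :: "nonlinearity \<Rightarrow> nonlinearity \<Rightarrow> bool" where
  "conjugate_to N F \<longleftrightarrow>
     (\<exists>M. invertible M \<and> (\<forall>z. F (act M z $ 1) (act M z $ 2) = act M (N (z $ 1) (z $ 2))))"

lemma conjugate_to_trans:
  assumes "conjugate_to N F" "conjugate_to F G"
  shows "conjugate_to N G"
proof -
  obtain M M' where "invertible M" "\<forall>z. F (act M z $ 1) (act M z $ 2) = act M (N (z $ 1) (z $ 2))"
    "invertible M'" "\<forall>z. G (act M' z $ 1) (act M' z $ 2) = act M' (F (z $ 1) (z $ 2))"
    using assms by (auto simp: conjugate_to_def)
  hence "invertible (M' ** M) \<and> (\<forall>z. G (act (M' ** M) z $ 1) (act (M' ** M) z $ 2) = act (M' ** M) (N (z $ 1) (z $ 2)))"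
    by (simp add: invertible_mult flip: act_act)
  thus ?thesis by (auto simp: conjugate_to_def)
qed

lemma conjugate_toI:
  assumes "a * d - b * c \<noteq> 0"
    and "\<And>z1 z2. F (a *\<^sub>R z1 + b *\<^sub>R z2) (c *\<^sub>R z1 + d *\<^sub>R z2) $ 1 = a *\<^sub>R N z1 z2 $ 1 + b *\<^sub>R N z1 z2 $ 2"
    and "\<And>z1 z2. F (a *\<^sub>R z1 + b *\<^sub>R z2) (c *\<^sub>R z1 + d *\<^sub>R z2) $ 2 = c *\<^sub>R N z1 z2 $ 1 + d *\<^sub>R N z1 z2 $ 2"
  shows "conjugate_to N F"
  unfolding conjugate_to_def
proof (intro exI conjI allI)
  let ?M = "vector [vector [a, b], vector [c, d]] :: real^2^2"
  show "invertible ?M" using assms(1) by (simp add: invertible_det_nz det_2)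
  show "F (act ?M z $ 1) (act ?M z $ 2) = act ?M (N (z $ 1) (z $ 2))" for z
    using assms(2,3)[of "z $ 1" "z $ 2"] by (simp add: vec_eq_iff forall_2 act_nth)
qed

lemma conjugate_to_refl [simp]: "conjugate_to N N"
  by (rule conjugate_toI[where a=1 and b=0 and c=0 and d=1]) auto

text \<open>\<open>quadratic_form_nonlinearity A B m p q r\<close> is $\partial G/\partial\bar z$ for
  $G = r\rho^2 + AX^2 + BY^2 + mXY + p\rho X + q\rho Y$ with $\rho=|z_1|^2+|z_2|^2$,
  $X=|z_1|^2-|z_2|^2$, $Y=2\mathrm{Re}(z_1\bar z_2)$. Rotating $(z_1,z_2)$ by an angle rotates
  $(X,Y)$ by twice that angle.\<close>

definition dens :: "complex \<Rightarrow> complex \<Rightarrow> real" where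
  "dens z1 z2 = (cmod z1)\<^sup>2 + (cmod z2)\<^sup>2"

definition diff_dens :: "complex \<Rightarrow> complex \<Rightarrow> real" where
  "diff_dens z1 z2 = (cmod z1)\<^sup>2 - (cmod z2)\<^sup>2"

definition cross_dens :: "complex \<Rightarrow> complex \<Rightarrow> real" where
  "cross_dens z1 z2 = 2 * Re (z1 * cnj z2)"

definition quadratic_form_nonlinearity ::
  "real \<Rightarrow> real \<Rightarrow> real \<Rightarrow> real \<Rightarrow> real \<Rightarrow> real \<Rightarrow> nonlinearity" where
  "quadratic_form_nonlinearity A B m p q r z1 z2 = (let \<rho> = dens z1 z2; X = diff_dens z1 z2; Y = cross_dens z1 z2;
      a0 = 2 * r * \<rho> + p * X + q * Y; a1 = 2 * A * X + m * Y + p * \<rho>; a2 = 2 * B * Y + m * X + q * \<rho> in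
    vector [(a0 + a1) *\<^sub>R z1 + a2 *\<^sub>R z2, (a0 - a1) *\<^sub>R z2 + a2 *\<^sub>R z1])"

abbreviation "qfn \<equiv> quadratic_form_nonlinearity"

text \<open>(X,Y) transforms like the double-angle vector of the pair of unknowns, so (z1,z2) is
  turned by half the angle of (C,S). The new coefficients are those of the potential written in the
  rotated coordinates.\<close>

lemma qfn_rotate:
  fixes C S :: real
  assumes CS: "C\<^sup>2 + S\<^sup>2 = 1"
  shows "conjugate_to (qfn A B m p q r)
    (qfn (A * C\<^sup>2 - m * C * S + B * S\<^sup>2) (A * S\<^sup>2 + m * S * C + B * C\<^sup>2)
      (2 * A * C * S + m * (C\<^sup>2 - S\<^sup>2) - 2 * B * C * S) (p * C - q * S) (p * S + q * C) r)"
proof -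
  obtain t where t: "C = cos t" "S = sin t" using sincos_total_2pi[OF CS] by metis
  define c where "c = cos (t / 2)"
  define s where "s = sin (t / 2)"
  have cs: "c\<^sup>2 + s\<^sup>2 = 1" by (simp add: c_def s_def)
  have Cc: "C = c\<^sup>2 - s\<^sup>2" and Ss: "S = 2 * c * s"
    using cos_double[of "t / 2"] sin_double[of "t / 2"] by (auto simp: t c_def s_def)
  \<comment> \<open>This and the next identity are the subtraction formulas for t - t/2; they carry
    the coefficients \<open>a1\<close>, \<open>a2\<close>, which turn by t, over to unknowns that
    turn by t/2.\<close>
  have 1: "C * c + S * s = c" 
  proof -
    have "C * c + S * s = c * (c\<^sup>2 + s\<^sup>2)" by (simp add: Cc Ss algebra_simps power2_eq_square)
    thus ?thesis using cs by simp
  qed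
  have 2: "S * c - C * s = s"
  proof -
    have "S * c - C * s = s * (c\<^sup>2 + s\<^sup>2)" by (simp add: Cc Ss algebra_simps power2_eq_square)
    thus ?thesis using cs by simp
  qed
  show ?thesis
  proof (rule conjugate_toI[where a=c and b="- s" and c=s and d=c])
    show "c * c - - s * s \<noteq> 0" using cs by (simp add: power2_eq_square)
    fix z1 z2 :: complex
    define w1 where "w1 = c *\<^sub>R z1 + (- s) *\<^sub>R z2"
    define w2 where "w2 = s *\<^sub>R z1 + c *\<^sub>R z2"
    define X Y \<rho> X' Y' where "X = diff_dens z1 z2" and "Y = cross_dens z1 z2" and "\<rho> = dens z1 z2"
      and "X' = diff_dens w1 w2" and "Y' = cross_dens w1 w2"
    have \<rho>': "dens w1 w2 = \<rho>"
    proof -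
      have "dens w1 w2 = (c\<^sup>2 + s\<^sup>2) * \<rho>"
        unfolding dens_def \<rho>_def w1_def w2_def cmod_power2 by (simp add: algebra_simps power2_eq_square)
      thus ?thesis using cs by simp
    qed
    have X': "X' = C * X - S * Y" and Y': "Y' = S * X + C * Y"
      unfolding X'_def Y'_def X_def Y_def diff_dens_def cross_dens_def w1_def w2_def cmod_power2 Cc Ss
      by (simp_all add: algebra_simps power2_eq_square)
    have "C * X' + S * Y' = (C\<^sup>2 + S\<^sup>2) * X" "- S * X' + C * Y' = (C\<^sup>2 + S\<^sup>2) * Y"
      by (simp_all add: X' Y' algebra_simps power2_eq_square)
    hence X: "X = C * X' + S * Y'" and Y: "Y = - S * X' + C * Y'" using CS by auto
    define a0 a1 a2 where "a0 = 2 * r * \<rho> + p * X + q * Y" and "a1 = 2 * A * X + m * Y + p * \<rho>"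
      and "a2 = 2 * B * Y + m * X + q * \<rho>"
    have a0': "2 * r * \<rho> + (p * C - q * S) * X' + (p * S + q * C) * Y' = a0"
      unfolding a0_def X Y by (simp add: algebra_simps)
    have a1': "2 * (A * C\<^sup>2 - m * C * S + B * S\<^sup>2) * X' + (2 * A * C * S + m * (C\<^sup>2 - S\<^sup>2) - 2 * B * C * S) * Y' + (p * C - q * S) * \<rho>
       = C * a1 - S * a2"
      unfolding a1_def a2_def X Y by (simp add: algebra_simps power2_eq_square)
    have a2': "2 * (A * S\<^sup>2 + m * S * C + B * C\<^sup>2) * Y' + (2 * A * C * S + m * (C\<^sup>2 - S\<^sup>2) - 2 * B * C * S) * X' + (p * S + q * C) * \<rho>
       = S * a1 + C * a2"
      unfolding a1_def a2_def X Y by (simp add: algebra_simps power2_eq_square)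
    have N: "qfn A B m p q r z1 z2 = vector [(a0 + a1) *\<^sub>R z1 + a2 *\<^sub>R z2, (a0 - a1) *\<^sub>R z2 + a2 *\<^sub>R z1]"
      by (simp add: quadratic_form_nonlinearity_def Let_def a0_def a1_def a2_def X_def Y_def \<rho>_def)
    have F: "qfn (A * C\<^sup>2 - m * C * S + B * S\<^sup>2) (A * S\<^sup>2 + m * S * C + B * C\<^sup>2)
      (2 * A * C * S + m * (C\<^sup>2 - S\<^sup>2) - 2 * B * C * S) (p * C - q * S) (p * S + q * C) r w1 w2
      = vector [(a0 + (C * a1 - S * a2)) *\<^sub>R w1 + (S * a1 + C * a2) *\<^sub>R w2, (a0 - (C * a1 - S * a2)) *\<^sub>R w2 + (S * a1 + C * a2) *\<^sub>R w1]"
      unfolding quadratic_form_nonlinearity_def Let_def \<rho>' X'_def[symmetric] Y'_def[symmetric] a0' a1' a2' ..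
    have e1: "(C * a1 - S * a2) *\<^sub>R w1 + (S * a1 + C * a2) *\<^sub>R w2
      = (a1 * (C * c + S * s) - a2 * (S * c - C * s)) *\<^sub>R z1 + (a1 * (S * c - C * s) + a2 * (C * c + S * s)) *\<^sub>R z2"
      unfolding w1_def w2_def by (simp add: algebra_simps)
    have e2: "- (C * a1 - S * a2) *\<^sub>R w2 + (S * a1 + C * a2) *\<^sub>R w1
      = (a1 * (S * c - C * s) + a2 * (C * c + S * s)) *\<^sub>R z1 + (- a1 * (C * c + S * s) + a2 * (S * c - C * s)) *\<^sub>R z2"
      unfolding w1_def w2_def by (simp add: algebra_simps)
    let ?F = "qfn (A * C\<^sup>2 - m * C * S + B * S\<^sup>2) (A * S\<^sup>2 + m * S * C + B * C\<^sup>2)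
      (2 * A * C * S + m * (C\<^sup>2 - S\<^sup>2) - 2 * B * C * S) (p * C - q * S) (p * S + q * C) r"
    note e1' = e1[unfolded 1 2] and e2' = e2[unfolded 1 2]
    have "?F w1 w2 $ 1 = a0 *\<^sub>R w1 + ((C * a1 - S * a2) *\<^sub>R w1 + (S * a1 + C * a2) *\<^sub>R w2)"
      unfolding F by (simp add: algebra_simps)
    also have "\<dots> = c *\<^sub>R qfn A B m p q r z1 z2 $ 1 + (- s) *\<^sub>R qfn A B m p q r z1 z2 $ 2"
      unfolding e1' N by (simp add: w1_def algebra_simps)
    finally show "?F (c *\<^sub>R z1 + (- s) *\<^sub>R z2) (s *\<^sub>R z1 + c *\<^sub>R z2) $ 1
       = c *\<^sub>R qfn A B m p q r z1 z2 $ 1 + (- s) *\<^sub>R qfn A B m p q r z1 z2 $ 2"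
      unfolding w1_def w2_def .
    have "?F w1 w2 $ 2 = a0 *\<^sub>R w2 + (- (C * a1 - S * a2) *\<^sub>R w2 + (S * a1 + C * a2) *\<^sub>R w1)"
      unfolding F by (simp add: algebra_simps)
    also have "\<dots> = s *\<^sub>R qfn A B m p q r z1 z2 $ 1 + c *\<^sub>R qfn A B m p q r z1 z2 $ 2"
      unfolding e2' N by (simp add: w2_def algebra_simps)
    finally show "?F (c *\<^sub>R z1 + (- s) *\<^sub>R z2) (s *\<^sub>R z1 + c *\<^sub>R z2) $ 2
       = s *\<^sub>R qfn A B m p q r z1 z2 $ 1 + c *\<^sub>R qfn A B m p q r z1 z2 $ 2"
      unfolding w1_def w2_def .
  qed
qed

text \<open>The change z2 to -z2 fixes \<rho> and X and flips the sign of Y.\<close>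

lemma qfn_reflect: "conjugate_to (qfn A B m p q r) (qfn A B (- m) p (- q) r)"
  by (rule conjugate_toI[where a=1 and b=0 and c=0 and d="-1"])
     (simp_all add: quadratic_form_nonlinearity_def Let_def dens_def diff_dens_def cross_dens_def algebra_simps)

text \<open>By cubic homogeneity, multiplying both unknowns by sqrt k divides all coefficients by k.
  Only positive k arise, which is why signs survive in the normal forms.\<close>

lemma qfn_scale:
  assumes k: "k > 0"
  shows "conjugate_to (qfn A B m p q r) (qfn (A / k) (B / k) (m / k) (p / k) (q / k) (r / k))"
proof -
  define s where "s = sqrt k"
  have s: "s > 0" "k = s\<^sup>2" using k by (auto simp: s_def)
  have d: "dens (s *\<^sub>R z1) (s *\<^sub>R z2) = s\<^sup>2 * dens z1 z2" "diff_dens (s *\<^sub>R z1) (s *\<^sub>R z2) = s\<^sup>2 * diff_dens z1 z2"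
    "cross_dens (s *\<^sub>R z1) (s *\<^sub>R z2) = s\<^sup>2 * cross_dens z1 z2" for z1 z2
    by (simp_all add: dens_def diff_dens_def cross_dens_def power_mult_distrib algebra_simps power2_eq_square)
  have "conjugate_to (qfn (s\<^sup>2 * A) (s\<^sup>2 * B) (s\<^sup>2 * m) (s\<^sup>2 * p) (s\<^sup>2 * q) (s\<^sup>2 * r)) (qfn A B m p q r)" for A B m p q r
    by (rule conjugate_toI[where a=s and b=0 and c=0 and d=s])
       (use s in \<open>simp_all add: quadratic_form_nonlinearity_def Let_def d algebra_simps\<close>)
  from this[of "A / k" "B / k" "m / k" "p / k" "q / k" "r / k"] show ?thesis
    using k unfolding s(2)[symmetric] by simp
qed

lemmas qfn_expand = fun_eq_iff vec_eq_iff forall_2 complex_eq_iff cmod_power2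
  quadratic_form_nonlinearity_def Let_def dens_def diff_dens_def cross_dens_def

section \<open>The five families as quadratic forms in the densities\<close>

lemma qfn_eq_NLS5:
  "qfn ((\<alpha>1 + \<alpha>2) / 2) ((\<alpha>1 - \<alpha>2) / 2) 0 (\<alpha>3 * cos \<eta>) (\<alpha>3 * sin \<eta>) (\<alpha>1 + r / 2) = NLS5 \<alpha>1 \<alpha>2 \<alpha>3 \<eta> r"
  by (simp add: qfn_expand NLS5_def) (simp add: field_simps power2_eq_square)

lemma qfn_eq_NLS4:
  "qfn ((\<alpha>1 + \<alpha>2) / 2) ((\<alpha>1 - \<alpha>2) / 2) 0 \<alpha>3 0 (\<alpha>1 + r / 2) = NLS4 \<alpha>1 \<alpha>2 \<alpha>3 r"
  by (simp add: qfn_expand NLS4_def) (simp add: field_simps power2_eq_square)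

lemma qfn_eq_NLS3:
  "qfn ((\<alpha>1 + \<alpha>2) / 2) ((\<alpha>1 - \<alpha>2) / 2) 0 0 0 (\<alpha>1 + r / 2) = NLS3 \<alpha>1 \<alpha>2 r"
  by (simp add: qfn_expand NLS3_def) (simp add: field_simps power2_eq_square)

lemma qfn_eq_NLS2:
  "qfn ((\<alpha> + \<beta>) / 8) 0 0 ((\<alpha> - \<beta>) / 4) 0 ((\<alpha> + \<beta>) / 8 + \<sigma> / 2) = NLS2 \<alpha> \<beta> \<sigma>"
  by (simp add: qfn_expand NLS2_def) (simp add: field_simps power2_eq_square)

lemma qfn_eq_NLS1:
  "qfn ((\<alpha> + \<beta>) / 8) 0 0 ((\<alpha> - \<beta>) / 4) 0 ((\<alpha> + \<beta>) / 8) = NLS1 \<alpha> \<beta>"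
  by (simp add: qfn_expand NLS1_def) (simp add: field_simps power2_eq_square)

text \<open>Decoupled equations can be scaled separately, which a common factor \<rho> would forbid;
  an unknown with zero coefficient is left unscaled.\<close>

lemma NLS1_normalize: "conjugate_to (NLS1 \<alpha> \<beta>) (NLS1 (sgn \<alpha>) (sgn \<beta>))"
proof -
  define k where "k x = (if x = 0 then 1 else sqrt \<bar>x\<bar>)" for x :: real
  have k: "k x > 0" "(k x)\<^sup>2 * sgn x = x" for x by (auto simp: k_def sgn_if)
  show ?thesis
  proof (rule conjugate_toI[where a="k \<alpha>" and b=0 and c=0 and d="k \<beta>"])
    show "k \<alpha> * k \<beta> - 0 * 0 \<noteq> 0" using k(1)[of \<alpha>] k(1)[of \<beta>] by simp
    have *: "sgn x *\<^sub>R ((cmod (k x *\<^sub>R z))\<^sup>2 *\<^sub>R (k x *\<^sub>R z)) = k x *\<^sub>R (x *\<^sub>R ((cmod z)\<^sup>2 *\<^sub>R z))" for x z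
    proof -
      have "sgn x *\<^sub>R ((cmod (k x *\<^sub>R z))\<^sup>2 *\<^sub>R (k x *\<^sub>R z)) = (((k x)\<^sup>2 * sgn x) * k x * (cmod z)\<^sup>2) *\<^sub>R z"
        by (simp add: power_mult_distrib mult_ac)
      thus ?thesis unfolding k(2) by (simp add: mult_ac)
    qed
    fix z1 z2
    show "NLS1 (sgn \<alpha>) (sgn \<beta>) (k \<alpha> *\<^sub>R z1 + 0 *\<^sub>R z2) (0 *\<^sub>R z1 + k \<beta> *\<^sub>R z2) $ 1 = k \<alpha> *\<^sub>R NLS1 \<alpha> \<beta> z1 z2 $ 1 + 0 *\<^sub>R NLS1 \<alpha> \<beta> z1 z2 $ 2"
      "NLS1 (sgn \<alpha>) (sgn \<beta>) (k \<alpha> *\<^sub>R z1 + 0 *\<^sub>R z2) (0 *\<^sub>R z1 + k \<beta> *\<^sub>R z2) $ 2 = 0 *\<^sub>R NLS1 \<alpha> \<beta> z1 z2 $ 1 + k \<beta> *\<^sub>R NLS1 \<alpha> \<beta> z1 z2 $ 2"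
      unfolding NLS1_def using *[of \<alpha> z1] *[of \<beta> z2] by simp_all
  qed
qed

text \<open>The coefficients $B$, $m$, $q$ vanish exactly when the system decouples up to $\rho z$.\<close>

lemma qfn_decoupled_standard:
  assumes p: "p \<ge> 0"
  shows "\<exists>F\<in>standard_nonlinearities. conjugate_to (qfn A 0 0 p 0 r) F"
proof (cases "r = A")
  case True
  \<comment> \<open>For r = A the potential is A(\<rho>^2+X^2) + p \<rho> X = (2A+p)|z1|^4 +
    (2A-p)|z2|^4.\<close>
  have "qfn A 0 0 p 0 r = NLS1 (4 * A + 2 * p) (4 * A - 2 * p)"
    using qfn_eq_NLS1[of "4 * A + 2 * p" "4 * A - 2 * p"] True by simp
  moreover have "NLS1 (sgn (4 * A + 2 * p)) (sgn (4 * A - 2 * p)) \<in> standard_nonlinearities"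
  proof -
    have "sgn (4 * A + 2 * p) \<in> {-1, 0, 1} \<and> sgn (4 * A - 2 * p) \<in> {-1, 0, 1} \<and> sgn (4 * A + 2 * p) \<ge> sgn (4 * A - 2 * p)"
      using p by (auto simp: sgn_if)
    thus ?thesis unfolding standard_nonlinearities_def by blast
  qed
  ultimately show ?thesis using NLS1_normalize by metis
next
  case False
  \<comment> \<open>The excess (r-A)\<rho>^2 over the decoupled potential contributes 2(r-A)\<rho>
    z_j to the j-th equation; k scales this coefficient to a sign.\<close>
  define k where "k = \<bar>2 * r - 2 * A\<bar>"
  have k: "k > 0" using False by (simp add: k_def)
  define \<sigma> where "\<sigma> = (2 * r - 2 * A) / k"
  have \<sigma>: "\<sigma> \<in> {-1, 1}" proof -
    have "x / \<bar>x\<bar> \<in> {-1, 1}" if "x \<noteq> 0" for x :: real using that by (cases "x > 0") auto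
    thus ?thesis using False unfolding \<sigma>_def k_def by simp
  qed
  have "qfn (A / k) (0 / k) (0 / k) (p / k) (0 / k) (r / k) = NLS2 (4 * A / k + 2 * p / k) (4 * A / k - 2 * p / k) \<sigma>"
    using qfn_eq_NLS2[of "4 * A / k + 2 * p / k" "4 * A / k - 2 * p / k" \<sigma>] k by (simp add: \<sigma>_def field_simps)
  hence "conjugate_to (qfn A 0 0 p 0 r) (NLS2 (4 * A / k + 2 * p / k) (4 * A / k - 2 * p / k) \<sigma>)"
    using qfn_scale[OF k, of A 0 0 p 0 r] by simp
  moreover have "NLS2 (4 * A / k + 2 * p / k) (4 * A / k - 2 * p / k) \<sigma> \<in> standard_nonlinearities"
  proof -
    have "4 * A / k + 2 * p / k \<ge> 4 * A / k - 2 * p / k" using p k by simp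
    thus ?thesis unfolding standard_nonlinearities_def using \<sigma> by blast
  qed
  ultimately show ?thesis by blast
qed

text \<open>With \<alpha>1 = A+B, \<alpha>2 = A-B and (p,q) in polar form with radius \<alpha>3, a
  positive scaling puts (\<alpha>1,\<alpha>2,\<alpha>3) on the unit sphere. The case q > 0 leads to
  \<open>NLS5\<close>; q = 0 < p with B nonzero to \<open>NLS4\<close>; p = q = 0 with AB nonzero to
  \<open>NLS3\<close>; the remaining cases decouple up to \<rho>.\<close>

lemma qfn_diagonal_standard:
  assumes AB: "A \<ge> B" and p: "p \<ge> 0" and q: "q \<ge> 0" and AqB: "q > 0 \<Longrightarrow> A > B"
  shows "\<exists>F\<in>standard_nonlinearities. conjugate_to (qfn A B 0 p q r) F"
proof -
  define a1 a2 a3 where "a1 = A + B" and "a2 = A - B" and "a3 = sqrt (p\<^sup>2 + q\<^sup>2)"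
  define k where "k = sqrt (a1\<^sup>2 + a2\<^sup>2 + a3\<^sup>2)"
  \<comment> \<open>Solves r/k = a1/k + R/2, the form of the last coefficient in
    \<open>qfn_eq_NLS3\<close> to \<open>qfn_eq_NLS5\<close>.\<close>
  define R where "R = 2 * (r - a1) / k"
  have k2: "k\<^sup>2 = a1\<^sup>2 + a2\<^sup>2 + a3\<^sup>2" by (simp add: k_def)
  have sc: "A / k = (a1 / k + a2 / k) / 2" "B / k = (a1 / k - a2 / k) / 2" "r / k = a1 / k + R / 2" if "k > 0"
    using that by (simp_all add: a1_def a2_def R_def field_simps)
  have nrm: "(a1 / k)\<^sup>2 + (a2 / k)\<^sup>2 + (a3 / k)\<^sup>2 = 1" if "k > 0"
    unfolding power_divide add_divide_distrib[symmetric] k2[symmetric] using that by simp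
  consider "q > 0" | "q = 0" "B = 0" | "q = 0" "B \<noteq> 0" "p > 0" | "q = 0" "B \<noteq> 0" "p = 0" "A \<noteq> 0"
    | "q = 0" "B \<noteq> 0" "p = 0" "A = 0"
    using p q by linarith
  thus ?thesis
  proof cases
    case 1
    have a3: "a3 > 0" using 1 by (simp add: a3_def add_nonneg_pos)
    have a2: "a2 > 0" using AqB[OF 1] by (simp add: a2_def)
    have "a1\<^sup>2 + a2\<^sup>2 + a3\<^sup>2 > 0" using a2 by (intro add_pos_nonneg add_nonneg_pos) auto
    hence k: "k > 0" by (simp add: k_def)
    have a32: "a3\<^sup>2 = p\<^sup>2 + q\<^sup>2" by (simp add: a3_def)
    have "(p / a3)\<^sup>2 + (q / a3)\<^sup>2 = 1"
      unfolding power_divide add_divide_distrib[symmetric] a32[symmetric] using a3 by simp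
    moreover have "0 \<le> p / a3" "0 \<le> q / a3" using a3 p q by auto
    \<comment> \<open>Both coordinates are nonnegative, so \<eta> lies in the first quadrant, where
      \<open>NLS5\<close> prescribes no sign for \<alpha>1.\<close>
    ultimately obtain \<eta> where \<eta>: "0 \<le> \<eta>" "\<eta> \<le> pi / 2" "p / a3 = cos \<eta>" "q / a3 = sin \<eta>"
      using sincos_total_pi_half by metis
    have "sin \<eta> > 0" using \<eta>(4) 1 a3 by (metis divide_pos_pos)
    hence \<eta>0: "\<eta> > 0" using \<eta>(1) by (cases "\<eta> = 0") auto
    have pk: "p / k = (a3 / k) * cos \<eta>" "q / k = (a3 / k) * sin \<eta>"
      using a3 k \<eta>(3,4)[symmetric] by auto
    have "qfn (A / k) (B / k) (0 / k) (p / k) (q / k) (r / k) = NLS5 (a1 / k) (a2 / k) (a3 / k) \<eta> R"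
      unfolding sc[OF k] pk qfn_eq_NLS5[symmetric] by simp
    hence "conjugate_to (qfn A B 0 p q r) (NLS5 (a1 / k) (a2 / k) (a3 / k) \<eta> R)"
      using qfn_scale[OF k, of A B 0 p q r] by simp
    moreover have "NLS5 (a1 / k) (a2 / k) (a3 / k) \<eta> R \<in> standard_nonlinearities"
    proof -
      have "a2 / k > 0 \<and> a3 / k > 0 \<and> (a1 / k)\<^sup>2 + (a2 / k)\<^sup>2 + (a3 / k)\<^sup>2 = 1 \<and>
        0 < \<eta> \<and> \<eta> < pi \<and> (\<eta> > pi / 2 \<longrightarrow> a1 / k > 0)"
        using a2 a3 k nrm[OF k] \<eta>0 \<eta>(2) pi_gt_zero by auto
      thus ?thesis unfolding standard_nonlinearities_def by blast
    qed
    ultimately show ?thesis by blast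
  next
    case 2
    thus ?thesis using qfn_decoupled_standard[OF p] by simp
  next
    case 3
    have a3: "a3 = p" using 3 p by (simp add: a3_def)
    have "a1\<^sup>2 + a2\<^sup>2 + a3\<^sup>2 > 0" using a3 3 by (intro add_nonneg_pos) auto
    hence k: "k > 0" by (simp add: k_def)
    have "qfn (A / k) (B / k) (0 / k) (p / k) (q / k) (r / k) = NLS4 (a1 / k) (a2 / k) (a3 / k) R"
      unfolding sc[OF k] using qfn_eq_NLS4[of "a1 / k" "a2 / k" "a3 / k" R] 3 a3 by simp
    hence "conjugate_to (qfn A B 0 p q r) (NLS4 (a1 / k) (a2 / k) (a3 / k) R)"
      using qfn_scale[OF k, of A B 0 p q r] by simp
    moreover have "NLS4 (a1 / k) (a2 / k) (a3 / k) R \<in> standard_nonlinearities"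
    proof -
      have "a2 / k \<ge> 0 \<and> a3 / k > 0 \<and> a1 / k \<noteq> a2 / k \<and> (a1 / k)\<^sup>2 + (a2 / k)\<^sup>2 + (a3 / k)\<^sup>2 = 1"
        using 3 AB a3 k nrm[OF k] by (auto simp: a1_def a2_def)
      thus ?thesis unfolding standard_nonlinearities_def by blast
    qed
    ultimately show ?thesis by blast
  next
    case 4
    have a3: "a3 = 0" using 4 by (simp add: a3_def)
    \<comment> \<open>Turns AB \<noteq> 0 into the condition \<alpha>1^2 \<noteq> \<alpha>2^2 of
      \<open>NLS3\<close>.\<close>
    have a12: "a1\<^sup>2 - a2\<^sup>2 = 4 * A * B" by (simp add: a1_def a2_def power2_eq_square algebra_simps)
    have "a1\<^sup>2 + a2\<^sup>2 + a3\<^sup>2 \<noteq> 0"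
    proof
      assume "a1\<^sup>2 + a2\<^sup>2 + a3\<^sup>2 = 0"
      hence "a1 = 0 \<and> a2 = 0" using a3 by (simp add: sum_power2_eq_zero_iff)
      thus False using a12 4 by auto
    qed
    hence k: "k > 0" by (simp add: k_def less_le)
    have "qfn (A / k) (B / k) (0 / k) (p / k) (q / k) (r / k) = NLS3 (a1 / k) (a2 / k) R"
      unfolding sc[OF k] using qfn_eq_NLS3[of "a1 / k" "a2 / k" R] 4 by simp
    hence "conjugate_to (qfn A B 0 p q r) (NLS3 (a1 / k) (a2 / k) R)"
      using qfn_scale[OF k, of A B 0 p q r] by simp
    moreover have "NLS3 (a1 / k) (a2 / k) R \<in> standard_nonlinearities"
    proof -
      have "(a1 / k)\<^sup>2 \<noteq> (a2 / k)\<^sup>2" using a12 4 k by (auto simp: power_divide)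
      hence "a2 / k \<ge> 0 \<and> (a1 / k)\<^sup>2 \<noteq> (a2 / k)\<^sup>2 \<and> (a1 / k)\<^sup>2 + (a2 / k)\<^sup>2 = 1"
        using AB a3 k nrm[OF k] by (auto simp: a2_def)
      thus ?thesis unfolding standard_nonlinearities_def by blast
    qed
    ultimately show ?thesis by blast
  next
    case 5
    \<comment> \<open>A quarter turn of (X,Y) exchanges A and B and so moves the only nonzero
      coefficient to X^2.\<close>
    have "conjugate_to (qfn A B 0 p q r) (qfn B 0 0 0 0 r)"
      using qfn_rotate[of 0 1 A B 0 p q r] 5 by simp
    moreover obtain F where "F \<in> standard_nonlinearities" "conjugate_to (qfn B 0 0 0 0 r) F"
      using qfn_decoupled_standard[of 0 B r] by auto
    ultimately show ?thesis using conjugate_to_trans by blast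
  qed
qed

text \<open>Rotating (X,Y) diagonalizes AX^2 + mXY + BY^2 with the larger eigenvalue first. If the
  eigenvalues differ, a half turn and the reflection of Y are still available and fix the signs of p
  and q; if they agree, every rotation is available and removes q.\<close>

theorem qfn_standard: "\<exists>F\<in>standard_nonlinearities. conjugate_to (qfn A B m p q r) F"
proof -
  define d where "d = sqrt ((A - B)\<^sup>2 + m\<^sup>2)"
  have d0: "d \<ge> 0" by (simp add: d_def)
  have d2: "d\<^sup>2 = (A - B)\<^sup>2 + m\<^sup>2" by (simp add: d_def)
  have "\<exists>A' B' p' q'. conjugate_to (qfn A B m p q r) (qfn A' B' 0 p' q' r) \<and> A' \<ge> B'"
  proof (cases "d = 0")
    case True
    hence "A = B" "m = 0" using d2 by (auto simp: sum_power2_eq_zero_iff)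
    thus ?thesis using conjugate_to_refl by blast
  next
    case False
    have "((A - B) / d)\<^sup>2 + (- m / d)\<^sup>2 = 1"
      unfolding power_divide add_divide_distrib[symmetric] power2_minus d2[symmetric] using False by simp
    then obtain t where t: "(A - B) / d = cos t" "- m / d = sin t" using sincos_total_2pi by metis
    \<comment> \<open>Rotating (X,Y) by an angle turns (A-B, m) by twice that angle; t is the total
      turn that sends this vector to (d, 0), so half of t is used.\<close>
    define C S where "C = cos (t / 2)" and "S = sin (t / 2)"
    have CS: "C\<^sup>2 + S\<^sup>2 = 1" by (simp add: C_def S_def)
    have ct: "cos t = C\<^sup>2 - S\<^sup>2" and st: "sin t = 2 * C * S"
      using cos_double[of "t / 2"] sin_double[of "t / 2"] by (auto simp: C_def S_def)
    have m': "2 * A * C * S + m * (C\<^sup>2 - S\<^sup>2) - 2 * B * C * S = 0"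
    proof -
      have "2 * A * C * S + m * (C\<^sup>2 - S\<^sup>2) - 2 * B * C * S = (A - B) * sin t + m * cos t"
        by (simp add: ct st algebra_simps)
      also have "\<dots> = 0" unfolding t[symmetric] using False by (simp add: field_simps)
      finally show ?thesis .
    qed
    have "(A * C\<^sup>2 - m * C * S + B * S\<^sup>2) - (A * S\<^sup>2 + m * S * C + B * C\<^sup>2) = (A - B) * cos t - m * sin t"
      by (simp add: ct st algebra_simps)
    also have "\<dots> = ((A - B)\<^sup>2 + m\<^sup>2) / d"
      unfolding t[symmetric] by (simp add: power2_eq_square add_divide_distrib)
    also have "\<dots> \<ge> 0" using d0 by simp
    finally have "A * C\<^sup>2 - m * C * S + B * S\<^sup>2 \<ge> A * S\<^sup>2 + m * S * C + B * C\<^sup>2" by simp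
    thus ?thesis using qfn_rotate[OF CS, of A B m p q r] unfolding m' by blast
  qed
  then obtain A' B' p' q' where 1: "conjugate_to (qfn A B m p q r) (qfn A' B' 0 p' q' r)" and AB: "A' \<ge> B'" by blast
  have "\<exists>p'' q''. conjugate_to (qfn A' B' 0 p' q' r) (qfn A' B' 0 p'' q'' r) \<and> p'' \<ge> 0 \<and> q'' \<ge> 0 \<and> (q'' > 0 \<longrightarrow> A' > B')"
  proof (cases "A' = B'")
    case False
    have "conjugate_to (qfn A' B' 0 p' q' r) (qfn A' B' 0 \<bar>p'\<bar> (if p' \<ge> 0 then q' else - q') r)"
    proof (cases "p' \<ge> 0")
      case True
      thus ?thesis by simp
    next
      case False
      thus ?thesis using qfn_rotate[of "-1" 0 A' B' 0 p' q' r] by simp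
    qed
    moreover have "conjugate_to (qfn A' B' 0 \<bar>p'\<bar> q r) (qfn A' B' 0 \<bar>p'\<bar> \<bar>q\<bar> r)" for q
    proof (cases "q \<ge> 0")
      case True
      thus ?thesis by simp
    next
      case False
      thus ?thesis using qfn_reflect[of A' B' 0 "\<bar>p'\<bar>" q r] by simp
    qed
    ultimately have "conjugate_to (qfn A' B' 0 p' q' r) (qfn A' B' 0 \<bar>p'\<bar> \<bar>if p' \<ge> 0 then q' else - q'\<bar> r)"
      using conjugate_to_trans by blast
    thus ?thesis using AB False by (intro exI conjI) auto
  next
    case True
    define e where "e = sqrt (p'\<^sup>2 + q'\<^sup>2)"
    show ?thesis
    proof (cases "e = 0")
      case 2: True
      hence "p' = 0" "q' = 0" by (auto simp: e_def sum_power2_eq_zero_iff)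
      thus ?thesis by (intro exI[of _ "0::real"]) simp
    next
      case 2: False
      have e2: "e\<^sup>2 = p'\<^sup>2 + q'\<^sup>2" by (simp add: e_def)
      define C S where "C = p' / e" and "S = - q' / e"
      have CS: "C\<^sup>2 + S\<^sup>2 = 1"
        unfolding C_def S_def power_divide add_divide_distrib[symmetric] power2_minus e2[symmetric] using 2 by simp
      have "A' * C\<^sup>2 - 0 * C * S + B' * S\<^sup>2 = A' * (C\<^sup>2 + S\<^sup>2)" "A' * S\<^sup>2 + 0 * S * C + B' * C\<^sup>2 = B' * (C\<^sup>2 + S\<^sup>2)"
        using True by (simp_all add: algebra_simps)
      hence eqs: "A' * C\<^sup>2 - 0 * C * S + B' * S\<^sup>2 = A'" "A' * S\<^sup>2 + 0 * S * C + B' * C\<^sup>2 = B'"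
        unfolding CS by simp_all
      have eqs': "2 * A' * C * S + 0 * (C\<^sup>2 - S\<^sup>2) - 2 * B' * C * S = 0"
        "p' * C - q' * S = (p'\<^sup>2 + q'\<^sup>2) / e" "p' * S + q' * C = 0"
        using True by (simp_all add: C_def S_def power2_eq_square add_divide_distrib)
      have "conjugate_to (qfn A' B' 0 p' q' r) (qfn A' B' 0 ((p'\<^sup>2 + q'\<^sup>2) / e) 0 r)"
        using qfn_rotate[OF CS, of A' B' 0 p' q' r] unfolding eqs eqs' .
      moreover have "(p'\<^sup>2 + q'\<^sup>2) / e \<ge> 0" by (simp add: e_def)
      ultimately show ?thesis by auto
    qed
  qed
  then obtain p'' q'' where 2: "conjugate_to (qfn A' B' 0 p' q' r) (qfn A' B' 0 p'' q'' r)"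
    and pq: "p'' \<ge> 0" "q'' \<ge> 0" "q'' > 0 \<longrightarrow> A' > B'" by blast
  obtain F where F: "F \<in> standard_nonlinearities" "conjugate_to (qfn A' B' 0 p'' q'' r) F"
    using qfn_diagonal_standard[OF AB pq(1,2)] pq(3) by blast
  show ?thesis using conjugate_to_trans[OF conjugate_to_trans[OF 1 2] F(2)] F(1) by blast
qed


subsection \<open>Invariance of solutions under linear changes of the unknowns\<close>

lemma norm_combination_squared_le:
  "(norm (a *\<^sub>R x + b *\<^sub>R (y::'a::real_normed_vector)))\<^sup>2 \<le> 2 * a\<^sup>2 * (norm x)\<^sup>2 + 2 * b\<^sup>2 * (norm y)\<^sup>2"
  using norm_add_squared_le[of "a *\<^sub>R x" "b *\<^sub>R y"] by (simp add: power_mult_distrib)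

lemma square_integrable_combination:
  fixes f g :: "'a::euclidean_space \<Rightarrow> 'b::euclidean_space"
  assumes f: "square_integrable f" and g: "square_integrable g"
  shows "square_integrable (\<lambda>x. a *\<^sub>R f x + b *\<^sub>R g x)"
  unfolding square_integrable_def
proof
  have [measurable]: "f \<in> borel_measurable lebesgue" "g \<in> borel_measurable lebesgue"
    using f g by (auto simp: square_integrable_def)
  show m: "(\<lambda>x. a *\<^sub>R f x + b *\<^sub>R g x) \<in> borel_measurable lebesgue" by measurable
  have "integrable lebesgue (\<lambda>x. 2 * (a\<^sup>2 * (norm (f x))\<^sup>2) + 2 * (b\<^sup>2 * (norm (g x))\<^sup>2))"
    using f g by (auto simp: square_integrable_def)
  thus "integrable lebesgue (\<lambda>x. (norm (a *\<^sub>R f x + b *\<^sub>R g x))\<^sup>2)"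
  proof (rule Bochner_Integration.integrable_bound)
    show "AE x in lebesgue. norm ((norm (a *\<^sub>R f x + b *\<^sub>R g x))\<^sup>2)
      \<le> norm (2 * (a\<^sup>2 * (norm (f x))\<^sup>2) + 2 * (b\<^sup>2 * (norm (g x))\<^sup>2))"
    proof (rule AE_I2)
      fix x
      have "(norm (a *\<^sub>R f x + b *\<^sub>R g x))\<^sup>2 \<le> 2 * (norm (a *\<^sub>R f x))\<^sup>2 + 2 * (norm (b *\<^sub>R g x))\<^sup>2"
        by (rule norm_add_squared_le)
      thus "norm ((norm (a *\<^sub>R f x + b *\<^sub>R g x))\<^sup>2) \<le> norm (2 * (a\<^sup>2 * (norm (f x))\<^sup>2) + 2 * (b\<^sup>2 * (norm (g x))\<^sup>2))"
        by (simp add: power_mult_distrib)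
    qed
  qed measurable
qed

lemma test_function_mult_integrable:
  fixes f :: "real^'k::finite \<Rightarrow> 'b::euclidean_space"
  assumes \<phi>: "test_function \<phi>" and f: "square_integrable f"
  shows "integrable lebesgue (\<lambda>x. \<phi> x *\<^sub>R f x)" "integrable lebesgue (\<lambda>x. partial k \<phi> x *\<^sub>R f x)"
proof -
  have *: "integrable lebesgue (\<lambda>x. \<psi> x *\<^sub>R f x)" if \<psi>: "l2 (\<lambda>x. complex_of_real (\<psi> x))" for \<psi> :: "real^'k \<Rightarrow> real"
  proof -
    have "Re \<circ> (\<lambda>x. complex_of_real (\<psi> x)) \<in> borel_measurable borel"
      using l2_measurable[OF \<psi>] by measurable
    hence m: "\<psi> \<in> borel_measurable lborel" by (simp add: o_def)
    have [measurable]: "\<psi> \<in> borel_measurable lebesgue" "f \<in> borel_measurable lebesgue"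
      using f measurable_completion[OF m] by (auto simp: square_integrable_def)
    have "integrable lborel (\<lambda>x. (\<psi> x)\<^sup>2)" using \<psi> by (simp add: l2_def)
    hence "integrable lebesgue (\<lambda>x. (\<psi> x)\<^sup>2)" using m by (subst integrable_completion) auto
    hence "integrable lebesgue (\<lambda>x. (\<psi> x)\<^sup>2 + (norm (f x))\<^sup>2)"
      using f by (auto simp: square_integrable_def)
    thus ?thesis
    proof (rule Bochner_Integration.integrable_bound)
      show "AE x in lebesgue. norm (\<psi> x *\<^sub>R f x) \<le> norm ((\<psi> x)\<^sup>2 + (norm (f x))\<^sup>2)"
      proof (rule AE_I2)
        fix x show "norm (\<psi> x *\<^sub>R f x) \<le> norm ((\<psi> x)\<^sup>2 + (norm (f x))\<^sup>2)"
          using mult_le_squares[of "\<bar>\<psi> x\<bar>" "norm (f x)"] by simp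
      qed
    qed measurable
  qed
  note l = l2_deriv_test_translate[OF \<phi>, of k, unfolded l2_deriv_def]
  show "integrable lebesgue (\<lambda>x. \<phi> x *\<^sub>R f x)" "integrable lebesgue (\<lambda>x. partial k \<phi> x *\<^sub>R f x)"
    using l by (auto intro!: * dest: spec[of _ 0])
qed

lemma H1_with_gradient_combination:
  assumes "H1_with_gradient f F" "H1_with_gradient g G"
  shows "H1_with_gradient (\<lambda>x. a *\<^sub>R f x + b *\<^sub>R g x) (\<lambda>x. a *\<^sub>R F x + b *\<^sub>R G x)"
  unfolding H1_with_gradient_def
proof (intro conjI allI impI)
  note sq = assms[unfolded H1_with_gradient_def, THEN conjunct1] assms[unfolded H1_with_gradient_def, THEN conjunct2, THEN conjunct1]
  show "square_integrable (\<lambda>x. a *\<^sub>R f x + b *\<^sub>R g x)" "square_integrable (\<lambda>x. a *\<^sub>R F x + b *\<^sub>R G x)"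
    by (intro square_integrable_combination sq)+
  fix \<phi> :: "real^3 \<Rightarrow> real" and k assume \<phi>: "test_function \<phi>"
  have i: "integrable lebesgue (\<lambda>x. \<phi> x *\<^sub>R F x $ k)" "integrable lebesgue (\<lambda>x. \<phi> x *\<^sub>R G x $ k)"
    using test_function_mult_integrable(1)[OF \<phi> sq(3), THEN integrable_bounded_linear[OF bounded_linear_vec_nth, of _ _ k]]
      test_function_mult_integrable(1)[OF \<phi> sq(4), THEN integrable_bounded_linear[OF bounded_linear_vec_nth, of _ _ k]] by auto
  have "(\<integral>x. partial k \<phi> x *\<^sub>R (a *\<^sub>R f x + b *\<^sub>R g x) \<partial>lebesgue)
    = (\<integral>x. a *\<^sub>R (partial k \<phi> x *\<^sub>R f x) + b *\<^sub>R (partial k \<phi> x *\<^sub>R g x) \<partial>lebesgue)"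
    by (simp add: scaleR_add_right mult.commute)
  also have "\<dots> = a *\<^sub>R (\<integral>x. partial k \<phi> x *\<^sub>R f x \<partial>lebesgue) + b *\<^sub>R (\<integral>x. partial k \<phi> x *\<^sub>R g x \<partial>lebesgue)"
    using test_function_mult_integrable(2)[OF \<phi> sq(1)] test_function_mult_integrable(2)[OF \<phi> sq(2)]
    by (subst Bochner_Integration.integral_add) (auto simp del: scaleR_scaleR)
  also have "\<dots> = - (a *\<^sub>R (\<integral>x. \<phi> x *\<^sub>R F x $ k \<partial>lebesgue) + b *\<^sub>R (\<integral>x. \<phi> x *\<^sub>R G x $ k \<partial>lebesgue))"
    using assms \<phi> by (simp add: H1_with_gradient_def)
  also have "a *\<^sub>R (\<integral>x. \<phi> x *\<^sub>R F x $ k \<partial>lebesgue) + b *\<^sub>R (\<integral>x. \<phi> x *\<^sub>R G x $ k \<partial>lebesgue)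
    = (\<integral>x. a *\<^sub>R (\<phi> x *\<^sub>R F x $ k) + b *\<^sub>R (\<phi> x *\<^sub>R G x $ k) \<partial>lebesgue)"
    using i by (subst Bochner_Integration.integral_add) (auto simp del: scaleR_scaleR)
  also have "\<dots> = (\<integral>x. \<phi> x *\<^sub>R (a *\<^sub>R F x + b *\<^sub>R G x) $ k \<partial>lebesgue)"
    by (simp add: scaleR_add_right mult.commute)
  finally show "(\<integral>x. partial k \<phi> x *\<^sub>R (a *\<^sub>R f x + b *\<^sub>R g x) \<partial>lebesgue)
    = - (\<integral>x. \<phi> x *\<^sub>R (a *\<^sub>R F x + b *\<^sub>R G x) $ k \<partial>lebesgue)" .
qed

text \<open>One implication is enough: applied to the inverse matrix it also gives the converse
  demanded by \<open>transforms_to\<close>.\<close>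

lemma H1_solution_act:
  assumes F: "\<And>z. F (act M z $ 1) (act M z $ 2) = act M (N (z $ 1) (z $ 2))"
    and sol: "H1_solution N I u Du"
  shows "H1_solution F I (\<lambda>t x. act M (u t x)) (\<lambda>t x. act M (Du t x))"
proof -
  have I: "open I" "is_interval I"
    and H1: "\<And>t j. t \<in> I \<Longrightarrow> H1_with_gradient (\<lambda>x. u t x $ j) (\<lambda>x. Du t x $ j)"
    and cont: "\<And>s j. s \<in> I \<Longrightarrow>
        ((\<lambda>t. \<integral>x. (norm (u t x $ j - u s x $ j))\<^sup>2 + (norm (Du t x $ j - Du s x $ j))\<^sup>2 \<partial>lebesgue) \<longlongrightarrow> 0) (at s within I)"
    and Nint: "\<And>t j \<phi>. t \<in> I \<Longrightarrow> test_function \<phi> \<Longrightarrow> integrable lebesgue (\<lambda>x. \<phi> x *\<^sub>R N (u t x $ 1) (u t x $ 2) $ j)"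
    and eq: "\<And>t j \<phi>. t \<in> I \<Longrightarrow> test_function \<phi> \<Longrightarrow>
        \<exists>D. ((\<lambda>s. \<integral>x. \<phi> x *\<^sub>R u s x $ j \<partial>lebesgue) has_vector_derivative D) (at t within I) \<and>
             \<i> * D - (\<integral>x. (\<Sum>k\<in>UNIV. partial k \<phi> x *\<^sub>R Du t x $ j $ k) \<partial>lebesgue)
               = (\<integral>x. \<phi> x *\<^sub>R N (u t x $ 1) (u t x $ 2) $ j \<partial>lebesgue)"
    using sol unfolding H1_solution_def by blast+
  have sqi: "square_integrable (\<lambda>x. u t x $ j)" "square_integrable (\<lambda>x. Du t x $ j)" if "t \<in> I" for t j
    using H1[OF that] by (auto simp: H1_with_gradient_def)
  show ?thesis
    unfolding H1_solution_def
  proof (intro conjI ballI allI impI I)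
    fix t j assume "t \<in> I"
    thus "H1_with_gradient (\<lambda>x. act M (u t x) $ j) (\<lambda>x. act M (Du t x) $ j)"
      unfolding act_nth by (intro H1_with_gradient_combination H1)
  next
    fix s j assume s: "s \<in> I"
    let ?a = "M $ j $ 1" and ?b = "M $ j $ 2"
    let ?E = "\<lambda>l t x. (norm (u t x $ l - u s x $ l))\<^sup>2 + (norm (Du t x $ l - Du s x $ l))\<^sup>2"
    have Ei: "integrable lebesgue (?E l t)" if "t \<in> I" for l t
      using square_integrable_combination[OF sqi(1)[OF that] sqi(1)[OF s], of 1 l "-1" l]
        square_integrable_combination[OF sqi(2)[OF that] sqi(2)[OF s], of 1 l "-1" l]
      by (auto simp: square_integrable_def)
    have le: "(norm (act M (u t x) $ j - act M (u s x) $ j))\<^sup>2 + (norm (act M (Du t x) $ j - act M (Du s x) $ j))\<^sup>2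
        \<le> 2 * ?a\<^sup>2 * ?E 1 t x + 2 * ?b\<^sup>2 * ?E 2 t x" for t x
    proof -
      have 1: "act M (u t x) $ j - act M (u s x) $ j = ?a *\<^sub>R (u t x $ 1 - u s x $ 1) + ?b *\<^sub>R (u t x $ 2 - u s x $ 2)"
        "act M (Du t x) $ j - act M (Du s x) $ j = ?a *\<^sub>R (Du t x $ 1 - Du s x $ 1) + ?b *\<^sub>R (Du t x $ 2 - Du s x $ 2)"
        by (simp_all add: act_nth scaleR_diff_right)
      show ?thesis unfolding 1
        using norm_combination_squared_le[of ?a "u t x $ 1 - u s x $ 1" ?b "u t x $ 2 - u s x $ 2"]
          norm_combination_squared_le[of ?a "Du t x $ 1 - Du s x $ 1" ?b "Du t x $ 2 - Du s x $ 2"]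
        unfolding distrib_left by linarith
    qed
    have lim: "((\<lambda>t. 2 * ?a\<^sup>2 * (\<integral>x. ?E 1 t x \<partial>lebesgue) + 2 * ?b\<^sup>2 * (\<integral>x. ?E 2 t x \<partial>lebesgue)) \<longlongrightarrow> 2 * ?a\<^sup>2 * 0 + 2 * ?b\<^sup>2 * 0) (at s within I)"
      by (intro tendsto_intros cont s)
    hence lim: "((\<lambda>t. 2 * ?a\<^sup>2 * (\<integral>x. ?E 1 t x \<partial>lebesgue) + 2 * ?b\<^sup>2 * (\<integral>x. ?E 2 t x \<partial>lebesgue)) \<longlongrightarrow> 0) (at s within I)"
      by simp
    show "((\<lambda>t. \<integral>x. (norm (act M (u t x) $ j - act M (u s x) $ j))\<^sup>2 + (norm (act M (Du t x) $ j - act M (Du s x) $ j))\<^sup>2 \<partial>lebesgue) \<longlongrightarrow> 0) (at s within I)"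
    proof (rule Lim_null_comparison[OF _ lim])
      have "norm (\<integral>x. (norm (act M (u t x) $ j - act M (u s x) $ j))\<^sup>2 + (norm (act M (Du t x) $ j - act M (Du s x) $ j))\<^sup>2 \<partial>lebesgue)
        \<le> 2 * ?a\<^sup>2 * (\<integral>x. ?E 1 t x \<partial>lebesgue) + 2 * ?b\<^sup>2 * (\<integral>x. ?E 2 t x \<partial>lebesgue)" if t: "t \<in> I" for t
      proof -
        have "(\<integral>x. (norm (act M (u t x) $ j - act M (u s x) $ j))\<^sup>2 + (norm (act M (Du t x) $ j - act M (Du s x) $ j))\<^sup>2 \<partial>lebesgue)
          \<le> (\<integral>x. 2 * ?a\<^sup>2 * ?E 1 t x + 2 * ?b\<^sup>2 * ?E 2 t x \<partial>lebesgue)"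
          by (rule integral_mono'[OF _ le]) (use Ei[OF t] in auto)
        also have "\<dots> = 2 * ?a\<^sup>2 * (\<integral>x. ?E 1 t x \<partial>lebesgue) + 2 * ?b\<^sup>2 * (\<integral>x. ?E 2 t x \<partial>lebesgue)"
          using Ei[OF t] by (subst Bochner_Integration.integral_add) auto
        finally show ?thesis by (simp add: integral_nonneg_AE)
      qed
      thus "eventually (\<lambda>t. norm (\<integral>x. (norm (act M (u t x) $ j - act M (u s x) $ j))\<^sup>2 + (norm (act M (Du t x) $ j - act M (Du s x) $ j))\<^sup>2 \<partial>lebesgue)
        \<le> 2 * ?a\<^sup>2 * (\<integral>x. ?E 1 t x \<partial>lebesgue) + 2 * ?b\<^sup>2 * (\<integral>x. ?E 2 t x \<partial>lebesgue)) (at s within I)"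
        by (auto simp: eventually_at_filter)
    qed
  next
    fix t j and \<phi> :: "real^3 \<Rightarrow> real" assume t: "t \<in> I" and \<phi>: "test_function \<phi>"
    let ?a = "M $ j $ 1" and ?b = "M $ j $ 2"
    have comb: "(\<integral>x. a *\<^sub>R f x + b *\<^sub>R g x \<partial>lebesgue) = a *\<^sub>R (\<integral>x. f x \<partial>lebesgue) + b *\<^sub>R (\<integral>x. g x \<partial>lebesgue)"
      if "integrable lebesgue f" "integrable lebesgue g" for a b and f g :: "real^3 \<Rightarrow> complex"
      using that by (subst Bochner_Integration.integral_add) auto
    have e: "\<phi> x *\<^sub>R F (act M (u t x) $ 1) (act M (u t x) $ 2) $ j
       = ?a *\<^sub>R (\<phi> x *\<^sub>R N (u t x $ 1) (u t x $ 2) $ 1) + ?b *\<^sub>R (\<phi> x *\<^sub>R N (u t x $ 1) (u t x $ 2) $ 2)" for x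
      unfolding F act_nth[of M "N _ _"] by (simp add: scaleR_add_right mult.commute)
    show "integrable lebesgue (\<lambda>x. \<phi> x *\<^sub>R F (act M (u t x) $ 1) (act M (u t x) $ 2) $ j)"
      unfolding e by (intro Bochner_Integration.integrable_add integrable_scaleR_right Nint t \<phi>)
    obtain D1 D2 where D: "((\<lambda>s. \<integral>x. \<phi> x *\<^sub>R u s x $ 1 \<partial>lebesgue) has_vector_derivative D1) (at t within I)"
      "\<i> * D1 - (\<integral>x. (\<Sum>k\<in>UNIV. partial k \<phi> x *\<^sub>R Du t x $ 1 $ k) \<partial>lebesgue) = (\<integral>x. \<phi> x *\<^sub>R N (u t x $ 1) (u t x $ 2) $ 1 \<partial>lebesgue)"
      "((\<lambda>s. \<integral>x. \<phi> x *\<^sub>R u s x $ 2 \<partial>lebesgue) has_vector_derivative D2) (at t within I)"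
      "\<i> * D2 - (\<integral>x. (\<Sum>k\<in>UNIV. partial k \<phi> x *\<^sub>R Du t x $ 2 $ k) \<partial>lebesgue) = (\<integral>x. \<phi> x *\<^sub>R N (u t x $ 1) (u t x $ 2) $ 2 \<partial>lebesgue)"
      using eq[OF t \<phi>, of 1] eq[OF t \<phi>, of 2] by blast
    have split: "(\<integral>x. \<phi> x *\<^sub>R act M (u s x) $ j \<partial>lebesgue) = ?a *\<^sub>R (\<integral>x. \<phi> x *\<^sub>R u s x $ 1 \<partial>lebesgue) + ?b *\<^sub>R (\<integral>x. \<phi> x *\<^sub>R u s x $ 2 \<partial>lebesgue)"
      if s: "s \<in> I" for s
    proof -
      have "(\<integral>x. \<phi> x *\<^sub>R act M (u s x) $ j \<partial>lebesgue) = (\<integral>x. ?a *\<^sub>R (\<phi> x *\<^sub>R u s x $ 1) + ?b *\<^sub>R (\<phi> x *\<^sub>R u s x $ 2) \<partial>lebesgue)"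
        by (simp add: act_nth scaleR_add_right mult.commute)
      also have "\<dots> = ?a *\<^sub>R (\<integral>x. \<phi> x *\<^sub>R u s x $ 1 \<partial>lebesgue) + ?b *\<^sub>R (\<integral>x. \<phi> x *\<^sub>R u s x $ 2 \<partial>lebesgue)"
        by (intro comb test_function_mult_integrable(1)[OF \<phi>] sqi s)
      finally show ?thesis .
    qed
    have "((\<lambda>s. ?a *\<^sub>R (\<integral>x. \<phi> x *\<^sub>R u s x $ 1 \<partial>lebesgue) + ?b *\<^sub>R (\<integral>x. \<phi> x *\<^sub>R u s x $ 2 \<partial>lebesgue))
        has_vector_derivative (?a *\<^sub>R D1 + ?b *\<^sub>R D2)) (at t within I)"
      by (intro has_vector_derivative_add bounded_linear.has_vector_derivative[OF bounded_linear_scaleR_right] D)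
    hence d: "((\<lambda>s. \<integral>x. \<phi> x *\<^sub>R act M (u s x) $ j \<partial>lebesgue) has_vector_derivative (?a *\<^sub>R D1 + ?b *\<^sub>R D2)) (at t within I)"
      by (rule has_vector_derivative_transform[OF t, rotated]) (simp add: split)
    have gi: "integrable lebesgue (\<lambda>x. \<Sum>k\<in>UNIV. partial k \<phi> x *\<^sub>R Du t x $ l $ k)" for l
      using test_function_mult_integrable(2)[OF \<phi> sqi(2)[OF t, of l], THEN integrable_bounded_linear[OF bounded_linear_vec_nth]]
      by (intro Bochner_Integration.integrable_sum) simp
    have "(\<integral>x. (\<Sum>k\<in>UNIV. partial k \<phi> x *\<^sub>R act M (Du t x) $ j $ k) \<partial>lebesgue)
      = (\<integral>x. ?a *\<^sub>R (\<Sum>k\<in>UNIV. partial k \<phi> x *\<^sub>R Du t x $ 1 $ k) + ?b *\<^sub>R (\<Sum>k\<in>UNIV. partial k \<phi> x *\<^sub>R Du t x $ 2 $ k) \<partial>lebesgue)"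
      by (simp add: act_nth scaleR_add_right scaleR_sum_right sum.distrib mult.commute)
    also have "\<dots> = ?a *\<^sub>R (\<integral>x. (\<Sum>k\<in>UNIV. partial k \<phi> x *\<^sub>R Du t x $ 1 $ k) \<partial>lebesgue)
       + ?b *\<^sub>R (\<integral>x. (\<Sum>k\<in>UNIV. partial k \<phi> x *\<^sub>R Du t x $ 2 $ k) \<partial>lebesgue)"
      by (rule comb[OF gi gi])
    finally have g: "(\<integral>x. (\<Sum>k\<in>UNIV. partial k \<phi> x *\<^sub>R act M (Du t x) $ j $ k) \<partial>lebesgue)
      = ?a *\<^sub>R (\<integral>x. (\<Sum>k\<in>UNIV. partial k \<phi> x *\<^sub>R Du t x $ 1 $ k) \<partial>lebesgue)
       + ?b *\<^sub>R (\<integral>x. (\<Sum>k\<in>UNIV. partial k \<phi> x *\<^sub>R Du t x $ 2 $ k) \<partial>lebesgue)" .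
    have n: "(\<integral>x. \<phi> x *\<^sub>R F (act M (u t x) $ 1) (act M (u t x) $ 2) $ j \<partial>lebesgue)
      = ?a *\<^sub>R (\<integral>x. \<phi> x *\<^sub>R N (u t x $ 1) (u t x $ 2) $ 1 \<partial>lebesgue) + ?b *\<^sub>R (\<integral>x. \<phi> x *\<^sub>R N (u t x $ 1) (u t x $ 2) $ 2 \<partial>lebesgue)"
      unfolding e by (intro comb Nint t \<phi>)
    have "\<i> * (?a *\<^sub>R D1 + ?b *\<^sub>R D2) - (\<integral>x. (\<Sum>k\<in>UNIV. partial k \<phi> x *\<^sub>R act M (Du t x) $ j $ k) \<partial>lebesgue)
      = (\<integral>x. \<phi> x *\<^sub>R F (act M (u t x) $ 1) (act M (u t x) $ 2) $ j \<partial>lebesgue)"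
      unfolding g n D(2,4)[symmetric] by (simp add: algebra_simps)
    thus "\<exists>D. ((\<lambda>s. \<integral>x. \<phi> x *\<^sub>R act M (u s x) $ j \<partial>lebesgue) has_vector_derivative D) (at t within I) \<and>
       \<i> * D - (\<integral>x. (\<Sum>k\<in>UNIV. partial k \<phi> x *\<^sub>R act M (Du t x) $ j $ k) \<partial>lebesgue)
         = (\<integral>x. \<phi> x *\<^sub>R F (act M (u t x) $ 1) (act M (u t x) $ 2) $ j \<partial>lebesgue)"
      using d by blast
  qed
qed

lemma conjugate_to_transforms_to:
  assumes "conjugate_to N F"
  shows "\<exists>M. invertible M \<and> transforms_to M N F"
proof -
  obtain M where M: "invertible M" and F: "\<And>z. F (act M z $ 1) (act M z $ 2) = act M (N (z $ 1) (z $ 2))"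
    using assms by (auto simp: conjugate_to_def)
  obtain M' where M': "M ** M' = mat 1" "M' ** M = mat 1" using M by (auto simp: invertible_def)
  have bk: "N (act M' z $ 1) (act M' z $ 2) = act M' (F (z $ 1) (z $ 2))" for z
    using arg_cong[OF F[of "act M' z"], of "act M'"] by (simp add: act_act M')
  have "H1_solution N I u Du \<longleftrightarrow> H1_solution F I (\<lambda>t x. act M (u t x)) (\<lambda>t x. act M (Du t x))" for I u Du
    using H1_solution_act[of F M N I u Du, OF F]
      H1_solution_act[of N M' F I "\<lambda>t x. act M (u t x)" "\<lambda>t x. act M (Du t x)", OF bk]
    by (auto simp: act_act M')
  thus ?thesis using M F unfolding transforms_to_def by blast
qed


subsection \<open>Gradient nonlinearities\<close>

text \<open>\<open>gradient_form A B D E F J\<close> is $\partial G/\partial\bar z$ for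
  $G = A s_1^2 + B Y^2 + D s_2^2 + E s_1 Y + F s_1 s_2 + J s_2 Y$ with $s_j=|z_j|^2$ and
  $Y=2\mathrm{Re}(z_1\bar z_2)$.\<close>

definition gradient_form :: "real \<Rightarrow> real \<Rightarrow> real \<Rightarrow> real \<Rightarrow> real \<Rightarrow> real \<Rightarrow> nonlinearity" where
  "gradient_form A B D E F J z1 z2 = (let s1 = (cmod z1)\<^sup>2; s2 = (cmod z2)\<^sup>2; Y = cross_dens z1 z2;
      b1 = 2 * A * s1 + E * Y + F * s2; b = 2 * B * Y + E * s1 + J * s2; b2 = 2 * D * s2 + F * s1 + J * Y in
    vector [b1 *\<^sub>R z1 + b *\<^sub>R z2, b *\<^sub>R z1 + b2 *\<^sub>R z2])"

text \<open>Substitute s1 = (\<rho>+X)/2 and s2 = (\<rho>-X)/2 in the potential.\<close>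

lemma gradient_form_eq_qfn:
  "gradient_form A B D E F J = qfn ((A + D - F) / 4) B ((E - J) / 2) ((A - D) / 2) ((E + J) / 2) ((A + D + F) / 4)"
  by (simp add: qfn_expand gradient_form_def) (simp add: field_simps power2_eq_square)

text \<open>Chain rule for an upper triangular substitution P: the gradient of G \<circ> P at z is
  P^T applied to the gradient of G at P z, and G \<circ> P is again a quadratic form in s1, s2, Y.
  Triangular P suffice, since they will be inverses of Cholesky factors.\<close>

lemma gradient_form_congruence:
  fixes p1 t p2 :: real
  obtains A' B' D' E' F' J' where
    "\<And>z1 z2. gradient_form A' B' D' E' F' J' z1 z2 $ 1 = p1 *\<^sub>R gradient_form A B D E F J (p1 *\<^sub>R z1 + t *\<^sub>R z2) (p2 *\<^sub>R z2) $ 1"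
    "\<And>z1 z2. gradient_form A' B' D' E' F' J' z1 z2 $ 2 = t *\<^sub>R gradient_form A B D E F J (p1 *\<^sub>R z1 + t *\<^sub>R z2) (p2 *\<^sub>R z2) $ 1
       + p2 *\<^sub>R gradient_form A B D E F J (p1 *\<^sub>R z1 + t *\<^sub>R z2) (p2 *\<^sub>R z2) $ 2"
proof -
  \<comment> \<open>Under the substitution s1 becomes al s1 + be Y + ga s2, Y becomes de Y + et s2,
    and s2 becomes ka s2.\<close>
  define al be ga de et ka where "al = p1\<^sup>2" and "be = p1 * t" and "ga = t\<^sup>2" and "de = p1 * p2" and "et = 2 * t * p2" and "ka = p2\<^sup>2"
  define A' B' D' E' F' J' where "A' = A * al\<^sup>2" and "B' = A * be\<^sup>2 + B * de\<^sup>2 + E * be * de"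
    and "D' = A * ga\<^sup>2 + B * et\<^sup>2 + D * ka\<^sup>2 + E * ga * et + F * ga * ka + J * et * ka"
    and "E' = 2 * A * al * be + E * al * de" and "F' = 2 * A * al * ga + E * al * et + F * al * ka"
    and "J' = 2 * A * be * ga + 2 * B * de * et + E * (be * et + ga * de) + F * be * ka + J * de * ka"
  show thesis
  proof (rule that[of A' B' D' E' F' J'])
    fix z1 z2 :: complex
    define s1 s2 Y where "s1 = (cmod z1)\<^sup>2" and "s2 = (cmod z2)\<^sup>2" and "Y = cross_dens z1 z2"
    have s1': "(cmod (p1 *\<^sub>R z1 + t *\<^sub>R z2))\<^sup>2 = al * s1 + be * Y + ga * s2"
      and Y': "cross_dens (p1 *\<^sub>R z1 + t *\<^sub>R z2) (p2 *\<^sub>R z2) = de * Y + et * s2"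
      and s2': "(cmod (p2 *\<^sub>R z2))\<^sup>2 = ka * s2"
      unfolding s1_def s2_def Y_def cross_dens_def cmod_power2 al_def be_def ga_def de_def et_def ka_def
      by (simp_all add: algebra_simps power2_eq_square)
    define b1 b b2 where "b1 = 2 * A * (al * s1 + be * Y + ga * s2) + E * (de * Y + et * s2) + F * (ka * s2)"
      and "b = 2 * B * (de * Y + et * s2) + E * (al * s1 + be * Y + ga * s2) + J * (ka * s2)"
      and "b2 = 2 * D * (ka * s2) + F * (al * s1 + be * Y + ga * s2) + J * (de * Y + et * s2)"
    have c: "2 * A' * s1 + E' * Y + F' * s2 = al * b1" "2 * B' * Y + E' * s1 + J' * s2 = be * b1 + de * b"
      "2 * D' * s2 + F' * s1 + J' * Y = ga * b1 + et * b + ka * b2"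
      unfolding A'_def B'_def D'_def E'_def F'_def J'_def b1_def b_def b2_def
      by (simp_all add: algebra_simps power2_eq_square)
    have L: "gradient_form A' B' D' E' F' J' z1 z2
      = vector [(al * b1) *\<^sub>R z1 + (be * b1 + de * b) *\<^sub>R z2, (be * b1 + de * b) *\<^sub>R z1 + (ga * b1 + et * b + ka * b2) *\<^sub>R z2]"
      unfolding gradient_form_def Let_def s1_def[symmetric] s2_def[symmetric] Y_def[symmetric] c ..
    have R: "gradient_form A B D E F J (p1 *\<^sub>R z1 + t *\<^sub>R z2) (p2 *\<^sub>R z2)
      = vector [b1 *\<^sub>R (p1 *\<^sub>R z1 + t *\<^sub>R z2) + b *\<^sub>R (p2 *\<^sub>R z2), b *\<^sub>R (p1 *\<^sub>R z1 + t *\<^sub>R z2) + b2 *\<^sub>R (p2 *\<^sub>R z2)]"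
      unfolding gradient_form_def Let_def s1' s2' Y' b1_def[symmetric] b_def[symmetric] b2_def[symmetric] ..
    show "gradient_form A' B' D' E' F' J' z1 z2 $ 1 = p1 *\<^sub>R gradient_form A B D E F J (p1 *\<^sub>R z1 + t *\<^sub>R z2) (p2 *\<^sub>R z2) $ 1"
      unfolding L R by (simp add: al_def be_def de_def algebra_simps power2_eq_square)
    show "gradient_form A' B' D' E' F' J' z1 z2 $ 2 = t *\<^sub>R gradient_form A B D E F J (p1 *\<^sub>R z1 + t *\<^sub>R z2) (p2 *\<^sub>R z2) $ 1
       + p2 *\<^sub>R gradient_form A B D E F J (p1 *\<^sub>R z1 + t *\<^sub>R z2) (p2 *\<^sub>R z2) $ 2"
      unfolding L R vector_2 scaleR_add_right scaleR_scaleR scaleR_add_left[symmetric]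
      by (simp add: be_def ga_def de_def et_def ka_def complex_eq_iff algebra_simps power2_eq_square)
  qed
qed

section \<open>Integrability conditions and reduction of gradient systems\<close>

definition quadlinear :: "('v::real_vector \<Rightarrow> 'v \<Rightarrow> 'v \<Rightarrow> 'v \<Rightarrow> real) \<Rightarrow> bool" where
  "quadlinear T \<longleftrightarrow> (\<forall>b c d. linear (\<lambda>a. T a b c d)) \<and> (\<forall>a c d. linear (\<lambda>b. T a b c d)) \<and>
     (\<forall>a b d. linear (\<lambda>c. T a b c d)) \<and> (\<forall>a b c. linear (\<lambda>d. T a b c d))"

definition diagonal_derivative :: "('v \<Rightarrow> 'v \<Rightarrow> 'v \<Rightarrow> 'v \<Rightarrow> real) \<Rightarrow> 'v \<Rightarrow> 'v \<Rightarrow> real" where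
  "diagonal_derivative T z w = T w z z z + T z w z z + T z z w z + T z z z w"

lemma quadlinear_simps:
  assumes "quadlinear T"
  shows "T (a + a') b c d = T a b c d + T a' b c d" "T a (b + b') c d = T a b c d + T a b' c d"
    "T a b (c + c') d = T a b c d + T a b c' d" "T a b c (d + d') = T a b c d + T a b c d'"
    "T (r *\<^sub>R a) b c d = r * T a b c d" "T a (r *\<^sub>R b) c d = r * T a b c d"
    "T a b (r *\<^sub>R c) d = r * T a b c d" "T a b c (r *\<^sub>R d) = r * T a b c d"
  using assms unfolding quadlinear_def
  by (simp_all add: linear_add[of "\<lambda>a. T a b c d"] linear_add[of "\<lambda>b. T a b c d"] linear_add[of "\<lambda>c. T a b c d"]
      linear_add[of "\<lambda>d. T a b c d"] linear_scale[of "\<lambda>a. T a b c d"] linear_scale[of "\<lambda>b. T a b c d"]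
      linear_scale[of "\<lambda>c. T a b c d"] linear_scale[of "\<lambda>d. T a b c d"])

text \<open>Euler's identity expresses the quartic form through its derivative; the linear coefficient of
  the polynomial $s \mapsto T(z+sw,\dots)$ is then recovered from its values at $\pm1,\pm2$.\<close>

lemma quadlinear_difference_identity:
  assumes T: "quadlinear T" and S: "\<And>z w. diagonal_derivative T z w = S w z"
  shows "48 * S w z = 8 * (S (z + w) (z + w) - S (z + (-1) *\<^sub>R w) (z + (-1) *\<^sub>R w))
     - (S (z + 2 *\<^sub>R w) (z + 2 *\<^sub>R w) - S (z + (-2) *\<^sub>R w) (z + (-2) *\<^sub>R w))"
  unfolding S[symmetric] diagonal_derivative_def quadlinear_simps[OF T] by (simp add: algebra_simps)

text \<open>These are the integrability conditions for a cubic vector field with a potential: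
  \<open>id\<close> says that \<open>S\<close> comes from a quartic form, and evaluation at vectors
  with entries 0, 1 and i yields six linear equations that determine them.\<close>

lemma cubic_gradient_relations:
  fixes l :: "nat \<Rightarrow> real"
  defines "S \<equiv> \<lambda>(w :: complex^2) (z :: complex^2). 2 * Re (cnj (w $ 1) * cubic_nonlinearity l (z $ 1) (z $ 2) $ 1
      + cnj (w $ 2) * cubic_nonlinearity l (z $ 1) (z $ 2) $ 2)"
  assumes id: "\<And>z w. 48 * S w z = 8 * (S (z + w) (z + w) - S (z + (-1) *\<^sub>R w) (z + (-1) *\<^sub>R w))
     - (S (z + 2 *\<^sub>R w) (z + 2 *\<^sub>R w) - S (z + (-2) *\<^sub>R w) (z + (-2) *\<^sub>R w))"
  shows "l 2 = 2 * l 7" "l 3 = l 7" "l 4 = l 8" "l 5 = l 9" "l 6 = l 11" "l 10 = 2 * l 11"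
proof -
  have *: "48 * S (vector [w1, w2]) (vector [z1, z2]) = 8 * (S (vector [z1 + w1, z2 + w2]) (vector [z1 + w1, z2 + w2])
      - S (vector [z1 - w1, z2 - w2]) (vector [z1 - w1, z2 - w2]))
     - (S (vector [z1 + 2 * w1, z2 + 2 * w2]) (vector [z1 + 2 * w1, z2 + 2 * w2])
      - S (vector [z1 - 2 * w1, z2 - 2 * w2]) (vector [z1 - 2 * w1, z2 - 2 * w2]))" for w1 w2 z1 z2
  proof -
    have v: "vector [z1, z2] + r *\<^sub>R vector [w1, w2] = (vector [z1 + r *\<^sub>R w1, z2 + r *\<^sub>R w2] :: complex^2)" for r
      by (simp add: vec_eq_iff forall_2)
    show ?thesis using id[of "vector [w1, w2]" "vector [z1, z2]"] v[of 1] v[of "-1"] v[of 2] v[of "-2"]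
      by (simp add: scaleR_conv_of_real)
  qed
  note ex = S_def cubic_nonlinearity_def vector_2 cmod_power2 Re_power2 Im_power2
  have 1: "l 2 + l 3 = 3 * l 7" using *[of 0 1 1 0] by (simp add: ex)
  have 2: "3 * l 6 = l 10 + l 11" using *[of 1 0 0 1] by (simp add: ex)
  have 3: "l 4 - l 5 = l 8 - l 9" using *[of 1 0 1 \<i>] by (simp add: ex)
  have 4: "l 4 + l 5 = l 8 + l 9" using *[of 0 1 1 1] 1 2 by (simp add: ex)
  have 5: "l 6 = 3 * l 10 - 5 * l 11" using *[of 0 1 1 \<i>] 1 by (simp add: ex)
  have 6: "3 * l 2 - 5 * l 3 = l 7" using *[of 1 0 \<i> 1] 2 by (simp add: ex)
  show "l 2 = 2 * l 7" "l 3 = l 7" "l 4 = l 8" "l 5 = l 9" "l 6 = l 11" "l 10 = 2 * l 11"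
    using 1 2 3 4 5 6 by linarith+
qed


lemma cubic_nonlinearity_eq_gradient_form:
  assumes "l 2 = 2 * l 7" "l 3 = l 7" "l 4 = l 8" "l 5 = l 9" "l 6 = l 11" "l 10 = 2 * l 11"
  shows "cubic_nonlinearity l = gradient_form (l 1 / 2) (l 9 / 2) (l 12 / 2) (l 7) (l 8 - l 9) (l 11)"
proof (intro ext)
  fix z1 z2
  show "cubic_nonlinearity l z1 z2 = gradient_form (l 1 / 2) (l 9 / 2) (l 12 / 2) (l 7) (l 8 - l 9) (l 11) z1 z2"
    unfolding cubic_nonlinearity_def gradient_form_def Let_def vec_eq_iff forall_2 vector_2 assms
    by (simp add: complex_eq_iff cmod_power2 Re_power2 Im_power2 cross_dens_def)
       (simp add: algebra_simps power2_eq_square)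
qed

text \<open>Let K be the matrix of a, b, c. By \<open>id\<close>, K N is a gradient. With the
  Cholesky factorization K = M^T M, the transformed nonlinearity M N(M^{-1} w) equals M^{-T} (K
  N)(M^{-1} w), which is the gradient of the potential composed with M^{-1}.\<close>

lemma gradient_system_standard_pos:
  fixes lam :: "nat \<Rightarrow> real" and T :: "complex^2 \<Rightarrow> complex^2 \<Rightarrow> complex^2 \<Rightarrow> complex^2 \<Rightarrow> real"
  assumes a: "a > 0" and abc: "b\<^sup>2 - a * c < 0" and T: "quadlinear T"
    and id: "\<And>z w. diagonal_derivative T z w
      = 2 * Re (cnj (a *\<^sub>R w $ 1 + b *\<^sub>R w $ 2) * cubic_nonlinearity lam (z $ 1) (z $ 2) $ 1
        + cnj (b *\<^sub>R w $ 1 + c *\<^sub>R w $ 2) * cubic_nonlinearity lam (z $ 1) (z $ 2) $ 2)"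
  shows "\<exists>F\<in>standard_nonlinearities. conjugate_to (cubic_nonlinearity lam) F"
proof -
  let ?N = "cubic_nonlinearity lam"
  \<comment> \<open>The coefficients of K N; an index shift by 6 leads from the first equation to
    the second.\<close>
  define l where "l k = (if k \<le> 6 then a * lam k + b * lam (k + 6) else b * lam (k - 6) + c * lam k)" for k
  have H: "cubic_nonlinearity l z1 z2 $ 1 = a *\<^sub>R ?N z1 z2 $ 1 + b *\<^sub>R ?N z1 z2 $ 2"
    "cubic_nonlinearity l z1 z2 $ 2 = b *\<^sub>R ?N z1 z2 $ 1 + c *\<^sub>R ?N z1 z2 $ 2" for z1 z2
    by (simp_all add: cubic_nonlinearity_def l_def algebra_simps)
  define S where "S = (\<lambda>(w :: complex^2) (z :: complex^2). 2 * Re (cnj (w $ 1) * cubic_nonlinearity l (z $ 1) (z $ 2) $ 1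
      + cnj (w $ 2) * cubic_nonlinearity l (z $ 1) (z $ 2) $ 2))"
  have "diagonal_derivative T z w = S w z" for z w
    unfolding id S_def H by (simp add: algebra_simps)
  from quadlinear_difference_identity[OF T, of S, OF this]
  have "l 2 = 2 * l 7" "l 3 = l 7" "l 4 = l 8" "l 5 = l 9" "l 6 = l 11" "l 10 = 2 * l 11"
    using cubic_gradient_relations[of l] unfolding S_def by blast+
  from cubic_nonlinearity_eq_gradient_form[OF this] obtain A B D E F J
    where G: "cubic_nonlinearity l = gradient_form A B D E F J" by blast
  \<comment> \<open>Entries of the Cholesky factor M with rows (\<alpha>,\<beta>) and (0,\<delta>);
    \<delta>^2 is det K / a.\<close>
  define \<alpha> \<beta> \<delta> where "\<alpha> = sqrt a" and "\<beta> = b / sqrt a" and "\<delta> = sqrt ((a * c - b\<^sup>2) / a)"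
  have \<alpha>: "\<alpha> > 0" "\<alpha>\<^sup>2 = a" using a by (auto simp: \<alpha>_def)
  have \<beta>: "\<beta> * \<alpha> = b" using a by (simp add: \<beta>_def \<alpha>_def)
  have \<delta>: "\<delta> > 0" "\<delta>\<^sup>2 = (a * c - b\<^sup>2) / a" using a abc by (auto simp: \<delta>_def)
  have cc: "\<delta>\<^sup>2 = c - \<beta>\<^sup>2"
  proof -
    have "\<beta>\<^sup>2 = b\<^sup>2 / a" using a by (simp add: \<beta>_def power_divide)
    thus ?thesis using \<delta>(2) a by (simp add: diff_divide_distrib)
  qed
  \<comment> \<open>The substitution in this congruence is M^{-1}.\<close>
  obtain A' B' D' E' F' J' where C:
    "\<And>z1 z2. gradient_form A' B' D' E' F' J' z1 z2 $ 1
      = (1 / \<alpha>) *\<^sub>R gradient_form A B D E F J ((1 / \<alpha>) *\<^sub>R z1 + (- \<beta> / (\<alpha> * \<delta>)) *\<^sub>R z2) ((1 / \<delta>) *\<^sub>R z2) $ 1"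
    "\<And>z1 z2. gradient_form A' B' D' E' F' J' z1 z2 $ 2
      = (- \<beta> / (\<alpha> * \<delta>)) *\<^sub>R gradient_form A B D E F J ((1 / \<alpha>) *\<^sub>R z1 + (- \<beta> / (\<alpha> * \<delta>)) *\<^sub>R z2) ((1 / \<delta>) *\<^sub>R z2) $ 1
       + (1 / \<delta>) *\<^sub>R gradient_form A B D E F J ((1 / \<alpha>) *\<^sub>R z1 + (- \<beta> / (\<alpha> * \<delta>)) *\<^sub>R z2) ((1 / \<delta>) *\<^sub>R z2) $ 2"
    by (rule gradient_form_congruence[where ?p1.0="1 / \<alpha>" and t="- \<beta> / (\<alpha> * \<delta>)" and ?p2.0="1 / \<delta>"
          and A=A and B=B and D=D and E=E and F=F and J=J]) (rule that)
  have "conjugate_to ?N (gradient_form A' B' D' E' F' J')"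
  proof (rule conjugate_toI[where a=\<alpha> and b=\<beta> and c=0 and d=\<delta>])
    show "\<alpha> * \<delta> - \<beta> * 0 \<noteq> 0" using \<alpha> \<delta> by simp
    fix z1 z2 :: complex
    let ?w1 = "\<alpha> *\<^sub>R z1 + \<beta> *\<^sub>R z2" and ?w2 = "0 *\<^sub>R z1 + \<delta> *\<^sub>R z2"
    have w: "(1 / \<alpha>) *\<^sub>R ?w1 + (- \<beta> / (\<alpha> * \<delta>)) *\<^sub>R ?w2 = z1" "(1 / \<delta>) *\<^sub>R ?w2 = z2"
      using \<alpha>(1) \<delta>(1) by (simp_all add: scaleR_add_right)
    have c1: "(1 / \<alpha>) * a = \<alpha>" "(1 / \<alpha>) * b = \<beta>"
      using \<alpha> \<beta>[symmetric] by (auto simp: power2_eq_square)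
    have c2: "(- \<beta> / (\<alpha> * \<delta>)) * a + (1 / \<delta>) * b = 0"
      unfolding \<alpha>(2)[symmetric] \<beta>[symmetric] using \<alpha>(1) \<delta>(1) by (simp add: field_simps power2_eq_square)
    have c3: "(- \<beta> / (\<alpha> * \<delta>)) * b + (1 / \<delta>) * c = \<delta>"
    proof -
      have "(- \<beta> / (\<alpha> * \<delta>)) * b + (1 / \<delta>) * c = (c - \<beta>\<^sup>2) / \<delta>"
        unfolding \<beta>[symmetric] using \<alpha>(1) \<delta>(1) by (simp add: field_simps power2_eq_square)
      thus ?thesis unfolding cc[symmetric] using \<delta>(1) by (simp add: power2_eq_square)
    qed
    show "gradient_form A' B' D' E' F' J' ?w1 ?w2 $ 1 = \<alpha> *\<^sub>R ?N z1 z2 $ 1 + \<beta> *\<^sub>R ?N z1 z2 $ 2"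
      unfolding C(1) unfolding w G[symmetric] H unfolding scaleR_add_right scaleR_scaleR c1 ..
    have "gradient_form A' B' D' E' F' J' ?w1 ?w2 $ 2
      = ((- \<beta> / (\<alpha> * \<delta>)) * a + (1 / \<delta>) * b) *\<^sub>R ?N z1 z2 $ 1 + ((- \<beta> / (\<alpha> * \<delta>)) * b + (1 / \<delta>) * c) *\<^sub>R ?N z1 z2 $ 2"
      unfolding C(2) unfolding w G[symmetric] H unfolding scaleR_add_right scaleR_scaleR scaleR_add_left by simp
    thus "gradient_form A' B' D' E' F' J' ?w1 ?w2 $ 2 = 0 *\<^sub>R ?N z1 z2 $ 1 + \<delta> *\<^sub>R ?N z1 z2 $ 2"
      unfolding c2 c3 .
  qed
  moreover obtain F0 where "F0 \<in> standard_nonlinearities" "conjugate_to (gradient_form A' B' D' E' F' J') F0"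
    using qfn_standard unfolding gradient_form_eq_qfn by blast
  ultimately show ?thesis using conjugate_to_trans by blast
qed

theorem gradient_system_standard:
  fixes lam :: "nat \<Rightarrow> real" and T :: "complex^2 \<Rightarrow> complex^2 \<Rightarrow> complex^2 \<Rightarrow> complex^2 \<Rightarrow> real"
  assumes abc: "b\<^sup>2 - a * c < 0" and T: "quadlinear T"
    and id: "\<And>z w. diagonal_derivative T z w
      = 2 * Re (cnj (a *\<^sub>R w $ 1 + b *\<^sub>R w $ 2) * cubic_nonlinearity lam (z $ 1) (z $ 2) $ 1
        + cnj (b *\<^sub>R w $ 1 + c *\<^sub>R w $ 2) * cubic_nonlinearity lam (z $ 1) (z $ 2) $ 2)"
  shows "\<exists>F\<in>standard_nonlinearities. conjugate_to (cubic_nonlinearity lam) F"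
proof -
  have "a \<noteq> 0" using abc by auto
  then consider "a > 0" | "a < 0" by linarith
  thus ?thesis
  proof cases
    case 1
    thus ?thesis using abc T id by (rule gradient_system_standard_pos)
  next
    case 2
    show ?thesis
    \<comment> \<open>A negative definite K is replaced by -K and T by -T; the nonlinearity stays
      the same.\<close>
    proof (rule gradient_system_standard_pos[of "- a" "- b" "- c" "\<lambda>a b c d. - T a b c d"])
      show "quadlinear (\<lambda>a b c d. - T a b c d)" using T unfolding quadlinear_def by (auto intro: linear_compose_neg)
      show "diagonal_derivative (\<lambda>a b c d. - T a b c d) z w
        = 2 * Re (cnj (- a *\<^sub>R w $ 1 + - b *\<^sub>R w $ 2) * cubic_nonlinearity lam (z $ 1) (z $ 2) $ 1
          + cnj (- b *\<^sub>R w $ 1 + - c *\<^sub>R w $ 2) * cubic_nonlinearity lam (z $ 1) (z $ 2) $ 2)" for z w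
      proof -
        have "diagonal_derivative (\<lambda>a b c d. - T a b c d) z w = - diagonal_derivative T z w"
          by (simp add: diagonal_derivative_def)
        thus ?thesis unfolding id by (simp add: algebra_simps)
      qed
    qed (use 2 abc in auto)
  qed
qed

subsection \<open>Even quartic polynomials\<close>

text \<open>A bound and measurability accompany bilinearity, so that densities built from solutions
  can be integrated directly. Measurability is stated for maps on \<open>real^3\<close> only, since
  a definition cannot quantify over domain types.\<close>

definition form2 :: "(complex^2 \<Rightarrow> complex^2 \<Rightarrow> real) \<Rightarrow> bool" where
  "form2 B \<longleftrightarrow> (\<forall>b. linear (\<lambda>a. B a b)) \<and> (\<forall>a. linear (\<lambda>b. B a b)) \<and>
     (\<exists>K. \<forall>a b. \<bar>B a b\<bar> \<le> K * (norm a * norm b)) \<and>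
     (\<forall>f g :: real^3 \<Rightarrow> complex^2. f \<in> borel_measurable borel \<longrightarrow> g \<in> borel_measurable borel \<longrightarrow>
        (\<lambda>x. B (f x) (g x)) \<in> borel_measurable borel)"

definition form4 :: "(complex^2 \<Rightarrow> complex^2 \<Rightarrow> complex^2 \<Rightarrow> complex^2 \<Rightarrow> real) \<Rightarrow> bool" where
  "form4 T \<longleftrightarrow> quadlinear T \<and>
     (\<exists>K. \<forall>a b c d. \<bar>T a b c d\<bar> \<le> K * (norm a * norm b * norm c * norm d)) \<and>
     (\<forall>f g h k :: real^3 \<Rightarrow> complex^2. f \<in> borel_measurable borel \<longrightarrow> g \<in> borel_measurable borel \<longrightarrow>
        h \<in> borel_measurable borel \<longrightarrow> k \<in> borel_measurable borel \<longrightarrow>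
        (\<lambda>x. T (f x) (g x) (h x) (k x)) \<in> borel_measurable borel)"

lemma form2_add:
  assumes "form2 B" "form2 B'"
  shows "form2 (\<lambda>a b. B a b + B' a b)"
proof -
  obtain K K' where K: "\<And>a b. \<bar>B a b\<bar> \<le> K * (norm a * norm b)" "\<And>a b. \<bar>B' a b\<bar> \<le> K' * (norm a * norm b)"
    using assms unfolding form2_def by blast
  have "\<bar>B a b + B' a b\<bar> \<le> (K + K') * (norm a * norm b)" for a b
    using K[of a b] by (simp add: algebra_simps)
  thus ?thesis using assms unfolding form2_def
    by (auto intro!: linear_compose_add borel_measurable_add)
qed

lemma form4_add:
  assumes "form4 B" "form4 B'"
  shows "form4 (\<lambda>a b c d. B a b c d + B' a b c d)"
proof -
  obtain K K' where K: "\<And>a b c d. \<bar>B a b c d\<bar> \<le> K * (norm a * norm b * norm c * norm d)"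
    "\<And>a b c d. \<bar>B' a b c d\<bar> \<le> K' * (norm a * norm b * norm c * norm d)"
    using assms unfolding form4_def by blast
  have "\<bar>B a b c d + B' a b c d\<bar> \<le> (K + K') * (norm a * norm b * norm c * norm d)" for a b c d
    using K[of a b c d] by (simp add: algebra_simps)
  thus ?thesis using assms unfolding form4_def quadlinear_def
    by (auto intro!: linear_compose_add borel_measurable_add)
qed

lemma form_zero: "form2 (\<lambda>a b. 0)" "form4 (\<lambda>a b c d. 0)"
  unfolding form2_def form4_def quadlinear_def by (auto simp: linear_zero intro!: exI[of _ 0])

text \<open>The letters from which monomials are built: components and their conjugates. Norm at
  most one makes the modulus of its coefficient a bound for a whole monomial.\<close>

definition contractive_functional :: "(complex^2 \<Rightarrow> complex) \<Rightarrow> bool" where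
  "contractive_functional l \<longleftrightarrow> linear l \<and> (\<forall>z. cmod (l z) \<le> norm z) \<and>
     (\<forall>f :: real^3 \<Rightarrow> complex^2. f \<in> borel_measurable borel \<longrightarrow> (\<lambda>x. l (f x)) \<in> borel_measurable borel)"

lemma contractive_functionalI:
  assumes l: "linear l" and b: "\<And>z. cmod (l z) \<le> norm z"
  shows "contractive_functional l"
proof -
  have "continuous_on UNIV l" using l by (simp add: linear_continuous_on linear_conv_bounded_linear)
  hence "l \<in> borel_measurable borel" by (rule borel_measurable_continuous_onI)
  thus ?thesis unfolding contractive_functional_def using l b by (auto intro: measurable_compose)
qed

lemma contractive_functional_components:
  "contractive_functional (\<lambda>z. z $ i)" "contractive_functional (\<lambda>z. cnj (z $ i))"
  by (auto intro!: contractive_functionalI linearI Finite_Cartesian_Product.norm_nth_le)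

lemma form2_product:
  assumes a: "contractive_functional a" and b: "contractive_functional b"
  shows "form2 (\<lambda>z1 z2. Re (C * (a z1 * b z2)))"
  unfolding form2_def
proof (intro conjI allI impI exI)
  have l: "linear a" "linear b" using a b by (auto simp: contractive_functional_def)
  show "linear (\<lambda>z1. Re (C * (a z1 * b z2)))" "linear (\<lambda>z2. Re (C * (a z1 * b z2)))" for z1 z2
    by (auto intro!: linearI simp: linear_add[OF l(1)] linear_add[OF l(2)] linear_scale[OF l(1)] linear_scale[OF l(2)] algebra_simps)
  show "\<bar>Re (C * (a z1 * b z2))\<bar> \<le> cmod C * (norm z1 * norm z2)" for z1 z2
  proof -
    have "\<bar>Re (C * (a z1 * b z2))\<bar> \<le> cmod (C * (a z1 * b z2))" by (rule abs_Re_le_cmod)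
    also have "\<dots> \<le> cmod C * (norm z1 * norm z2)"
      unfolding norm_mult using a b by (intro mult_left_mono mult_mono) (auto simp: contractive_functional_def)
    finally show ?thesis .
  qed
  fix f g :: "real^3 \<Rightarrow> complex^2" assume "f \<in> borel_measurable borel" "g \<in> borel_measurable borel"
  hence [measurable]: "(\<lambda>x. a (f x)) \<in> borel_measurable borel" "(\<lambda>x. b (g x)) \<in> borel_measurable borel"
    using a b by (auto simp: contractive_functional_def)
  show "(\<lambda>x. Re (C * (a (f x) * b (g x)))) \<in> borel_measurable borel" by measurable
qed

lemma form4_product:
  assumes a: "contractive_functional a" and b: "contractive_functional b"
    and c: "contractive_functional c" and d: "contractive_functional d"
  shows "form4 (\<lambda>z1 z2 z3 z4. Re (C * (a z1 * b z2 * c z3 * d z4)))"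
  unfolding form4_def quadlinear_def
proof (intro conjI allI impI exI)
  have l: "linear a" "linear b" "linear c" "linear d" using a b c d by (auto simp: contractive_functional_def)
  note ls = l[THEN linear_add] l[THEN linear_scale]
  show "linear (\<lambda>z1. Re (C * (a z1 * b z2 * c z3 * d z4)))" "linear (\<lambda>z2. Re (C * (a z1 * b z2 * c z3 * d z4)))"
    "linear (\<lambda>z3. Re (C * (a z1 * b z2 * c z3 * d z4)))" "linear (\<lambda>z4. Re (C * (a z1 * b z2 * c z3 * d z4)))" for z1 z2 z3 z4
    by (auto intro!: linearI simp: ls algebra_simps)
  show "\<bar>Re (C * (a z1 * b z2 * c z3 * d z4))\<bar> \<le> cmod C * (norm z1 * norm z2 * norm z3 * norm z4)" for z1 z2 z3 z4
  proof -
    have "\<bar>Re (C * (a z1 * b z2 * c z3 * d z4))\<bar> \<le> cmod (C * (a z1 * b z2 * c z3 * d z4))" by (rule abs_Re_le_cmod)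
    also have "\<dots> \<le> cmod C * (norm z1 * norm z2 * norm z3 * norm z4)"
      unfolding norm_mult using a b c d
      by (intro mult_left_mono mult_mono mult_nonneg_nonneg) (auto simp: contractive_functional_def)
    finally show ?thesis .
  qed
  fix f g h k :: "real^3 \<Rightarrow> complex^2"
  assume "f \<in> borel_measurable borel" "g \<in> borel_measurable borel" "h \<in> borel_measurable borel" "k \<in> borel_measurable borel"
  hence [measurable]: "(\<lambda>x. a (f x)) \<in> borel_measurable borel" "(\<lambda>x. b (g x)) \<in> borel_measurable borel"
    "(\<lambda>x. c (h x)) \<in> borel_measurable borel" "(\<lambda>x. d (k x)) \<in> borel_measurable borel"
    using a b c d by (auto simp: contractive_functional_def)
  show "(\<lambda>x. Re (C * (a (f x) * b (g x) * c (h x) * d (k x)))) \<in> borel_measurable borel" by measurable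
qed

definition even_quartic :: "(complex^2 \<Rightarrow> real) \<Rightarrow> bool" where
  "even_quartic f \<longleftrightarrow> (\<exists>c B T. form2 B \<and> form4 T \<and> (\<forall>z. f z = c + B z z + T z z z z))"

lemma even_quartic_add: "even_quartic f \<Longrightarrow> even_quartic g \<Longrightarrow> even_quartic (\<lambda>z. f z + g z)"
  unfolding even_quartic_def
proof (elim exE conjE)
  fix c c' B B' T T'
  assume *: "form2 B" "form4 T" "\<forall>z. f z = c + B z z + T z z z z"
    "form2 B'" "form4 T'" "\<forall>z. g z = c' + B' z z + T' z z z z"
  show "\<exists>c B T. form2 B \<and> form4 T \<and> (\<forall>z. f z + g z = c + B z z + T z z z z)"
    by (rule exI[of _ "c + c'"], rule exI[of _ "\<lambda>a b. B a b + B' a b"],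
        rule exI[of _ "\<lambda>a b c d. T a b c d + T' a b c d"])
       (use * form2_add form4_add in auto)
qed

lemma even_quartic_const: "even_quartic (\<lambda>z. c)"
  unfolding even_quartic_def using form_zero by (intro exI conjI) auto

lemma even_quartic_sum: "(\<And>i. i \<in> A \<Longrightarrow> even_quartic (f i)) \<Longrightarrow> even_quartic (\<lambda>z. \<Sum>i\<in>A. f i z)"
  by (induction A rule: infinite_finite_induct) (auto intro: even_quartic_add even_quartic_const)

lemma even_quartic_monomial:
  assumes "\<And>l. l \<in> set ls \<Longrightarrow> contractive_functional l" "even (length ls)" "length ls \<le> 4"
  shows "even_quartic (\<lambda>z. Re (C * prod_list (map (\<lambda>l. l z) ls)))"
proof -
  consider "ls = []" | a b where "ls = [a, b]" | a b c d where "ls = [a, b, c, d]"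
  proof (cases ls rule: list.exhaust)
    case (Cons a ls1)
    show ?thesis
    proof (cases ls1)
      case (Cons b ls2)
      note 1 = \<open>ls = a # ls1\<close> Cons
      show ?thesis
      proof (cases ls2)
        case (Cons c ls3)
        show ?thesis
        proof (cases ls3)
          case Cons2: (Cons d ls4)
          have "ls4 = []" using assms(2,3) 1 Cons Cons2 by auto
          thus ?thesis using that(3)[of a b c d] 1 Cons Cons2 by simp
        qed (use assms(2) 1 Cons in simp)
      qed (use 1 that(2)[of a b] in simp)
    qed (use assms(2) \<open>ls = a # ls1\<close> in simp)
  qed (use that(1) in simp)
  thus ?thesis
  proof cases
    case 1
    thus ?thesis using even_quartic_const by simp
  next
    case (2 a b)
    have "form2 (\<lambda>z1 z2. Re (C * (a z1 * b z2)))" using assms(1) 2 by (intro form2_product) auto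
    thus ?thesis unfolding even_quartic_def 2 using form_zero(2) by (intro exI[of _ 0] exI conjI) auto
  next
    case (3 a b c d)
    have "form4 (\<lambda>z1 z2 z3 z4. Re (C * (a z1 * b z2 * c z3 * d z4)))" using assms(1) 3 by (intro form4_product) auto
    thus ?thesis unfolding even_quartic_def 3 using form_zero(1)
      by (intro exI[of _ 0] exI[of _ "\<lambda>a b. 0"] exI[of _ "\<lambda>z1 z2 z3 z4. Re (C * (a z1 * b z2 * c z3 * d z4))"] conjI)
         (auto simp: mult.assoc)
  qed
qed

text \<open>Averaging \<open>g\<close> over z and -z removes the monomials of odd total degree
  without appeal to uniqueness of coefficients; the others are products of 0, 2 or 4
  letters.\<close>

lemma even_real_quartic_polynomial:
  assumes g: "real_quartic_polynomial g" and even_g: "\<And>z1 z2. g (- z1) (- z2) = g z1 z2"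
  shows "even_quartic (\<lambda>z. g (z $ 1) (z $ 2))"
proof -
  obtain C where C: "\<And>z1 z2. complex_of_real (g z1 z2) =
          (\<Sum>i\<le>4. \<Sum>j\<le>4 - i. \<Sum>k\<le>4 - i - j. \<Sum>l\<le>4 - i - j - k.
             C i j k l * z1 ^ i * cnj z1 ^ j * z2 ^ k * cnj z2 ^ l)"
    using g unfolding real_quartic_polynomial_def by blast
  define t where "t i j k l z = Re (C i j k l * (z $ 1) ^ i * cnj (z $ 1) ^ j * (z $ 2) ^ k * cnj (z $ 2) ^ l)"
    for i j k l and z :: "complex^2"
  have gt: "g (z $ 1) (z $ 2) = (\<Sum>i\<le>4. \<Sum>j\<le>4 - i. \<Sum>k\<le>4 - i - j. \<Sum>l\<le>4 - i - j - k. t i j k l z)" for z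
    using arg_cong[OF C[of "z $ 1" "z $ 2"], of Re] by (simp add: t_def)
  have tm: "t i j k l (- z) = (-1) ^ (i + j + k + l) * t i j k l z" for i j k l z
  proof -
    have "C i j k l * ((- z) $ 1) ^ i * cnj ((- z) $ 1) ^ j * ((- z) $ 2) ^ k * cnj ((- z) $ 2) ^ l
      = complex_of_real ((-1) ^ (i + j + k + l)) * (C i j k l * (z $ 1) ^ i * cnj (z $ 1) ^ j * (z $ 2) ^ k * cnj (z $ 2) ^ l)"
      by (simp add: power_minus[of "z $ _"] power_minus[of "cnj (z $ _)"] power_add mult_ac)
    moreover have "Re (complex_of_real r * X) = r * Re X" for r X by simp
    ultimately show ?thesis unfolding t_def by (simp only:)
  qed
  define t' where "t' i j k l z = (if even (i + j + k + l) then t i j k l z else 0)" for i j k l and z :: "complex^2"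
  have tt: "t i j k l z + t i j k l (- z) = 2 * t' i j k l z" for i j k l z
    by (simp add: tm t'_def)
  have "2 * g (z $ 1) (z $ 2) = g (z $ 1) (z $ 2) + g ((- z) $ 1) ((- z) $ 2)" for z :: "complex^2"
    by (simp add: even_g)
  also have "g (z $ 1) (z $ 2) + g ((- z) $ 1) ((- z) $ 2) = 2 * (\<Sum>i\<le>4. \<Sum>j\<le>4 - i. \<Sum>k\<le>4 - i - j. \<Sum>l\<le>4 - i - j - k. t' i j k l z)" for z
    unfolding gt by (simp add: tt sum_distrib_left flip: sum.distrib)
  finally have "g (z $ 1) (z $ 2) = (\<Sum>i\<le>4. \<Sum>j\<le>4 - i. \<Sum>k\<le>4 - i - j. \<Sum>l\<le>4 - i - j - k. t' i j k l z)" for z by simp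
  moreover have "even_quartic (\<lambda>z. \<Sum>i\<le>4. \<Sum>j\<le>4 - i. \<Sum>k\<le>4 - i - j. \<Sum>l\<le>4 - i - j - k. t' i j k l z)"
  proof (intro even_quartic_sum)
    fix i j k l :: nat assume ijkl: "i \<in> {..4}" "j \<in> {..4 - i}" "k \<in> {..4 - i - j}" "l \<in> {..4 - i - j - k}"
    show "even_quartic (t' i j k l)"
    proof (cases "even (i + j + k + l)")
      case True
      let ?ls = "replicate i (\<lambda>z::complex^2. z $ 1) @ replicate j (\<lambda>z. cnj (z $ 1)) @ replicate k (\<lambda>z. z $ 2) @ replicate l (\<lambda>z. cnj (z $ 2))"
      have "even_quartic (\<lambda>z. Re (C i j k l * prod_list (map (\<lambda>l. l z) ?ls)))"
        using True ijkl by (intro even_quartic_monomial) (auto simp: contractive_functional_components)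
      moreover have "(\<lambda>z. Re (C i j k l * prod_list (map (\<lambda>l. l z) ?ls))) = t' i j k l"
        using True by (simp add: fun_eq_iff t'_def t_def prod_list_replicate mult.assoc)
      ultimately show ?thesis by simp
    next
      case False
      hence "t' i j k l = (\<lambda>_. 0)" by (simp add: fun_eq_iff t'_def)
      thus ?thesis using even_quartic_const by simp
    qed
  qed
  ultimately show ?thesis by simp
qed

subsection \<open>Second moments of Gaussians\<close>

text \<open>The variance of the standard normal distribution after the substitution y = s t.\<close>

lemma gaussian_second_moment_1:
  fixes q :: real
  assumes q: "q > 0"
  shows "integrable lborel (\<lambda>t. t\<^sup>2 * exp (- q * t\<^sup>2))" "(\<integral>t. t\<^sup>2 * exp (- q * t\<^sup>2) \<partial>lborel) = sqrt (pi / q) * (1 / (2 * q))"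
proof -
  define s where "s = sqrt (2 * q)"
  have s: "s > 0" "s\<^sup>2 = 2 * q" using q by (auto simp: s_def)
  have hb: "has_bochner_integral lborel (\<lambda>x. std_normal_density x * x\<^sup>2) 1"
    using std_normal_moment_even[of 1] by (simp add: fact_2)
  have e: "std_normal_density (s * t) * (s * t)\<^sup>2 = (2 * q / sqrt (2 * pi)) * (t\<^sup>2 * exp (- q * t\<^sup>2))" for t
    using s by (simp add: std_normal_density_def power_mult_distrib)
  have "has_bochner_integral lborel (\<lambda>t. std_normal_density (0 + s * t) * (0 + s * t)\<^sup>2) (1 /\<^sub>R \<bar>s\<bar>)"
    using lborel_has_bochner_integral_real_affine_iff[of s "\<lambda>x. std_normal_density x * x\<^sup>2" 1 0] hb s by simp
  hence "has_bochner_integral lborel (\<lambda>t. (2 * q / sqrt (2 * pi)) * (t\<^sup>2 * exp (- q * t\<^sup>2))) (1 / s)"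
    unfolding add_0_left e using s by (simp add: divide_inverse)
  from has_bochner_integral_mult_right[OF this, of "sqrt (2 * pi) / (2 * q)"]
  have *: "has_bochner_integral lborel (\<lambda>t. t\<^sup>2 * exp (- q * t\<^sup>2)) (sqrt (2 * pi) / (2 * q) * (1 / s))"
    using q by (simp add: mult.assoc[symmetric])
  have "sqrt (2 * pi) / (2 * q) * (1 / s) = sqrt (pi / q) * (1 / (2 * q))"
    using q by (simp add: s_def real_sqrt_divide real_sqrt_mult)
  thus "integrable lborel (\<lambda>t. t\<^sup>2 * exp (- q * t\<^sup>2))" "(\<integral>t. t\<^sup>2 * exp (- q * t\<^sup>2) \<partial>lborel) = sqrt (pi / q) * (1 / (2 * q))"
    using * by (auto simp: has_bochner_integral_iff)
qed

lemma gaussian_second_moment: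
  fixes q :: real
  assumes q: "q > 0"
  shows "integrable lborel (\<lambda>x::'a::euclidean_space. (norm x)\<^sup>2 * exp (- q * (norm x)\<^sup>2))" (is ?int)
    and "(\<integral>x. (norm (x::'a))\<^sup>2 * exp (- q * (norm x)\<^sup>2) \<partial>lborel) = DIM('a) / (2 * q) * sqrt (pi / q) ^ DIM('a)" (is ?eq)
proof -
  \<comment> \<open>Coordinate \<open>b0\<close> carries the factor t^2 and the others plain
    Gaussians; |x|^2 arises by summing over \<open>b0\<close>.\<close>
  define f where "f b0 b t = (if b = b0 then t\<^sup>2 * exp (- q * t\<^sup>2) else exp (- q * t\<^sup>2))" for b0 b :: 'a and t :: real
  have g1: "integrable lborel (\<lambda>t::real. exp (- q * t\<^sup>2))" "(\<integral>t. exp (- q * (t::real)\<^sup>2) \<partial>lborel) = sqrt (pi / q)"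
    using gaussian_integral[OF q, where 'a=real] by auto
  have fi: "integrable lborel (f b0 b)" for b0 b
    unfolding f_def[abs_def] using gaussian_second_moment_1(1)[OF q] g1(1) by (cases "b = b0") auto
  have fI: "integral\<^sup>L lborel (f b0 b) = sqrt (pi / q) * (if b = b0 then 1 / (2 * q) else 1)" for b0 b
    unfolding f_def[abs_def] using gaussian_second_moment_1(2)[OF q] g1(2) by (cases "b = b0") auto
  have prod: "(\<Prod>b\<in>Basis. f b0 b (x \<bullet> b)) = (x \<bullet> b0)\<^sup>2 * exp (- q * (norm x)\<^sup>2)" if "b0 \<in> Basis" for b0 x
  proof -
    have "f b0 b (x \<bullet> b) = (if b = b0 then (x \<bullet> b)\<^sup>2 else 1) * exp (- q * (x \<bullet> b)\<^sup>2)" for b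
      by (simp add: f_def)
    hence "(\<Prod>b\<in>Basis. f b0 b (x \<bullet> b)) = (\<Prod>b\<in>Basis. if b = b0 then (x \<bullet> b)\<^sup>2 else 1) * (\<Prod>b\<in>Basis. exp (- q * (x \<bullet> b)\<^sup>2))"
      by (simp add: prod.distrib)
    also have "(\<Prod>b\<in>Basis. if b = b0 then (x \<bullet> b)\<^sup>2 else 1) = (x \<bullet> b0)\<^sup>2"
      using that by (simp add: prod.delta)
    also have "(\<Prod>b\<in>Basis. exp (- q * (x \<bullet> b)\<^sup>2)) = exp (- q * (norm x)\<^sup>2)"
      by (simp add: norm_sq_Basis[of x] exp_sum[symmetric] sum_distrib_left sum_negf[symmetric])
    finally show ?thesis .
  qed
  have i: "integrable lborel (\<lambda>x. (x \<bullet> b0)\<^sup>2 * exp (- q * (norm x)\<^sup>2))" if "b0 \<in> Basis" for b0 :: 'a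
    using integrable_lborel_prod[of "f b0", OF fi] unfolding prod[OF that] .
  have I: "(\<integral>x. (x \<bullet> b0)\<^sup>2 * exp (- q * (norm x)\<^sup>2) \<partial>lborel) = sqrt (pi / q) ^ DIM('a) * (1 / (2 * q))" if "b0 \<in> Basis" for b0 :: 'a
  proof -
    have "(\<integral>x. (x \<bullet> b0)\<^sup>2 * exp (- q * (norm x)\<^sup>2) \<partial>lborel) = (\<Prod>b\<in>Basis. sqrt (pi / q) * (if b = b0 then 1 / (2 * q) else 1))"
      using integral_lborel_prod[of "f b0", OF fi] unfolding prod[OF that] fI .
    also have "\<dots> = sqrt (pi / q) ^ DIM('a) * (1 / (2 * q))"
      using that by (simp add: prod.distrib prod.delta)
    finally show ?thesis .
  qed
  have e: "(norm x)\<^sup>2 * exp (- q * (norm x)\<^sup>2) = (\<Sum>b0\<in>Basis. (x \<bullet> b0)\<^sup>2 * exp (- q * (norm x)\<^sup>2))" for x :: 'a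
    by (simp add: norm_sq_Basis[of x] sum_distrib_right)
  show ?int unfolding e by (intro Bochner_Integration.integrable_sum i)
  show ?eq unfolding e using i I by (simp add: Bochner_Integration.integral_sum)
qed

section \<open>Gaussians as Fourier integrals\<close>

definition gaussian_transform :: "real \<Rightarrow> real^3 \<Rightarrow> complex" where
  "gaussian_transform \<alpha> \<xi> = complex_of_real (exp (- (norm \<xi>)\<^sup>2 / (4 * \<alpha>)) / sqrt (4 * pi * \<alpha>) ^ 3)"

lemma decays_gaussian:
  fixes q :: real
  assumes q: "q > 0"
  shows "decays n (\<lambda>\<xi>::'a::euclidean_space. complex_of_real (exp (- q * (norm \<xi>)\<^sup>2)))"
proof (rule decays_antimono[of "Suc n"])
  \<comment> \<open>From (1+x/N)^N \<le> e^x with x = q(1+|\<xi>|^2) and N = n+1; taking n+1 instead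
    of n keeps the divisor nonzero for n = 0.\<close>
  define C where "C = exp q * (real (Suc n) / q) ^ Suc n"
  show "decays (Suc n) (\<lambda>\<xi>::'a. complex_of_real (exp (- q * (norm \<xi>)\<^sup>2)))"
  proof (rule decaysI)
    show "continuous_on UNIV (\<lambda>\<xi>::'a. complex_of_real (exp (- q * (norm \<xi>)\<^sup>2)))" by (intro continuous_intros)
    fix \<xi> :: 'a
    define y where "y = 1 + (norm \<xi>)\<^sup>2"
    have y: "y > 0" by (simp add: y_def)
    have "(q * y / real (Suc n)) ^ Suc n \<le> (1 + q * y / real (Suc n)) ^ Suc n"
      using q y by (intro power_mono) auto
    also have "\<dots> \<le> exp (q * y)"
      using q y by (intro exp_ge_one_plus_x_over_n_power_n) (auto intro: order_trans[of _ 0])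
    finally have *: "(q * y / real (Suc n)) ^ Suc n \<le> exp (q * y)" .
    have "exp (- q * (norm \<xi>)\<^sup>2) = exp q / exp (q * y)"
      by (simp add: y_def algebra_simps flip: exp_diff)
    also have "\<dots> \<le> exp q / (q * y / real (Suc n)) ^ Suc n"
      using * q y by (intro divide_left_mono) (auto intro!: mult_pos_pos)
    also have "\<dots> = C * wt (Suc n) \<xi>"
      using q y by (simp add: C_def wt_def y_def[symmetric] power_divide power_mult_distrib divide_simps del: power_Suc)
    finally show "norm (complex_of_real (exp (- q * (norm \<xi>)\<^sup>2))) \<le> C * wt (Suc n) \<xi>" by simp
  qed
qed simp

lemma decays_gaussian_transform:
  assumes "\<alpha> > 0"
  shows "decays n (gaussian_transform \<alpha>)"
proof -
  have "decays n (\<lambda>\<xi>::real^3. complex_of_real (1 / sqrt (4 * pi * \<alpha>) ^ 3) * complex_of_real (exp (- (1 / (4 * \<alpha>)) * (norm \<xi>)\<^sup>2)))"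
    using assms by (intro decays_cmult decays_gaussian) auto
  thus ?thesis by (simp add: gaussian_transform_def[abs_def])
qed

lemma fint_gaussian_transform:
  assumes \<alpha>: "\<alpha> > 0"
  shows "fint (gaussian_transform \<alpha>) x = exp (- \<alpha> * (norm x)\<^sup>2)"
proof -
  have q: "1 / (4 * \<alpha>) > 0" using \<alpha> by simp
  have s: "sqrt (pi / (1 / (4 * \<alpha>))) = sqrt (4 * pi * \<alpha>)" by (simp add: mult_ac)
  have "fint (gaussian_transform \<alpha>) x
     = (\<integral>\<xi>. complex_of_real (1 / sqrt (4 * pi * \<alpha>) ^ 3) * (cis (\<xi> \<bullet> x) * exp (- (1 / (4 * \<alpha>)) * (norm \<xi>)\<^sup>2)) \<partial>lborel)"
    unfolding fint_def gaussian_transform_def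
    by (intro Bochner_Integration.integral_cong refl) (simp add: inner_commute[of x])
  also have "\<dots> = complex_of_real (1 / sqrt (4 * pi * \<alpha>) ^ 3) * (sqrt (4 * pi * \<alpha>) ^ 3 * exp (- (norm x)\<^sup>2 / (4 * (1 / (4 * \<alpha>)))))"
    unfolding integral_mult_right_zero gaussian_fourier(2)[OF q] s by simp
  also have "\<dots> = exp (- \<alpha> * (norm x)\<^sup>2)" using \<alpha> by (simp add: mult.commute)
  finally show ?thesis .
qed

text \<open>The left-hand side is $-\int \Delta(e^{-\alpha|x|^2})\,e^{-\beta|x|^2}\,dx$.\<close>

lemma gaussian_laplacian_pairing:
  assumes \<alpha>: "\<alpha> > 0" and \<beta>: "\<beta> > 0"
  shows "(\<integral>x. fint (\<lambda>\<xi>. (norm \<xi>)\<^sup>2 * gaussian_transform \<alpha> \<xi>) x * exp (- \<beta> * (norm x)\<^sup>2) \<partial>lborel)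
    = complex_of_real (6 * \<alpha> * \<beta> / (\<alpha> + \<beta>) * sqrt (pi / (\<alpha> + \<beta>)) ^ 3)"
proof -
  \<comment> \<open>The exponent of the product of the two Gaussians on the frequency side.\<close>
  define q where "q = 1 / (4 * \<alpha>) + 1 / (4 * \<beta>)"
  have q: "q > 0" using \<alpha> \<beta> by (simp add: q_def add_pos_pos)
  have qe: "q = (\<alpha> + \<beta>) / (4 * \<alpha> * \<beta>)" using \<alpha> \<beta> by (simp add: q_def field_simps)
  have i: "integrable lborel (\<lambda>\<xi>::real^3. (norm \<xi>)\<^sup>2 * gaussian_transform \<alpha> \<xi>)"
    by (rule decays_integrable[of 3]) (use decays_norm_sq_mult[OF decays_gaussian_transform[OF \<alpha>]] in auto)
  have "(\<integral>x. fint (\<lambda>\<xi>. (norm \<xi>)\<^sup>2 * gaussian_transform \<alpha> \<xi>) x * exp (- \<beta> * (norm x)\<^sup>2) \<partial>lborel)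
    = (\<integral>\<xi>. (norm \<xi>)\<^sup>2 * gaussian_transform \<alpha> \<xi> * (sqrt (pi / \<beta>) ^ DIM(real^3) * exp (- (norm \<xi>)\<^sup>2 / (4 * \<beta>))) \<partial>lborel)"
    by (rule fint_gaussian_pairing[OF i \<beta>])
  also have "\<dots> = (\<integral>\<xi>. complex_of_real ((sqrt (pi / \<beta>) ^ 3 / sqrt (4 * pi * \<alpha>) ^ 3) * ((norm (\<xi>::real^3))\<^sup>2 * exp (- q * (norm \<xi>)\<^sup>2))) \<partial>lborel)"
  proof (intro Bochner_Integration.integral_cong refl)
    fix \<xi> :: "real^3"
    have "exp (- q * (norm \<xi>)\<^sup>2) = exp (- (norm \<xi>)\<^sup>2 / (4 * \<alpha>)) * exp (- (norm \<xi>)\<^sup>2 / (4 * \<beta>))"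
      by (simp add: q_def algebra_simps flip: exp_add)
    thus "(norm \<xi>)\<^sup>2 * gaussian_transform \<alpha> \<xi> * (sqrt (pi / \<beta>) ^ DIM(real^3) * exp (- (norm \<xi>)\<^sup>2 / (4 * \<beta>)))
      = complex_of_real ((sqrt (pi / \<beta>) ^ 3 / sqrt (4 * pi * \<alpha>) ^ 3) * ((norm (\<xi>::real^3))\<^sup>2 * exp (- q * (norm \<xi>)\<^sup>2)))"
      by (simp add: gaussian_transform_def)
  qed
  also have "\<dots> = complex_of_real ((sqrt (pi / \<beta>) ^ 3 / sqrt (4 * pi * \<alpha>) ^ 3) * (\<integral>\<xi>. (norm (\<xi>::real^3))\<^sup>2 * exp (- q * (norm \<xi>)\<^sup>2) \<partial>lborel))"
    unfolding integral_complex_of_real integral_mult_right_zero ..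
  also have "(sqrt (pi / \<beta>) ^ 3 / sqrt (4 * pi * \<alpha>) ^ 3) * (\<integral>\<xi>. (norm (\<xi>::real^3))\<^sup>2 * exp (- q * (norm \<xi>)\<^sup>2) \<partial>lborel)
     = (3 / (2 * q)) * (sqrt (pi / \<beta>) / sqrt (4 * pi * \<alpha>) * sqrt (pi / q)) ^ 3"
    using gaussian_second_moment(2)[OF q, where 'a="real^3"] by (simp add: power_mult_distrib power_divide mult_ac)
  also have "sqrt (pi / \<beta>) / sqrt (4 * pi * \<alpha>) * sqrt (pi / q) = sqrt (pi / \<beta> / (4 * pi * \<alpha>) * (pi / q))"
    by (simp only: real_sqrt_divide real_sqrt_mult)
  also have "pi / \<beta> / (4 * pi * \<alpha>) * (pi / q) = pi / (\<alpha> + \<beta>)"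
    unfolding qe using \<alpha> \<beta> by (simp add: field_simps)
  also have "3 / (2 * q) = 6 * \<alpha> * \<beta> / (\<alpha> + \<beta>)"
    unfolding qe using \<alpha> \<beta> by (simp add: field_simps)
  finally show ?thesis .
qed

subsection \<open>The time derivative of the energy\<close>

text \<open>Polymorphic because it is applied to gradients in \<open>complex^3\<close> and, after
  integration by parts, to values in \<open>complex\<close>.\<close>

definition kinetic_form :: "real \<Rightarrow> real \<Rightarrow> real \<Rightarrow> 'b::real_inner^2 \<Rightarrow> 'b^2 \<Rightarrow> real" where
  "kinetic_form a b c p q = a * (p $ 1 \<bullet> q $ 1) + b * (p $ 1 \<bullet> q $ 2 + p $ 2 \<bullet> q $ 1) + c * (p $ 2 \<bullet> q $ 2)"

lemma kinetic_form_linear: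
  "kinetic_form a b c p (q + q') = kinetic_form a b c p q + kinetic_form a b c p q'"
  "kinetic_form a b c (p + p') q = kinetic_form a b c p q + kinetic_form a b c p' q"
  "kinetic_form a b c p (r *\<^sub>R q) = r * kinetic_form a b c p q"
  "kinetic_form a b c (r *\<^sub>R p) q = r * kinetic_form a b c p q"
  by (simp_all add: kinetic_form_def inner_add_right inner_add_left algebra_simps)

lemma kinetic_form_commute: "kinetic_form a b c p q = kinetic_form a b c q p"
  by (simp add: kinetic_form_def inner_commute add.commute)

lemma kinetic_form_bound:
  "\<bar>kinetic_form a b c p q\<bar> \<le> (\<bar>a\<bar> + 2 * \<bar>b\<bar> + \<bar>c\<bar>) * (norm p * norm q)"
proof -
  have i: "\<bar>p $ i \<bullet> q $ j\<bar> \<le> norm p * norm q" for i j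
    using Cauchy_Schwarz_ineq2[of "p $ i" "q $ j"]
      mult_mono[OF Finite_Cartesian_Product.norm_nth_le[of p i] Finite_Cartesian_Product.norm_nth_le[of q j]] by simp
  have "\<bar>kinetic_form a b c p q\<bar> \<le> \<bar>a\<bar> * \<bar>p $ 1 \<bullet> q $ 1\<bar> + \<bar>b\<bar> * (\<bar>p $ 1 \<bullet> q $ 2\<bar> + \<bar>p $ 2 \<bullet> q $ 1\<bar>) + \<bar>c\<bar> * \<bar>p $ 2 \<bullet> q $ 2\<bar>"
    unfolding kinetic_form_def abs_mult[symmetric]
    by (intro order_trans[OF abs_triangle_ineq] add_mono order_refl)
       (auto simp: abs_mult intro!: mult_left_mono)
  also have "\<dots> \<le> \<bar>a\<bar> * (norm p * norm q) + \<bar>b\<bar> * (norm p * norm q + norm p * norm q) + \<bar>c\<bar> * (norm p * norm q)"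
    by (intro add_mono mult_left_mono i) auto
  finally show ?thesis by (simp add: algebra_simps)
qed

lemma vec_nth_measurable: "F \<in> borel_measurable M \<Longrightarrow> (\<lambda>x. (F x :: 'b::euclidean_space^'k::finite) $ i) \<in> borel_measurable M"
  by (rule measurable_compose[OF _ borel_measurable_continuous_onI]) (auto intro!: continuous_intros)

lemma kinetic_form_measurable:
  fixes F G :: "'a \<Rightarrow> 'b::euclidean_space^2"
  assumes "F \<in> borel_measurable M" "G \<in> borel_measurable M"
  shows "(\<lambda>x. kinetic_form a b c (F x) (G x)) \<in> borel_measurable M"
proof -
  note [measurable] = assms[THEN vec_nth_measurable]
  show ?thesis unfolding kinetic_form_def by measurable
qed

definition minus_i :: "complex^2 \<Rightarrow> complex^2" where
  "minus_i z = (\<chi> j. - \<i> * z $ j)"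

lemma minus_i_linear: "minus_i (z + w) = minus_i z + minus_i w" "minus_i (r *\<^sub>R z) = r *\<^sub>R minus_i z"
  by (simp_all add: minus_i_def vec_eq_iff algebra_simps)

text \<open>Multiplication by -i is skew and commutes with the real symmetric matrix of the form;
  this is why the free flow conserves the kinetic energy.\<close>

lemma kinetic_form_minus_i: "kinetic_form a b c z (minus_i z) = 0"
  by (simp add: kinetic_form_def minus_i_def inner_complex_def algebra_simps)

text \<open>Coefficients of z_a z_b cnj z_c. The mixed product z1 z2 is booked under (a,b) = (1,2)
  alone, so the trilinear form is not symmetric; its diagonal is the nonlinearity.\<close>

definition cubic_coeff :: "(nat \<Rightarrow> real) \<Rightarrow> 2 \<Rightarrow> 2 \<Rightarrow> 2 \<Rightarrow> 2 \<Rightarrow> real" where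
  "cubic_coeff l j a b c = (let k = if j = 1 then 0 else 6 in
     if b = 1 then (if a = 1 then l (k + (if c = 1 then 1 else 3)) else 0)
     else if a = 1 then l (k + (if c = 1 then 2 else 4)) else l (k + (if c = 1 then 5 else 6)))"

definition cubic_trilinear :: "(nat \<Rightarrow> real) \<Rightarrow> complex^2 \<Rightarrow> complex^2 \<Rightarrow> complex^2 \<Rightarrow> complex^2" where
  "cubic_trilinear l u v w = (\<chi> j. \<Sum>a\<in>UNIV. \<Sum>b\<in>UNIV. \<Sum>c\<in>UNIV. cubic_coeff l j a b c * (u $ a * v $ b * cnj (w $ c)))"

lemma cubic_nonlinearity_trilinear: "cubic_nonlinearity l (z $ 1) (z $ 2) = cubic_trilinear l z z z"
proof -
  have l2: "l (Suc (Suc 0)) = l 2" by (simp only: numeral_2_eq_2)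
  show ?thesis
    by (simp add: vec_eq_iff forall_2 cubic_nonlinearity_def cubic_trilinear_def cubic_coeff_def sum_2 Let_def l2)
       (simp add: complex_eq_iff cmod_power2 Re_power2 Im_power2, simp add: algebra_simps power2_eq_square)
qed

lemma cubic_trilinear_linear:
  "cubic_trilinear l (u + u') v w = cubic_trilinear l u v w + cubic_trilinear l u' v w"
  "cubic_trilinear l u (v + v') w = cubic_trilinear l u v w + cubic_trilinear l u v' w"
  "cubic_trilinear l u v (w + w') = cubic_trilinear l u v w + cubic_trilinear l u v w'"
  "cubic_trilinear l (r *\<^sub>R u) v w = r *\<^sub>R cubic_trilinear l u v w"
  "cubic_trilinear l u (r *\<^sub>R v) w = r *\<^sub>R cubic_trilinear l u v w"
  "cubic_trilinear l u v (r *\<^sub>R w) = r *\<^sub>R cubic_trilinear l u v w"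
  by (simp_all add: vec_eq_iff cubic_trilinear_def sum.distrib scaleR_sum_right algebra_simps)

text \<open>The integrand of the time derivative of the energy, for value z and h = -\<Delta>u. The
  velocity is w = -i h - i N(z); after integration by parts the kinetic term is 2K(h,w), which
  equals 2K(h,-i N(z)) by \<open>kinetic_form_minus_i\<close>.\<close>

definition energy_rate ::
  "real \<Rightarrow> real \<Rightarrow> real \<Rightarrow> (nat \<Rightarrow> real) \<Rightarrow> (complex^2 \<Rightarrow> complex^2 \<Rightarrow> real) \<Rightarrow>
   (complex^2 \<Rightarrow> complex^2 \<Rightarrow> complex^2 \<Rightarrow> complex^2 \<Rightarrow> real) \<Rightarrow> complex^2 \<Rightarrow> complex^2 \<Rightarrow> real" where
  "energy_rate a b c lam B T z h = (let n = minus_i (cubic_trilinear lam z z z); w = minus_i h + n in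
     2 * kinetic_form a b c h n + (B w z + B z w) + diagonal_derivative T z w)"

lemma form2_linear:
  assumes "form2 B"
  shows "B (x + x') y = B x y + B x' y" "B x (y + y') = B x y + B x y'"
    "B (r *\<^sub>R x) y = r * B x y" "B x (r *\<^sub>R y) = r * B x y"
  using assms linear_add[of "\<lambda>x. B x y"] linear_add[of "B x"] linear_scale[of "\<lambda>x. B x y"] linear_scale[of "B x"]
  unfolding form2_def by auto

lemma abs_add_bound: "\<bar>x\<bar> \<le> A \<Longrightarrow> \<bar>y\<bar> \<le> B \<Longrightarrow> \<bar>x + y\<bar> \<le> A + (B :: real)"
  by linarith

text \<open>Expansion at z+h gives 16 terms. Without the constant and the four linear ones 11
  remain, each with at least two factors h; the other two factors are bounded by R.\<close>

lemma quadlinear_diag_remainder: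
  assumes T: "quadlinear T" and K: "\<And>a b c d. \<bar>T a b c d\<bar> \<le> K * (norm a * norm b * norm c * norm d)"
    and R: "norm z \<le> R" "norm h \<le> R"
  shows "\<bar>T (z + h) (z + h) (z + h) (z + h) - T z z z z - diagonal_derivative T z h\<bar> \<le> 11 * (\<bar>K\<bar> * R\<^sup>2) * (norm h)\<^sup>2"
proof -
  have R0: "R \<ge> 0" using order_trans[OF norm_ge_zero R(1)] .
  have M: "\<bar>T a b c d\<bar> \<le> (\<bar>K\<bar> * R\<^sup>2) * (norm h)\<^sup>2"
    if "norm a * norm b * norm c * norm d = (norm h)\<^sup>2 * (x * y)" "x \<in> {norm z, norm h}" "y \<in> {norm z, norm h}" for a b c d x y
  proof -
    have xy: "0 \<le> x" "x \<le> R" "0 \<le> y" "y \<le> R" using that R by auto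
    have "\<bar>T a b c d\<bar> \<le> K * ((norm h)\<^sup>2 * (x * y))" using K[of a b c d] unfolding that(1) .
    also have "\<dots> \<le> \<bar>K\<bar> * ((norm h)\<^sup>2 * (x * y))" using xy by (intro mult_right_mono) auto
    also have "\<dots> \<le> \<bar>K\<bar> * ((norm h)\<^sup>2 * (R * R))"
      using xy R0 by (intro mult_left_mono mult_mono) auto
    finally show ?thesis by (simp add: power2_eq_square mult_ac)
  qed
  have e: "T (z + h) (z + h) (z + h) (z + h) - T z z z z - diagonal_derivative T z h
    = T h h z z + T h z h z + T h z z h + T z h h z + T z h z h + T z z h h
     + T h h h z + T h h z h + T h z h h + T z h h h + T h h h h"
    unfolding diagonal_derivative_def quadlinear_simps[OF T] by simp
  let ?M = "(\<bar>K\<bar> * R\<^sup>2) * (norm h)\<^sup>2"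
  have 1: "\<bar>T h h z z\<bar> \<le> ?M" "\<bar>T h z h z\<bar> \<le> ?M" "\<bar>T h z z h\<bar> \<le> ?M" "\<bar>T z h h z\<bar> \<le> ?M" "\<bar>T z h z h\<bar> \<le> ?M" "\<bar>T z z h h\<bar> \<le> ?M"
    by (rule M[where x="norm z" and y="norm z"]; simp add: power2_eq_square mult_ac)+
  have 2: "\<bar>T h h h z\<bar> \<le> ?M" "\<bar>T h h z h\<bar> \<le> ?M" "\<bar>T h z h h\<bar> \<le> ?M" "\<bar>T z h h h\<bar> \<le> ?M"
    by (rule M[where x="norm z" and y="norm h"]; simp add: power2_eq_square mult_ac)+
  have 3: "\<bar>T h h h h\<bar> \<le> ?M"
    by (rule M[where x="norm h" and y="norm h"]; simp add: power2_eq_square mult_ac)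
  have "\<bar>T h h z z + T h z h z + T h z z h + T z h h z + T z h z h + T z z h h
     + T h h h z + T h h z h + T h z h h + T z h h h + T h h h h\<bar> \<le> ?M + ?M + ?M + ?M + ?M + ?M + ?M + ?M + ?M + ?M + ?M"
    by (intro abs_add_bound 1 2 3)
  thus ?thesis unfolding e by (simp add: mult.assoc)
qed

lemma inner_complex_mult_cnj: "x \<bullet> y = Re (x * cnj y)"
  by (simp add: inner_complex_def)

text \<open>Integration by parts in each coordinate; the second derivatives of \<open>v\<close> add
  up to its Laplacian by \<open>fint_norm_sq\<close>.\<close>

lemma gradient_pairing:
  fixes v w :: "real^3 \<Rightarrow> complex"
  assumes v: "decays 6 v" and w: "decays 5 w"
  shows "(\<integral>x. (\<chi> k. fint (\<lambda>\<xi>. (\<i> * (\<xi> $ k)) * v \<xi>) x) \<bullet> (\<chi> k. fint (\<lambda>\<xi>. (\<i> * (\<xi> $ k)) * w \<xi>) x) \<partial>lborel)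
     = (\<integral>x. fint (\<lambda>\<xi>. (norm \<xi>)\<^sup>2 * v \<xi>) x \<bullet> fint w x \<partial>lborel)"
proof -
  have dim: "DIM(real^3) \<le> 4" by simp
  have v5: "decays (Suc 4) (\<lambda>\<xi>. (\<i> * (\<xi> $ k)) * v \<xi>)" for k
    by (rule decays_component_mult) (use v in simp)
  have w4: "decays 4 (\<lambda>\<xi>. (\<i> * (\<xi> $ k)) * w \<xi>)" for k
    by (rule decays_component_mult) (use w in simp)
  have v4: "decays 4 (\<lambda>\<xi>. (\<i> * (\<xi> $ k)) * ((\<i> * (\<xi> $ k)) * v \<xi>))" for k
    by (rule decays_component_mult[OF v5])
  have l: "l2 (fint (\<lambda>\<xi>. (\<i> * (\<xi> $ k)) * v \<xi>))" "l2 (fint (\<lambda>\<xi>. (\<i> * (\<xi> $ k)) * w \<xi>))"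
     "l2 (fint (\<lambda>\<xi>. (\<i> * (\<xi> $ k)) * ((\<i> * (\<xi> $ k)) * v \<xi>)))" "l2 (fint w)" for k
    using l2_fint[OF _ v5[of k]] l2_fint[OF dim w4[of k]] l2_fint[OF dim v4[of k]] l2_fint[OF _ w] by auto
  have ii: "integrable lborel (\<lambda>x. f x * cnj (g x))" if "l2 f" "l2 g" for f g :: "real^3 \<Rightarrow> complex"
    by (rule l2_mult_integrable[OF that, where c=1]) (use l2_measurable[OF that(1)] l2_measurable[OF that(2)] in \<open>auto simp: norm_mult\<close>)
  have ibp: "(\<integral>x. fint (\<lambda>\<xi>. (\<i> * (\<xi> $ k)) * v \<xi>) x * cnj (fint (\<lambda>\<xi>. (\<i> * (\<xi> $ k)) * w \<xi>) x) \<partial>lborel)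
    = - (\<integral>x. fint (\<lambda>\<xi>. (\<i> * (\<xi> $ k)) * ((\<i> * (\<xi> $ k)) * v \<xi>)) x * cnj (fint w x) \<partial>lborel)" for k
    using fint_integral_by_parts[OF dim v5[of k], of w "axis k 1"] w by (simp add: inner_axis)
  have "(\<integral>x. (\<chi> k. fint (\<lambda>\<xi>. (\<i> * (\<xi> $ k)) * v \<xi>) x) \<bullet> (\<chi> k. fint (\<lambda>\<xi>. (\<i> * (\<xi> $ k)) * w \<xi>) x) \<partial>lborel)
    = (\<integral>x. Re (\<Sum>k\<in>UNIV. fint (\<lambda>\<xi>. (\<i> * (\<xi> $ k)) * v \<xi>) x * cnj (fint (\<lambda>\<xi>. (\<i> * (\<xi> $ k)) * w \<xi>) x)) \<partial>lborel)"
    by (simp add: inner_vec_def inner_complex_mult_cnj)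
  also have "\<dots> = Re (\<integral>x. (\<Sum>k\<in>UNIV. fint (\<lambda>\<xi>. (\<i> * (\<xi> $ k)) * v \<xi>) x * cnj (fint (\<lambda>\<xi>. (\<i> * (\<xi> $ k)) * w \<xi>) x)) \<partial>lborel)"
    by (intro integral_bounded_linear[OF bounded_linear_Re] Bochner_Integration.integrable_sum ii l)
  also have "(\<integral>x. (\<Sum>k\<in>UNIV. fint (\<lambda>\<xi>. (\<i> * (\<xi> $ k)) * v \<xi>) x * cnj (fint (\<lambda>\<xi>. (\<i> * (\<xi> $ k)) * w \<xi>) x)) \<partial>lborel)
    = (\<Sum>k\<in>UNIV. (\<integral>x. fint (\<lambda>\<xi>. (\<i> * (\<xi> $ k)) * v \<xi>) x * cnj (fint (\<lambda>\<xi>. (\<i> * (\<xi> $ k)) * w \<xi>) x) \<partial>lborel))"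
    by (intro Bochner_Integration.integral_sum ii l)
  also have "\<dots> = (\<Sum>k\<in>UNIV. - (\<integral>x. fint (\<lambda>\<xi>. (\<i> * (\<xi> $ k)) * ((\<i> * (\<xi> $ k)) * v \<xi>)) x * cnj (fint w x) \<partial>lborel))"
    unfolding ibp ..
  also have "\<dots> = (\<integral>x. (- (\<Sum>k\<in>UNIV. fint (\<lambda>\<xi>. (\<i> * (\<xi> $ k)) * ((\<i> * (\<xi> $ k)) * v \<xi>)) x)) * cnj (fint w x) \<partial>lborel)"
    using ii[OF l(3) l(4)] by (simp add: sum_negf sum_distrib_right Bochner_Integration.integral_sum)
  also have "\<dots> = (\<integral>x. fint (\<lambda>\<xi>. (norm \<xi>)\<^sup>2 * v \<xi>) x * cnj (fint w x) \<partial>lborel)"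
    unfolding fint_norm_sq[OF v, symmetric] ..
  also have "Re \<dots> = (\<integral>x. Re (fint (\<lambda>\<xi>. (norm \<xi>)\<^sup>2 * v \<xi>) x * cnj (fint w x)) \<partial>lborel)"
  proof (rule integral_bounded_linear[OF bounded_linear_Re, symmetric])
    have "l2 (fint (\<lambda>\<xi>. (norm \<xi>)\<^sup>2 * v \<xi>))"
      by (rule l2_fint[of 5]) (use decays_norm_sq_mult[of 5 v] v in auto)
    thus "integrable lborel (\<lambda>x. fint (\<lambda>\<xi>. (norm \<xi>)\<^sup>2 * v \<xi>) x * cnj (fint w x))" by (rule ii[OF _ l(4)])
  qed
  finally show ?thesis by (simp add: inner_complex_mult_cnj)
qed


lemma l2_inner_integrable:
  fixes f g :: "'a::euclidean_space \<Rightarrow> 'b::euclidean_space^2"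
  assumes f: "l2 f" and g: "l2 g"
  shows "integrable lborel (\<lambda>x. kinetic_form a b c (f x) (g x))"
  by (rule l2_mult_integrable[OF f g])
     (use kinetic_form_bound kinetic_form_measurable l2_measurable[OF f] l2_measurable[OF g] in auto)

lemma kinetic_form_pairing:
  fixes v :: "2 \<Rightarrow> real^3 \<Rightarrow> complex"
  assumes v: "\<And>j. decays 6 (v j)" and w: "\<And>j. decays 5 (w j)"
  shows "(\<integral>x. kinetic_form a b c (\<chi> j k. fint (\<lambda>\<xi>. (\<i> * (\<xi> $ k)) * v j \<xi>) x) (\<chi> j k. fint (\<lambda>\<xi>. (\<i> * (\<xi> $ k)) * w j \<xi>) x) \<partial>lborel)
     = (\<integral>x. kinetic_form a b c (\<chi> j. fint (\<lambda>\<xi>. (norm \<xi>)\<^sup>2 * v j \<xi>) x) (\<chi> j. fint (w j) x) \<partial>lborel)"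
proof -
  define Dv where "Dv j x = (\<chi> k. fint (\<lambda>\<xi>. (\<i> * (\<xi> $ k)) * v j \<xi>) x)" for j x
  define Dw where "Dw j x = (\<chi> k. fint (\<lambda>\<xi>. (\<i> * (\<xi> $ k)) * w j \<xi>) x)" for j x
  define P where "P j = fint (\<lambda>\<xi>. (norm \<xi>)\<^sup>2 * v j \<xi>)" for j
  have v5: "decays 5 (\<lambda>\<xi>. (\<i> * (\<xi> $ k)) * v j \<xi>)" for j k by (rule decays_component_mult) (use v in simp)
  have w4: "decays 4 (\<lambda>\<xi>. (\<i> * (\<xi> $ k)) * w j \<xi>)" for j k by (rule decays_component_mult) (use w in simp)
  have l: "l2 (Dv j)" "l2 (Dw j)" "l2 (P j)" "l2 (fint (w j))" for j
    unfolding Dv_def[abs_def] Dw_def[abs_def] P_def using decays_norm_sq_mult[of 5 "v j"] v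
    by (auto intro!: l2_vec l2_fint[OF _ v5] l2_fint[OF _ w4] l2_fint[OF _ w] l2_fint[of 5])
  have i: "integrable lborel (\<lambda>x. f x \<bullet> g x)" if "l2 f" "l2 g" for f g :: "real^3 \<Rightarrow> 'b::euclidean_space"
    by (rule l2_mult_integrable[OF that, where c=1])
       (use l2_measurable[OF that(1)] l2_measurable[OF that(2)] Cauchy_Schwarz_ineq2 in auto)
  have e: "(\<integral>x. Dv i x \<bullet> Dw j x \<partial>lborel) = (\<integral>x. P i x \<bullet> fint (w j) x \<partial>lborel)" for i j
    unfolding Dv_def Dw_def P_def by (rule gradient_pairing[OF v w])
  have "(\<integral>x. a * (Dv 1 x \<bullet> Dw 1 x) + b * (Dv 1 x \<bullet> Dw 2 x + Dv 2 x \<bullet> Dw 1 x) + c * (Dv 2 x \<bullet> Dw 2 x) \<partial>lborel)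
    = (\<integral>x. a * (P 1 x \<bullet> fint (w 1) x) + b * (P 1 x \<bullet> fint (w 2) x + P 2 x \<bullet> fint (w 1) x) + c * (P 2 x \<bullet> fint (w 2) x) \<partial>lborel)"
    using i[OF l(1,2)] i[OF l(3,4)] e by simp
  thus ?thesis by (simp add: kinetic_form_def Dv_def Dw_def P_def)
qed

text \<open>The energy is a functional of the pair U = (u, Du), quadratic in Du and quartic in the
  uniformly bounded u. Since U is differentiable in L^2 at time 0,
  \<open>has_vector_derivative_integral_l2\<close> computes its derivative, which conservation
  forces to be zero.\<close>

theorem energy_rate_vanishes:
  fixes v0 :: "real^3 \<Rightarrow> complex^2"
  assumes cons: "energy_conserved (cubic_nonlinearity lam) a b c g"
    and B: "form2 B" and T: "form4 T" and g: "\<And>z. g (z $ 1) (z $ 2) = B z z + T z z z z"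
    and v0: "\<And>j. decays 6 (\<lambda>\<xi>. v0 \<xi> $ j)"
  defines "E \<equiv> \<lambda>x. energy_rate a b c lam B T (\<chi> j. fint (\<lambda>\<xi>. v0 \<xi> $ j) x) (\<chi> j. fint (\<lambda>\<xi>. (norm \<xi>)\<^sup>2 * v0 \<xi> $ j) x)"
  shows "integrable lborel E" "(\<integral>x. E x \<partial>lborel) = 0"
proof -
  let ?N = "cubic_nonlinearity lam"
  have N: "?N (z $ 1) (z $ 2) $ j = (\<Sum>a\<in>UNIV. \<Sum>b\<in>UNIV. \<Sum>c\<in>UNIV. cubic_coeff lam j a b c * (z $ a * z $ b * cnj (z $ c)))" for z j
    unfolding cubic_nonlinearity_trilinear by (simp add: cubic_trilinear_def)
  obtain T0 R u Du v1 where T0: "T0 > 0" and sol: "H1_solution ?N {-T0<..<T0} u Du" and ub: "\<And>t x. norm (u t x) \<le> R"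
    and u0: "\<And>x j. u 0 x $ j = fint (\<lambda>\<xi>. v0 \<xi> $ j) x"
    and Du0: "\<And>x j k. Du 0 x $ j $ k = fint (\<lambda>\<xi>. (\<i> * (\<xi> $ k)) * v0 \<xi> $ j) x"
    and v1: "\<And>j. decays 5 (v1 j)"
    and v1f: "\<And>x j. fint (v1 j) x = - \<i> * fint (\<lambda>\<xi>. (norm \<xi>)\<^sup>2 * v0 \<xi> $ j) x - \<i> * ?N (u 0 x $ 1) (u 0 x $ 2) $ j"
    and d: "l2_deriv (\<lambda>t x. (u t x, Du t x)) (\<lambda>x. (\<chi> j. fint (v1 j) x, \<chi> j k. fint (\<lambda>\<xi>. (\<i> * (\<xi> $ k)) * v1 j \<xi>) x)) 0"
    by (rule H1_solution_exists[OF v0 N]) blast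
  define U where "U t x = (u t x, Du t x)" for t x
  define w where "w x = (\<chi> j. fint (v1 j) x)" for x
  define Dw where "Dw x = (\<chi> j k. fint (\<lambda>\<xi>. (\<i> * (\<xi> $ k)) * v1 j \<xi>) x)" for x
  define P where "P x = (\<chi> j. fint (\<lambda>\<xi>. (norm \<xi>)\<^sup>2 * v0 \<xi> $ j) x)" for x
  define e where "e y = kinetic_form a b c (snd y) (snd y) + (B (fst y) (fst y) + T (fst y) (fst y) (fst y) (fst y))"
    for y :: "(complex^2) \<times> (complex^3^2)"
  define rate where "rate x h = (B h (u 0 x) + B (u 0 x) h) + diagonal_derivative T (u 0 x) h" for x h
  define D where "D x y = 2 * kinetic_form a b c (Du 0 x) (snd y) + rate x (fst y)" for x and y :: "(complex^2) \<times> (complex^3^2)"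
  have U': "l2_deriv U (\<lambda>x. (w x, Dw x)) 0" using d by (simp add: U_def[abs_def] w_def Dw_def)
  have lU: "l2 (U t)" and lw: "l2 (\<lambda>x. (w x, Dw x))" for t using U' by (auto simp: l2_deriv_def)
  have fs: "l2 (\<lambda>x. fst (f x))" "l2 (\<lambda>x. snd (f x))" if "l2 f" for f :: "real^3 \<Rightarrow> (complex^2) \<times> (complex^3^2)"
  proof -
    have "continuous_on UNIV (fst :: (complex^2) \<times> (complex^3^2) \<Rightarrow> _)" "continuous_on UNIV (snd :: (complex^2) \<times> (complex^3^2) \<Rightarrow> _)"
      by (intro continuous_intros)+
    note m = this[THEN borel_measurable_continuous_onI, THEN measurable_compose[OF l2_measurable[OF that]]]
    show "l2 (\<lambda>x. fst (f x))" by (rule l2_bound[OF that m(1), where c=1]) (metis mult_1 norm_fst_le prod.collapse)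
    show "l2 (\<lambda>x. snd (f x))" by (rule l2_bound[OF that m(2), where c=1]) (metis mult_1 norm_snd_le prod.collapse)
  qed
  have lu: "l2 (u t)" and lDu: "l2 (Du t)" for t using fs[OF lU[of t]] by (auto simp: U_def)
  have lw1: "l2 w" and lDw: "l2 Dw" using fs[OF lw] by auto
  have n1: "norm (fst y) \<le> norm y" and n2: "norm (snd y) \<le> norm y" for y :: "(complex^2) \<times> (complex^3^2)"
    by (metis norm_fst_le prod.collapse) (metis norm_snd_le prod.collapse)
  obtain K2' where K2': "\<And>x y. \<bar>B x y\<bar> \<le> K2' * (norm x * norm y)" using B unfolding form2_def by blast
  obtain K4' where K4': "\<And>x y z w. \<bar>T x y z w\<bar> \<le> K4' * (norm x * norm y * norm z * norm w)" using T unfolding form4_def by blast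
  have TQ: "quadlinear T" using T by (simp add: form4_def)
  define K2 K4 where "K2 = \<bar>K2'\<bar>" and "K4 = \<bar>K4'\<bar>"
  have K2: "\<bar>B x y\<bar> \<le> K2 * (norm x * norm y)" for x y
    unfolding K2_def by (rule order_trans[OF K2'[of x y] mult_right_mono]) auto
  have K4: "\<bar>T x y z w\<bar> \<le> K4 * (norm x * norm y * norm z * norm w)" for x y z w
    unfolding K4_def by (rule order_trans[OF K4'[of x y z w] mult_right_mono]) auto
  have K0: "K2 \<ge> 0" "K4 \<ge> 0" by (auto simp: K2_def K4_def)
  define Kk where "Kk = \<bar>a\<bar> + 2 * \<bar>b\<bar> + \<bar>c\<bar>"
  have Kk0: "Kk \<ge> 0" by (simp add: Kk_def)
  have R0: "R \<ge> 0" using order_trans[OF norm_ge_zero ub] .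
  have K4z: "\<bar>T x y z h\<bar> \<le> K4 * R\<^sup>2 * (norm p * norm q)"
    if "norm x * norm y * norm z * norm h = (r * s) * (norm p * norm q)" "0 \<le> r" "r \<le> R" "0 \<le> s" "s \<le> R"
    for x y z h r s and p q :: "complex^2"
  proof -
    have "\<bar>T x y z h\<bar> \<le> K4 * ((r * s) * (norm p * norm q))" using K4[of x y z h] that(1) by simp
    also have "\<dots> \<le> K4 * ((R * R) * (norm p * norm q))"
      using that K0 by (intro mult_left_mono mult_right_mono mult_mono) auto
    finally show ?thesis by (simp add: power2_eq_square mult_ac)
  qed
  define C1 where "C1 = 2 * Kk + 2 * K2 + 4 * (K4 * R\<^sup>2)"
  have rate_bound: "\<bar>rate x h\<bar> \<le> (2 * K2 + 4 * (K4 * R\<^sup>2)) * (norm (u 0 x) * norm h)" for x h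
  proof -
    have "\<bar>T h (u 0 x) (u 0 x) (u 0 x)\<bar> \<le> K4 * R\<^sup>2 * (norm (u 0 x) * norm h)"
      "\<bar>T (u 0 x) h (u 0 x) (u 0 x)\<bar> \<le> K4 * R\<^sup>2 * (norm (u 0 x) * norm h)"
      "\<bar>T (u 0 x) (u 0 x) h (u 0 x)\<bar> \<le> K4 * R\<^sup>2 * (norm (u 0 x) * norm h)"
      "\<bar>T (u 0 x) (u 0 x) (u 0 x) h\<bar> \<le> K4 * R\<^sup>2 * (norm (u 0 x) * norm h)"
      by (rule K4z[where r="norm (u 0 x)" and s="norm (u 0 x)"]; simp add: ub)+
    moreover have "\<bar>B h (u 0 x)\<bar> \<le> K2 * (norm (u 0 x) * norm h)" "\<bar>B (u 0 x) h\<bar> \<le> K2 * (norm (u 0 x) * norm h)"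
      using K2[of h "u 0 x"] K2[of "u 0 x" h] by (auto simp: mult.commute)
    ultimately have "\<bar>rate x h\<bar> \<le> (K2 * (norm (u 0 x) * norm h) + K2 * (norm (u 0 x) * norm h))
      + (K4 * R\<^sup>2 * (norm (u 0 x) * norm h) + K4 * R\<^sup>2 * (norm (u 0 x) * norm h)
         + K4 * R\<^sup>2 * (norm (u 0 x) * norm h) + K4 * R\<^sup>2 * (norm (u 0 x) * norm h))"
      unfolding rate_def diagonal_derivative_def by (intro abs_add_bound)
    thus ?thesis by (simp add: algebra_simps)
  qed
  have rate_meas: "(\<lambda>x. rate x (f x)) \<in> borel_measurable borel" if f: "f \<in> borel_measurable borel" for f
  proof -
    note u0m = l2_measurable[OF lu[of 0]]
    have [measurable]: "(\<lambda>x. B (f x) (u 0 x)) \<in> borel_measurable borel" "(\<lambda>x. B (u 0 x) (f x)) \<in> borel_measurable borel"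
      using B f u0m unfolding form2_def by blast+
    have [measurable]: "(\<lambda>x. T (f x) (u 0 x) (u 0 x) (u 0 x)) \<in> borel_measurable borel" "(\<lambda>x. T (u 0 x) (f x) (u 0 x) (u 0 x)) \<in> borel_measurable borel"
      "(\<lambda>x. T (u 0 x) (u 0 x) (f x) (u 0 x)) \<in> borel_measurable borel" "(\<lambda>x. T (u 0 x) (u 0 x) (u 0 x) (f x)) \<in> borel_measurable borel"
      using T f u0m unfolding form4_def by blast+
    show ?thesis unfolding rate_def diagonal_derivative_def by measurable
  qed
  have em: "(\<lambda>x. e (U t x)) \<in> borel_measurable borel" for t
  proof -
    note m = l2_measurable[OF lu[of t]] l2_measurable[OF lDu[of t]]
    have [measurable]: "(\<lambda>x. B (u t x) (u t x)) \<in> borel_measurable borel" using B m unfolding form2_def by blast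
    have [measurable]: "(\<lambda>x. T (u t x) (u t x) (u t x) (u t x)) \<in> borel_measurable borel" using T m unfolding form4_def by blast
    note [measurable] = kinetic_form_measurable[OF m(2) m(2), of a b c]
    show ?thesis unfolding e_def U_def by simp
  qed
  have ei: "integrable lborel (\<lambda>x. e (U t x))" for t
  proof (rule l2_mult_integrable[OF lU[of t] lU[of t] em, where c="Kk + K2 + K4 * R\<^sup>2"])
    fix x
    have "\<bar>T (u t x) (u t x) (u t x) (u t x)\<bar> \<le> K4 * R\<^sup>2 * (norm (u t x) * norm (u t x))"
      by (rule K4z[where r="norm (u t x)" and s="norm (u t x)"]) (auto simp: ub)
    hence "\<bar>e (U t x)\<bar> \<le> Kk * (norm (Du t x) * norm (Du t x)) + (K2 * (norm (u t x) * norm (u t x)) + K4 * R\<^sup>2 * (norm (u t x) * norm (u t x)))"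
      unfolding e_def U_def fst_conv snd_conv Kk_def
      using kinetic_form_bound[of a b c "Du t x" "Du t x"] K2[of "u t x" "u t x"] by linarith
    also have "\<dots> \<le> Kk * (norm (U t x) * norm (U t x)) + (K2 * (norm (U t x) * norm (U t x)) + K4 * R\<^sup>2 * (norm (U t x) * norm (U t x)))"
      using n1[of "U t x"] n2[of "U t x"] K0 Kk0 by (intro add_mono mult_left_mono mult_mono) (auto simp: U_def)
    finally show "norm (e (U t x)) \<le> (Kk + K2 + K4 * R\<^sup>2) * (norm (U t x) * norm (U t x))" by (simp add: algebra_simps)
  qed
  have Dk: "l2 (\<lambda>x. C1 * norm (U 0 x))" using l2_scaleR[OF l2_norm[OF lU[of 0]], of C1] by simp
  have Dl: "linear (D x)" for x
    unfolding D_def rate_def diagonal_derivative_def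
    by (rule linearI) (auto simp: kinetic_form_linear form2_linear[OF B] quadlinear_simps[OF TQ] algebra_simps)
  have Db: "norm (D x y) \<le> C1 * norm (U 0 x) * norm y" for x y
  proof -
    have "\<bar>D x y\<bar> \<le> 2 * (Kk * (norm (Du 0 x) * norm (snd y))) + (2 * K2 + 4 * (K4 * R\<^sup>2)) * (norm (u 0 x) * norm (fst y))"
      unfolding D_def Kk_def using kinetic_form_bound[of a b c "Du 0 x" "snd y"] rate_bound[of x "fst y"] by linarith
    also have "\<dots> \<le> 2 * (Kk * (norm (U 0 x) * norm y)) + (2 * K2 + 4 * (K4 * R\<^sup>2)) * (norm (U 0 x) * norm y)"
      using n1[of "U 0 x"] n2[of "U 0 x"] n1[of y] n2[of y] K0 Kk0
      by (intro add_mono mult_left_mono mult_mono) (auto simp: U_def)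
    finally show ?thesis by (simp add: C1_def algebra_simps)
  qed
  have Dm: "(\<lambda>x. D x (f x)) \<in> borel_measurable borel" if f: "f \<in> borel_measurable borel" for f
  proof -
    have m: "(\<lambda>x. fst (f x)) \<in> borel_measurable borel" "(\<lambda>x. snd (f x)) \<in> borel_measurable borel"
      by (intro measurable_compose[OF f] borel_measurable_continuous_onI continuous_intros)+
    note [measurable] = rate_meas[OF m(1)] kinetic_form_measurable[OF l2_measurable[OF lDu[of 0]] m(2), of a b c]
    show ?thesis unfolding D_def by simp
  qed
  have Dr: "norm (e (U t x) - e (U 0 x) - D x (U t x - U 0 x)) \<le> (Kk + K2 + 11 * (K4 * (2 * R)\<^sup>2)) * (norm (U t x - U 0 x))\<^sup>2" for t x
  proof -
    define h q where "h = u t x - u 0 x" and "q = Du t x - Du 0 x"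
    have ut: "u t x = u 0 x + h" "Du t x = Du 0 x + q" by (auto simp: h_def q_def)
    have dU: "U t x - U 0 x = (h, q)" by (simp add: U_def h_def q_def)
    have eq: "e (U t x) - e (U 0 x) - D x (U t x - U 0 x) = kinetic_form a b c q q + B h h
      + (T (u 0 x + h) (u 0 x + h) (u 0 x + h) (u 0 x + h) - T (u 0 x) (u 0 x) (u 0 x) (u 0 x) - diagonal_derivative T (u 0 x) h)"
      unfolding dU e_def D_def rate_def U_def fst_conv snd_conv ut
      by (simp add: kinetic_form_linear form2_linear[OF B] kinetic_form_commute[of a b c q "Du 0 x"] algebra_simps)
    have "\<bar>T (u 0 x + h) (u 0 x + h) (u 0 x + h) (u 0 x + h) - T (u 0 x) (u 0 x) (u 0 x) (u 0 x) - diagonal_derivative T (u 0 x) h\<bar>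
      \<le> 11 * (\<bar>K4\<bar> * (2 * R)\<^sup>2) * (norm h)\<^sup>2"
    \<comment> \<open>2R bounds the base point as well as the increment, a difference of two values
      of norm at most R.\<close>
    proof (rule quadlinear_diag_remainder[OF TQ K4])
      show "norm (u 0 x) \<le> 2 * R" using ub[of 0 x] R0 by simp
      show "norm h \<le> 2 * R" unfolding h_def using norm_triangle_ineq4[of "u t x" "u 0 x"] ub[of t x] ub[of 0 x] by simp
    qed
    hence tb: "\<bar>T (u 0 x + h) (u 0 x + h) (u 0 x + h) (u 0 x + h) - T (u 0 x) (u 0 x) (u 0 x) (u 0 x) - diagonal_derivative T (u 0 x) h\<bar>
      \<le> 11 * (K4 * (2 * R)\<^sup>2) * (norm h)\<^sup>2"
      unfolding abs_of_nonneg[OF K0(2)] .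
    have "\<bar>e (U t x) - e (U 0 x) - D x (U t x - U 0 x)\<bar>
      \<le> Kk * (norm q * norm q) + K2 * (norm h * norm h) + 11 * (K4 * (2 * R)\<^sup>2) * (norm h)\<^sup>2"
      unfolding eq Kk_def by (intro abs_add_bound kinetic_form_bound K2 tb)
    also have "\<dots> = Kk * (norm q)\<^sup>2 + K2 * (norm h)\<^sup>2 + 11 * (K4 * (2 * R)\<^sup>2) * (norm h)\<^sup>2"
      by (simp add: power2_eq_square)
    also have "\<dots> \<le> Kk * (norm (h, q))\<^sup>2 + K2 * (norm (h, q))\<^sup>2 + 11 * (K4 * (2 * R)\<^sup>2) * (norm (h, q))\<^sup>2"
      using n1[of "(h, q)"] n2[of "(h, q)"] K0 Kk0 by (intro add_mono mult_left_mono power_mono) auto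
    finally show ?thesis unfolding dU by (simp add: algebra_simps)
  qed
  note hv = has_vector_derivative_integral_l2[where e="\<lambda>_. e" and D=D and k="\<lambda>x. C1 * norm (U 0 x)", OF U' Dk Dl Db Dm ei Dr]
  have Di: "integrable lborel (\<lambda>x. D x (w x, Dw x))" by (rule hv(2))
  note hv(1)
  moreover have "((\<lambda>t. \<integral>x. e (U t x) \<partial>lborel) has_vector_derivative 0) (at 0)"
  proof -
    have ee: "energy_density a b c g (u t x) (Du t x) = e (U t x)" for t x
      by (simp add: energy_density_def e_def U_def g kinetic_form_def power2_norm_eq_inner inner_vec_def inner_complex_def
          inner_commute algebra_simps)
    obtain E0 where E0: "\<And>t. t \<in> {-T0<..<T0} \<Longrightarrow> (\<integral>x. energy_density a b c g (u t x) (Du t x) \<partial>lebesgue) = E0"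
    proof -
      note cons[unfolded energy_conserved_def, THEN spec, THEN spec, THEN spec, THEN mp, OF sol, THEN conjunct2, unfolded constant_on_def]
      thus thesis using that by (elim exE) simp
    qed
    have "(\<integral>x. e (U t x) \<partial>lborel) = E0" if "t \<in> {-T0<..<T0}" for t
    proof -
      have "(\<lambda>x. e (U t x)) \<in> borel_measurable lborel" using em by simp
      thus ?thesis using E0[OF that] unfolding ee by (simp add: integral_completion)
    qed
    thus ?thesis
      by (intro has_vector_derivative_transform_within_open[OF has_vector_derivative_const[of E0], where S="{-T0<..<T0}"])
         (use T0 in auto)
  qed
  ultimately have D0: "(\<integral>x. D x (w x, Dw x) \<partial>lborel) = 0" by (rule vector_derivative_unique_at)
  have lP: "l2 P" unfolding P_def[abs_def]
    by (intro l2_vec l2_fint[of 5]) (use decays_norm_sq_mult[of 5] v0 in auto)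
  have k1: "integrable lborel (\<lambda>x. kinetic_form a b c (Du 0 x) (Dw x))" and k2: "integrable lborel (\<lambda>x. kinetic_form a b c (P x) (w x))"
    by (intro l2_inner_integrable lDu lDw lP lw1)+
  have Du0': "Du 0 x = (\<chi> j k. fint (\<lambda>\<xi>. (\<i> * (\<xi> $ k)) * v0 \<xi> $ j) x)" for x by (simp add: vec_eq_iff Du0)
  \<comment> \<open>Takes the derivatives off the velocity, so that only its value enters the
    rate.\<close>
  have kp: "(\<integral>x. kinetic_form a b c (Du 0 x) (Dw x) \<partial>lborel) = (\<integral>x. kinetic_form a b c (P x) (w x) \<partial>lborel)"
    unfolding Du0' Dw_def P_def w_def by (rule kinetic_form_pairing[OF v0 v1])
  have "integrable lborel (\<lambda>x. D x (w x, Dw x) - 2 * kinetic_form a b c (Du 0 x) (Dw x))" using Di k1 by auto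
  hence ri: "integrable lborel (\<lambda>x. rate x (w x))" by (simp add: D_def)
  \<comment> \<open>The part -i P of the velocity drops out of 2K(P,w) by
    \<open>kinetic_form_minus_i\<close>.\<close>
  have E: "E x = 2 * kinetic_form a b c (P x) (w x) + rate x (w x)" for x
  proof -
    have u0': "(\<chi> j. fint (\<lambda>\<xi>. v0 \<xi> $ j) x) = u 0 x" by (simp add: vec_eq_iff u0)
    have w': "w x = minus_i (P x) + minus_i (cubic_trilinear lam (u 0 x) (u 0 x) (u 0 x))"
      unfolding cubic_nonlinearity_trilinear[symmetric] by (simp add: vec_eq_iff w_def P_def minus_i_def v1f)
    show ?thesis
      unfolding E_def u0' P_def[symmetric] energy_rate_def Let_def rate_def w'
      by (simp add: kinetic_form_linear kinetic_form_minus_i)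
  qed
  show "integrable lborel E" unfolding E using k2 ri by auto
  have "(\<integral>x. E x \<partial>lborel) = 2 * (\<integral>x. kinetic_form a b c (P x) (w x) \<partial>lborel) + (\<integral>x. rate x (w x) \<partial>lborel)"
    unfolding E using k2 ri by simp
  also have "\<dots> = (\<integral>x. D x (w x, Dw x) \<partial>lborel)"
    unfolding kp[symmetric] D_def using k1 ri by simp
  finally show "(\<integral>x. E x \<partial>lborel) = 0" using D0 by simp
qed

subsection \<open>Testing conservation with Gaussian data\<close>

definition gauss :: "real \<Rightarrow> real^3 \<Rightarrow> real" where
  "gauss \<alpha> x = exp (- \<alpha> * (norm x)\<^sup>2)"

text \<open>Minus the Laplacian of the Gaussian, given by its symbol |\<xi>|^2. Taking the real part
  loses nothing, as the density is real and even. What enters below is its integral against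
  Gaussians.\<close>

definition neg_laplace_gauss :: "real \<Rightarrow> real^3 \<Rightarrow> real" where
  "neg_laplace_gauss \<alpha> x = Re (fint (\<lambda>\<xi>. (norm \<xi>)\<^sup>2 * gaussian_transform \<alpha> \<xi>) x)"

lemma fint_neg_laplace_gauss:
  assumes "\<alpha> > 0"
  shows "fint (\<lambda>\<xi>. (norm \<xi>)\<^sup>2 * gaussian_transform \<alpha> \<xi>) x = complex_of_real (neg_laplace_gauss \<alpha> x)"
proof -
  have m: "(\<lambda>\<xi>::real^3. (norm \<xi>)\<^sup>2 * gaussian_transform \<alpha> \<xi>) \<in> borel_measurable borel"
    by (rule decays_measurable[of 0], rule decays_norm_sq_mult, rule decays_gaussian_transform[OF assms])
  have "cnj (fint (\<lambda>\<xi>. (norm \<xi>)\<^sup>2 * gaussian_transform \<alpha> \<xi>) x) = fint (\<lambda>\<xi>. (norm \<xi>)\<^sup>2 * gaussian_transform \<alpha> \<xi>) x"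
    unfolding fint_reflect[OF m, symmetric] by (simp add: gaussian_transform_def)
  thus ?thesis unfolding neg_laplace_gauss_def by (simp add: complex_eq_iff)
qed

lemma l2_gauss: "\<alpha> > 0 \<Longrightarrow> l2 (gauss \<alpha>)"
  using l2_fint[of 3 "gaussian_transform \<alpha>"] decays_gaussian_transform[of \<alpha> 3]
  by (simp add: l2_def fint_gaussian_transform gauss_def[abs_def])

lemma l2_neg_laplace_gauss:
  assumes "\<alpha> > 0"
  shows "l2 (neg_laplace_gauss \<alpha>)"
proof -
  have l: "l2 (fint (\<lambda>\<xi>. (norm \<xi>)\<^sup>2 * gaussian_transform \<alpha> \<xi>))"
    by (rule l2_fint[of 3], simp, intro decays_norm_sq_mult decays_gaussian_transform assms)
  show ?thesis
    by (rule l2_bound[OF l, where c=1])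
       (use l2_measurable[OF l] abs_Re_le_cmod in \<open>auto simp: neg_laplace_gauss_def[abs_def]\<close>)
qed

lemma neg_laplace_gauss_integral:
  assumes \<alpha>: "\<alpha> > 0" and \<beta>: "\<beta> > 0"
  shows "integrable lborel (\<lambda>x. neg_laplace_gauss \<alpha> x * gauss \<beta> x)"
    and "(\<integral>x. neg_laplace_gauss \<alpha> x * gauss \<beta> x \<partial>lborel) = 6 * \<alpha> * \<beta> / (\<alpha> + \<beta>) * sqrt (pi / (\<alpha> + \<beta>)) ^ 3"
proof -
  show i: "integrable lborel (\<lambda>x. neg_laplace_gauss \<alpha> x * gauss \<beta> x)"
    using l2_measurable[OF l2_neg_laplace_gauss[OF \<alpha>]] l2_measurable[OF l2_gauss[OF \<beta>]]
    by (intro l2_mult_integrable[OF l2_neg_laplace_gauss[OF \<alpha>] l2_gauss[OF \<beta>], where c=1]) (auto simp: abs_mult)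
  have "complex_of_real (\<integral>x. neg_laplace_gauss \<alpha> x * gauss \<beta> x \<partial>lborel)
    = (\<integral>x. complex_of_real (neg_laplace_gauss \<alpha> x * gauss \<beta> x) \<partial>lborel)"
    by (rule integral_complex_of_real[symmetric])
  also have "\<dots> = complex_of_real (6 * \<alpha> * \<beta> / (\<alpha> + \<beta>) * sqrt (pi / (\<alpha> + \<beta>)) ^ 3)"
    using gaussian_laplacian_pairing[OF \<alpha> \<beta>] unfolding fint_neg_laplace_gauss[OF \<alpha>] gauss_def of_real_mult .
  finally show "(\<integral>x. neg_laplace_gauss \<alpha> x * gauss \<beta> x \<partial>lborel) = 6 * \<alpha> * \<beta> / (\<alpha> + \<beta>) * sqrt (pi / (\<alpha> + \<beta>)) ^ 3"
    by (simp only: of_real_eq_iff)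
qed

lemma gauss_mult: "gauss \<alpha> x * gauss \<beta> x = gauss (\<alpha> + \<beta>) x"
  by (simp add: gauss_def algebra_simps flip: exp_add)

text \<open>\<mu> is the overall amplitude and s the size of the perturbation in direction w; as
  both are arbitrary, coefficients of a polynomial in \<mu> and s can be extracted from the
  vanishing integrals.\<close>

lemma energy_rate_gaussians:
  fixes \<mu> s :: real and w z :: "complex^2"
  assumes cons: "energy_conserved (cubic_nonlinearity lam) a b c g"
    and B: "form2 B" and T: "form4 T" and g: "\<And>z. g (z $ 1) (z $ 2) = B z z + T z z z z"
    and \<alpha>: "\<alpha> > 0" and \<beta>: "\<beta> > 0"
  defines "E \<equiv> \<lambda>x. energy_rate a b c lam B T ((\<mu> * (s * gauss \<alpha> x)) *\<^sub>R w + (\<mu> * gauss \<beta> x) *\<^sub>R z)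
      ((\<mu> * (s * neg_laplace_gauss \<alpha> x)) *\<^sub>R w + (\<mu> * neg_laplace_gauss \<beta> x) *\<^sub>R z)"
  shows "integrable lborel E" "(\<integral>x. E x \<partial>lborel) = 0"
proof -
  define v0 where "v0 \<xi> = (\<chi> j. (\<mu> * s) * w $ j * gaussian_transform \<alpha> \<xi> + \<mu> * z $ j * gaussian_transform \<beta> \<xi>)" for \<xi>
  note ga = decays_gaussian_transform[OF \<alpha>] and gb = decays_gaussian_transform[OF \<beta>]
  have v0: "decays 6 (\<lambda>\<xi>. v0 \<xi> $ j)" for j
    unfolding v0_def vec_lambda_beta by (intro decays_add decays_cmult ga gb)
  have ia: "integrable lborel (\<lambda>\<xi>. C * gaussian_transform \<alpha> \<xi>)" "integrable lborel (\<lambda>\<xi>. C * gaussian_transform \<beta> \<xi>)" for C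
    by (intro decays_integrable[of 3] decays_cmult ga gb; simp)+
  have ib: "integrable lborel (\<lambda>\<xi>::real^3. C * ((norm \<xi>)\<^sup>2 * gaussian_transform \<alpha> \<xi>))"
     "integrable lborel (\<lambda>\<xi>::real^3. C * ((norm \<xi>)\<^sup>2 * gaussian_transform \<beta> \<xi>))" for C
    by (intro decays_integrable[of 3] decays_cmult decays_norm_sq_mult ga gb; simp)+
  have 1: "(\<chi> j. fint (\<lambda>\<xi>. v0 \<xi> $ j) x) = (\<mu> * (s * gauss \<alpha> x)) *\<^sub>R w + (\<mu> * gauss \<beta> x) *\<^sub>R z" for x
  proof -
    have "fint (\<lambda>\<xi>. v0 \<xi> $ j) x = (\<mu> * s) * w $ j * gauss \<alpha> x + \<mu> * z $ j * gauss \<beta> x" for j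
      unfolding v0_def vec_lambda_beta fint_add[OF ia] fint_cmult fint_gaussian_transform[OF \<alpha>] fint_gaussian_transform[OF \<beta>] gauss_def ..
    thus ?thesis by (simp add: vec_eq_iff scaleR_conv_of_real[where 'a=complex] mult_ac)
  qed
  have 2: "(\<chi> j. fint (\<lambda>\<xi>. (norm \<xi>)\<^sup>2 * v0 \<xi> $ j) x)
      = (\<mu> * (s * neg_laplace_gauss \<alpha> x)) *\<^sub>R w + (\<mu> * neg_laplace_gauss \<beta> x) *\<^sub>R z" for x
  proof -
    have "fint (\<lambda>\<xi>. (norm \<xi>)\<^sup>2 * v0 \<xi> $ j) x = (\<mu> * s) * w $ j * neg_laplace_gauss \<alpha> x + \<mu> * z $ j * neg_laplace_gauss \<beta> x" for j
    proof -
      have "(\<lambda>\<xi>. (norm \<xi>)\<^sup>2 * v0 \<xi> $ j)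
        = (\<lambda>\<xi>. ((\<mu> * s) * w $ j) * ((norm \<xi>)\<^sup>2 * gaussian_transform \<alpha> \<xi>) + (\<mu> * z $ j) * ((norm \<xi>)\<^sup>2 * gaussian_transform \<beta> \<xi>))"
        by (simp add: v0_def fun_eq_iff algebra_simps)
      thus ?thesis
        by (simp only: fint_add[OF ib] fint_cmult fint_neg_laplace_gauss[OF \<alpha>] fint_neg_laplace_gauss[OF \<beta>])
    qed
    thus ?thesis by (simp add: vec_eq_iff scaleR_conv_of_real[where 'a=complex] mult_ac)
  qed
  show "integrable lborel E" "(\<integral>x. E x \<partial>lborel) = 0"
    using energy_rate_vanishes[OF cons B T g v0] unfolding E_def 1 2 by simp_all
qed

text \<open>Polarization of the terms of degree four that contain the Laplacian: the first slot
  takes h, the others the value of u. Separate slots let h and u carry different scalar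
  profiles.\<close>

definition quartic_rate ::
  "real \<Rightarrow> real \<Rightarrow> real \<Rightarrow> (nat \<Rightarrow> real) \<Rightarrow> (complex^2 \<Rightarrow> complex^2 \<Rightarrow> complex^2 \<Rightarrow> complex^2 \<Rightarrow> real) \<Rightarrow>
   complex^2 \<Rightarrow> complex^2 \<Rightarrow> complex^2 \<Rightarrow> complex^2 \<Rightarrow> real" where
  "quartic_rate a b c lam T h x y z = 2 * kinetic_form a b c h (minus_i (cubic_trilinear lam x y z))
     + (T (minus_i h) x y z + T x (minus_i h) y z + T x y (minus_i h) z + T x y z (minus_i h))"

text \<open>The contribution of the quadratic part of \<open>g\<close>, again of degree four because
  the nonlinearity is cubic, but free of the Laplacian.\<close>

definition mass_rate ::
  "(nat \<Rightarrow> real) \<Rightarrow> (complex^2 \<Rightarrow> complex^2 \<Rightarrow> real) \<Rightarrow> complex^2 \<Rightarrow> complex^2 \<Rightarrow> complex^2 \<Rightarrow> complex^2 \<Rightarrow> real" where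
  "mass_rate lam B x y z w = B (minus_i (cubic_trilinear lam x y z)) w + B w (minus_i (cubic_trilinear lam x y z))"

lemma quadlinearI:
  assumes "\<And>a a' b c d. T (a + a') b c d = T a b c d + T a' b c d" "\<And>a b b' c d. T a (b + b') c d = T a b c d + T a b' c d"
    "\<And>a b c c' d. T a b (c + c') d = T a b c d + T a b c' d" "\<And>a b c d d'. T a b c (d + d') = T a b c d + T a b c d'"
    "\<And>r a b c d. T (r *\<^sub>R a) b c d = r * T a b c d" "\<And>r a b c d. T a (r *\<^sub>R b) c d = r * T a b c d"
    "\<And>r a b c d. T a b (r *\<^sub>R c) d = r * T a b c d" "\<And>r a b c d. T a b c (r *\<^sub>R d) = r * T a b c d"
  shows "quadlinear T"
  unfolding quadlinear_def using assms by (auto intro!: linearI)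

lemma quadlinear_quartic_rate:
  assumes "quadlinear T"
  shows "quadlinear (quartic_rate a b c lam T)"
  by (rule quadlinearI)
     (simp_all add: quartic_rate_def kinetic_form_linear minus_i_linear cubic_trilinear_linear quadlinear_simps[OF assms] algebra_simps)

lemma quadlinear_mass_rate:
  assumes "form2 B"
  shows "quadlinear (mass_rate lam B)"
  by (rule quadlinearI)
     (simp_all add: mass_rate_def minus_i_linear cubic_trilinear_linear form2_linear[OF assms] algebra_simps)

text \<open>The part of \<open>energy_rate\<close> that is homogeneous of degree four is isolated by three amplitudes.\<close>

lemma energy_rate_quartic_part:
  assumes B: "form2 B" and T: "quadlinear T"
  shows "72 * (quartic_rate a b c lam T h z z z + mass_rate lam B z z z z)
    = 12 * energy_rate a b c lam B T (2 *\<^sub>R z) (2 *\<^sub>R h) - energy_rate a b c lam B T (3 *\<^sub>R z) (3 *\<^sub>R h)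
      - 39 * energy_rate a b c lam B T (1 *\<^sub>R z) (1 *\<^sub>R h)"
  \<comment> \<open>The degrees present are 2, 4 and 6, and 12 2^k - 3^k - 39 vanishes for k = 2 and
    k = 6 and equals 72 for k = 4.\<close>
  unfolding energy_rate_def quartic_rate_def mass_rate_def diagonal_derivative_def Let_def
    kinetic_form_linear minus_i_linear cubic_trilinear_linear form2_linear[OF B] quadlinear_simps[OF T]
  by (simp add: algebra_simps)

text \<open>For a polynomial of degree at most four this stencil is 12 times the linear coefficient:
  even powers cancel, and the cubic one contributes 16 - 16. The first slot has its own scalars p, q
  because there the Laplacian acts.\<close>

lemma quadlinear_linear_coefficient:
  fixes p q f g :: real and w z :: "'v::real_vector"
  assumes Q: "quadlinear Q"
  defines "F \<equiv> \<lambda>s. Q ((s * p) *\<^sub>R w + q *\<^sub>R z) ((s * f) *\<^sub>R w + g *\<^sub>R z) ((s * f) *\<^sub>R w + g *\<^sub>R z) ((s * f) *\<^sub>R w + g *\<^sub>R z)"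
  shows "8 * (F 1 - F (-1)) - (F 2 - F (-2))
    = 12 * (p * g ^ 3 * Q w z z z + q * g\<^sup>2 * f * (Q z w z z + Q z z w z + Q z z z w))"
  unfolding F_def quadlinear_simps[OF Q] by (simp add: algebra_simps power2_eq_square power3_eq_cube)

text \<open>In the terms linear in s the four factors have total exponent \<alpha>+3\<beta>. By
  \<open>neg_laplace_gauss_integral\<close> a Laplacian on the profile of w contributes
  6\<alpha>(3\<beta>)/(\<alpha>+3\<beta>), one on a profile of z contributes
  6\<beta>(\<alpha>+2\<beta>)/(\<alpha>+3\<beta>), and a term without Laplacian has factor 1. A
  common positive factor has been divided out.\<close>

lemma rate_relation:
  assumes cons: "energy_conserved (cubic_nonlinearity lam) a b c g"
    and B: "form2 B" and T: "form4 T" and g: "\<And>z. g (z $ 1) (z $ 2) = B z z + T z z z z"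
    and \<alpha>: "\<alpha> > 0" and \<beta>: "\<beta> > 0"
  defines "Q \<equiv> quartic_rate a b c lam T" and "W \<equiv> mass_rate lam B"
  shows "18 * \<alpha> * \<beta> * Q w z z z + 6 * \<beta> * (\<alpha> + 2 * \<beta>) * (Q z w z z + Q z z w z + Q z z z w)
     + (\<alpha> + 3 * \<beta>) * (W w z z z + W z w z z + W z z w z + W z z z w) = 0"
proof -
  have TQ: "quadlinear T" using T by (simp add: form4_def)
  have Q: "quadlinear Q" and W: "quadlinear W"
    unfolding Q_def W_def using quadlinear_quartic_rate[OF TQ] quadlinear_mass_rate[OF B] by auto
  define u where "u s x = (s * gauss \<alpha> x) *\<^sub>R w + gauss \<beta> x *\<^sub>R z" for s x
  define h where "h s x = (s * neg_laplace_gauss \<alpha> x) *\<^sub>R w + neg_laplace_gauss \<beta> x *\<^sub>R z" for s x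
  define E where "E \<mu> s x = energy_rate a b c lam B T (\<mu> *\<^sub>R u s x) (\<mu> *\<^sub>R h s x)" for \<mu> s x
  have E: "integrable lborel (E \<mu> s)" "(\<integral>x. E \<mu> s x \<partial>lborel) = 0" for \<mu> s
    using energy_rate_gaussians[OF cons B T g \<alpha> \<beta>, of \<mu> s w z]
    by (simp_all add: E_def[abs_def] u_def h_def scaleR_add_right)
  define X where "X s x = Q (h s x) (u s x) (u s x) (u s x) + W (u s x) (u s x) (u s x) (u s x)" for s x
  have XE: "X s x = (12 * E 2 s x - E 3 s x - 39 * E 1 s x) / 72" for s x
    using energy_rate_quartic_part[OF B TQ, of a b c lam "h s x" "u s x"] unfolding X_def E_def Q_def W_def by simp
  have X: "integrable lborel (X s)" "(\<integral>x. X s x \<partial>lborel) = 0" for s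
    unfolding XE[abs_def] using E by simp_all
  let ?p = "neg_laplace_gauss \<alpha>" and ?q = "neg_laplace_gauss \<beta>" and ?f = "gauss \<alpha>" and ?g = "gauss \<beta>"
  let ?t1 = "Q w z z z" and ?t2 = "Q z w z z + Q z z w z + Q z z z w" and ?t3 = "W w z z z + W z w z z + W z z w z + W z z z w"
  have lin: "(8 * (X 1 x - X (-1) x) - (X 2 x - X (-2) x)) / 12
    = (?p x * gauss (3 * \<beta>) x) * ?t1 + (?q x * gauss (\<alpha> + 2 * \<beta>) x) * ?t2 + gauss (\<alpha> + 3 * \<beta>) x * ?t3" for x
  proof -
    have g3: "?g x ^ 3 = gauss (3 * \<beta>) x" "(?g x)\<^sup>2 * ?f x = gauss (\<alpha> + 2 * \<beta>) x" "?f x * gauss (3 * \<beta>) x = gauss (\<alpha> + 3 * \<beta>) x"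
      by (simp_all add: power2_eq_square power3_eq_cube gauss_mult algebra_simps)
    have "8 * (X 1 x - X (-1) x) - (X 2 x - X (-2) x)
      = 12 * (?p x * ?g x ^ 3 * ?t1 + ?q x * (?g x)\<^sup>2 * ?f x * ?t2) + 12 * (?f x * ?g x ^ 3 * W w z z z + ?g x * (?g x)\<^sup>2 * ?f x * (W z w z z + W z z w z + W z z z w))"
      using quadlinear_linear_coefficient[OF Q, of "?p x" w "?q x" z "?f x" "?g x"]
        quadlinear_linear_coefficient[OF W, of "?f x" w "?g x" z "?f x" "?g x"]
      unfolding X_def u_def h_def by simp
    also have "\<dots> = 12 * ((?p x * ?g x ^ 3) * ?t1 + (?q x * ((?g x)\<^sup>2 * ?f x)) * ?t2 + (?f x * ?g x ^ 3) * ?t3)"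
      by (simp add: algebra_simps power2_eq_square power3_eq_cube)
    finally show ?thesis unfolding g3 by simp
  qed
  have b3: "3 * \<beta> > 0" "\<alpha> + 2 * \<beta> > 0" "\<alpha> + 3 * \<beta> > 0" using \<alpha> \<beta> by auto
  define A where "A = \<alpha> + 3 * \<beta>"
  have A: "A > 0" "\<alpha> + 3 * \<beta> = A" "\<beta> + (\<alpha> + 2 * \<beta>) = A" using b3 by (auto simp: A_def)
  note i1 = neg_laplace_gauss_integral[OF \<alpha> b3(1), unfolded A] and i2 = neg_laplace_gauss_integral[OF \<beta> b3(2), unfolded A]
  have i3: "integrable lborel (gauss A)" "(\<integral>x. gauss A x \<partial>lborel) = sqrt (pi / A) ^ 3"
    unfolding gauss_def[abs_def] using gaussian_integral[OF A(1), where 'a="real^3"] by simp_all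
  have "(\<integral>x. (8 * (X 1 x - X (-1) x) - (X 2 x - X (-2) x)) / 12 \<partial>lborel) = 0"
    using X by simp
  hence "(\<integral>x. (?p x * gauss (3 * \<beta>) x) * ?t1 + (?q x * gauss (\<alpha> + 2 * \<beta>) x) * ?t2 + gauss A x * ?t3 \<partial>lborel) = 0"
    unfolding lin A .
  moreover have "(\<integral>x. (?p x * gauss (3 * \<beta>) x) * ?t1 + (?q x * gauss (\<alpha> + 2 * \<beta>) x) * ?t2 + gauss A x * ?t3 \<partial>lborel)
    = (6 * \<alpha> * (3 * \<beta>) / A * sqrt (pi / A) ^ 3) * ?t1 + (6 * \<beta> * (\<alpha> + 2 * \<beta>) / A * sqrt (pi / A) ^ 3) * ?t2 + sqrt (pi / A) ^ 3 * ?t3"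
    by (subst Bochner_Integration.integral_add, (intro Bochner_Integration.integrable_add integrable_mult_left i1 i2 i3)+,
        subst Bochner_Integration.integral_add, (intro integrable_mult_left i1 i2 i3)+)
       (simp only: integral_mult_left_zero i1(2) i2(2) i3(2))
  moreover have "\<dots> = (sqrt (pi / A) ^ 3 / A) * (18 * \<alpha> * \<beta> * ?t1 + 6 * \<beta> * (\<alpha> + 2 * \<beta>) * ?t2 + A * ?t3)"
    using A(1) by (simp add: field_simps)
  ultimately show ?thesis using A(1) unfolding A(2) by simp
qed

theorem energy_conserved_gradient:
  assumes cons: "energy_conserved (cubic_nonlinearity lam) a b c g"
    and B: "form2 B" and T: "form4 T" and g: "\<And>z. g (z $ 1) (z $ 2) = B z z + T z z z z"
  shows "diagonal_derivative T z w
      = 2 * Re (cnj (a *\<^sub>R w $ 1 + b *\<^sub>R w $ 2) * cubic_nonlinearity lam (z $ 1) (z $ 2) $ 1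
        + cnj (b *\<^sub>R w $ 1 + c *\<^sub>R w $ 2) * cubic_nonlinearity lam (z $ 1) (z $ 2) $ 2)"
proof -
  \<comment> \<open>The Laplacian enters the velocity with the factor -i; perturbing in direction i
    w makes w appear in the derivative of T.\<close>
  define w' where "w' = (\<chi> j. \<i> * w $ j)"
  let ?N = "cubic_trilinear lam z z z"
  note r = rate_relation[OF cons B T g, of _ _ w' z]
  have "quartic_rate a b c lam T w' z z z = 0"
    \<comment> \<open>From (1,1) to (2,2) the coefficients of the Laplacian terms quadruple while
      that of the \<open>mass_rate\<close> terms doubles, so the latter vanish. The two kinds of
      Laplacian terms have equal coefficients 18 at (1,1) but 36 and 24 at (2,1), so both vanish as
      well.\<close>
    using r[of 1 1] r[of 2 2] r[of 2 1] by (simp add: algebra_simps)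
  moreover have "minus_i w' = w" by (simp add: vec_eq_iff minus_i_def w'_def)
  moreover have "kinetic_form a b c w' (minus_i ?N) = - kinetic_form a b c w ?N"
    by (simp add: kinetic_form_def minus_i_def w'_def inner_complex_def algebra_simps)
  ultimately have "diagonal_derivative T z w = 2 * kinetic_form a b c w ?N"
    unfolding quartic_rate_def diagonal_derivative_def by simp
  thus ?thesis
    unfolding cubic_nonlinearity_trilinear by (simp add: kinetic_form_def inner_complex_def algebra_simps)
qed

text \<open>Applied to the zero solution, integrability of the density kills the constant term.\<close>

lemma energy_conserved_constant_term:
  assumes cons: "energy_conserved (cubic_nonlinearity lam) a b c g"
  shows "g 0 0 = 0"
proof -
  have N: "cubic_nonlinearity lam (z $ 1) (z $ 2) $ j = (\<Sum>a\<in>UNIV. \<Sum>b\<in>UNIV. \<Sum>c\<in>UNIV. cubic_coeff lam j a b c * (z $ a * z $ b * cnj (z $ c)))" for z j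
    unfolding cubic_nonlinearity_trilinear by (simp add: cubic_trilinear_def)
  have d: "decays 6 (\<lambda>\<xi>. (0 :: complex^2) $ j)" for j :: 2 by auto
  obtain T0 u Du where T0: "T0 > 0" and sol: "H1_solution (cubic_nonlinearity lam) {-T0<..<T0} u Du"
    and u0: "\<And>x j. u 0 x $ j = fint (\<lambda>\<xi>::real^3. (0 :: complex^2) $ j) x"
    and Du0: "\<And>x j k. Du 0 x $ j $ k = fint (\<lambda>\<xi>. (\<i> * (\<xi> $ k)) * (0 :: complex^2) $ j) x"
    by (rule H1_solution_exists[of "\<lambda>_. 0", OF d N]) blast
  have "integrable lebesgue (\<lambda>x. energy_density a b c g (u 0 x) (Du 0 x))"
    using cons[unfolded energy_conserved_def, THEN spec, THEN spec, THEN spec, THEN mp, OF sol, THEN conjunct1] T0 by simp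
  moreover have "energy_density a b c g (u 0 x) (Du 0 x) = g 0 0" for x
  proof -
    have "u 0 x = 0" "Du 0 x = 0" by (simp_all add: vec_eq_iff u0 Du0 fint_def)
    thus ?thesis by (simp add: energy_density_def)
  qed
  ultimately have "integrable lebesgue (\<lambda>x::real^3. g 0 0)" by simp
  hence "integrable lborel (\<lambda>x::real^3. g 0 0)" by (simp add: integrable_completion)
  hence "(\<integral>\<^sup>+x. ennreal (norm (g 0 0)) \<partial>(lborel :: (real^3) measure)) < \<infinity>"
    unfolding integrable_iff_bounded by simp
  thus ?thesis by (simp add: ennreal_mult_eq_top_iff less_top[symmetric])
qed

theorem theoremA1:
  fixes lam :: "nat \<Rightarrow> real"
  assumes "\<exists>(a::real) b c g. b\<^sup>2 - a * c < 0 \<and>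
             real_quartic_polynomial g \<and>
             (\<forall>z1 z2 \<theta>. g (cis \<theta> * z1) (cis \<theta> * z2) = g z1 z2) \<and>
             energy_conserved (cubic_nonlinearity lam) a b c g"
  shows "\<exists>M :: real^2^2. invertible M \<and>
           (\<exists>F \<in> standard_nonlinearities. transforms_to M (cubic_nonlinearity lam) F)"
proof -
  obtain a b c g where abc: "b\<^sup>2 - a * c < 0" and poly: "real_quartic_polynomial g"
    and gauge: "\<And>z1 z2 \<theta>. g (cis \<theta> * z1) (cis \<theta> * z2) = g z1 z2"
    and cons: "energy_conserved (cubic_nonlinearity lam) a b c g"
    using assms by blast
  \<comment> \<open>The gauge rotation by pi is the reflection z to -z, which gives the parity
    needed to split off odd degrees.\<close>
  have "g (- z1) (- z2) = g z1 z2" for z1 z2 using gauge[of pi z1 z2] by simp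
  from even_real_quartic_polynomial[OF poly this] obtain c0 B T
    where B: "form2 B" and T: "form4 T" and g: "\<And>z. g (z $ 1) (z $ 2) = c0 + B z z + T z z z z"
    unfolding even_quartic_def by blast
  have TQ: "quadlinear T" using T by (simp add: form4_def)
  have "B 0 0 = 0" "T 0 0 0 0 = 0"
    using form2_linear(3)[OF B, of 0 0 0] quadlinear_simps(5)[OF TQ, of 0 0 0 0 0] by auto
  hence "c0 = 0" using g[of 0] energy_conserved_constant_term[OF cons] by simp
  hence "g (z $ 1) (z $ 2) = B z z + T z z z z" for z using g by simp
  from energy_conserved_gradient[OF cons B T this]
  obtain F where "F \<in> standard_nonlinearities" "conjugate_to (cubic_nonlinearity lam) F"
    using gradient_system_standard[OF abc TQ] by blast
  thus ?thesis using conjugate_to_transforms_to by blast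
qed

end
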